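(* Let $G$ be a profinite group and $R$ a unital ring. Let $\mathrm{inc}$ be the inclusion of the category of Weyl-$G$-sheaves of $R$-modules into the category of $G$-equivariant sheaves of $R$-modules over $\mathcal{S}G$. Then $\mathrm{inc}$ is left adjoint to the functor $\mathrm{Weyl}$ from $G$-equivariant sheaves of $R$-modules over $\mathcal{S}G$ to Weyl-$G$-sheaves of $R$-modules. The functor $\mathrm{inc}\circ\mathrm{Weyl}$ is idempotent, hence the inclusion functor is fully faithful. The category of Weyl-$G$-sheaves of $R$-modules is an abelian category with all small colimits and limits. Limits are constructed by taking the limit of the underlying diagram in the category of $G$-equivariant sheaves of $R$-modules over $\mathcal{S}G$ and applying the functor $\mathrm{Weyl}$.
   Context: A profinite group is a compact, Hausdorff, totally disconnected topological group. $\mathcal{S}G$ is the set of closed subgroups of $G$ with the topology having as basis the sets $O(N,NK)=\{L\in\mathcal{S}G\mid NL=NK\}$ for $N$ an open normal subgroup and $K$ a closed subgroup of $G$; it is a profinite $G$-space under conjugation $(g,K)\mapsto gKg^{-1}$. A $G$-equivariant sheaf of $R$-modules over a $G$-space $X$ is a $G$-equivariant local homeomorphism $p\colon E\to X$, with $E$ a space with continuous $G$-action, such that each stalk $E_x=p^{-1}(x)$ is a (left) $R$-module, the fibrewise subtraction $E\times_X E\to E$ and each map $e\mapsto re$ ($r\in R$) are continuous, and each map $g\colon E_x\to E_{gx}$ is $R$-linear. Morphisms are continuous $G$-equivariant maps over $X$ that are $R$-linear on stalks. The stabiliser of $K\in\mathcal{S}G$ is the normaliser $N_GK$, so $K$ acts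 on the stalk $E_K$ of any $G$-sheaf $E$ over $\mathcal{S}G$. A Weyl-$G$-sheaf of $R$-modules is a $G$-equivariant sheaf of $R$-modules $E$ over $\mathcal{S}G$ such that $K$ acts trivially on $E_K$ for every $K\in\mathcal{S}G$; morphisms are morphisms of $G$-sheaves of $R$-modules. For a $G$-sheaf of $R$-modules $E$ over $\mathcal{S}G$, $\mathrm{Weyl}(E)\subseteq E$ is the subspace (with the subspace topology) whose stalk over $K$ is $\mathrm{Weyl}(E)_K=(E_K)^K$, the $K$-fixed points of $E_K$, with the restricted $G$-action and projection; on morphisms $\mathrm{Weyl}$ is restriction. *)

theory Defs
  imports "HOL-Analysis.Analysis" "HOL-Algebra.Group_Action" "HOL-Algebra.Module" "HOL-Library.Equipollence"
begin

section \<open>Categories\<close>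

record ('o, 'a) precat =
  Obj :: "'o set"
  Arr :: "'a set"
  Dom :: "'a \<Rightarrow> 'o"
  Cod :: "'a \<Rightarrow> 'o"
  Idt :: "'o \<Rightarrow> 'a"
  Cmp :: "'a \<Rightarrow> 'a \<Rightarrow> 'a"  (infixl \<open>\<cdot>\<index>\<close> 70)

definition Hom :: "('o, 'a) precat \<Rightarrow> 'o \<Rightarrow> 'o \<Rightarrow> 'a set" where
  "Hom C a b = {f \<in> Arr C. Dom C f = a \<and> Cod C f = b}"

locale category =
  fixes C :: "('o, 'a) precat" (structure)
  assumes Dom_Obj: "f \<in> Arr C \<Longrightarrow> Dom C f \<in> Obj C"
    and Cod_Obj: "f \<in> Arr C \<Longrightarrow> Cod C f \<in> Obj C"
    and Idt_Hom: "a \<in> Obj C \<Longrightarrow> Idt C a \<in> Hom C a a"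
    and Cmp_Hom: "f \<in> Hom C a b \<Longrightarrow> g \<in> Hom C b c \<Longrightarrow> g \<cdot> f \<in> Hom C a c"
    and Cmp_assoc:
      "f \<in> Hom C a b \<Longrightarrow> g \<in> Hom C b c \<Longrightarrow> h \<in> Hom C c d \<Longrightarrow> (h \<cdot> g) \<cdot> f = h \<cdot> (g \<cdot> f)"
    and Cmp_Idt_right: "f \<in> Hom C a b \<Longrightarrow> f \<cdot> Idt C a = f"
    and Cmp_Idt_left: "f \<in> Hom C a b \<Longrightarrow> Idt C b \<cdot> f = f"

definition full_subcategory :: "('o, 'a) precat \<Rightarrow> 'o set \<Rightarrow> ('o, 'a) precat" where
  "full_subcategory C S =
     C\<lparr>Obj := Obj C \<inter> S, Arr := {f \<in> Arr C. Dom C f \<in> S \<and> Cod C f \<in> S}\<rparr>"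

record ('o, 'a, 'p, 'b) cfunctor =
  OMap :: "'o \<Rightarrow> 'p"
  AMap :: "'a \<Rightarrow> 'b"

locale is_functor = source: category C + target: category D
  for C :: "('o, 'a) precat" and D :: "('p, 'b) precat" +
  fixes F :: "('o, 'a, 'p, 'b) cfunctor"
  assumes OMap_Obj: "a \<in> Obj C \<Longrightarrow> OMap F a \<in> Obj D"
    and AMap_Hom: "f \<in> Hom C a b \<Longrightarrow> AMap F f \<in> Hom D (OMap F a) (OMap F b)"
    and AMap_Idt: "a \<in> Obj C \<Longrightarrow> AMap F (Idt C a) = Idt D (OMap F a)"
    and AMap_Cmp: "f \<in> Hom C a b \<Longrightarrow> g \<in> Hom C b c \<Longrightarrow>
      AMap F (g \<cdot>\<^bsub>C\<^esub> f) = AMap F g \<cdot>\<^bsub>D\<^esub> AMap F f"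

definition functor_comp ::
  "('p, 'b, 'q, 'c) cfunctor \<Rightarrow> ('o, 'a, 'p, 'b) cfunctor \<Rightarrow> ('o, 'a, 'q, 'c) cfunctor"
  where "functor_comp G F = \<lparr>OMap = OMap G \<circ> OMap F, AMap = AMap G \<circ> AMap F\<rparr>"

definition functors_agree ::
  "('o, 'a) precat \<Rightarrow> ('o, 'a, 'p, 'b) cfunctor \<Rightarrow> ('o, 'a, 'p, 'b) cfunctor \<Rightarrow> bool" where
  "functors_agree C F G \<longleftrightarrow>
     (\<forall>a \<in> Obj C. OMap F a = OMap G a) \<and> (\<forall>f \<in> Arr C. AMap F f = AMap G f)"

definition idempotent_functor :: "('o, 'a) precat \<Rightarrow> ('o, 'a, 'o, 'a) cfunctor \<Rightarrow> bool" where
  "idempotent_functor C F \<longleftrightarrow> is_functor C C F \<and> functors_agree C (functor_comp F F) F"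

definition fully_faithful ::
  "('o, 'a) precat \<Rightarrow> ('p, 'b) precat \<Rightarrow> ('o, 'a, 'p, 'b) cfunctor \<Rightarrow> bool" where
  "fully_faithful C D F \<longleftrightarrow> is_functor C D F \<and>
     (\<forall>a \<in> Obj C. \<forall>b \<in> Obj C. bij_betw (AMap F) (Hom C a b) (Hom D (OMap F a) (OMap F b)))"

definition left_adjoint ::
  "('o, 'a) precat \<Rightarrow> ('p, 'b) precat \<Rightarrow>
   ('o, 'a, 'p, 'b) cfunctor \<Rightarrow> ('p, 'b, 'o, 'a) cfunctor \<Rightarrow> bool" where
  "left_adjoint C D F G \<longleftrightarrow> is_functor C D F \<and> is_functor D C G \<and>
     (\<exists>\<phi>.
        (\<forall>c \<in> Obj C. \<forall>d \<in> Obj D.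
           bij_betw (\<phi> c d) (Hom D (OMap F c) d) (Hom C c (OMap G d))) \<and>
        (\<forall>c \<in> Obj C. \<forall>c' \<in> Obj C. \<forall>d \<in> Obj D. \<forall>d' \<in> Obj D.
           \<forall>u \<in> Hom C c' c. \<forall>v \<in> Hom D d d'. \<forall>h \<in> Hom D (OMap F c) d.
             \<phi> c' d' (v \<cdot>\<^bsub>D\<^esub> h \<cdot>\<^bsub>D\<^esub> AMap F u) = AMap G v \<cdot>\<^bsub>C\<^esub> \<phi> c d h \<cdot>\<^bsub>C\<^esub> u))"

subsection \<open>Limits and colimits\<close>

definition is_cone ::
  "('o, 'a) precat \<Rightarrow> ('i, 'j) precat \<Rightarrow> ('i, 'j, 'o, 'a) cfunctor \<Rightarrow> 'o \<Rightarrow> ('i \<Rightarrow> 'a) \<Rightarrow> bool" where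
  "is_cone C J D L \<pi> \<longleftrightarrow> L \<in> Obj C \<and> (\<forall>i \<in> Obj J. \<pi> i \<in> Hom C L (OMap D i)) \<and>
     (\<forall>u \<in> Arr J. AMap D u \<cdot>\<^bsub>C\<^esub> \<pi> (Dom J u) = \<pi> (Cod J u))"

definition is_limit ::
  "('o, 'a) precat \<Rightarrow> ('i, 'j) precat \<Rightarrow> ('i, 'j, 'o, 'a) cfunctor \<Rightarrow> 'o \<Rightarrow> ('i \<Rightarrow> 'a) \<Rightarrow> bool" where
  "is_limit C J D L \<pi> \<longleftrightarrow> is_cone C J D L \<pi> \<and>
     (\<forall>M \<mu>. is_cone C J D M \<mu> \<longrightarrow>
        (\<exists>!h. h \<in> Hom C M L \<and> (\<forall>i \<in> Obj J. \<pi> i \<cdot>\<^bsub>C\<^esub> h = \<mu> i)))"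

definition is_cocone ::
  "('o, 'a) precat \<Rightarrow> ('i, 'j) precat \<Rightarrow> ('i, 'j, 'o, 'a) cfunctor \<Rightarrow> 'o \<Rightarrow> ('i \<Rightarrow> 'a) \<Rightarrow> bool" where
  "is_cocone C J D L \<iota> \<longleftrightarrow> L \<in> Obj C \<and> (\<forall>i \<in> Obj J. \<iota> i \<in> Hom C (OMap D i) L) \<and>
     (\<forall>u \<in> Arr J. \<iota> (Cod J u) \<cdot>\<^bsub>C\<^esub> AMap D u = \<iota> (Dom J u))"

definition is_colimit ::
  "('o, 'a) precat \<Rightarrow> ('i, 'j) precat \<Rightarrow> ('i, 'j, 'o, 'a) cfunctor \<Rightarrow> 'o \<Rightarrow> ('i \<Rightarrow> 'a) \<Rightarrow> bool" where
  "is_colimit C J D L \<iota> \<longleftrightarrow> is_cocone C J D L \<iota> \<and>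
     (\<forall>M \<mu>. is_cocone C J D M \<mu> \<longrightarrow>
        (\<exists>!h. h \<in> Hom C L M \<and> (\<forall>i \<in> Obj J. h \<cdot>\<^bsub>C\<^esub> \<iota> i = \<mu> i)))"

text \<open>Below, the total spaces of sheaves are subsets of a fixed infinite set \<open>U\<close> of arbitrary
  type, which plays the role of a universe.  A diagram shape with set of arrows \<open>I\<close> is small
  relative to \<open>U\<close> when \<open>|U|^|I| \<le> |U|\<close>.  Every finite set \<open>I\<close> satisfies this, and an arbitrary
  nonempty set \<open>I\<close> satisfies it for every \<open>U\<close> of the form \<open>I \<times> \<nat> \<rightarrow> V\<close>; so each set-indexed
  diagram becomes small on enlarging \<open>U\<close>.\<close>

definition small_category :: "'u set \<Rightarrow> ('i, 'j) precat \<Rightarrow> bool" where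
  "small_category U J \<longleftrightarrow> category J \<and> (Arr J \<rightarrow>\<^sub>E U) \<lesssim> U"

subsection \<open>Abelian categories\<close>

definition preadditive :: "('o, 'a) precat \<Rightarrow> ('a \<Rightarrow> 'a \<Rightarrow> 'a) \<Rightarrow> bool" where
  "preadditive C pls \<longleftrightarrow>
     (\<forall>a \<in> Obj C. \<forall>b \<in> Obj C. \<exists>z.
        comm_group \<lparr>carrier = Hom C a b, monoid.mult = pls, one = z\<rparr>) \<and>
     (\<forall>a b c. \<forall>f \<in> Hom C a b. \<forall>f' \<in> Hom C a b. \<forall>g \<in> Hom C b c. \<forall>g' \<in> Hom C b c.
        g \<cdot>\<^bsub>C\<^esub> pls f f' = pls (g \<cdot>\<^bsub>C\<^esub> f) (g \<cdot>\<^bsub>C\<^esub> f') \<and>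
        pls g g' \<cdot>\<^bsub>C\<^esub> f = pls (g \<cdot>\<^bsub>C\<^esub> f) (g' \<cdot>\<^bsub>C\<^esub> f))"

definition zero_object :: "('o, 'a) precat \<Rightarrow> 'o \<Rightarrow> bool" where
  "zero_object C z \<longleftrightarrow> z \<in> Obj C \<and>
     (\<forall>a \<in> Obj C. (\<exists>!f. f \<in> Hom C a z) \<and> (\<exists>!f. f \<in> Hom C z a))"

definition zero_arrow :: "('o, 'a) precat \<Rightarrow> 'a \<Rightarrow> bool" where
  "zero_arrow C f \<longleftrightarrow> f \<in> Arr C \<and>
     (\<exists>z g h. zero_object C z \<and> g \<in> Hom C (Dom C f) z \<and> h \<in> Hom C z (Cod C f) \<and>
        f = h \<cdot>\<^bsub>C\<^esub> g)"

definition is_product :: "('o, 'a) precat \<Rightarrow> 'o \<Rightarrow> 'o \<Rightarrow> 'o \<Rightarrow> 'a \<Rightarrow> 'a \<Rightarrow> bool" where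
  "is_product C a b p \<pi>\<^sub>1 \<pi>\<^sub>2 \<longleftrightarrow> \<pi>\<^sub>1 \<in> Hom C p a \<and> \<pi>\<^sub>2 \<in> Hom C p b \<and>
     (\<forall>c. \<forall>f \<in> Hom C c a. \<forall>g \<in> Hom C c b.
        \<exists>!h. h \<in> Hom C c p \<and> \<pi>\<^sub>1 \<cdot>\<^bsub>C\<^esub> h = f \<and> \<pi>\<^sub>2 \<cdot>\<^bsub>C\<^esub> h = g)"

definition is_coproduct :: "('o, 'a) precat \<Rightarrow> 'o \<Rightarrow> 'o \<Rightarrow> 'o \<Rightarrow> 'a \<Rightarrow> 'a \<Rightarrow> bool" where
  "is_coproduct C a b p \<iota>\<^sub>1 \<iota>\<^sub>2 \<longleftrightarrow> \<iota>\<^sub>1 \<in> Hom C a p \<and> \<iota>\<^sub>2 \<in> Hom C b p \<and>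
     (\<forall>c. \<forall>f \<in> Hom C a c. \<forall>g \<in> Hom C b c.
        \<exists>!h. h \<in> Hom C p c \<and> h \<cdot>\<^bsub>C\<^esub> \<iota>\<^sub>1 = f \<and> h \<cdot>\<^bsub>C\<^esub> \<iota>\<^sub>2 = g)"

definition is_kernel :: "('o, 'a) precat \<Rightarrow> 'a \<Rightarrow> 'a \<Rightarrow> bool" where
  "is_kernel C f k \<longleftrightarrow> f \<in> Arr C \<and> k \<in> Arr C \<and> Cod C k = Dom C f \<and> zero_arrow C (f \<cdot>\<^bsub>C\<^esub> k) \<and>
     (\<forall>g \<in> Arr C. Cod C g = Dom C f \<and> zero_arrow C (f \<cdot>\<^bsub>C\<^esub> g) \<longrightarrow>
        (\<exists>!h. h \<in> Hom C (Dom C g) (Dom C k) \<and> k \<cdot>\<^bsub>C\<^esub> h = g))"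

definition is_cokernel :: "('o, 'a) precat \<Rightarrow> 'a \<Rightarrow> 'a \<Rightarrow> bool" where
  "is_cokernel C f q \<longleftrightarrow> f \<in> Arr C \<and> q \<in> Arr C \<and> Dom C q = Cod C f \<and> zero_arrow C (q \<cdot>\<^bsub>C\<^esub> f) \<and>
     (\<forall>g \<in> Arr C. Dom C g = Cod C f \<and> zero_arrow C (g \<cdot>\<^bsub>C\<^esub> f) \<longrightarrow>
        (\<exists>!h. h \<in> Hom C (Cod C q) (Cod C g) \<and> h \<cdot>\<^bsub>C\<^esub> q = g))"

definition mono_arrow :: "('o, 'a) precat \<Rightarrow> 'a \<Rightarrow> bool" where
  "mono_arrow C f \<longleftrightarrow> f \<in> Arr C \<and>
     (\<forall>a. \<forall>g \<in> Hom C a (Dom C f). \<forall>h \<in> Hom C a (Dom C f). f \<cdot>\<^bsub>C\<^esub> g = f \<cdot>\<^bsub>C\<^esub> h \<longrightarrow> g = h)"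

definition epi_arrow :: "('o, 'a) precat \<Rightarrow> 'a \<Rightarrow> bool" where
  "epi_arrow C f \<longleftrightarrow> f \<in> Arr C \<and>
     (\<forall>a. \<forall>g \<in> Hom C (Cod C f) a. \<forall>h \<in> Hom C (Cod C f) a. g \<cdot>\<^bsub>C\<^esub> f = h \<cdot>\<^bsub>C\<^esub> f \<longrightarrow> g = h)"

locale abelian_category = category +
  assumes preadditive: "\<exists>pls. preadditive C pls"
    and zero: "\<exists>z. zero_object C z"
    and products: "\<lbrakk>a \<in> Obj C; b \<in> Obj C\<rbrakk> \<Longrightarrow> \<exists>p \<pi>\<^sub>1 \<pi>\<^sub>2. is_product C a b p \<pi>\<^sub>1 \<pi>\<^sub>2"
    and coproducts: "\<lbrakk>a \<in> Obj C; b \<in> Obj C\<rbrakk> \<Longrightarrow> \<exists>p \<iota>\<^sub>1 \<iota>\<^sub>2. is_coproduct C a b p \<iota>\<^sub>1 \<iota>\<^sub>2"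
    and kernels: "f \<in> Arr C \<Longrightarrow> \<exists>k. is_kernel C f k"
    and cokernels: "f \<in> Arr C \<Longrightarrow> \<exists>q. is_cokernel C f q"
    and mono_normal: "mono_arrow C f \<Longrightarrow> \<exists>g. is_kernel C g f"
    and epi_normal: "epi_arrow C f \<Longrightarrow> \<exists>g. is_cokernel C g f"

section \<open>Profinite groups and their spaces of closed subgroups\<close>

locale topological_group = group G for G (structure) +
  fixes T :: "'a topology"
  assumes topspace_eq: "topspace T = carrier G"
    and continuous_mult: "continuous_map (prod_topology T T) T (\<lambda>(x, y). x \<otimes> y)"
    and continuous_inv: "continuous_map T T (\<lambda>x. inv x)"

definition totally_disconnected_space :: "'a topology \<Rightarrow> bool" where
  "totally_disconnected_space X \<longleftrightarrow> (\<forall>S. connectedin X S \<longrightarrow> (\<exists>x. S \<subseteq> {x}))"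

locale profinite_group = topological_group +
  assumes compact: "compact_space T"
    and Hausdorff: "Hausdorff_space T"
    and totally_disconnected: "totally_disconnected_space T"

definition closed_subgroups :: "('g, 'z) monoid_scheme \<Rightarrow> 'g topology \<Rightarrow> 'g set set" where
  "closed_subgroups G T = {K. subgroup K G \<and> closedin T K}"

definition subgroup_nbhd ::
  "('g, 'z) monoid_scheme \<Rightarrow> 'g topology \<Rightarrow> 'g set \<Rightarrow> 'g set \<Rightarrow> 'g set set" where
  "subgroup_nbhd G T N K = {L \<in> closed_subgroups G T. N <#>\<^bsub>G\<^esub> L = N <#>\<^bsub>G\<^esub> K}"

text \<open>The generating family is closed under intersection locally at each point
  (\<open>O(M \<inter> N, (M \<inter> N)L) \<subseteq> O(M, ML) \<inter> O(N, NL)\<close>), so it is a basis of the topology it generates.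
  Since \<open>NNK = NK\<close>, the set \<open>subgroup_nbhd G T N K\<close> is \<open>O(N, NK)\<close>.\<close>

definition subgroup_space :: "('g, 'z) monoid_scheme \<Rightarrow> 'g topology \<Rightarrow> 'g set topology" where
  "subgroup_space G T = topology_generated_by
     {subgroup_nbhd G T N K | N K. N \<lhd> G \<and> openin T N \<and> K \<in> closed_subgroups G T}"

definition subgroup_conj ::
  "('g, 'z) monoid_scheme \<Rightarrow> 'g topology \<Rightarrow> 'g \<Rightarrow> 'g set \<Rightarrow> 'g set" where
  "subgroup_conj G T g = (\<lambda>K \<in> closed_subgroups G T. g <#\<^bsub>G\<^esub> K #>\<^bsub>G\<^esub> (inv\<^bsub>G\<^esub> g))"

section \<open>Equivariant sheaves of modules\<close>

text \<open>The library locale \<^locale>\<open>module\<close> requires a commutative ring of scalars.\<close>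

locale left_module = R?: ring R + M?: abelian_group M
  for R :: "('r, 'y) ring_scheme" (structure) and M :: "('r, 'm, 'z) module_scheme" (structure) +
  assumes smult_closed: "\<lbrakk>r \<in> carrier R; x \<in> carrier M\<rbrakk> \<Longrightarrow> r \<odot>\<^bsub>M\<^esub> x \<in> carrier M"
    and smult_l_distr: "\<lbrakk>r \<in> carrier R; s \<in> carrier R; x \<in> carrier M\<rbrakk> \<Longrightarrow>
      (r \<oplus>\<^bsub>R\<^esub> s) \<odot>\<^bsub>M\<^esub> x = r \<odot>\<^bsub>M\<^esub> x \<oplus>\<^bsub>M\<^esub> s \<odot>\<^bsub>M\<^esub> x"
    and smult_r_distr: "\<lbrakk>r \<in> carrier R; x \<in> carrier M; y \<in> carrier M\<rbrakk> \<Longrightarrow>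
      r \<odot>\<^bsub>M\<^esub> (x \<oplus>\<^bsub>M\<^esub> y) = r \<odot>\<^bsub>M\<^esub> x \<oplus>\<^bsub>M\<^esub> r \<odot>\<^bsub>M\<^esub> y"
    and smult_assoc: "\<lbrakk>r \<in> carrier R; s \<in> carrier R; x \<in> carrier M\<rbrakk> \<Longrightarrow>
      (r \<otimes>\<^bsub>R\<^esub> s) \<odot>\<^bsub>M\<^esub> x = r \<odot>\<^bsub>M\<^esub> (s \<odot>\<^bsub>M\<^esub> x)"
    and smult_one: "x \<in> carrier M \<Longrightarrow> \<one>\<^bsub>R\<^esub> \<odot>\<^bsub>M\<^esub> x = x"

definition R_linear ::
  "('r, 'y) ring_scheme \<Rightarrow> ('r, 'm, 'z) module_scheme \<Rightarrow> ('r, 'n, 'w) module_scheme \<Rightarrow>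
   ('m \<Rightarrow> 'n) \<Rightarrow> bool" where
  "R_linear R M N f \<longleftrightarrow> f \<in> carrier M \<rightarrow> carrier N \<and>
     (\<forall>x \<in> carrier M. \<forall>y \<in> carrier M. f (x \<oplus>\<^bsub>M\<^esub> y) = f x \<oplus>\<^bsub>N\<^esub> f y) \<and>
     (\<forall>r \<in> carrier R. \<forall>x \<in> carrier M. f (r \<odot>\<^bsub>M\<^esub> x) = r \<odot>\<^bsub>N\<^esub> f x)"

definition continuous_action ::
  "('g, 'z) monoid_scheme \<Rightarrow> 'g topology \<Rightarrow> 'x topology \<Rightarrow> ('g \<Rightarrow> 'x \<Rightarrow> 'x) \<Rightarrow> bool" where
  "continuous_action G T X act \<longleftrightarrow> group_action G (topspace X) act \<and>
     continuous_map (prod_topology T X) X (\<lambda>(g, x). act g x)"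

definition local_homeomorphism :: "'e topology \<Rightarrow> 'x topology \<Rightarrow> ('e \<Rightarrow> 'x) \<Rightarrow> bool" where
  "local_homeomorphism E X p \<longleftrightarrow> p \<in> topspace E \<rightarrow> topspace X \<and>
     (\<forall>e \<in> topspace E. \<exists>V. openin E V \<and> e \<in> V \<and> openin X (p ` V) \<and>
        homeomorphic_map (subtopology E V) (subtopology X (p ` V)) p)"

text \<open>A sheaf is recorded by its total space, projection, action, and the fibrewise module
  operations; \<open>szero E x\<close> is the zero of the stalk over \<open>x\<close>.\<close>

record ('g, 'r, 'x, 'e) gsheaf =
  total :: "'e topology"
  proj :: "'e \<Rightarrow> 'x"
  gact :: "'g \<Rightarrow> 'e \<Rightarrow> 'e"
  sadd :: "'e \<Rightarrow> 'e \<Rightarrow> 'e"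
  szero :: "'x \<Rightarrow> 'e"
  ssmult :: "'r \<Rightarrow> 'e \<Rightarrow> 'e"

definition fibre_product :: "('g, 'r, 'x, 'e) gsheaf \<Rightarrow> ('e \<times> 'e) set" where
  "fibre_product E =
     {(a, b). a \<in> topspace (total E) \<and> b \<in> topspace (total E) \<and> proj E a = proj E b}"

text \<open>The multiplicative fields of the underlying ring record are not part of the module
  structure.\<close>

definition stalk :: "('g, 'r, 'x, 'e) gsheaf \<Rightarrow> 'x \<Rightarrow> ('r, 'e) module" where
  "stalk E x = \<lparr>carrier = {e \<in> topspace (total E). proj E e = x},
     monoid.mult = undefined, one = undefined,
     zero = szero E x, add = sadd E, smult = ssmult E\<rparr>"

text \<open>The last group of assumptions fixes the values of the structure maps outside their
  domains, so that equality of records is equality of sheaves.\<close>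

locale equivariant_sheaf =
  fixes G :: "('g, 'z) monoid_scheme" and T :: "'g topology"
    and X :: "'x topology" and act :: "'g \<Rightarrow> 'x \<Rightarrow> 'x"
    and R :: "('r, 'y) ring_scheme" and E :: "('g, 'r, 'x, 'e) gsheaf"
  assumes action: "continuous_action G T (total E) (gact E)"
    and local_homeomorphism: "local_homeomorphism (total E) X (proj E)"
    and equivariant: "\<lbrakk>g \<in> carrier G; e \<in> topspace (total E)\<rbrakk> \<Longrightarrow>
      proj E (gact E g e) = act g (proj E e)"
    and stalk_module: "x \<in> topspace X \<Longrightarrow> left_module R (stalk E x)"
    and continuous_minus:
      "continuous_map (subtopology (prod_topology (total E) (total E)) (fibre_product E)) (total E)
         (\<lambda>(a, b). a \<ominus>\<^bsub>stalk E (proj E a)\<^esub> b)"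
    and continuous_smult: "r \<in> carrier R \<Longrightarrow> continuous_map (total E) (total E) (ssmult E r)"
    and action_linear: "\<lbrakk>g \<in> carrier G; x \<in> topspace X\<rbrakk> \<Longrightarrow>
      R_linear R (stalk E x) (stalk E (act g x)) (gact E g)"
    and proj_ext: "proj E \<in> extensional (topspace (total E))"
    and gact_ext: "gact E \<in> extensional (carrier G)"
    and sadd_ext: "(a, b) \<notin> fibre_product E \<Longrightarrow> sadd E a b = undefined"
    and szero_ext: "szero E \<in> extensional (topspace X)"
    and ssmult_ext: "ssmult E \<in> extensional (carrier R)"
      "r \<in> carrier R \<Longrightarrow> ssmult E r \<in> extensional (topspace (total E))"

definition sheaf_maps ::
  "('g, 'z) monoid_scheme \<Rightarrow> 'x topology \<Rightarrow> ('r, 'y) ring_scheme \<Rightarrow>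
   ('g, 'r, 'x, 'e) gsheaf \<Rightarrow> ('g, 'r, 'x, 'e) gsheaf \<Rightarrow> ('e \<Rightarrow> 'e) set" where
  "sheaf_maps G X R E F = {f \<in> extensional (topspace (total E)).
     continuous_map (total E) (total F) f \<and>
     (\<forall>e \<in> topspace (total E). proj F (f e) = proj E e) \<and>
     (\<forall>g \<in> carrier G. \<forall>e \<in> topspace (total E). f (gact E g e) = gact F g (f e)) \<and>
     (\<forall>x \<in> topspace X. R_linear R (stalk E x) (stalk F x) f)}"

type_synonym ('g, 'r, 'x, 'e) sheaf_arrow =
  "('g, 'r, 'x, 'e) gsheaf \<times> ('e \<Rightarrow> 'e) \<times> ('g, 'r, 'x, 'e) gsheaf"

definition sheaf_cat ::
  "('g, 'z) monoid_scheme \<Rightarrow> 'g topology \<Rightarrow> 'x topology \<Rightarrow> ('g \<Rightarrow> 'x \<Rightarrow> 'x) \<Rightarrow>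
   ('r, 'y) ring_scheme \<Rightarrow> 'e set \<Rightarrow>
   (('g, 'r, 'x, 'e) gsheaf, ('g, 'r, 'x, 'e) sheaf_arrow) precat" where
  "sheaf_cat G T X act R U =
     (let Ob = {E. equivariant_sheaf G T X act R E \<and> topspace (total E) \<subseteq> U} in
      \<lparr>Obj = Ob,
       Arr = {(E, f, F). E \<in> Ob \<and> F \<in> Ob \<and> f \<in> sheaf_maps G X R E F},
       Dom = (\<lambda>(E, f, F). E),
       Cod = (\<lambda>(E, f, F). F),
       Idt = (\<lambda>E. (E, (\<lambda>e \<in> topspace (total E). e), E)),
       Cmp = (\<lambda>(E', g, F') (E, f, F). (E, compose (topspace (total E)) g f, F'))\<rparr>)"

section \<open>Weyl sheaves\<close>

definition gsheaf_cat ::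
  "('g, 'z) monoid_scheme \<Rightarrow> 'g topology \<Rightarrow> ('r, 'y) ring_scheme \<Rightarrow> 'e set \<Rightarrow>
   (('g, 'r, 'g set, 'e) gsheaf, ('g, 'r, 'g set, 'e) sheaf_arrow) precat" where
  "gsheaf_cat G T R U = sheaf_cat G T (subgroup_space G T) (subgroup_conj G T) R U"

definition is_weyl ::
  "('g, 'z) monoid_scheme \<Rightarrow> 'g topology \<Rightarrow> ('g, 'r, 'g set, 'e) gsheaf \<Rightarrow> bool" where
  "is_weyl G T E \<longleftrightarrow>
     (\<forall>K \<in> closed_subgroups G T. \<forall>k \<in> K. \<forall>e \<in> carrier (stalk E K). gact E k e = e)"

definition weyl_cat ::
  "('g, 'z) monoid_scheme \<Rightarrow> 'g topology \<Rightarrow> ('r, 'y) ring_scheme \<Rightarrow> 'e set \<Rightarrow>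
   (('g, 'r, 'g set, 'e) gsheaf, ('g, 'r, 'g set, 'e) sheaf_arrow) precat" where
  "weyl_cat G T R U = full_subcategory (gsheaf_cat G T R U) {E. is_weyl G T E}"

definition weyl_set :: "('g, 'r, 'g set, 'e) gsheaf \<Rightarrow> 'e set" where
  "weyl_set E = {e \<in> topspace (total E). \<forall>k \<in> proj E e. gact E k e = e}"

definition weyl_sheaf ::
  "('g, 'z) monoid_scheme \<Rightarrow> ('r, 'y) ring_scheme \<Rightarrow>
   ('g, 'r, 'g set, 'e) gsheaf \<Rightarrow> ('g, 'r, 'g set, 'e) gsheaf" where
  "weyl_sheaf G R E =
     (let W = weyl_set E in
      \<lparr>total = subtopology (total E) W,
       proj = restrict (proj E) W,
       gact = (\<lambda>g \<in> carrier G. restrict (gact E g) W),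
       sadd = (\<lambda>a b. if a \<in> W \<and> b \<in> W then sadd E a b else undefined),
       szero = szero E,
       ssmult = (\<lambda>r \<in> carrier R. restrict (ssmult E r) W)\<rparr>)"

definition weyl_functor ::
  "('g, 'z) monoid_scheme \<Rightarrow> ('r, 'y) ring_scheme \<Rightarrow>
   (('g, 'r, 'g set, 'e) gsheaf, ('g, 'r, 'g set, 'e) sheaf_arrow,
    ('g, 'r, 'g set, 'e) gsheaf, ('g, 'r, 'g set, 'e) sheaf_arrow) cfunctor" where
  "weyl_functor G R =
     \<lparr>OMap = weyl_sheaf G R,
      AMap = (\<lambda>(E, f, F). (weyl_sheaf G R E, restrict f (weyl_set E), weyl_sheaf G R F))\<rparr>"

definition inc_functor :: "('o, 'a, 'o, 'a) cfunctor" where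
  "inc_functor = \<lparr>OMap = (\<lambda>E. E), AMap = (\<lambda>f. f)\<rparr>"

end

theory Submission
  imports Defs
begin

text \<open>Limits, colimits and quotients of sheaves are all presented in the same way: take the module of
  all families of possibly discontinuous sections of the given sheaves, single out those that are
  continuous, equivariant for an open subgroup and compatible near a point \<open>x\<close>, and divide
  by those that are to be zero at \<open>x\<close>.  A cardinality estimate names the classes by elements
  of \<open>U\<close>.  The \<open>K\<close>-fixed points of the stalks \<open>E\<^sub>K\<close> form an open subset by compactness of \<open>K\<close>, so
  \<open>Weyl(E)\<close> is a subsheaf, and every map from a Weyl sheaf lands in it; this gives the adjunction and the
  limits.  Colimits, kernels and cokernels of Weyl sheaves are computed among all
  sheaves.  A sheaf map is open, so an injective one is the kernel of its cokernel and a surjective one the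
  cokernel of its kernel.\<close>

section \<open>Preliminaries\<close>

text \<open>A presentation by global families, rather than by sheafification, keeps everything
  inside one module with a linear action of \<open>G\<close>: a stalk is a subquotient of that
  module, and only membership in the submodules varies with the point. Continuity of the action is
  the obstacle for infinite limits. A section of a single sheaf is equivariant near a point for some
  open neighbourhood of the identity, but the neighbourhoods belonging to infinitely many components
  may have no open intersection; so one neighbourhood is demanded for all components at once.
  Nothing is lost, because a section of the vertex of a cone brings its own neighbourhood, which
  serves all its components. The other obstacle is that total spaces must lie in \<open>U\<close>.
  For colimits a class is determined by finitely many elements; for limits, compact open sets of
  closed subgroups replace a section by finite data for each index. The universal properties are
  proved against every sheaf on the type, without a bound by \<open>U\<close>, so that they persist
  in every larger set \<open>V\<close>.\<close>

lemma continuous_map_pointwise: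
  "continuous_map X Y f \<longleftrightarrow> f \<in> topspace X \<rightarrow> topspace Y \<and>
     (\<forall>x \<in> topspace X. \<forall>V. openin Y V \<longrightarrow> f x \<in> V \<longrightarrow>
        (\<exists>U. openin X U \<and> x \<in> U \<and> (\<forall>y \<in> U. f y \<in> V)))"
  unfolding continuous_map_eq_topcontinuous_at topcontinuous_at_def by fastforce

lemma openin_prod_topologyE:
  assumes "openin (prod_topology X Y) S" "(a, b) \<in> S"
  obtains U V where "openin X U" "openin Y V" "a \<in> U" "b \<in> V" "U \<times> V \<subseteq> S"
  using assms unfolding openin_prod_topology_alt by metis

lemma continuous_map_mem: "continuous_map X Y f \<Longrightarrow> x \<in> topspace X \<Longrightarrow> f x \<in> topspace Y"
  by (auto simp: continuous_map_def)

text \<open>Openness of \<open>W\<close> turns a relatively open preimage into an open subset of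
  \<open>X\<close>. This is how the domain of a continuous section is shrunk in what
  follows.\<close>

lemma openin_continuous_map_preimage_subtopology:
  assumes "openin X W" "continuous_map (subtopology X W) Y f" "openin Y V"
  shows "openin X {x \<in> W. f x \<in> V}"
proof -
  have "{x \<in> topspace (subtopology X W). f x \<in> V} = {x \<in> W. f x \<in> V}"
    using openin_subset[OF assms(1)] by auto
  with openin_continuous_map_preimage[OF assms(2,3)] show ?thesis
    using openin_trans_full assms(1) by fastforce
qed

section \<open>Modules over a possibly noncommutative ring\<close>

context left_module
begin

lemma smult_r_null: "r \<in> carrier R \<Longrightarrow> r \<odot>\<^bsub>M\<^esub> \<zero>\<^bsub>M\<^esub> = \<zero>\<^bsub>M\<^esub>"
  by (metis M.add.l_cancel_one M.l_zero M.zero_closed smult_closed smult_r_distr)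

lemma smult_r_minus:
  assumes "r \<in> carrier R" "x \<in> carrier M"
  shows "r \<odot>\<^bsub>M\<^esub> (\<ominus>\<^bsub>M\<^esub> x) = \<ominus>\<^bsub>M\<^esub> (r \<odot>\<^bsub>M\<^esub> x)"
  by (metis M.a_inv_closed M.minus_equality M.l_neg assms smult_closed smult_r_distr smult_r_null)

lemma smult_r_diff:
  "r \<in> carrier R \<Longrightarrow> x \<in> carrier M \<Longrightarrow> y \<in> carrier M \<Longrightarrow>
    r \<odot>\<^bsub>M\<^esub> (x \<ominus>\<^bsub>M\<^esub> y) = r \<odot>\<^bsub>M\<^esub> x \<ominus>\<^bsub>M\<^esub> r \<odot>\<^bsub>M\<^esub> y"
  by (simp add: a_minus_def smult_r_distr smult_r_minus)

end

lemma (in abelian_group) minus_eq_zero_iff: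
  "x \<in> carrier G \<Longrightarrow> y \<in> carrier G \<Longrightarrow> x \<ominus> y = \<zero> \<longleftrightarrow> x = y"
  by (simp add: a_minus_def) (metis a_inv_closed minus_equality minus_minus r_neg)

text \<open>Additivity forces this: the image of zero equals its own double, and a group has no
  other such element. \<open>R_linear\<close> itself has no clause about zero.\<close>

lemma R_linear_zero:
  assumes "abelian_group M" "abelian_group N" "R_linear R M N f"
  shows "f \<zero>\<^bsub>M\<^esub> = \<zero>\<^bsub>N\<^esub>"
proof -
  interpret M: abelian_group M by fact
  interpret N: abelian_group N by fact
  have "f \<zero>\<^bsub>M\<^esub> \<in> carrier N" "f \<zero>\<^bsub>M\<^esub> \<oplus>\<^bsub>N\<^esub> f \<zero>\<^bsub>M\<^esub> = f \<zero>\<^bsub>M\<^esub>"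
    using assms(3) M.zero_closed M.l_zero unfolding R_linear_def by (force, metis)
  then show ?thesis by (metis N.add.l_cancel_one)
qed

lemma R_linear_minus:
  assumes "abelian_group M" "abelian_group N" "R_linear R M N f" "x \<in> carrier M" "y \<in> carrier M"
  shows "f (x \<ominus>\<^bsub>M\<^esub> y) = f x \<ominus>\<^bsub>N\<^esub> f y"
proof -
  interpret M: abelian_group M by fact
  interpret N: abelian_group N by fact
  have cl: "f z \<in> carrier N" if "z \<in> carrier M" for z
    using assms(3) that unfolding R_linear_def by auto
  have add: "f (z \<oplus>\<^bsub>M\<^esub> w) = f z \<oplus>\<^bsub>N\<^esub> f w" if "z \<in> carrier M" "w \<in> carrier M" for z w
    using assms(3) that unfolding R_linear_def by auto
  have "f (\<ominus>\<^bsub>M\<^esub> y) \<oplus>\<^bsub>N\<^esub> f y = \<zero>\<^bsub>N\<^esub>"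
    using add[of "\<ominus>\<^bsub>M\<^esub> y" y] assms R_linear_zero[OF assms(1-3)] by (simp add: M.l_neg)
  then have "f (\<ominus>\<^bsub>M\<^esub> y) = \<ominus>\<^bsub>N\<^esub> f y"
    using assms cl by (simp add: N.minus_equality)
  then show ?thesis using assms by (simp add: a_minus_def add)
qed

section \<open>Products of modules\<close>

definition product_module :: "'k set \<Rightarrow> ('k \<Rightarrow> ('r, 'm) module) \<Rightarrow> ('r, 'k \<Rightarrow> 'm) module" where
  "product_module I M = \<lparr>carrier = (\<Pi>\<^sub>E i\<in>I. carrier (M i)), monoid.mult = undefined, one = undefined,
     zero = (\<lambda>i\<in>I. \<zero>\<^bsub>M i\<^esub>), add = (\<lambda>s t. \<lambda>i\<in>I. s i \<oplus>\<^bsub>M i\<^esub> t i), smult = (\<lambda>r s. \<lambda>i\<in>I. r \<odot>\<^bsub>M i\<^esub> s i)\<rparr>"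

lemma product_module_simps [simp]:
  "carrier (product_module I M) = (\<Pi>\<^sub>E i\<in>I. carrier (M i))"
  "\<zero>\<^bsub>product_module I M\<^esub> = (\<lambda>i\<in>I. \<zero>\<^bsub>M i\<^esub>)"
  "s \<oplus>\<^bsub>product_module I M\<^esub> t = (\<lambda>i\<in>I. s i \<oplus>\<^bsub>M i\<^esub> t i)"
  "r \<odot>\<^bsub>product_module I M\<^esub> s = (\<lambda>i\<in>I. r \<odot>\<^bsub>M i\<^esub> s i)"
  by (simp_all add: product_module_def)

lemma left_module_product:
  assumes "ring R" and M: "\<And>i. i \<in> I \<Longrightarrow> left_module R (M i)"
  shows "left_module R (product_module I M)"
proof -
  interpret R: ring R by fact
  have ab: "abelian_group (M i)" if "i \<in> I" for i
    using M[OF that] by (simp add: left_module_def)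
  have mo: "abelian_monoid (M i)" if "i \<in> I" for i
    using ab[OF that] by (simp add: abelian_group_def)
  have grp: "abelian_group (product_module I M)"
  proof (rule abelian_groupI)
    fix s t u
    assume s: "s \<in> carrier (product_module I M)"
    then show "\<exists>y \<in> carrier (product_module I M). y \<oplus>\<^bsub>product_module I M\<^esub> s = \<zero>\<^bsub>product_module I M\<^esub>"
      by (intro bexI[of _ "\<lambda>i\<in>I. \<ominus>\<^bsub>M i\<^esub> s i"])
        (auto simp: fun_eq_iff abelian_group.l_neg[OF ab] abelian_group.a_inv_closed[OF ab] PiE_iff)
    show "\<zero>\<^bsub>product_module I M\<^esub> \<oplus>\<^bsub>product_module I M\<^esub> s = s"
      using s by (intro ext) (auto simp: abelian_monoid.l_zero[OF mo] PiE_iff extensional_def)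
    assume t: "t \<in> carrier (product_module I M)"
    show "s \<oplus>\<^bsub>product_module I M\<^esub> t \<in> carrier (product_module I M)"
      using s t by (auto simp: abelian_monoid.a_closed[OF mo] PiE_iff)
    show "s \<oplus>\<^bsub>product_module I M\<^esub> t = t \<oplus>\<^bsub>product_module I M\<^esub> s"
      using s t by (auto simp: abelian_monoid.a_comm[OF mo] PiE_iff)
    assume u: "u \<in> carrier (product_module I M)"
    show "s \<oplus>\<^bsub>product_module I M\<^esub> t \<oplus>\<^bsub>product_module I M\<^esub> u = s \<oplus>\<^bsub>product_module I M\<^esub> (t \<oplus>\<^bsub>product_module I M\<^esub> u)"
      using s t u by (auto simp: abelian_monoid.a_assoc[OF mo] PiE_iff fun_eq_iff)
  qed (auto simp: abelian_monoid.zero_closed[OF mo])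
  show ?thesis
    unfolding left_module_def left_module_axioms_def
    using grp M assms(1)
    by (auto simp: PiE_iff fun_eq_iff left_module.smult_l_distr[OF M] left_module.smult_assoc[OF M]
        left_module.smult_one[OF M] left_module.smult_r_distr[OF M] extensional_def
        intro: left_module.smult_closed[OF M])
qed

text \<open>Subtraction in the product is given only through abstract inverses. Each coordinate
  projection is linear, so \<open>R_linear_minus\<close> transports subtraction to the factors
  without computing an inverse.\<close>

lemma product_module_minus:
  assumes "\<And>i. i \<in> I \<Longrightarrow> left_module R (M i)" "ring R"
    and s: "s \<in> carrier (product_module I M)" and t: "t \<in> carrier (product_module I M)"
  shows "s \<ominus>\<^bsub>product_module I M\<^esub> t = (\<lambda>i\<in>I. s i \<ominus>\<^bsub>M i\<^esub> t i)"
proof -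
  let ?P = "product_module I M"
  have ab: "abelian_group (M i)" if "i \<in> I" for i
    using assms(1)[OF that] by (simp add: left_module_def)
  have P: "abelian_group ?P"
    using left_module_product[of R I M] assms(1,2) by (simp add: left_module_def)
  have "s \<ominus>\<^bsub>?P\<^esub> t \<in> carrier ?P"
    using P s t by (simp add: abelian_group.minus_closed del: product_module_simps)
  then have ext: "s \<ominus>\<^bsub>?P\<^esub> t \<in> extensional I" by (simp add: PiE_iff)
  have "(s \<ominus>\<^bsub>?P\<^esub> t) i = s i \<ominus>\<^bsub>M i\<^esub> t i" if "i \<in> I" for i
  proof (rule R_linear_minus[OF P ab[OF that] _ s t])
    show "R_linear R ?P (M i) (\<lambda>s. s i)"
      using that by (auto simp: R_linear_def)
  qed
  then show ?thesis using ext by (auto simp: fun_eq_iff extensional_def)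
qed

section \<open>Sheaves over a space with group action\<close>

lemma stalk_simps [simp]:
  "e \<in> carrier (stalk E x) \<longleftrightarrow> e \<in> topspace (total E) \<and> proj E e = x"
  "\<zero>\<^bsub>stalk E x\<^esub> = szero E x"
  "a \<oplus>\<^bsub>stalk E x\<^esub> b = sadd E a b"
  "r \<odot>\<^bsub>stalk E x\<^esub> b = ssmult E r b"
  by (auto simp: stalk_def)

text \<open>The record stores addition, whereas \<open>equivariant_sheaf\<close> postulates
  continuity of subtraction. The stalk is that of \<open>a\<close>, so the formula is literally the
  one in that axiom.\<close>

definition sminus :: "('g, 'r, 'x, 'e) gsheaf \<Rightarrow> 'e \<Rightarrow> 'e \<Rightarrow> 'e" where
  "sminus E a b = a \<ominus>\<^bsub>stalk E (proj E a)\<^esub> b"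

text \<open>The section is a total function whose values off \<open>W\<close> are irrelevant;
  restricting it changes only \<open>W\<close>.\<close>

definition local_section ::
  "'x topology \<Rightarrow> ('g, 'r, 'x, 'e) gsheaf \<Rightarrow> 'x set \<Rightarrow> ('x \<Rightarrow> 'e) \<Rightarrow> bool" where
  "local_section X E W t \<longleftrightarrow> openin X W \<and> continuous_map (subtopology X W) (total E) t \<and>
     (\<forall>x \<in> W. proj E (t x) = x)"

lemma local_section_subset:
  "local_section X E W t \<Longrightarrow> openin X W' \<Longrightarrow> W' \<subseteq> W \<Longrightarrow> local_section X E W' t"
  unfolding local_section_def by (meson continuous_map_from_subtopology_mono subsetD)

lemma local_section_cong:
  "local_section X E W t \<Longrightarrow> (\<And>x. x \<in> W \<Longrightarrow> t x = t' x) \<Longrightarrow> local_section X E W t'"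
  unfolding local_section_def by (auto elim!: continuous_map_eq)

lemma local_sectionD:
  assumes "local_section X E W t"
  shows "openin X W" "W \<subseteq> topspace X" "continuous_map (subtopology X W) (total E) t"
    "x \<in> W \<Longrightarrow> t x \<in> topspace (total E)" "x \<in> W \<Longrightarrow> proj E (t x) = x"
  using assms unfolding local_section_def
  by (auto simp: openin_subset continuous_map_def Pi_iff dest!: openin_subset)

text \<open>Sheaf theory is developed over a general space with continuous action. The space of
  closed subgroups under conjugation becomes an instance in \<open>weyl_universe\<close>.\<close>

locale group_space = topological_group G T
  for G :: "('g, 'z) monoid_scheme" (structure) and T +
  fixes X :: "'x topology" and act :: "'g \<Rightarrow> 'x \<Rightarrow> 'x" and R :: "('r, 'y) ring_scheme"
  assumes action: "continuous_action G T X act" and ring: "ring R"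
begin

abbreviation sheaf :: "('g, 'r, 'x, 'e) gsheaf \<Rightarrow> bool" where
  "sheaf E \<equiv> equivariant_sheaf G T X act R E"

lemma group_action_act: "group_action G (topspace X) act"
  using action by (simp add: continuous_action_def)

lemma act_closed [simp]: "g \<in> carrier G \<Longrightarrow> x \<in> topspace X \<Longrightarrow> act g x \<in> topspace X"
  using group_action.element_image[OF group_action_act] by blast

lemma act_mult: "g \<in> carrier G \<Longrightarrow> h \<in> carrier G \<Longrightarrow> x \<in> topspace X \<Longrightarrow> act (g \<otimes> h) x = act g (act h x)"
  using group_action.composition_rule[OF group_action_act] by blast

lemma act_one [simp]: "x \<in> topspace X \<Longrightarrow> act \<one> x = x"
  using group_action.id_eq_one[OF group_action_act] by (metis restrict_apply)

lemma act_inv [simp]: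
  "g \<in> carrier G \<Longrightarrow> x \<in> topspace X \<Longrightarrow> act g (act (inv g) x) = x"
  "g \<in> carrier G \<Longrightarrow> x \<in> topspace X \<Longrightarrow> act (inv g) (act g x) = x"
  by (simp_all flip: act_mult)

lemma continuous_act: "continuous_map (prod_topology T X) X (\<lambda>(g, x). act g x)"
  using action by (simp add: continuous_action_def)

lemma continuous_act_compose:
  assumes "continuous_map Z T a" "continuous_map Z X b"
  shows "continuous_map Z X (\<lambda>z. act (a z) (b z))"
  using continuous_map_compose[OF _ continuous_act, of Z "\<lambda>z. (a z, b z)"] assms
  by (simp add: continuous_map_pairwise o_def)

text \<open>Translation by \<open>g\<close> is inverted by translation by \<open>inv g\<close>, so
  the image is a preimage under a continuous map. The explicit set serves to decide membership in
  the translate.\<close>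

lemma open_act_image:
  assumes g: "g \<in> carrier G" and W: "openin X W"
  shows "openin X (act g ` W)" "act g ` W = {y \<in> topspace X. act (inv g) y \<in> W}"
proof -
  have WX: "W \<subseteq> topspace X" using W openin_subset by blast
  show eq: "act g ` W = {y \<in> topspace X. act (inv g) y \<in> W}"
    using WX g by (force simp: image_iff)
  have "continuous_map X X (\<lambda>y. act (inv g) y)"
    using g topspace_eq by (intro continuous_act_compose) auto
  then show "openin X (act g ` W)"
    unfolding eq using W by (rule openin_continuous_map_preimage)
qed

section \<open>Arithmetic in the stalks of a sheaf\<close>

context
  fixes E :: "('g, 'r, 'x, 'e) gsheaf"
  assumes E: "sheaf E"
begin

lemma stalk_left_module: "x \<in> topspace X \<Longrightarrow> left_module R (stalk E x)"
  using E by (simp add: equivariant_sheaf.stalk_module)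

lemma stalk_abelian_group: "x \<in> topspace X \<Longrightarrow> abelian_group (stalk E x)"
  using stalk_left_module by (simp add: left_module_def)

lemma proj_closed [simp]: "e \<in> topspace (total E) \<Longrightarrow> proj E e \<in> topspace X"
  using E unfolding equivariant_sheaf_def local_homeomorphism_def by blast

lemma szero_closed [simp]:
  assumes "x \<in> topspace X"
  shows "szero E x \<in> topspace (total E)" "proj E (szero E x) = x"
proof -
  interpret abelian_group "stalk E x" using stalk_abelian_group assms .
  show "szero E x \<in> topspace (total E)" "proj E (szero E x) = x" using zero_closed by auto
qed

lemma sadd_closed [simp]:
  assumes "a \<in> topspace (total E)" "b \<in> topspace (total E)" "proj E a = proj E b"
  shows "sadd E a b \<in> topspace (total E)" "proj E (sadd E a b) = proj E b"
proof -
  interpret abelian_group "stalk E (proj E b)" using stalk_abelian_group assms by simp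
  show "sadd E a b \<in> topspace (total E)" "proj E (sadd E a b) = proj E b"
    using a_closed[of a b] assms by auto
qed

lemma sminus_stalk: "proj E a = x \<Longrightarrow> a \<ominus>\<^bsub>stalk E x\<^esub> b = sminus E a b"
  by (simp add: sminus_def)

lemma sminus_closed [simp]:
  assumes "a \<in> topspace (total E)" "b \<in> topspace (total E)" "proj E a = proj E b"
  shows "sminus E a b \<in> topspace (total E)" "proj E (sminus E a b) = proj E b"
proof -
  interpret abelian_group "stalk E (proj E b)" using stalk_abelian_group assms by simp
  show "sminus E a b \<in> topspace (total E)" "proj E (sminus E a b) = proj E b"
    using minus_closed[of a b] assms by (auto simp: sminus_def)
qed

lemma sminus_self: "a \<in> topspace (total E) \<Longrightarrow> sminus E a a = szero E (proj E a)"
  using abelian_group.minus_eq_zero_iff[OF stalk_abelian_group, of "proj E a" a a]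
  by (simp add: sminus_def)

lemma sminus_eq_zero_iff:
  assumes "a \<in> topspace (total E)" "b \<in> topspace (total E)" "proj E a = proj E b"
  shows "sminus E a b = szero E (proj E b) \<longleftrightarrow> a = b"
  using abelian_group.minus_eq_zero_iff[OF stalk_abelian_group, of "proj E b" a b] assms
  by (simp add: sminus_def)

lemma sminus_zero_right:
  assumes "a \<in> topspace (total E)"
  shows "sminus E a (szero E (proj E a)) = a"
proof -
  interpret abelian_group "stalk E (proj E a)" using stalk_abelian_group assms by simp
  have "\<ominus>\<^bsub>stalk E (proj E a)\<^esub> \<zero>\<^bsub>stalk E (proj E a)\<^esub> = \<zero>\<^bsub>stalk E (proj E a)\<^esub>"
    using minus_equality[OF l_zero] zero_closed by blast
  then show ?thesis using assms r_zero[of a] by (simp add: sminus_def a_minus_def)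
qed

text \<open>Only subtraction is postulated to be continuous; writing \<open>a + b\<close> as
  \<open>a - (0 - b)\<close> passes continuity on to addition.\<close>

lemma sadd_eq_sminus:
  assumes "a \<in> topspace (total E)" "b \<in> topspace (total E)" "proj E a = proj E b"
  shows "sadd E a b = sminus E a (sminus E (szero E (proj E b)) b)"
proof -
  interpret abelian_group "stalk E (proj E b)" using stalk_abelian_group assms by simp
  have "sminus E (szero E (proj E b)) b = \<ominus>\<^bsub>stalk E (proj E b)\<^esub> b"
    using assms l_zero[of "\<ominus>\<^bsub>stalk E (proj E b)\<^esub> b"] a_inv_closed[of b] by (simp add: sminus_def a_minus_def)
  then show ?thesis
    using assms minus_minus[of b] by (simp add: sminus_def a_minus_def)
qed

lemma sadd_sminus:
  assumes "a \<in> topspace (total E)" "b \<in> topspace (total E)" "proj E a = proj E b"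
  shows "sadd E (sminus E a b) b = a"
proof -
  interpret abelian_group "stalk E (proj E b)" using stalk_abelian_group assms by simp
  show ?thesis
    using assms a_assoc[of a "\<ominus>\<^bsub>stalk E (proj E b)\<^esub> b" b] a_inv_closed[of b] l_neg[of b] r_zero[of a]
    by (simp add: sminus_def a_minus_def)
qed

lemma sadd_zero:
  assumes "a \<in> topspace (total E)" "proj E a = x"
  shows "sadd E a (szero E x) = a" "sadd E (szero E x) a = a"
proof -
  interpret abelian_group "stalk E (proj E a)" using stalk_abelian_group[of "proj E a"] assms(1) by simp
  show "sadd E a (szero E x) = a" "sadd E (szero E x) a = a"
    using assms r_zero[of a] l_zero[of a] by auto
qed

lemma ssmult_closed [simp]:
  assumes "r \<in> carrier R" "a \<in> topspace (total E)"
  shows "ssmult E r a \<in> topspace (total E)" "proj E (ssmult E r a) = proj E a"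
  using left_module.smult_closed[OF stalk_left_module, of "proj E a" r a] assms by auto

lemma ssmult_zero: "r \<in> carrier R \<Longrightarrow> x \<in> topspace X \<Longrightarrow> ssmult E r (szero E x) = szero E x"
  using left_module.smult_r_null[OF stalk_left_module, of x r] by auto

lemma group_action_gact: "group_action G (topspace (total E)) (gact E)"
  using E by (simp add: equivariant_sheaf_def continuous_action_def)

lemma gact_closed [simp]:
  assumes "g \<in> carrier G" "a \<in> topspace (total E)"
  shows "gact E g a \<in> topspace (total E)" "proj E (gact E g a) = act g (proj E a)"
  using assms group_action.element_image[OF group_action_gact] equivariant_sheaf.equivariant[OF E]
  by blast+

lemma gact_mult: "g \<in> carrier G \<Longrightarrow> h \<in> carrier G \<Longrightarrow> a \<in> topspace (total E) \<Longrightarrow>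
    gact E (g \<otimes> h) a = gact E g (gact E h a)"
  using group_action.composition_rule[OF group_action_gact] by blast

lemma gact_one [simp]: "a \<in> topspace (total E) \<Longrightarrow> gact E \<one> a = a"
  using group_action.id_eq_one[OF group_action_gact] by (metis restrict_apply)

lemma gact_inv [simp]:
  "g \<in> carrier G \<Longrightarrow> a \<in> topspace (total E) \<Longrightarrow> gact E g (gact E (inv g) a) = a"
  "g \<in> carrier G \<Longrightarrow> a \<in> topspace (total E) \<Longrightarrow> gact E (inv g) (gact E g a) = a"
  by (simp_all flip: gact_mult)

lemma gact_linear:
  "g \<in> carrier G \<Longrightarrow> x \<in> topspace X \<Longrightarrow> R_linear R (stalk E x) (stalk E (act g x)) (gact E g)"
  using equivariant_sheaf.action_linear[OF E] .

lemma gact_sadd: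
  assumes "g \<in> carrier G" "a \<in> topspace (total E)" "b \<in> topspace (total E)" "proj E a = proj E b"
  shows "gact E g (sadd E a b) = sadd E (gact E g a) (gact E g b)"
  using gact_linear[of g "proj E b"] assms by (simp add: R_linear_def)

lemma gact_ssmult:
  assumes "g \<in> carrier G" "r \<in> carrier R" "a \<in> topspace (total E)"
  shows "gact E g (ssmult E r a) = ssmult E r (gact E g a)"
  using gact_linear[of g "proj E a"] assms by (simp add: R_linear_def)

lemma gact_szero:
  assumes "g \<in> carrier G" "x \<in> topspace X"
  shows "gact E g (szero E x) = szero E (act g x)"
  using R_linear_zero[OF _ _ gact_linear[of g x]] assms by (simp add: stalk_abelian_group)

lemma gact_sminus:
  assumes "g \<in> carrier G" "a \<in> topspace (total E)" "b \<in> topspace (total E)" "proj E a = proj E b"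
  shows "gact E g (sminus E a b) = sminus E (gact E g a) (gact E g b)"
  using R_linear_minus[OF _ _ gact_linear[of g "proj E a"], of a b] assms
  by (simp add: stalk_abelian_group sminus_def)

section \<open>Sheets, local sections and continuity\<close>

lemma continuous_gact: "continuous_map (prod_topology T (total E)) (total E) (\<lambda>(g, a). gact E g a)"
  using E by (simp add: equivariant_sheaf_def continuous_action_def)

lemma continuous_gact_compose:
  assumes "continuous_map Z T a" "continuous_map Z (total E) b"
  shows "continuous_map Z (total E) (\<lambda>z. gact E (a z) (b z))"
  using continuous_map_compose[OF _ continuous_gact, of Z "\<lambda>z. (a z, b z)"] assms
  by (simp add: continuous_map_pairwise o_def)

lemma continuous_ssmult: "r \<in> carrier R \<Longrightarrow> continuous_map (total E) (total E) (ssmult E r)"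
  using equivariant_sheaf.continuous_smult[OF E] .

text \<open>On a sheet \<open>V\<close> the projection has a continuous inverse \<open>t\<close>.
  Both are returned, since some arguments use injectivity of the projection on \<open>V\<close> and
  others the section.\<close>

lemma section_homeo_through:
  assumes "e \<in> topspace (total E)"
  obtains V t where "openin (total E) V" "e \<in> V" "inj_on (proj E) V"
    "continuous_map (subtopology (total E) V) X (proj E)"
    "local_section X E (proj E ` V) t" "t (proj E e) = e"
proof -
  obtain V where V: "openin (total E) V" "e \<in> V" "openin X (proj E ` V)"
    "homeomorphic_map (subtopology (total E) V) (subtopology X (proj E ` V)) (proj E)"
    using equivariant_sheaf.local_homeomorphism[OF E] assms unfolding local_homeomorphism_def by blast
  then obtain t where t: "homeomorphic_maps (subtopology (total E) V) (subtopology X (proj E ` V)) (proj E) t"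
    using homeomorphic_map_maps by blast
  have VE: "V \<subseteq> topspace (total E)" using V openin_subset by blast
  have "inj_on (proj E) V"
    using V(4) VE by (simp add: homeomorphic_map_def inf.absorb2)
  moreover have "continuous_map (subtopology (total E) V) X (proj E)"
    using V(4) by (meson continuous_map_into_fulltopology homeomorphic_imp_continuous_map)
  moreover have "local_section X E (proj E ` V) t"
    using t V VE unfolding local_section_def homeomorphic_maps_def
    by (auto simp: continuous_map_in_subtopology)
  moreover have "t (proj E e) = e"
    using t V VE unfolding homeomorphic_maps_def by auto
  ultimately show thesis using V that by blast
qed

text \<open>\<open>local_homeomorphism\<close> asserts continuity only sheet by sheet; the sheets
  are open and cover the total space.\<close>

lemma continuous_proj: "continuous_map (total E) X (proj E)"
  unfolding continuous_map_pointwise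
proof (intro conjI ballI allI impI)
  fix e O' assume e: "e \<in> topspace (total E)" and O': "openin X O'" "proj E e \<in> O'"
  obtain V where V: "openin (total E) V" "e \<in> V"
    "continuous_map (subtopology (total E) V) X (proj E)"
    using section_homeo_through[OF e] by metis
  have "openin (total E) {v \<in> V. proj E v \<in> O'}"
    using V(1,3) O'(1) by (rule openin_continuous_map_preimage_subtopology)
  then show "\<exists>U. openin (total E) U \<and> e \<in> U \<and> (\<forall>y\<in>U. proj E y \<in> O')"
    using V O' by blast
qed simp

text \<open>Where two lifts of the same map agree, both values lie in one sheet \<open>V\<close>;
  nearby they stay in \<open>V\<close>, and the projection is injective there. All equalities of
  germs rest on this.\<close>

lemma openin_agree:
  assumes a: "continuous_map Z (total E) a" and b: "continuous_map Z (total E) b"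
    and ab: "\<And>z. z \<in> topspace Z \<Longrightarrow> proj E (a z) = proj E (b z)"
  shows "openin Z {z \<in> topspace Z. a z = b z}"
proof (subst openin_subopen, safe)
  fix z assume z: "z \<in> topspace Z" "a z = b z"
  then have "a z \<in> topspace (total E)" using z continuous_map_mem[OF a] by blast
  then obtain V where V: "openin (total E) V" "a z \<in> V" "inj_on (proj E) V"
    using section_homeo_through by metis
  let ?Y = "{y \<in> topspace Z. a y \<in> V} \<inter> {y \<in> topspace Z. b y \<in> V}"
  have "openin Z ?Y"
    using a b V(1) by (intro openin_Int openin_continuous_map_preimage)
  moreover have "?Y \<subseteq> {z \<in> topspace Z. a z = b z}"
    using V(3) ab by (auto dest: inj_onD)
  ultimately show "\<exists>Y. openin Z Y \<and> z \<in> Y \<and> Y \<subseteq> {z \<in> topspace Z. a z = b z}"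
    using z V(2) by (intro exI[of _ ?Y]) auto
qed

text \<open>Over the preimage of \<open>W'\<close> under the projection, the identity and
  \<open>t\<close> composed with the projection are two lifts of the projection. They agree exactly
  on the image of \<open>W'\<close> under \<open>t\<close>.\<close>

lemma openin_section_image:
  assumes t: "local_section X E W t" and W': "openin X W'" "W' \<subseteq> W"
  shows "openin (total E) (t ` W')"
proof -
  have t': "local_section X E W' t" using local_section_subset[OF t W'] .
  let ?Y = "{e \<in> topspace (total E). proj E e \<in> W'}"
  have Y: "openin (total E) ?Y" using continuous_proj W'(1) by (rule openin_continuous_map_preimage)
  have "continuous_map (subtopology (total E) ?Y) (subtopology X W') (proj E)"
    using continuous_proj by (auto simp: continuous_map_in_subtopology continuous_map_from_subtopology)
  then have "continuous_map (subtopology (total E) ?Y) (total E) (\<lambda>e. t (proj E e))"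
    using continuous_map_compose local_sectionD(3)[OF t'] unfolding o_def by blast
  then have "openin (subtopology (total E) ?Y) {e \<in> topspace (subtopology (total E) ?Y). t (proj E e) = e}"
    using local_sectionD[OF t'] by (intro openin_agree) auto
  then have "openin (total E) {e \<in> topspace (subtopology (total E) ?Y). t (proj E e) = e}"
    using Y openin_trans_full by blast
  moreover have "{e \<in> topspace (subtopology (total E) ?Y). t (proj E e) = e} = t ` W'"
    using local_sectionD[OF t'] by (force simp: image_iff)
  ultimately show ?thesis by simp
qed

lemma openin_sections_agree:
  assumes t: "local_section X E W t" and t': "local_section X E W' t'"
  shows "openin X {x \<in> W \<inter> W'. t x = t' x}"
proof -
  have W: "openin X (W \<inter> W')" using t t' by (simp add: local_section_def openin_Int)
  have s: "local_section X E (W \<inter> W') t" "local_section X E (W \<inter> W') t'"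
    using t t' W by (auto intro: local_section_subset)
  have "openin (subtopology X (W \<inter> W')) {x \<in> topspace (subtopology X (W \<inter> W')). t x = t' x}"
    using local_sectionD[OF s(1)] local_sectionD[OF s(2)] by (intro openin_agree) auto
  then have "openin X {x \<in> topspace (subtopology X (W \<inter> W')). t x = t' x}"
    using W by (rule openin_trans_full)
  moreover have "{x \<in> topspace (subtopology X (W \<inter> W')). t x = t' x} = {x \<in> W \<inter> W'. t x = t' x}"
    using openin_subset[OF W] by auto
  ultimately show ?thesis by simp
qed

text \<open>Images of sections are open and cover the total space, so continuity may be tested along
  sections, where it becomes continuity on a subset of \<open>X\<close>.\<close>

lemma continuous_map_from_total:
  assumes "\<And>e. e \<in> topspace (total E) \<Longrightarrow>
    \<exists>W t. local_section X E W t \<and> proj E e \<in> W \<and> t (proj E e) = e \<and>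
      continuous_map (subtopology X W) Y (\<lambda>x. f (t x))"
  shows "continuous_map (total E) Y f"
  unfolding continuous_map_pointwise
proof (intro conjI ballI allI impI Pi_I)
  fix e assume "e \<in> topspace (total E)"
  then obtain W t where t: "local_section X E W t" "proj E e \<in> W" "t (proj E e) = e"
    and c: "continuous_map (subtopology X W) Y (\<lambda>x. f (t x))" using assms by blast
  have W: "openin X W" "W \<subseteq> topspace X" using local_sectionD[OF t(1)] by auto
  show "f e \<in> topspace Y"
    using continuous_map_mem[OF c, of "proj E e"] t W by auto
  fix O' assume O': "openin Y O'" "f e \<in> O'"
  have "openin X {x \<in> W. f (t x) \<in> O'}"
    using W(1) c O'(1) by (rule openin_continuous_map_preimage_subtopology)
  then have "openin (total E) (t ` {x \<in> W. f (t x) \<in> O'})"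
    using openin_section_image[OF t(1)] by blast
  then show "\<exists>U. openin (total E) U \<and> e \<in> U \<and> (\<forall>y\<in>U. f y \<in> O')"
    using t O' by (intro exI[of _ "t ` {x \<in> W. f (t x) \<in> O'}"]) (auto simp: image_iff intro!: bexI[of _ "proj E e"])
qed

lemma continuous_sminus:
  assumes a: "continuous_map Z (total E) a" and b: "continuous_map Z (total E) b"
    and ab: "\<And>z. z \<in> topspace Z \<Longrightarrow> proj E (a z) = proj E (b z)"
  shows "continuous_map Z (total E) (\<lambda>z. sminus E (a z) (b z))"
proof -
  have "continuous_map Z (subtopology (prod_topology (total E) (total E)) (fibre_product E)) (\<lambda>z. (a z, b z))"
    using a b ab continuous_map_mem[OF a] continuous_map_mem[OF b]
    by (auto simp: continuous_map_in_subtopology continuous_map_pairwise o_def fibre_product_def)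
  from continuous_map_compose[OF this equivariant_sheaf.continuous_minus[OF E]] show ?thesis
    by (simp add: o_def sminus_def)
qed

text \<open>Near any point the zero section is \<open>t - t\<close> for a local section
  \<open>t\<close>, and subtraction is continuous. A suitable \<open>t\<close> is the one through
  the zero element itself.\<close>

lemma continuous_szero: "continuous_map X (total E) (szero E)"
  unfolding continuous_map_pointwise
proof (intro conjI ballI allI impI Pi_I)
  fix x V assume x: "x \<in> topspace X" and V: "openin (total E) V" "szero E x \<in> V"
  obtain W t where t: "local_section X E W t" "x \<in> W" "t x = szero E x"
    using section_homeo_through[of "szero E x"] x by (metis imageI szero_closed)
  have W: "openin X W" "W \<subseteq> topspace X" using local_sectionD[OF t(1)] by auto
  have "continuous_map (subtopology X W) (total E) (\<lambda>y. sminus E (t y) (t y))"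
    using local_sectionD[OF t(1)] by (intro continuous_sminus) auto
  then have "continuous_map (subtopology X W) (total E) (szero E)"
    by (rule continuous_map_eq) (use local_sectionD[OF t(1)] sminus_self in auto)
  then have "openin X {y \<in> W. szero E y \<in> V}"
    using W(1) V(1) by (intro openin_continuous_map_preimage_subtopology)
  then show "\<exists>U. openin X U \<and> x \<in> U \<and> (\<forall>y\<in>U. szero E y \<in> V)"
    using t V by blast
qed simp

lemma continuous_sadd:
  assumes a: "continuous_map Z (total E) a" and b: "continuous_map Z (total E) b"
    and ab: "\<And>z. z \<in> topspace Z \<Longrightarrow> proj E (a z) = proj E (b z)"
  shows "continuous_map Z (total E) (\<lambda>z. sadd E (a z) (b z))"
proof -
  have mem: "a z \<in> topspace (total E)" "b z \<in> topspace (total E)" if "z \<in> topspace Z" for z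
    using that continuous_map_mem[OF a] continuous_map_mem[OF b] by auto
  have z: "continuous_map Z (total E) (\<lambda>z. szero E (proj E (b z)))"
    using continuous_map_compose[OF continuous_map_compose[OF b continuous_proj] continuous_szero]
    by (simp add: o_def)
  have "continuous_map Z (total E) (\<lambda>z. sminus E (a z) (sminus E (szero E (proj E (b z))) (b z)))"
    using mem ab by (intro continuous_sminus a b z) auto
  then show ?thesis
    by (rule continuous_map_eq) (use mem ab sadd_eq_sminus in auto)
qed

lemma local_section_zero: "openin X W \<Longrightarrow> local_section X E W (szero E)"
  using continuous_szero openin_subset[of X W] unfolding local_section_def
  by (auto simp: continuous_map_from_subtopology)

lemma local_section_minus:
  assumes "local_section X E W t" "local_section X E W t'"
  shows "local_section X E W (\<lambda>x. sminus E (t x) (t' x))"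
  using local_sectionD[OF assms(1)] local_sectionD[OF assms(2)]
  unfolding local_section_def by (auto intro!: continuous_sminus)

lemma local_section_add:
  assumes "local_section X E W t" "local_section X E W t'"
  shows "local_section X E W (\<lambda>x. sadd E (t x) (t' x))"
  using local_sectionD[OF assms(1)] local_sectionD[OF assms(2)]
  unfolding local_section_def by (auto intro!: continuous_sadd)

lemma local_section_smult:
  assumes "local_section X E W t" "r \<in> carrier R"
  shows "local_section X E W (\<lambda>x. ssmult E r (t x))"
  using local_sectionD[OF assms(1)] assms(2)
    continuous_map_compose[OF local_sectionD(3)[OF assms(1)] continuous_ssmult[OF assms(2)]]
  unfolding local_section_def by (auto simp: o_def)

lemma local_section_gact:
  assumes t: "local_section X E W t" and g: "g \<in> carrier G"
  shows "local_section X E (act g ` W) (\<lambda>y. gact E g (t (act (inv g) y)))"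
proof -
  have W: "openin X W" "W \<subseteq> topspace X" using local_sectionD[OF t] by auto
  note im = open_act_image[OF g W(1)]
  have "continuous_map (subtopology X (act g ` W)) X (\<lambda>y. act (inv g) y)"
    using g topspace_eq by (intro continuous_act_compose) auto
  then have "continuous_map (subtopology X (act g ` W)) (subtopology X W) (\<lambda>y. act (inv g) y)"
    using im W g by (auto simp: continuous_map_in_subtopology)
  from continuous_map_compose[OF this local_sectionD(3)[OF t]]
  have "continuous_map (subtopology X (act g ` W)) (total E) (\<lambda>y. gact E g (t (act (inv g) y)))"
    using g topspace_eq by (intro continuous_gact_compose) (auto simp: o_def)
  then show ?thesis
    unfolding local_section_def using im local_sectionD[OF t] W g by auto
qed

text \<open>Both maps \<open>(g, x) \<mapsto> g (t x)\<close> and \<open>(g, x) \<mapsto> t (g x)\<close> lift \<open>(g, x) \<mapsto> g x\<close>, so the set where they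
  agree is open.\<close>

lemma openin_section_equivariant:
  assumes t: "local_section X E W t"
  shows "openin (prod_topology T X)
    {(g, x) \<in> carrier G \<times> W. act g x \<in> W \<and> gact E g (t x) = t (act g x)}"
proof -
  let ?P = "prod_topology T X"
  let ?Y = "{z \<in> topspace ?P. snd z \<in> W} \<inter> {z \<in> topspace ?P. act (fst z) (snd z) \<in> W}"
  have W: "openin X W" "W \<subseteq> topspace X" using local_sectionD[OF t] by auto
  have c: "continuous_map ?P X snd" "continuous_map ?P X (\<lambda>z. act (fst z) (snd z))"
    by (auto intro: continuous_act_compose continuous_map_fst continuous_map_snd)
  have Y: "openin ?P ?Y" using c W(1) by (intro openin_Int openin_continuous_map_preimage)
  have tY: "topspace (subtopology ?P ?Y) = ?Y" by auto
  have "continuous_map (subtopology ?P ?Y) (subtopology X W) snd"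
    "continuous_map (subtopology ?P ?Y) (subtopology X W) (\<lambda>z. act (fst z) (snd z))"
    using c by (auto simp: continuous_map_in_subtopology continuous_map_from_subtopology)
  then have "continuous_map (subtopology ?P ?Y) (total E) (\<lambda>z. t (snd z))"
    "continuous_map (subtopology ?P ?Y) (total E) (\<lambda>z. t (act (fst z) (snd z)))"
    using continuous_map_compose[OF _ local_sectionD(3)[OF t]] by (auto simp: o_def)
  then have "openin (subtopology ?P ?Y) {z \<in> topspace (subtopology ?P ?Y).
      gact E (fst z) (t (snd z)) = t (act (fst z) (snd z))}"
    using local_sectionD[OF t] topspace_eq
    by (intro openin_agree continuous_gact_compose)
      (auto simp: continuous_map_from_subtopology continuous_map_fst)
  then have "openin ?P {z \<in> ?Y. gact E (fst z) (t (snd z)) = t (act (fst z) (snd z))}"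
    using Y openin_trans_full unfolding tY by blast
  moreover have "{z \<in> ?Y. gact E (fst z) (t (snd z)) = t (act (fst z) (snd z))} =
    {(g, x) \<in> carrier G \<times> W. act g x \<in> W \<and> gact E g (t x) = t (act g x)}"
    using W topspace_eq by auto
  ultimately show ?thesis by simp
qed

text \<open>The pairs \<open>(g, x)\<close> at which a section is equivariant form an open set
  containing the identity paired with the base point, hence a box \<open>H\<close> times
  \<open>W'\<close>. The set \<open>H\<close> is an open neighbourhood of the identity, not
  necessarily a subgroup. This supplies the equivariance demanded in
  \<open>regular_on\<close>.\<close>

lemma equivariant_section_through:
  assumes e: "e \<in> topspace (total E)"
  obtains W t H where "local_section X E W t" "proj E e \<in> W" "t (proj E e) = e"
    "openin T H" "\<one> \<in> H" "\<And>h x. h \<in> H \<Longrightarrow> x \<in> W \<Longrightarrow> gact E h (t x) = t (act h x)"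
proof -
  obtain W t where t: "local_section X E W t" "proj E e \<in> W" "t (proj E e) = e"
    using section_homeo_through[OF e] e by (metis imageI)
  let ?S = "{(g, x) \<in> carrier G \<times> W. act g x \<in> W \<and> gact E g (t x) = t (act g x)}"
  have "(\<one>, proj E e) \<in> ?S" using t e by auto
  then obtain H W' where HW: "openin T H" "openin X W'" "\<one> \<in> H" "proj E e \<in> W'" "H \<times> W' \<subseteq> ?S"
    by (rule openin_prod_topologyE[OF openin_section_equivariant[OF t(1)]])
  \<comment> \<open>The identity lies in \<open>H\<close>, so the box already places every point of
    \<open>W'\<close> in \<open>W\<close>.\<close>
  have "W' \<subseteq> W" using HW by auto
  then have "local_section X E W' t" using local_section_subset[OF t(1) HW(2)] by blast
  then show thesis using that[of W' t H] HW t(3) by auto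
qed

end

end

section \<open>Criteria for actions, local homeomorphisms and submodules\<close>

lemma group_actionI:
  assumes "group G"
    and "\<And>g. g \<in> carrier G \<Longrightarrow> \<phi> g \<in> extensional S"
    and "\<And>g x. g \<in> carrier G \<Longrightarrow> x \<in> S \<Longrightarrow> \<phi> g x \<in> S"
    and "\<And>x. x \<in> S \<Longrightarrow> \<phi> \<one>\<^bsub>G\<^esub> x = x"
    and "\<And>g h x. g \<in> carrier G \<Longrightarrow> h \<in> carrier G \<Longrightarrow> x \<in> S \<Longrightarrow> \<phi> (g \<otimes>\<^bsub>G\<^esub> h) x = \<phi> g (\<phi> h x)"
  shows "group_action G S \<phi>"
proof -
  interpret group G by fact
  have inv: "\<phi> (inv\<^bsub>G\<^esub> g) (\<phi> g x) = x" "\<phi> g (\<phi> (inv\<^bsub>G\<^esub> g) x) = x" if "g \<in> carrier G" "x \<in> S" for g x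
    using assms(4,5) that by (simp_all flip: assms(5))
  \<comment> \<open>The action of the inverse element is a two-sided inverse on \<open>S\<close>;
    extensionality supplies the rest of \<open>Bij\<close>.\<close>
  have bij: "\<phi> g \<in> Bij S" if "g \<in> carrier G" for g
    unfolding Bij_def using that assms(2,3) inv
    by (auto intro!: bij_betw_byWitness[of S "\<phi> (inv\<^bsub>G\<^esub> g)"])
  have "\<phi> \<in> hom G (BijGroup S)"
  proof (rule homI)
    fix g h assume g: "g \<in> carrier G" and h: "h \<in> carrier G"
    have "\<phi> (g \<otimes>\<^bsub>G\<^esub> h) = compose S (\<phi> g) (\<phi> h)"
      using assms(2)[of "g \<otimes>\<^bsub>G\<^esub> h"] assms(5) g h by (auto simp: fun_eq_iff compose_def extensional_def)
    then show "\<phi> (g \<otimes>\<^bsub>G\<^esub> h) = \<phi> g \<otimes>\<^bsub>BijGroup S\<^esub> \<phi> h"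
      using bij g h by (simp add: BijGroup_def)
  qed (simp add: BijGroup_def bij)
  then show ?thesis
    unfolding group_action_def group_hom_def group_hom_axioms_def
    using assms(1) group_BijGroup by blast
qed

text \<open>A section with open image is a homeomorphism onto that image, with the projection as its
  inverse.\<close>

lemma local_homeomorphismI:
  assumes p: "continuous_map E X p"
    and sec: "\<And>e. e \<in> topspace E \<Longrightarrow> \<exists>W t. openin X W \<and> p e \<in> W \<and>
      continuous_map (subtopology X W) E t \<and> (\<forall>x\<in>W. p (t x) = x) \<and> t (p e) = e \<and> openin E (t ` W)"
  shows "local_homeomorphism E X p"
  unfolding local_homeomorphism_def
proof (intro conjI ballI)
  show "p \<in> topspace E \<rightarrow> topspace X" using continuous_map_mem[OF p] by blast
next
  fix e assume "e \<in> topspace E"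
  then obtain W t where W: "openin X W" "p e \<in> W" and t: "continuous_map (subtopology X W) E t"
    "\<And>x. x \<in> W \<Longrightarrow> p (t x) = x" "t (p e) = e" "openin E (t ` W)" using sec by metis
  have pt: "p ` t ` W = W" using t(2) by force
  have "homeomorphic_maps (subtopology E (t ` W)) (subtopology X W) p t"
    unfolding homeomorphic_maps_def
    using p t by (auto simp: continuous_map_in_subtopology continuous_map_from_subtopology)
  then show "\<exists>V. openin E V \<and> e \<in> V \<and> openin X (p ` V) \<and>
      homeomorphic_map (subtopology E V) (subtopology X (p ` V)) p"
    using W t(3,4) pt homeomorphic_map_maps by (intro exI[of _ "t ` W"]) force
qed

text \<open>The operations of \<open>N\<close> need to match those of \<open>M\<close> only on the
  carrier of \<open>N\<close>, as happens for subsheaves, whose operations are undefined elsewhere.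
  Closure under subtraction yields negatives and sums; the two subtractions agree because the
  inclusion is linear.\<close>

lemma left_module_submodule:
  assumes M: "left_module R M" and sub: "carrier N \<subseteq> carrier M"
    and add: "\<And>x y. x \<in> carrier N \<Longrightarrow> y \<in> carrier N \<Longrightarrow> x \<oplus>\<^bsub>N\<^esub> y = x \<oplus>\<^bsub>M\<^esub> y"
    and zero: "\<zero>\<^bsub>N\<^esub> = \<zero>\<^bsub>M\<^esub>" "\<zero>\<^bsub>M\<^esub> \<in> carrier N"
    and smult: "\<And>r x. r \<in> carrier R \<Longrightarrow> x \<in> carrier N \<Longrightarrow> r \<odot>\<^bsub>N\<^esub> x = r \<odot>\<^bsub>M\<^esub> x"
    and mcl: "\<And>x y. x \<in> carrier N \<Longrightarrow> y \<in> carrier N \<Longrightarrow> x \<ominus>\<^bsub>M\<^esub> y \<in> carrier N"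
    and scl: "\<And>r x. r \<in> carrier R \<Longrightarrow> x \<in> carrier N \<Longrightarrow> r \<odot>\<^bsub>M\<^esub> x \<in> carrier N"
  shows "left_module R N"
    and "\<And>x y. x \<in> carrier N \<Longrightarrow> y \<in> carrier N \<Longrightarrow> x \<ominus>\<^bsub>N\<^esub> y = x \<ominus>\<^bsub>M\<^esub> y"
proof -
  interpret left_module R M by fact
  have mem [simp]: "x \<in> carrier M" if "x \<in> carrier N" for x using that sub by blast
  have neg: "\<ominus>\<^bsub>M\<^esub> x \<in> carrier N" if "x \<in> carrier N" for x
    using mcl[OF zero(2) that] that by (simp add: a_minus_def)
  have cl: "x \<oplus>\<^bsub>M\<^esub> y \<in> carrier N" if "x \<in> carrier N" "y \<in> carrier N" for x y
    using mcl[OF that(1) neg[OF that(2)]] that by (simp add: a_minus_def)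
  have grp: "abelian_group N"
  proof (rule abelian_groupI)
    fix x assume x: "x \<in> carrier N"
    then show "\<exists>y\<in>carrier N. y \<oplus>\<^bsub>N\<^esub> x = \<zero>\<^bsub>N\<^esub>"
      using neg by (intro bexI[of _ "\<ominus>\<^bsub>M\<^esub> x"]) (auto simp: add zero M.l_neg)
  qed (auto simp: add zero cl M.a_ac)
  show "left_module R N"
    unfolding left_module_def left_module_axioms_def
    using grp R.ring_axioms
    by (auto simp: smult add cl smult_l_distr smult_r_distr smult_assoc smult_one scl)
  show "x \<ominus>\<^bsub>N\<^esub> y = x \<ominus>\<^bsub>M\<^esub> y" if "x \<in> carrier N" "y \<in> carrier N" for x y
  proof (rule R_linear_minus[of N M R "\<lambda>x. x"])
    show "R_linear R N M (\<lambda>x. x)" using sub by (auto simp: R_linear_def add smult)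
  qed (use that grp M.abelian_group_axioms in auto)
qed

section \<open>Maps of sheaves and subsheaves\<close>

context group_space
begin

lemma sheaf_mapsI:
  assumes "sheaf E" "sheaf F"
    and "f \<in> extensional (topspace (total E))" "continuous_map (total E) (total F) f"
    and "\<And>e. e \<in> topspace (total E) \<Longrightarrow> proj F (f e) = proj E e"
    and "\<And>g e. g \<in> carrier G \<Longrightarrow> e \<in> topspace (total E) \<Longrightarrow> f (gact E g e) = gact F g (f e)"
    and "\<And>a b. a \<in> topspace (total E) \<Longrightarrow> b \<in> topspace (total E) \<Longrightarrow> proj E a = proj E b \<Longrightarrow>
      f (sadd E a b) = sadd F (f a) (f b)"
    and "\<And>r a. r \<in> carrier R \<Longrightarrow> a \<in> topspace (total E) \<Longrightarrow> f (ssmult E r a) = ssmult F r (f a)"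
  shows "f \<in> sheaf_maps G X R E F"
  unfolding sheaf_maps_def R_linear_def using assms continuous_map_mem[OF assms(4)] by auto

context
  fixes E F :: "('g, 'r, 'x, 'e) gsheaf" and f :: "'e \<Rightarrow> 'e"
  assumes E: "sheaf E" and F: "sheaf F" and f: "f \<in> sheaf_maps G X R E F"
begin

lemma sheaf_map_continuous: "continuous_map (total E) (total F) f"
  and sheaf_map_ext: "f \<in> extensional (topspace (total E))"
  and sheaf_map_proj [simp]: "e \<in> topspace (total E) \<Longrightarrow> proj F (f e) = proj E e"
  and sheaf_map_gact: "g \<in> carrier G \<Longrightarrow> e \<in> topspace (total E) \<Longrightarrow> f (gact E g e) = gact F g (f e)"
  and sheaf_map_linear: "x \<in> topspace X \<Longrightarrow> R_linear R (stalk E x) (stalk F x) f"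
  using f by (auto simp: sheaf_maps_def)

lemma sheaf_map_closed [simp]: "e \<in> topspace (total E) \<Longrightarrow> f e \<in> topspace (total F)"
  using continuous_map_mem[OF sheaf_map_continuous] .

lemma sheaf_map_sadd:
  "a \<in> topspace (total E) \<Longrightarrow> b \<in> topspace (total E) \<Longrightarrow> proj E a = proj E b \<Longrightarrow>
    f (sadd E a b) = sadd F (f a) (f b)"
  using sheaf_map_linear[of "proj E b"] proj_closed[OF E] by (simp add: R_linear_def)

lemma sheaf_map_ssmult:
  "r \<in> carrier R \<Longrightarrow> a \<in> topspace (total E) \<Longrightarrow> f (ssmult E r a) = ssmult F r (f a)"
  using sheaf_map_linear[of "proj E a"] proj_closed[OF E] by (simp add: R_linear_def)

lemma sheaf_map_szero: "x \<in> topspace X \<Longrightarrow> f (szero E x) = szero F x"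
  using R_linear_zero[OF stalk_abelian_group[OF E] stalk_abelian_group[OF F] sheaf_map_linear] by simp

lemma sheaf_map_sminus:
  "a \<in> topspace (total E) \<Longrightarrow> b \<in> topspace (total E) \<Longrightarrow> proj E a = proj E b \<Longrightarrow>
    f (sminus E a b) = sminus F (f a) (f b)"
  using R_linear_minus[OF stalk_abelian_group[OF E] stalk_abelian_group[OF F] sheaf_map_linear[of "proj E b"],
      of a b] proj_closed[OF E]
  by (simp add: sminus_def)

lemma sheaf_map_section:
  assumes t: "local_section X E W t"
  shows "local_section X F W (\<lambda>x. f (t x))"
  using local_sectionD[OF t] continuous_map_compose[OF local_sectionD(3)[OF t] sheaf_map_continuous]
  by (simp add: local_section_def o_def)

text \<open>A sheaf map carries sections to sections, and images of sections are open in either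
  sheaf.\<close>

lemma sheaf_map_open:
  assumes "openin (total E) V"
  shows "openin (total F) (f ` V)"
proof (subst openin_subopen, safe)
  fix e assume e: "e \<in> V"
  have eE: "e \<in> topspace (total E)" using openin_subset[OF assms] e by blast
  obtain W t where t: "local_section X E W t" "proj E e \<in> W" "t (proj E e) = e"
    using section_homeo_through[OF E eE] eE by (metis imageI)
  let ?W = "{x \<in> W. t x \<in> V}"
  have W: "openin X ?W" using local_sectionD[OF t(1)] assms
    by (intro openin_continuous_map_preimage_subtopology)
  have "openin (total F) ((\<lambda>x. f (t x)) ` ?W)"
    using openin_section_image[OF F sheaf_map_section[OF t(1)] W] by blast
  then show "\<exists>T. openin (total F) T \<and> f e \<in> T \<and> T \<subseteq> f ` V"
    using t e by (intro exI[of _ "(\<lambda>x. f (t x)) ` ?W"]) (auto intro!: rev_image_eqI[of "proj E e"])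
qed

end

lemma sheaf_maps_comp:
  assumes E: "sheaf E" and F: "sheaf F" and H: "sheaf H"
    and f: "f \<in> sheaf_maps G X R E F" and g: "g \<in> sheaf_maps G X R F H"
  shows "compose (topspace (total E)) g f \<in> sheaf_maps G X R E H"
proof (rule sheaf_mapsI[OF E H])
  show "continuous_map (total E) (total H) (compose (topspace (total E)) g f)"
    using continuous_map_compose[OF sheaf_map_continuous[OF E F f] sheaf_map_continuous[OF F H g]]
    by (rule continuous_map_eq) (simp add: compose_def)
qed (auto simp: compose_def E F H sheaf_map_closed[OF E F f] sheaf_map_proj[OF E F f]
    sheaf_map_proj[OF F H g] sheaf_map_gact[OF E F f] sheaf_map_gact[OF F H g]
    sheaf_map_sadd[OF E F f] sheaf_map_sadd[OF F H g] sheaf_map_ssmult[OF E F f] sheaf_map_ssmult[OF F H g]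
    gact_closed[OF E] sadd_closed[OF E] ssmult_closed[OF E])

lemma sheaf_maps_id:
  assumes E: "sheaf E"
  shows "(\<lambda>e\<in>topspace (total E). e) \<in> sheaf_maps G X R E E"
proof (rule sheaf_mapsI[OF E E])
  show "continuous_map (total E) (total E) (\<lambda>e\<in>topspace (total E). e)"
    using continuous_map_id by (rule continuous_map_eq) auto
qed (auto simp: gact_closed[OF E] sadd_closed[OF E] ssmult_closed[OF E])

end

text \<open>The construction of \<open>weyl_sheaf\<close> with the fixed points replaced by an
  arbitrary set \<open>W\<close>, so that it also yields kernels. \<open>szero\<close> is kept
  because \<open>stable_subset\<close> puts the zero elements into \<open>W\<close>.\<close>

definition subsheaf ::
  "('g, 'z) monoid_scheme \<Rightarrow> ('r, 'y) ring_scheme \<Rightarrow> ('g, 'r, 'x, 'e) gsheaf \<Rightarrow> 'e set \<Rightarrow>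
   ('g, 'r, 'x, 'e) gsheaf" where
  "subsheaf G R E W =
     \<lparr>total = subtopology (total E) W,
      proj = restrict (proj E) W,
      gact = (\<lambda>g \<in> carrier G. restrict (gact E g) W),
      sadd = (\<lambda>a b. if a \<in> W \<and> b \<in> W then sadd E a b else undefined),
      szero = szero E,
      ssmult = (\<lambda>r \<in> carrier R. restrict (ssmult E r) W)\<rparr>"

lemma subsheaf_simps [simp]:
  "total (subsheaf G R E W) = subtopology (total E) W"
  "e \<in> W \<Longrightarrow> proj (subsheaf G R E W) e = proj E e"
  "g \<in> carrier G \<Longrightarrow> e \<in> W \<Longrightarrow> gact (subsheaf G R E W) g e = gact E g e"
  "a \<in> W \<Longrightarrow> b \<in> W \<Longrightarrow> sadd (subsheaf G R E W) a b = sadd E a b"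
  "szero (subsheaf G R E W) = szero E"
  "r \<in> carrier R \<Longrightarrow> e \<in> W \<Longrightarrow> ssmult (subsheaf G R E W) r e = ssmult E r e"
  by (simp_all add: subsheaf_def)

context group_space
begin

text \<open>Closure under addition follows from the zero elements and subtraction, and subtraction
  is the operation whose continuity is postulated.\<close>

definition stable_subset :: "('g, 'r, 'x, 'e) gsheaf \<Rightarrow> 'e set \<Rightarrow> bool" where
  "stable_subset E W \<longleftrightarrow> openin (total E) W \<and> (\<forall>x \<in> topspace X. szero E x \<in> W) \<and>
     (\<forall>a \<in> W. \<forall>b \<in> W. proj E a = proj E b \<longrightarrow> sminus E a b \<in> W) \<and>
     (\<forall>r \<in> carrier R. \<forall>a \<in> W. ssmult E r a \<in> W) \<and>
     (\<forall>g \<in> carrier G. \<forall>a \<in> W. gact E g a \<in> W)"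

lemma stable_subset_subset: "stable_subset E W \<Longrightarrow> W \<subseteq> topspace (total E)"
  by (simp add: stable_subset_def openin_subset)

lemma stable_subset_sadd:
  assumes E: "sheaf E" and W: "stable_subset E W"
    and "a \<in> W" "b \<in> W" "proj E a = proj E b"
  shows "sadd E a b \<in> W"
proof -
  have "szero E (proj E b) \<in> W" "a \<in> topspace (total E)" "b \<in> topspace (total E)"
    using assms(2-4) proj_closed[OF E] stable_subset_subset[OF W] unfolding stable_subset_def by blast+
  moreover from this have "sminus E a (sminus E (szero E (proj E b)) b) \<in> W"
    using assms E unfolding stable_subset_def by (simp add: proj_closed szero_closed sminus_closed)
  ultimately show ?thesis using assms(5) sadd_eq_sminus[OF E] by simp
qed

lemma sheaf_subsheaf:
  fixes E :: "('g, 'r, 'x, 'e) gsheaf"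
  assumes E: "sheaf E" and W: "stable_subset E W"
  shows "sheaf (subsheaf G R E W)"
proof -
  let ?S = "subsheaf G R E W"
  have oW: "openin (total E) W" and WE: "W \<subseteq> topspace (total E)"
    using W stable_subset_subset by (auto simp: stable_subset_def)
  have ts [simp]: "topspace (total ?S) = W" using WE by auto
  have cl: "\<And>x. x \<in> topspace X \<Longrightarrow> szero E x \<in> W"
    "\<And>a b. a \<in> W \<Longrightarrow> b \<in> W \<Longrightarrow> proj E a = proj E b \<Longrightarrow> sminus E a b \<in> W"
    "\<And>r a. r \<in> carrier R \<Longrightarrow> a \<in> W \<Longrightarrow> ssmult E r a \<in> W"
    "\<And>g a. g \<in> carrier G \<Longrightarrow> a \<in> W \<Longrightarrow> gact E g a \<in> W"
    using W by (auto simp: stable_subset_def)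
  have clE [simp]: "a \<in> W \<Longrightarrow> a \<in> topspace (total E)" for a using WE by blast
  have mods: "left_module R (stalk ?S x)"
    "\<And>a b. a \<in> carrier (stalk ?S x) \<Longrightarrow> b \<in> carrier (stalk ?S x) \<Longrightarrow>
       a \<ominus>\<^bsub>stalk ?S x\<^esub> b = a \<ominus>\<^bsub>stalk E x\<^esub> b"
    if "x \<in> topspace X" for x
  proof -
    have ca: "a \<in> carrier (stalk ?S x) \<longleftrightarrow> a \<in> W \<and> proj E a = x" for a
      using WE by auto
    note sub = left_module_submodule[OF stalk_left_module[OF E that], of "stalk ?S x"]
    show "left_module R (stalk ?S x)"
      by (rule sub) (unfold ca, use that in \<open>auto simp: cl E sminus_stalk sminus_closed ssmult_closed szero_closed\<close>)
    show "a \<ominus>\<^bsub>stalk ?S x\<^esub> b = a \<ominus>\<^bsub>stalk E x\<^esub> b"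
      if "a \<in> carrier (stalk ?S x)" "b \<in> carrier (stalk ?S x)" for a b
      by (rule sub) (use that in \<open>unfold ca\<close>,
        use \<open>x \<in> topspace X\<close> in \<open>auto simp: cl E sminus_stalk sminus_closed ssmult_closed szero_closed\<close>)
  qed
  have cont_id: "continuous_map (total ?S) (total E) (\<lambda>e. e)"
    by (simp add: continuous_map_from_subtopology)
  show ?thesis
  proof (rule equivariant_sheaf.intro)
    show "continuous_action G T (total ?S) (gact ?S)"
      unfolding continuous_action_def
    proof
      show "group_action G (topspace (total ?S)) (gact ?S)"
        unfolding ts by (rule group_actionI)
          (auto simp: is_group cl gact_mult[OF E] gact_one[OF E] subsheaf_def)
      have "continuous_map (prod_topology T (total ?S)) (total E) (\<lambda>z. gact E (fst z) (snd z))"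
        using continuous_map_compose[OF continuous_map_snd cont_id]
        by (intro continuous_gact_compose[OF E] continuous_map_fst) (simp add: o_def)
      then have "continuous_map (prod_topology T (total ?S)) (total ?S) (\<lambda>z. gact E (fst z) (snd z))"
        by (auto simp: continuous_map_in_subtopology cl topspace_eq)
      then show "continuous_map (prod_topology T (total ?S)) (total ?S) (\<lambda>(g, a). gact ?S g a)"
        by (rule continuous_map_eq) (auto simp: topspace_eq)
    qed
    show "local_homeomorphism (total ?S) X (proj ?S)"
    proof (rule local_homeomorphismI)
      have "continuous_map (total ?S) X (proj E)"
        by (simp add: continuous_map_from_subtopology continuous_proj[OF E])
      then show "continuous_map (total ?S) X (proj ?S)"
        by (rule continuous_map_eq) auto
      fix e assume "e \<in> topspace (total ?S)"
      then have e: "e \<in> W" by simp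
      obtain V t where t: "local_section X E V t" "proj E e \<in> V" "t (proj E e) = e"
        using section_homeo_through[OF E clE[OF e]] clE[OF e] by (metis imageI)
      \<comment> \<open>The section of \<open>E\<close> is cut down to the points where it runs
        inside \<open>W\<close>; openness of \<open>W\<close> makes this an open set, so
        \<open>W\<close> inherits the sheets of \<open>E\<close>.\<close>
      let ?V = "{x \<in> V. t x \<in> W}"
      have V: "openin X ?V" using local_sectionD[OF t(1)] oW
        by (intro openin_continuous_map_preimage_subtopology)
      then have t': "local_section X E ?V t" using local_section_subset[OF t(1)] by blast
      have "openin (total E) (t ` ?V)" using openin_section_image[OF E t' V] by blast
      then have "openin (total ?S) (t ` ?V)"
        by (auto simp: openin_subtopology intro!: exI[of _ "t ` ?V"])
      then show "\<exists>V t. openin X V \<and> proj ?S e \<in> V \<and> continuous_map (subtopology X V) (total ?S) t \<and>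
         (\<forall>x\<in>V. proj ?S (t x) = x) \<and> t (proj ?S e) = e \<and> openin (total ?S) (t ` V)"
        using V t e local_sectionD[OF t'] by (intro exI[of _ ?V] exI[of _ t]) (auto simp: continuous_map_in_subtopology)
    qed
    show "left_module R (stalk ?S x)" if "x \<in> topspace X" for x using mods that by blast
    have "continuous_map (subtopology (prod_topology (total ?S) (total ?S)) (fibre_product ?S)) (total E)
        (\<lambda>z. sminus E (fst z) (snd z))"
    proof (rule continuous_sminus[OF E])
      show "continuous_map (subtopology (prod_topology (total ?S) (total ?S)) (fibre_product ?S)) (total E) fst"
        "continuous_map (subtopology (prod_topology (total ?S) (total ?S)) (fibre_product ?S)) (total E) snd"
        unfolding subsheaf_simps
        by (rule continuous_map_from_subtopology, rule continuous_map_into_fulltopology,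
          rule continuous_map_fst continuous_map_snd)+
    qed (use WE in \<open>auto simp: fibre_product_def\<close>)
    then have "continuous_map (subtopology (prod_topology (total ?S) (total ?S)) (fibre_product ?S)) (total ?S)
        (\<lambda>z. sminus E (fst z) (snd z))"
      using WE by (auto simp: continuous_map_in_subtopology fibre_product_def cl)
    then show "continuous_map (subtopology (prod_topology (total ?S) (total ?S)) (fibre_product ?S)) (total ?S)
        (\<lambda>(a, b). a \<ominus>\<^bsub>stalk ?S (proj ?S a)\<^esub> b)"
      by (rule continuous_map_eq)
        (use WE in \<open>auto simp: fibre_product_def mods proj_closed[OF E] sminus_def\<close>)
    show "continuous_map (total ?S) (total ?S) (ssmult ?S r)" if "r \<in> carrier R" for r
    proof -
      have "continuous_map (total ?S) (total ?S) (ssmult E r)"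
        using continuous_map_compose[OF cont_id continuous_ssmult[OF E that]] that
        by (auto simp: continuous_map_in_subtopology o_def cl)
      then show ?thesis by (rule continuous_map_eq) (auto simp: that)
    qed
    show "R_linear R (stalk ?S x) (stalk ?S (act g x)) (gact ?S g)"
      if "g \<in> carrier G" "x \<in> topspace X" for g x
      using that WE by (auto simp: R_linear_def cl gact_sadd[OF E] gact_ssmult[OF E] gact_closed[OF E]
        stable_subset_sadd[OF E W])
    show "sadd ?S a b = undefined" if "(a, b) \<notin> fibre_product ?S" for a b
      using that equivariant_sheaf.sadd_ext[OF E, of a b] WE by (auto simp: subsheaf_def fibre_product_def)
    show "proj ?S \<in> extensional (topspace (total ?S))" unfolding ts by (simp add: subsheaf_def)
    show "ssmult ?S r \<in> extensional (topspace (total ?S))" if "r \<in> carrier R" for r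
      unfolding ts using that by (simp add: subsheaf_def)
  qed (use equivariant_sheaf.szero_ext[OF E] WE in \<open>auto simp: subsheaf_def gact_closed[OF E] cl\<close>)
qed

lemma sheaf_maps_into_subsheaf:
  assumes M: "sheaf M" and E: "sheaf E" and W: "stable_subset E W"
    and f: "f \<in> sheaf_maps G X R M E" and "\<And>m. m \<in> topspace (total M) \<Longrightarrow> f m \<in> W"
  shows "f \<in> sheaf_maps G X R M (subsheaf G R E W)"
proof (rule sheaf_mapsI[OF M sheaf_subsheaf[OF E W]])
qed (use assms in \<open>auto simp: sheaf_map_ext[OF M E f] continuous_map_in_subtopology
    sheaf_map_continuous[OF M E f] sheaf_map_gact[OF M E f] sheaf_map_sadd[OF M E f]
    sheaf_map_ssmult[OF M E f] sheaf_map_proj[OF M E f]\<close>)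

lemma sheaf_maps_from_subsheaf:
  assumes M: "sheaf M" and E: "sheaf E" and W: "stable_subset E W"
    and f: "f \<in> sheaf_maps G X R E M"
  shows "restrict f W \<in> sheaf_maps G X R (subsheaf G R E W) M"
proof (rule sheaf_mapsI[OF sheaf_subsheaf[OF E W] M])
  have WE: "W \<subseteq> topspace (total E)" using stable_subset_subset[OF W] .
  show "restrict f W \<in> extensional (topspace (total (subsheaf G R E W)))"
    using WE by (auto simp: extensional_def)
  have "continuous_map (subtopology (total E) W) (total M) f"
    by (simp add: continuous_map_from_subtopology sheaf_map_continuous[OF E M f])
  then show "continuous_map (total (subsheaf G R E W)) (total M) (restrict f W)"
    unfolding subsheaf_simps by (rule continuous_map_eq) auto
qed (use W in \<open>auto simp: stable_subset_def sheaf_map_gact[OF E M f] sheaf_map_sadd[OF E M f]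
    sheaf_map_ssmult[OF E M f] sheaf_map_proj[OF E M f] stable_subset_sadd[OF E W]\<close>)

lemma sheaf_maps_inclusion:
  assumes E: "sheaf E" and W: "stable_subset E W"
  shows "(\<lambda>e\<in>W. e) \<in> sheaf_maps G X R (subsheaf G R E W) E"
proof -
  have "restrict (\<lambda>e\<in>topspace (total E). e) W = (\<lambda>e\<in>W. e)"
    using stable_subset_subset[OF W] by (simp add: inf.absorb2)
  then show ?thesis using sheaf_maps_from_subsheaf[OF E E W sheaf_maps_id[OF E]] by simp
qed

text \<open>The image is open because sheaf maps are open; the algebraic closure properties are
  transported from \<open>E\<close> along the map.\<close>

lemma stable_subset_image:
  assumes E: "sheaf E" and F: "sheaf F" and f: "f \<in> sheaf_maps G X R E F"
  shows "stable_subset F (f ` topspace (total E))"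
proof -
  have "szero F x \<in> f ` topspace (total E)" if "x \<in> topspace X" for x
    using that sheaf_map_szero[OF E F f that] szero_closed[OF E that] by (metis imageI)
  then show ?thesis
    unfolding stable_subset_def
    using sheaf_map_open[OF E F f openin_topspace]
    by (auto simp: sheaf_map_proj[OF E F f] simp flip: sheaf_map_sminus[OF E F f]
      sheaf_map_ssmult[OF E F f] sheaf_map_gact[OF E F f]
      intro!: imageI sminus_closed[OF E] ssmult_closed[OF E] gact_closed[OF E])
qed

text \<open>The kernel is where the map agrees with the zero section, and agreement of two lifts is
  an open condition.\<close>

lemma stable_subset_kernel:
  assumes E: "sheaf E" and F: "sheaf F" and f: "f \<in> sheaf_maps G X R E F"
  shows "stable_subset E {e \<in> topspace (total E). f e = szero F (proj E e)}"
proof -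
  have "continuous_map (total E) (total F) (\<lambda>e. szero F (proj E e))"
    using continuous_map_compose[OF continuous_proj[OF E] continuous_szero[OF F]] by (simp add: o_def)
  then have "openin (total E) {e \<in> topspace (total E). f e = szero F (proj E e)}"
    by (intro openin_agree[OF F] sheaf_map_continuous[OF E F f]) (simp_all add: sheaf_map_proj[OF E F f] szero_closed[OF F] proj_closed[OF E])
  then show ?thesis
    unfolding stable_subset_def
    by (auto simp: sheaf_map_szero[OF E F f] szero_closed[OF E] szero_closed[OF F] proj_closed[OF E]
      sheaf_map_sminus[OF E F f] sminus_closed[OF E] sminus_self[OF F] sheaf_map_ssmult[OF E F f]
      ssmult_closed[OF E] ssmult_zero[OF F] sheaf_map_gact[OF E F f] gact_closed[OF E] gact_szero[OF F])
qed

section \<open>Zero, difference and sum of maps of sheaves\<close>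

lemma sheaf_maps_zero:
  assumes E: "sheaf E" and F: "sheaf F"
  shows "(\<lambda>e\<in>topspace (total E). szero F (proj E e)) \<in> sheaf_maps G X R E F"
proof (rule sheaf_mapsI[OF E F])
  have "continuous_map (total E) (total F) (\<lambda>e. szero F (proj E e))"
    using continuous_map_compose[OF continuous_proj[OF E] continuous_szero[OF F]] by (simp add: o_def)
  then show "continuous_map (total E) (total F) (\<lambda>e\<in>topspace (total E). szero F (proj E e))"
    by (rule continuous_map_eq) simp
qed (auto simp: proj_closed[OF E] szero_closed[OF F] gact_closed[OF E] gact_szero[OF F] sadd_closed[OF E]
    sadd_zero[OF F] ssmult_closed[OF E] ssmult_zero[OF F])

lemma sheaf_maps_minus:
  assumes E: "sheaf E" and F: "sheaf F" and f: "f \<in> sheaf_maps G X R E F" and g: "g \<in> sheaf_maps G X R E F"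
  shows "(\<lambda>e\<in>topspace (total E). sminus F (f e) (g e)) \<in> sheaf_maps G X R E F"
proof (rule sheaf_mapsI[OF E F])
  note [simp] = sheaf_map_proj[OF E F f] sheaf_map_proj[OF E F g] sheaf_map_closed[OF E F f] sheaf_map_closed[OF E F g]
    gact_closed[OF E] sadd_closed[OF E] ssmult_closed[OF E] sminus_closed[OF F] proj_closed[OF E]
  have "continuous_map (total E) (total F) (\<lambda>e. sminus F (f e) (g e))"
    by (intro continuous_sminus[OF F] sheaf_map_continuous[OF E F f] sheaf_map_continuous[OF E F g]) simp
  then show "continuous_map (total E) (total F) (\<lambda>e\<in>topspace (total E). sminus F (f e) (g e))"
    by (rule continuous_map_eq) simp
  fix a assume a: "a \<in> topspace (total E)"
  show "(\<lambda>e\<in>topspace (total E). sminus F (f e) (g e)) (gact E h a) =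
      gact F h ((\<lambda>e\<in>topspace (total E). sminus F (f e) (g e)) a)" if "h \<in> carrier G" for h
    using a that by (simp add: sheaf_map_gact[OF E F f] sheaf_map_gact[OF E F g] gact_sminus[OF F])
  interpret left_module R "stalk F (proj E a)" using stalk_left_module[OF F] a by simp
  show "(\<lambda>e\<in>topspace (total E). sminus F (f e) (g e)) (ssmult E r a) =
      ssmult F r ((\<lambda>e\<in>topspace (total E). sminus F (f e) (g e)) a)" if "r \<in> carrier R" for r
    using a that smult_r_diff[of r "f a" "g a"] sminus_stalk[OF F]
    by (simp add: sheaf_map_ssmult[OF E F f] sheaf_map_ssmult[OF E F g] ssmult_closed[OF F])
  fix b assume b: "b \<in> topspace (total E)" and ab: "proj E a = proj E b"
  have mem: "c \<in> carrier (stalk F (proj E a))" if "c \<in> {f a, f b, g a, g b}" for c using a b ab that by auto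
  have "f a \<oplus>\<^bsub>stalk F (proj E a)\<^esub> f b \<ominus>\<^bsub>stalk F (proj E a)\<^esub> (g a \<oplus>\<^bsub>stalk F (proj E a)\<^esub> g b) =
    (f a \<ominus>\<^bsub>stalk F (proj E a)\<^esub> g a) \<oplus>\<^bsub>stalk F (proj E a)\<^esub> (f b \<ominus>\<^bsub>stalk F (proj E a)\<^esub> g b)"
    using mem by (simp add: a_minus_def M.minus_add M.a_ac del: stalk_simps)
  then show "(\<lambda>e\<in>topspace (total E). sminus F (f e) (g e)) (sadd E a b) =
      sadd F ((\<lambda>e\<in>topspace (total E). sminus F (f e) (g e)) a) ((\<lambda>e\<in>topspace (total E). sminus F (f e) (g e)) b)"
    using a b ab by (simp add: sheaf_map_sadd[OF E F f] sheaf_map_sadd[OF E F g] sminus_stalk[OF F] sadd_closed[OF F])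
qed (simp_all add: sheaf_map_proj[OF E F f] sheaf_map_proj[OF E F g] sheaf_map_closed[OF E F f]
    sheaf_map_closed[OF E F g] sminus_closed[OF F])

lemma sheaf_maps_add:
  assumes E: "sheaf E" and F: "sheaf F" and f: "f \<in> sheaf_maps G X R E F" and g: "g \<in> sheaf_maps G X R E F"
  shows "(\<lambda>e\<in>topspace (total E). sadd F (f e) (g e)) \<in> sheaf_maps G X R E F"
proof -
  \<comment> \<open>The sum is \<open>f - (0 - g)\<close>, so the zero map and differences
    suffice.\<close>
  have "(\<lambda>e\<in>topspace (total E). sadd F (f e) (g e)) = (\<lambda>e\<in>topspace (total E). sminus F (f e)
    ((\<lambda>e\<in>topspace (total E). sminus F ((\<lambda>e\<in>topspace (total E). szero F (proj E e)) e) (g e)) e))"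
    by (auto simp: fun_eq_iff sadd_eq_sminus[OF F] sheaf_map_closed[OF E F f] sheaf_map_closed[OF E F g]
        sheaf_map_proj[OF E F f] sheaf_map_proj[OF E F g])
  then show ?thesis
    using sheaf_maps_minus[OF E F f sheaf_maps_minus[OF E F sheaf_maps_zero[OF E F] g]] by simp
qed

end

text \<open>Module axioms are identities and existence statements, so they pass along a surjection
  compatible with the operations. Injectivity is not involved, as the map will be the passage from
  \<open>A x\<close> to its classes.\<close>

lemma left_module_image:
  assumes N: "left_module R N" and carrier: "carrier M = f ` carrier N"
    and add: "\<And>x y. x \<in> carrier N \<Longrightarrow> y \<in> carrier N \<Longrightarrow> f (x \<oplus>\<^bsub>N\<^esub> y) = f x \<oplus>\<^bsub>M\<^esub> f y"
    and zero: "f \<zero>\<^bsub>N\<^esub> = \<zero>\<^bsub>M\<^esub>"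
    and smult: "\<And>r x. r \<in> carrier R \<Longrightarrow> x \<in> carrier N \<Longrightarrow> f (r \<odot>\<^bsub>N\<^esub> x) = r \<odot>\<^bsub>M\<^esub> f x"
  shows "left_module R M"
proof -
  interpret left_module R N by fact
  have grp: "abelian_group M"
  proof (rule abelian_groupI)
    fix x assume "x \<in> carrier M"
    then obtain a where a: "a \<in> carrier N" "x = f a" by (auto simp: carrier)
    then have "f (\<ominus>\<^bsub>N\<^esub> a) \<oplus>\<^bsub>M\<^esub> x = \<zero>\<^bsub>M\<^esub>"
      using zero add[of "\<ominus>\<^bsub>N\<^esub> a" a] by (simp add: M.l_neg)
    then show "\<exists>y\<in>carrier M. y \<oplus>\<^bsub>M\<^esub> x = \<zero>\<^bsub>M\<^esub>" using a by (auto simp: carrier)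
  qed (auto simp: carrier M.a_ac simp flip: add zero)
  show ?thesis
    unfolding left_module_def left_module_axioms_def
    using grp R.ring_axioms
    by (auto simp: carrier smult_closed smult_l_distr smult_r_distr smult_assoc smult_one simp flip: add smult)
qed

section \<open>Sheaves presented by germs of sections\<close>

text \<open>The elements of \<open>P\<close> are global families of possibly discontinuous sections, \<open>A x\<close> consists of those
  that are admissible near \<open>x\<close>, and \<open>B x\<close> of those whose germ at \<open>x\<close> is to be zero.  The presented sheaf
  has the stalk \<open>A x / B x\<close>; the function \<open>val\<close> names the classes by elements of the universe.\<close>

locale sheaf_presentation = group_space G T X act R
  for G :: "('g, 'z) monoid_scheme" (structure) and T and X :: "'x topology" and act
    and R :: "('r, 'y) ring_scheme" +
  fixes P :: "('r, 's) module" and \<sigma> :: "'g \<Rightarrow> 's \<Rightarrow> 's"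
    and A B :: "'x \<Rightarrow> 's set" and val :: "'s \<Rightarrow> 'x \<Rightarrow> 'e"
  assumes P: "left_module R P"
    and sigma_linear: "g \<in> carrier G \<Longrightarrow> R_linear R P P (\<sigma> g)"
    and sigma_one: "s \<in> carrier P \<Longrightarrow> \<sigma> \<one> s = s"
    and sigma_mult: "g \<in> carrier G \<Longrightarrow> h \<in> carrier G \<Longrightarrow> s \<in> carrier P \<Longrightarrow> \<sigma> (g \<otimes> h) s = \<sigma> g (\<sigma> h s)"
    and A_P: "s \<in> A x \<Longrightarrow> s \<in> carrier P"
    and B_A: "x \<in> topspace X \<Longrightarrow> s \<in> B x \<Longrightarrow> s \<in> A x"
    and B_zero: "x \<in> topspace X \<Longrightarrow> \<zero>\<^bsub>P\<^esub> \<in> B x"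
    and A_minus: "x \<in> topspace X \<Longrightarrow> s \<in> A x \<Longrightarrow> t \<in> A x \<Longrightarrow> s \<ominus>\<^bsub>P\<^esub> t \<in> A x"
    and B_minus: "x \<in> topspace X \<Longrightarrow> s \<in> B x \<Longrightarrow> t \<in> B x \<Longrightarrow> s \<ominus>\<^bsub>P\<^esub> t \<in> B x"
    and A_smult: "x \<in> topspace X \<Longrightarrow> r \<in> carrier R \<Longrightarrow> s \<in> A x \<Longrightarrow> r \<odot>\<^bsub>P\<^esub> s \<in> A x"
    and B_smult: "x \<in> topspace X \<Longrightarrow> r \<in> carrier R \<Longrightarrow> s \<in> B x \<Longrightarrow> r \<odot>\<^bsub>P\<^esub> s \<in> B x"
    and A_sigma: "x \<in> topspace X \<Longrightarrow> g \<in> carrier G \<Longrightarrow> s \<in> A x \<Longrightarrow> \<sigma> g s \<in> A (act g x)"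
    and B_sigma: "x \<in> topspace X \<Longrightarrow> g \<in> carrier G \<Longrightarrow> s \<in> B x \<Longrightarrow> \<sigma> g s \<in> B (act g x)"
    and A_open: "openin X {x \<in> topspace X. s \<in> A x}"
    and B_open: "openin X {x \<in> topspace X. s \<in> B x}"
    and A_continuous: "x \<in> topspace X \<Longrightarrow> s \<in> A x \<Longrightarrow>
      \<exists>H W. openin T H \<and> \<one> \<in> H \<and> openin X W \<and> x \<in> W \<and>
        (\<forall>h \<in> H. \<forall>y \<in> W. \<sigma> h s \<ominus>\<^bsub>P\<^esub> s \<in> B (act h y))"
    and val_eq: "x \<in> topspace X \<Longrightarrow> y \<in> topspace X \<Longrightarrow> s \<in> A x \<Longrightarrow> t \<in> A y \<Longrightarrow>
      val s x = val t y \<longleftrightarrow> x = y \<and> s \<ominus>\<^bsub>P\<^esub> t \<in> B x"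
begin

definition germs :: "'e set" where
  "germs = {val s x | s x. x \<in> topspace X \<and> s \<in> A x}"

text \<open>A chosen representative behind a name. The structure maps are defined through it, and
  \<open>val_eq\<close> makes their values independent of the choice.\<close>

definition rep :: "'e \<Rightarrow> 's \<times> 'x" where
  "rep e = (SOME z. snd z \<in> topspace X \<and> fst z \<in> A (snd z) \<and> val (fst z) (snd z) = e)"

text \<open>The topology is the final one for the maps \<open>val s\<close>, each taken on the set
  of points where \<open>s\<close> is admissible, which is open by \<open>A_open\<close>.\<close>

definition quotient_sheaf :: "('g, 'r, 'x, 'e) gsheaf" where
  "quotient_sheaf =
     \<lparr>total = topology (\<lambda>V. V \<subseteq> germs \<and> (\<forall>s. openin X {x \<in> topspace X. s \<in> A x \<and> val s x \<in> V})),
      proj = (\<lambda>e\<in>germs. snd (rep e)),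
      gact = (\<lambda>g\<in>carrier G. \<lambda>e\<in>germs. val (\<sigma> g (fst (rep e))) (act g (snd (rep e)))),
      sadd = (\<lambda>a b. if a \<in> germs \<and> b \<in> germs \<and> snd (rep a) = snd (rep b)
        then val (fst (rep a) \<oplus>\<^bsub>P\<^esub> fst (rep b)) (snd (rep b)) else undefined),
      szero = (\<lambda>x\<in>topspace X. val \<zero>\<^bsub>P\<^esub> x),
      ssmult = (\<lambda>r\<in>carrier R. \<lambda>e\<in>germs. val (r \<odot>\<^bsub>P\<^esub> fst (rep e)) (snd (rep e)))\<rparr>"

lemma P_simps:
  "s \<in> carrier P \<Longrightarrow> t \<in> carrier P \<Longrightarrow> s \<ominus>\<^bsub>P\<^esub> (\<zero>\<^bsub>P\<^esub> \<ominus>\<^bsub>P\<^esub> t) = s \<oplus>\<^bsub>P\<^esub> t"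
  "s \<in> carrier P \<Longrightarrow> s \<ominus>\<^bsub>P\<^esub> s = \<zero>\<^bsub>P\<^esub>"
  "a \<in> carrier P \<Longrightarrow> b \<in> carrier P \<Longrightarrow> s \<in> carrier P \<Longrightarrow> t \<in> carrier P \<Longrightarrow>
    (a \<oplus>\<^bsub>P\<^esub> b) \<ominus>\<^bsub>P\<^esub> (s \<oplus>\<^bsub>P\<^esub> t) = (a \<ominus>\<^bsub>P\<^esub> s) \<oplus>\<^bsub>P\<^esub> (b \<ominus>\<^bsub>P\<^esub> t)"
proof -
  interpret left_module R P by (rule P)
  show "s \<in> carrier P \<Longrightarrow> t \<in> carrier P \<Longrightarrow> s \<ominus>\<^bsub>P\<^esub> (\<zero>\<^bsub>P\<^esub> \<ominus>\<^bsub>P\<^esub> t) = s \<oplus>\<^bsub>P\<^esub> t"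
    "s \<in> carrier P \<Longrightarrow> s \<ominus>\<^bsub>P\<^esub> s = \<zero>\<^bsub>P\<^esub>"
    "a \<in> carrier P \<Longrightarrow> b \<in> carrier P \<Longrightarrow> s \<in> carrier P \<Longrightarrow> t \<in> carrier P \<Longrightarrow>
    (a \<oplus>\<^bsub>P\<^esub> b) \<ominus>\<^bsub>P\<^esub> (s \<oplus>\<^bsub>P\<^esub> t) = (a \<ominus>\<^bsub>P\<^esub> s) \<oplus>\<^bsub>P\<^esub> (b \<ominus>\<^bsub>P\<^esub> t)"
    by (simp_all add: a_minus_def M.minus_add M.a_ac M.r_neg)
qed

lemma A_zero: "x \<in> topspace X \<Longrightarrow> \<zero>\<^bsub>P\<^esub> \<in> A x"
  using B_A B_zero by blast

lemma A_add: "x \<in> topspace X \<Longrightarrow> s \<in> A x \<Longrightarrow> t \<in> A x \<Longrightarrow> s \<oplus>\<^bsub>P\<^esub> t \<in> A x"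
  using A_minus[OF _ _ A_minus[OF _ A_zero]] A_P by (simp flip: P_simps(1))

lemma B_add: "x \<in> topspace X \<Longrightarrow> s \<in> B x \<Longrightarrow> t \<in> B x \<Longrightarrow> s \<oplus>\<^bsub>P\<^esub> t \<in> B x"
  using B_minus[OF _ _ B_minus[OF _ B_zero]] A_P[OF B_A] by (simp flip: P_simps(1))

lemma val_eqI: "x \<in> topspace X \<Longrightarrow> s \<in> A x \<Longrightarrow> t \<in> A x \<Longrightarrow> s \<ominus>\<^bsub>P\<^esub> t \<in> B x \<Longrightarrow> val s x = val t x"
  using val_eq by blast

lemma rep_val:
  assumes "x \<in> topspace X" "s \<in> A x"
  shows "snd (rep (val s x)) = x" "fst (rep (val s x)) \<in> A x" "fst (rep (val s x)) \<ominus>\<^bsub>P\<^esub> s \<in> B x"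
proof -
  let ?z = "rep (val s x)"
  have z: "snd ?z \<in> topspace X \<and> fst ?z \<in> A (snd ?z) \<and> val (fst ?z) (snd ?z) = val s x"
    unfolding rep_def by (rule someI[of _ "(s, x)"]) (use assms in simp)
  then have "snd ?z = x \<and> fst ?z \<ominus>\<^bsub>P\<^esub> s \<in> B (snd ?z)"
    using val_eq[of "snd ?z" x "fst ?z" s] assms by blast
  then show "snd ?z = x" "fst ?z \<in> A x" "fst ?z \<ominus>\<^bsub>P\<^esub> s \<in> B x" using z by auto
qed

lemma val_in_germs [simp]: "x \<in> topspace X \<Longrightarrow> s \<in> A x \<Longrightarrow> val s x \<in> germs"
  unfolding germs_def by blast

lemma germsE:
  assumes "e \<in> germs"
  obtains s x where "x \<in> topspace X" "s \<in> A x" "e = val s x"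
  using assms unfolding germs_def by blast

lemma openin_quotient:
  "openin (total quotient_sheaf) V \<longleftrightarrow>
    V \<subseteq> germs \<and> (\<forall>s. openin X {x \<in> topspace X. s \<in> A x \<and> val s x \<in> V})"
proof -
  have "istopology (\<lambda>V. V \<subseteq> germs \<and> (\<forall>s. openin X {x \<in> topspace X. s \<in> A x \<and> val s x \<in> V}))"
    unfolding istopology_def
  proof (intro conjI allI impI ballI)
    fix V V' s
    assume V: "V \<subseteq> germs \<and> (\<forall>s. openin X {x \<in> topspace X. s \<in> A x \<and> val s x \<in> V})"
      and V': "V' \<subseteq> germs \<and> (\<forall>s. openin X {x \<in> topspace X. s \<in> A x \<and> val s x \<in> V'})"
    show "V \<inter> V' \<subseteq> germs" using V by blast
    have "{x \<in> topspace X. s \<in> A x \<and> val s x \<in> V \<inter> V'} =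
        {x \<in> topspace X. s \<in> A x \<and> val s x \<in> V} \<inter> {x \<in> topspace X. s \<in> A x \<and> val s x \<in> V'}"
      by blast
    then show "openin X {x \<in> topspace X. s \<in> A x \<and> val s x \<in> V \<inter> V'}" using V V' by auto
  next
    fix \<K> s
    assume K: "\<forall>V\<in>\<K>. V \<subseteq> germs \<and> (\<forall>s. openin X {x \<in> topspace X. s \<in> A x \<and> val s x \<in> V})"
    then show "\<Union> \<K> \<subseteq> germs" by blast
    have "{x \<in> topspace X. s \<in> A x \<and> val s x \<in> \<Union> \<K>} =
        (\<Union>V\<in>\<K>. {x \<in> topspace X. s \<in> A x \<and> val s x \<in> V})" by blast
    then show "openin X {x \<in> topspace X. s \<in> A x \<and> val s x \<in> \<Union> \<K>}" using K by auto
  qed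
  then show ?thesis by (simp add: quotient_sheaf_def)
qed

lemma topspace_quotient [simp]: "topspace (total quotient_sheaf) = germs"
proof -
  have "openin (total quotient_sheaf) germs"
  proof -
    have "{x \<in> topspace X. s \<in> A x \<and> val s x \<in> germs} = {x \<in> topspace X. s \<in> A x}" for s by auto
    then show ?thesis unfolding openin_quotient using A_open by simp
  qed
  moreover have "topspace (total quotient_sheaf) \<subseteq> germs"
    using openin_topspace openin_quotient by blast
  ultimately show ?thesis using openin_subset by blast
qed

lemma proj_quotient: "x \<in> topspace X \<Longrightarrow> s \<in> A x \<Longrightarrow> proj quotient_sheaf (val s x) = x"
  by (simp add: quotient_sheaf_def rep_val)

lemma szero_quotient: "x \<in> topspace X \<Longrightarrow> szero quotient_sheaf x = val \<zero>\<^bsub>P\<^esub> x"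
  by (simp add: quotient_sheaf_def)

lemma sadd_quotient:
  assumes "x \<in> topspace X" "s \<in> A x" "t \<in> A x"
  shows "sadd quotient_sheaf (val s x) (val t x) = val (s \<oplus>\<^bsub>P\<^esub> t) x"
  using assms rep_val[of x s] rep_val[of x t]
  by (auto simp: quotient_sheaf_def A_add P_simps(3) A_P intro!: val_eqI B_add)

lemma ssmult_quotient:
  assumes "r \<in> carrier R" "x \<in> topspace X" "s \<in> A x"
  shows "ssmult quotient_sheaf r (val s x) = val (r \<odot>\<^bsub>P\<^esub> s) x"
  using assms rep_val[of x s] B_smult[of x r]
  by (auto simp: quotient_sheaf_def A_smult A_P simp flip: left_module.smult_r_diff[OF P] intro!: val_eqI)

lemma sigma_minus:
  "g \<in> carrier G \<Longrightarrow> s \<in> carrier P \<Longrightarrow> t \<in> carrier P \<Longrightarrow> \<sigma> g (s \<ominus>\<^bsub>P\<^esub> t) = \<sigma> g s \<ominus>\<^bsub>P\<^esub> \<sigma> g t"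
  using P R_linear_minus[OF _ _ sigma_linear] by (auto simp: left_module_def)

lemma gact_quotient:
  assumes "g \<in> carrier G" "x \<in> topspace X" "s \<in> A x"
  shows "gact quotient_sheaf g (val s x) = val (\<sigma> g s) (act g x)"
  using assms rep_val[of x s] B_sigma[of x g]
  by (auto simp: quotient_sheaf_def A_sigma A_P simp flip: sigma_minus intro!: val_eqI)

text \<open>The submodule \<open>A x\<close> of \<open>P\<close> maps onto the stalk by
  \<open>val\<close>, and both the axioms and the subtraction are transported along this
  surjection.\<close>

lemma stalk_quotient:
  assumes x: "x \<in> topspace X"
  shows "left_module R (stalk quotient_sheaf x)"
    and "s \<in> A x \<Longrightarrow> t \<in> A x \<Longrightarrow> val s x \<ominus>\<^bsub>stalk quotient_sheaf x\<^esub> val t x = val (s \<ominus>\<^bsub>P\<^esub> t) x"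
    and "carrier (stalk quotient_sheaf x) = (\<lambda>s. val s x) ` A x"
proof -
  let ?N = "P\<lparr>carrier := A x\<rparr>"
  note sub = left_module_submodule[OF P, of ?N]
  have N: "left_module R ?N"
    by (rule sub) (auto simp: A_P A_zero A_minus A_smult x)
  have Nm: "s \<ominus>\<^bsub>?N\<^esub> t = s \<ominus>\<^bsub>P\<^esub> t" if "s \<in> A x" "t \<in> A x" for s t
    by (rule sub) (use that in \<open>auto simp: A_P A_zero A_minus A_smult x\<close>)
  show c: "carrier (stalk quotient_sheaf x) = (\<lambda>s. val s x) ` A x"
    using x by (auto simp: proj_quotient elim!: germsE)
  show M: "left_module R (stalk quotient_sheaf x)"
    by (rule left_module_image[OF N, where f = "\<lambda>s. val s x"])
      (unfold c, auto simp: x sadd_quotient ssmult_quotient szero_quotient)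
  assume s: "s \<in> A x" "t \<in> A x"
  have "R_linear R ?N (stalk quotient_sheaf x) (\<lambda>s. val s x)"
    using x unfolding R_linear_def c by (auto simp: sadd_quotient ssmult_quotient)
  then show "val s x \<ominus>\<^bsub>stalk quotient_sheaf x\<^esub> val t x = val (s \<ominus>\<^bsub>P\<^esub> t) x"
    using R_linear_minus[of ?N "stalk quotient_sheaf x" R "\<lambda>s. val s x" s t] N M s Nm
    by (simp add: left_module_def)
qed

lemma openin_val_preimage:
  "openin (total quotient_sheaf) V \<Longrightarrow> openin X {x \<in> topspace X. s \<in> A x \<and> val s x \<in> V}"
  by (simp add: openin_quotient)

text \<open>Openness is tested against an arbitrary family \<open>t\<close>. By
  \<open>val_eq\<close> a germ of \<open>t\<close> coincides with a germ of \<open>s\<close> only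
  over the same point, and then exactly where \<open>s - t\<close> belongs to \<open>B\<close>,
  which is open by \<open>B_open\<close>.\<close>

lemma openin_val_image:
  assumes "openin X W" "\<And>x. x \<in> W \<Longrightarrow> s \<in> A x"
  shows "openin (total quotient_sheaf) (val s ` W)"
  unfolding openin_quotient
proof (intro conjI allI)
  have WX: "W \<subseteq> topspace X" using assms openin_subset by blast
  then show "val s ` W \<subseteq> germs" using assms by auto
  fix t
  have "{x \<in> topspace X. t \<in> A x \<and> val t x \<in> val s ` W} =
      W \<inter> {x \<in> topspace X. t \<in> A x} \<inter> {x \<in> topspace X. s \<ominus>\<^bsub>P\<^esub> t \<in> B x}"
  proof (intro equalityI subsetI)
    fix x assume "x \<in> {x \<in> topspace X. t \<in> A x \<and> val t x \<in> val s ` W}"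
    then obtain y where y: "y \<in> W" "val s y = val t x" and x: "x \<in> topspace X" "t \<in> A x" by auto
    then have "y = x \<and> s \<ominus>\<^bsub>P\<^esub> t \<in> B y" using val_eq[of y x s t] assms WX by blast
    then show "x \<in> W \<inter> {x \<in> topspace X. t \<in> A x} \<inter> {x \<in> topspace X. s \<ominus>\<^bsub>P\<^esub> t \<in> B x}"
      using x y by auto
  next
    fix x assume x: "x \<in> W \<inter> {x \<in> topspace X. t \<in> A x} \<inter> {x \<in> topspace X. s \<ominus>\<^bsub>P\<^esub> t \<in> B x}"
    then have "val s x = val t x" using assms by (auto intro: val_eqI)
    then show "x \<in> {x \<in> topspace X. t \<in> A x \<and> val t x \<in> val s ` W}" using x by (auto intro: rev_image_eqI)
  qed
  then show "openin X {x \<in> topspace X. t \<in> A x \<and> val t x \<in> val s ` W}"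
    using assms(1) A_open B_open by (simp add: openin_Int)
qed

lemma val_continuous:
  assumes "openin X W" "\<And>x. x \<in> W \<Longrightarrow> s \<in> A x"
  shows "continuous_map (subtopology X W) (total quotient_sheaf) (val s)"
  unfolding continuous_map_def
proof (intro conjI allI impI)
  have WX: "W \<subseteq> topspace X" using assms openin_subset by blast
  show "val s \<in> topspace (subtopology X W) \<rightarrow> topspace (total quotient_sheaf)"
    using assms by auto
  fix V assume "openin (total quotient_sheaf) V"
  then have o: "openin X (W \<inter> {x \<in> topspace X. s \<in> A x \<and> val s x \<in> V})"
    using assms(1) openin_val_preimage by blast
  have "{x \<in> topspace (subtopology X W). val s x \<in> V} = W \<inter> {x \<in> topspace X. s \<in> A x \<and> val s x \<in> V}"
    using assms WX by auto
  with o show "openin (subtopology X W) {x \<in> topspace (subtopology X W). val s x \<in> V}"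
    using openin_subtopology_Int2[OF o, of W] by (simp add: Int_assoc[symmetric] flip: Int_assoc)
qed

text \<open>The substantial axiom is joint continuity of the action. For \<open>k\<close> near
  \<open>g\<close> write \<open>k = g h\<close> with \<open>h\<close> near the identity; then
  \<open>\<sigma> h s\<close> and \<open>s\<close> differ by a relation, so \<open>k\<close> and
  \<open>g\<close> carry \<open>s\<close> to the same germ over the same point, and the germs of the
  single family \<open>\<sigma> g s\<close> vary continuously. The remaining axioms are read off on
  sections \<open>val s\<close>.\<close>

theorem sheaf_quotient: "sheaf quotient_sheaf"
proof (rule equivariant_sheaf.intro)
  let ?Q = quotient_sheaf
  show "continuous_action G T (total ?Q) (gact ?Q)"
    unfolding continuous_action_def
  proof
    show "group_action G (topspace (total ?Q)) (gact ?Q)"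
    proof (rule group_actionI)
      show "gact ?Q g \<in> extensional (topspace (total ?Q))" if "g \<in> carrier G" for g
        unfolding topspace_quotient using that by (simp add: quotient_sheaf_def)
    qed (auto simp: is_group gact_quotient A_sigma sigma_one sigma_mult A_P act_mult elim!: germsE)
    show "continuous_map (prod_topology T (total ?Q)) (total ?Q) (\<lambda>(g, e). gact ?Q g e)"
      unfolding continuous_map_pointwise
    proof (intro conjI ballI allI impI)
      show "(\<lambda>(g, e). gact ?Q g e) \<in> topspace (prod_topology T (total ?Q)) \<rightarrow> topspace (total ?Q)"
        by (auto simp: topspace_eq gact_quotient A_sigma elim!: germsE)
      fix z V assume z: "z \<in> topspace (prod_topology T (total ?Q))" and V: "openin (total ?Q) V"
        and zV: "(\<lambda>(g, e). gact ?Q g e) z \<in> V"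
      obtain g s x where g: "g \<in> carrier G" and x: "x \<in> topspace X" and s: "s \<in> A x" and zeq: "z = (g, val s x)"
        using z by (auto simp: topspace_eq elim!: germsE)
      have sP: "s \<in> carrier P" using s A_P by blast
      obtain H W where HW: "openin T H" "\<one> \<in> H" "openin X W" "x \<in> W"
        "\<And>h y. h \<in> H \<Longrightarrow> y \<in> W \<Longrightarrow> \<sigma> h s \<ominus>\<^bsub>P\<^esub> s \<in> B (act h y)"
        using A_continuous[OF x s] by blast
      \<comment> \<open>The points where the germ of the fixed family \<open>\<sigma> g s\<close>
        lies in \<open>V\<close>. Continuity of the action on \<open>X\<close> keeps
        \<open>act k y\<close> in this set for \<open>(k, y)\<close> near
        \<open>(g, x)\<close>.\<close>
      let ?W1 = "{y \<in> topspace X. \<sigma> g s \<in> A y \<and> val (\<sigma> g s) y \<in> V}"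
      have W1: "openin X ?W1" using openin_val_preimage[OF V] .
      have "openin (prod_topology T X) {w \<in> topspace (prod_topology T X). (\<lambda>(g, x). act g x) w \<in> ?W1}"
        using continuous_act W1 by (rule openin_continuous_map_preimage)
      moreover have "(g, x) \<in> {w \<in> topspace (prod_topology T X). (\<lambda>(g, x). act g x) w \<in> ?W1}"
        using g x s zV zeq by (simp add: topspace_eq gact_quotient A_sigma)
      ultimately obtain H1 W2 where HW1: "openin T H1" "openin X W2" "g \<in> H1" "x \<in> W2"
        "H1 \<times> W2 \<subseteq> {w \<in> topspace (prod_topology T X). (\<lambda>(g, x). act g x) w \<in> ?W1}"
        by (rule openin_prod_topologyE)
      have "continuous_map T (prod_topology T T) (\<lambda>k. (inv g, k))"
        using g by (simp add: continuous_map_pairwise o_def topspace_eq)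
      \<comment> \<open>Left translation by \<open>inv g\<close> turns nearness of \<open>k\<close>
        to \<open>g\<close> into membership of \<open>inv g \<otimes> k\<close> in \<open>H\<close>,
        where \<open>A_continuous\<close> applies.\<close>
      from continuous_map_compose[OF this continuous_mult]
      have H2: "openin T {k \<in> topspace T. inv g \<otimes> k \<in> H}"
        using openin_continuous_map_preimage[OF _ HW(1)] by (simp add: o_def)
      let ?Y = "W \<inter> W2 \<inter> {y \<in> topspace X. s \<in> A y}"
      have Y: "openin X ?Y" using HW HW1 A_open by blast
      let ?U = "(H1 \<inter> {k \<in> topspace T. inv g \<otimes> k \<in> H}) \<times> (val s ` ?Y)"
      have "openin (prod_topology T (total ?Q)) ?U"
        unfolding openin_prod_Times_iff using HW1(1) H2 openin_val_image[OF Y] by blast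
      moreover have "z \<in> ?U" using g x s zeq HW HW1 by (auto simp: topspace_eq)
      moreover have "(\<lambda>(g, e). gact ?Q g e) w \<in> V" if "w \<in> ?U" for w
      proof -
        obtain k y where w: "w = (k, val s y)" and k: "k \<in> H1" "k \<in> carrier G" "inv g \<otimes> k \<in> H"
          and y: "y \<in> W" "y \<in> W2" "y \<in> topspace X" "s \<in> A y"
          using \<open>w \<in> ?U\<close> by (auto simp: topspace_eq)
        let ?h = "inv g \<otimes> k"
        have h: "?h \<in> carrier G" "g \<otimes> ?h = k" using g k by (auto simp flip: m_assoc)
        have ky: "act k y \<in> ?W1" using subsetD[OF HW1(5), of "(k, y)"] k y by simp
        have hy: "\<sigma> ?h s \<ominus>\<^bsub>P\<^esub> s \<in> B (act ?h y)" using HW(5) k y by blast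
        have sh: "\<sigma> ?h s \<in> carrier P" using A_P[OF A_sigma] h y by blast
        \<comment> \<open>The relation between \<open>\<sigma> ?h s\<close> and \<open>s\<close> at
          \<open>act ?h y\<close> is moved by \<open>g\<close>, landing at
          \<open>act k y\<close>.\<close>
        have "\<sigma> g (\<sigma> ?h s) \<ominus>\<^bsub>P\<^esub> \<sigma> g s \<in> B (act g (act ?h y))"
          using B_sigma[OF _ g hy] sh sP g h y by (simp add: sigma_minus)
        then have "\<sigma> k s \<ominus>\<^bsub>P\<^esub> \<sigma> g s \<in> B (act k y)"
          using g h y sP by (simp flip: sigma_mult act_mult)
        then have "val (\<sigma> k s) (act k y) = val (\<sigma> g s) (act k y)"
          using ky y k by (intro val_eqI) (auto simp: A_sigma)
        then show ?thesis using ky w k y by (simp add: gact_quotient)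
      qed
      ultimately show "\<exists>U. openin (prod_topology T (total ?Q)) U \<and> z \<in> U \<and> (\<forall>w\<in>U. (\<lambda>(g, e). gact ?Q g e) w \<in> V)"
        by blast
    qed
  qed
  show "local_homeomorphism (total ?Q) X (proj ?Q)"
  proof (rule local_homeomorphismI)
    show "continuous_map (total ?Q) X (proj ?Q)"
      unfolding continuous_map_def
    proof (intro conjI allI impI)
      fix V assume V: "openin X V"
      have "{x \<in> topspace X. s \<in> A x \<and> val s x \<in> {e \<in> topspace (total ?Q). proj ?Q e \<in> V}} =
        {x \<in> topspace X. s \<in> A x} \<inter> V" for s
        using openin_subset[OF V] by (auto simp: proj_quotient)
      then show "openin (total ?Q) {e \<in> topspace (total ?Q). proj ?Q e \<in> V}"
        unfolding openin_quotient using A_open V by auto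
    qed (auto simp: proj_quotient elim!: germsE)
    fix e assume "e \<in> topspace (total ?Q)"
    then obtain s x where x: "x \<in> topspace X" "s \<in> A x" "e = val s x" by (auto elim!: germsE)
    then show "\<exists>W t. openin X W \<and> proj ?Q e \<in> W \<and> continuous_map (subtopology X W) (total ?Q) t \<and>
        (\<forall>x\<in>W. proj ?Q (t x) = x) \<and> t (proj ?Q e) = e \<and> openin (total ?Q) (t ` W)"
      using A_open[of s] val_continuous[OF A_open] openin_val_image[OF A_open]
      by (intro exI[of _ "{x \<in> topspace X. s \<in> A x}"] exI[of _ "val s"]) (auto simp: proj_quotient)
  qed
  show "proj ?Q (gact ?Q g e) = act g (proj ?Q e)" if "g \<in> carrier G" "e \<in> topspace (total ?Q)" for g e
    using that by (auto simp: gact_quotient proj_quotient A_sigma elim!: germsE)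
  show "left_module R (stalk ?Q x)" if "x \<in> topspace X" for x using stalk_quotient that by blast
  show "continuous_map (subtopology (prod_topology (total ?Q) (total ?Q)) (fibre_product ?Q)) (total ?Q)
         (\<lambda>(a, b). a \<ominus>\<^bsub>stalk ?Q (proj ?Q a)\<^esub> b)"
    unfolding continuous_map_pointwise
  proof (intro conjI ballI allI impI)
    show "(\<lambda>(a, b). a \<ominus>\<^bsub>stalk ?Q (proj ?Q a)\<^esub> b) \<in>
      topspace (subtopology (prod_topology (total ?Q) (total ?Q)) (fibre_product ?Q)) \<rightarrow> topspace (total ?Q)"
      by (auto simp: fibre_product_def proj_quotient stalk_quotient A_minus elim!: germsE)
    fix z V assume z: "z \<in> topspace (subtopology (prod_topology (total ?Q) (total ?Q)) (fibre_product ?Q))"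
      and V: "openin (total ?Q) V" and zV: "(\<lambda>(a, b). a \<ominus>\<^bsub>stalk ?Q (proj ?Q a)\<^esub> b) z \<in> V"
    obtain s t x where x: "x \<in> topspace X" and s: "s \<in> A x" and t: "t \<in> A x" and zeq: "z = (val s x, val t x)"
      using z by (auto simp: fibre_product_def proj_quotient elim!: germsE)
    let ?W = "{y \<in> topspace X. s \<ominus>\<^bsub>P\<^esub> t \<in> A y \<and> val (s \<ominus>\<^bsub>P\<^esub> t) y \<in> V} \<inter>
      {y \<in> topspace X. s \<in> A y} \<inter> {y \<in> topspace X. t \<in> A y}"
    have W: "openin X ?W" using openin_val_preimage[OF V] A_open by blast
    let ?U = "fibre_product ?Q \<inter> (val s ` ?W \<times> val t ` ?W)"
    have "openin (prod_topology (total ?Q) (total ?Q)) (val s ` ?W \<times> val t ` ?W)"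
      unfolding openin_prod_Times_iff using openin_val_image[OF W] by blast
    then have "openin (subtopology (prod_topology (total ?Q) (total ?Q)) (fibre_product ?Q)) ?U"
      by (rule openin_subtopology_Int2)
    moreover have "z \<in> ?U"
      using x s t zeq zV by (auto simp: fibre_product_def proj_quotient stalk_quotient A_minus)
    moreover have "(\<lambda>(a, b). a \<ominus>\<^bsub>stalk ?Q (proj ?Q a)\<^esub> b) w \<in> V" if "w \<in> ?U" for w
      using that by (auto simp: fibre_product_def proj_quotient stalk_quotient)
    ultimately show "\<exists>U. openin (subtopology (prod_topology (total ?Q) (total ?Q)) (fibre_product ?Q)) U \<and> z \<in> U \<and>
      (\<forall>w\<in>U. (\<lambda>(a, b). a \<ominus>\<^bsub>stalk ?Q (proj ?Q a)\<^esub> b) w \<in> V)" by blast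
  qed
  show "continuous_map (total ?Q) (total ?Q) (ssmult ?Q r)" if r: "r \<in> carrier R" for r
    unfolding continuous_map_def
  proof (intro conjI allI impI)
    fix V assume V: "openin (total ?Q) V"
    have "{x \<in> topspace X. s \<in> A x \<and> val s x \<in> {e \<in> topspace (total ?Q). ssmult ?Q r e \<in> V}} =
        {x \<in> topspace X. s \<in> A x} \<inter> {x \<in> topspace X. r \<odot>\<^bsub>P\<^esub> s \<in> A x \<and> val (r \<odot>\<^bsub>P\<^esub> s) x \<in> V}" for s
      using r by (auto simp: ssmult_quotient A_smult)
    then show "openin (total ?Q) {e \<in> topspace (total ?Q). ssmult ?Q r e \<in> V}"
      unfolding openin_quotient using A_open openin_val_preimage[OF V] by auto
  qed (use r in \<open>auto simp: ssmult_quotient A_smult elim!: germsE\<close>)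
  show "R_linear R (stalk ?Q x) (stalk ?Q (act g x)) (gact ?Q g)" if g: "g \<in> carrier G" and x: "x \<in> topspace X" for g x
    using sigma_linear[OF g] act_closed[OF g x] g x unfolding R_linear_def stalk_quotient(3)[OF x] stalk_quotient(3)[OF act_closed[OF g x]]
    by (auto simp: gact_quotient sadd_quotient ssmult_quotient A_sigma A_add A_smult A_P)
  show "sadd ?Q a b = undefined" if "(a, b) \<notin> fibre_product ?Q" for a b
    using that unfolding fibre_product_def topspace_quotient by (auto simp: quotient_sheaf_def)
  show "proj ?Q \<in> extensional (topspace (total ?Q))" unfolding topspace_quotient by (simp add: quotient_sheaf_def)
  show "ssmult ?Q r \<in> extensional (topspace (total ?Q))" if "r \<in> carrier R" for r
    unfolding topspace_quotient using that by (simp add: quotient_sheaf_def)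
qed (simp_all add: quotient_sheaf_def)

lemma val_local_section:
  "openin X W \<Longrightarrow> (\<And>x. x \<in> W \<Longrightarrow> s \<in> A x) \<Longrightarrow> local_section X quotient_sheaf W (val s)"
  unfolding local_section_def using val_continuous[of W s] openin_subset[of X W]
  by (auto simp: proj_quotient)

end

section \<open>Families of sections\<close>

locale sheaf_family = group_space G T X act R
  for G :: "('g, 'z) monoid_scheme" (structure) and T and X :: "'x topology" and act
    and R :: "('r, 'y) ring_scheme" +
  fixes I :: "'i set" and D :: "'i \<Rightarrow> ('g, 'r, 'x, 'e) gsheaf"
  assumes D: "i \<in> I \<Longrightarrow> sheaf (D i)"
begin

definition families :: "('r, 'i \<times> 'x \<Rightarrow> 'e) module" where
  "families = product_module (I \<times> topspace X) (\<lambda>(i, x). stalk (D i) x)"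

text \<open>The usual action on sections, \<open>(g s)(x) = g s(g^-1 x)\<close>, in every
  component.\<close>

definition family_act :: "'g \<Rightarrow> ('i \<times> 'x \<Rightarrow> 'e) \<Rightarrow> ('i \<times> 'x \<Rightarrow> 'e)" where
  "family_act g s = (\<lambda>(i, x)\<in>I \<times> topspace X. gact (D i) g (s (i, act (inv g) x)))"

text \<open>One set \<open>H\<close> and one open set \<open>W\<close> serve all indices; with
  separate choices the action on an infinite limit could fail to be continuous. Equivariance is
  tested only when \<open>act h x\<close> stays in \<open>W\<close>, so that the condition concerns
  values on \<open>W\<close> alone.\<close>

definition regular_on :: "'x set \<Rightarrow> 'g set \<Rightarrow> ('i \<times> 'x \<Rightarrow> 'e) \<Rightarrow> bool" where
  "regular_on W H s \<longleftrightarrow> (\<forall>i \<in> I. local_section X (D i) W (\<lambda>x. s (i, x)) \<and>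
     (\<forall>h \<in> H. \<forall>x \<in> W. act h x \<in> W \<longrightarrow> gact (D i) h (s (i, x)) = s (i, act h x)))"

text \<open>The neighbourhood is common to all indices, in line with \<open>regular_on\<close>. This
  is vanishing of a germ of the whole family.\<close>

definition null_germ :: "'x \<Rightarrow> ('i \<times> 'x \<Rightarrow> 'e) \<Rightarrow> bool" where
  "null_germ x s \<longleftrightarrow> (\<exists>W. openin X W \<and> x \<in> W \<and> (\<forall>i \<in> I. \<forall>y \<in> W. s (i, y) = szero (D i) y))"

text \<open>The parameter \<open>C\<close> is the condition special to the construction:
  compatibility with the arrows for limits, finite support for colimits and quotients.\<close>

definition admissible :: "('x set \<Rightarrow> ('i \<times> 'x \<Rightarrow> 'e) \<Rightarrow> bool) \<Rightarrow> 'x \<Rightarrow> ('i \<times> 'x \<Rightarrow> 'e) set" where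
  "admissible C x = {s \<in> carrier families. \<exists>W H. openin X W \<and> x \<in> W \<and> openin T H \<and> \<one> \<in> H \<and>
    regular_on W H s \<and> C W s}"

lemma families_carrier:
  "s \<in> carrier families \<longleftrightarrow> s \<in> extensional (I \<times> topspace X) \<and>
    (\<forall>i \<in> I. \<forall>x \<in> topspace X. s (i, x) \<in> topspace (total (D i)) \<and> proj (D i) (s (i, x)) = x)"
  unfolding families_def by (auto simp: PiE_iff)

lemma left_module_families: "left_module R families"
  unfolding families_def using D ring
  by (intro left_module_product) (auto simp: stalk_left_module)

lemma families_simps:
  assumes "i \<in> I" "x \<in> topspace X"
  shows "\<zero>\<^bsub>families\<^esub> (i, x) = szero (D i) x"
    "(s \<oplus>\<^bsub>families\<^esub> t) (i, x) = sadd (D i) (s (i, x)) (t (i, x))"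
    "(r \<odot>\<^bsub>families\<^esub> s) (i, x) = ssmult (D i) r (s (i, x))"
    "s \<in> carrier families \<Longrightarrow> t \<in> carrier families \<Longrightarrow>
       (s \<ominus>\<^bsub>families\<^esub> t) (i, x) = sminus (D i) (s (i, x)) (t (i, x))"
    "family_act g s (i, x) = gact (D i) g (s (i, act (inv g) x))"
proof -
  assume "s \<in> carrier families" "t \<in> carrier families"
  moreover have "left_module R ((\<lambda>(i, x). stalk (D i) x) k)" if "k \<in> I \<times> topspace X" for k
    using that D by (auto simp: stalk_left_module)
  ultimately show "(s \<ominus>\<^bsub>families\<^esub> t) (i, x) = sminus (D i) (s (i, x)) (t (i, x))"
    using assms product_module_minus[of "I \<times> topspace X" R "\<lambda>(i, x). stalk (D i) x" s t] ring
    unfolding families_def by (auto simp: sminus_def PiE_iff simp del: product_module_simps)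
      (auto simp: PiE_iff)
qed (use assms in \<open>auto simp: families_def family_act_def\<close>)

lemma families_closed:
  assumes "s \<in> carrier families" "i \<in> I" "x \<in> topspace X"
  shows "s (i, x) \<in> topspace (total (D i))" "proj (D i) (s (i, x)) = x"
  using assms families_carrier by auto

lemma families_eqI:
  assumes "s \<in> carrier families" "t \<in> carrier families"
    "\<And>i x. i \<in> I \<Longrightarrow> x \<in> topspace X \<Longrightarrow> s (i, x) = t (i, x)"
  shows "s = t"
proof (rule extensionalityI[of _ "I \<times> topspace X"])
qed (use assms families_carrier in auto)

lemma family_act_closed: "g \<in> carrier G \<Longrightarrow> s \<in> carrier families \<Longrightarrow> family_act g s \<in> carrier families"
  by (auto simp: families_carrier family_act_def gact_closed[OF D])

lemma family_act_linear:
  assumes g: "g \<in> carrier G"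
  shows "R_linear R families families (family_act g)"
proof -
  interpret left_module R families by (rule left_module_families)
  show ?thesis
    unfolding R_linear_def
  proof (intro conjI ballI funcsetI)
    fix s t assume s: "s \<in> carrier families" and t: "t \<in> carrier families"
    show "family_act g (s \<oplus>\<^bsub>families\<^esub> t) = family_act g s \<oplus>\<^bsub>families\<^esub> family_act g t"
      using s t g
      by (intro families_eqI) (auto simp: families_simps family_act_closed families_closed gact_sadd[OF D])
  next
    fix r s assume r: "r \<in> carrier R" and s: "s \<in> carrier families"
    show "family_act g (r \<odot>\<^bsub>families\<^esub> s) = r \<odot>\<^bsub>families\<^esub> family_act g s"
      using s r g
      by (intro families_eqI)
        (auto simp: families_simps family_act_closed families_closed gact_ssmult[OF D] smult_closed)
  qed (use g family_act_closed in blast)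
qed

lemma family_act_one: "s \<in> carrier families \<Longrightarrow> family_act \<one> s = s"
  by (intro families_eqI) (auto simp: families_simps family_act_closed families_closed gact_one[OF D])

lemma family_act_mult:
  assumes "g \<in> carrier G" "h \<in> carrier G" "s \<in> carrier families"
  shows "family_act (g \<otimes> h) s = family_act g (family_act h s)"
  using assms
  by (intro families_eqI)
    (auto simp: families_simps family_act_closed families_closed gact_mult[OF D] act_mult inv_mult_group)

lemma regular_on_mono:
  "regular_on W H s \<Longrightarrow> openin X W' \<Longrightarrow> W' \<subseteq> W \<Longrightarrow> H' \<subseteq> H \<Longrightarrow> regular_on W' H' s"
  unfolding regular_on_def using local_section_subset by blast

lemma regular_on_zero:
  "openin X W \<Longrightarrow> H \<subseteq> carrier G \<Longrightarrow> regular_on W H \<zero>\<^bsub>families\<^esub>"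
  unfolding regular_on_def using openin_subset[of X W]
  by (auto simp: families_simps gact_szero[OF D] subset_iff intro: local_section_cong[OF local_section_zero[OF D]])

lemma regular_on_minus:
  assumes "regular_on W H s" "regular_on W H t" "openin X W" "H \<subseteq> carrier G"
    and s: "s \<in> carrier families" and t: "t \<in> carrier families"
  shows "regular_on W H (s \<ominus>\<^bsub>families\<^esub> t)"
proof -
  have X: "x \<in> topspace X" if "x \<in> W" for x using assms(3) openin_subset that by blast
  show ?thesis
    unfolding regular_on_def
  proof (intro ballI conjI impI)
    fix i assume i: "i \<in> I"
    then have "local_section X (D i) W (\<lambda>x. sminus (D i) (s (i, x)) (t (i, x)))"
      using assms by (intro local_section_minus[OF D]) (auto simp: regular_on_def)
    then show "local_section X (D i) W (\<lambda>x. (s \<ominus>\<^bsub>families\<^esub> t) (i, x))"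
      by (rule local_section_cong) (simp add: families_simps i X s t)
    fix h x assume h: "h \<in> H" and x: "x \<in> W" "act h x \<in> W"
    then show "gact (D i) h ((s \<ominus>\<^bsub>families\<^esub> t) (i, x)) = (s \<ominus>\<^bsub>families\<^esub> t) (i, act h x)"
      using assms i X[OF x(1)] X[OF x(2)]
      by (auto simp: families_simps gact_sminus[OF D] families_closed regular_on_def)
  qed
qed

lemma regular_on_smult:
  assumes "regular_on W H s" "openin X W" "H \<subseteq> carrier G" "r \<in> carrier R" and s: "s \<in> carrier families"
  shows "regular_on W H (r \<odot>\<^bsub>families\<^esub> s)"
proof -
  have X: "x \<in> topspace X" if "x \<in> W" for x using assms(2) openin_subset that by blast
  show ?thesis
    unfolding regular_on_def
  proof (intro ballI conjI impI)
    fix i assume i: "i \<in> I"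
    then have "local_section X (D i) W (\<lambda>x. ssmult (D i) r (s (i, x)))"
      using assms by (intro local_section_smult[OF D]) (auto simp: regular_on_def)
    then show "local_section X (D i) W (\<lambda>x. (r \<odot>\<^bsub>families\<^esub> s) (i, x))"
      by (rule local_section_cong) (simp add: families_simps i X)
    fix h x assume h: "h \<in> H" and x: "x \<in> W" "act h x \<in> W"
    then show "gact (D i) h ((r \<odot>\<^bsub>families\<^esub> s) (i, x)) = (r \<odot>\<^bsub>families\<^esub> s) (i, act h x)"
      using assms i X[OF x(1)] X[OF x(2)]
      by (auto simp: families_simps gact_ssmult[OF D] families_closed regular_on_def subset_iff)
  qed
qed

text \<open>If \<open>h\<close> fixes a family then the conjugate of \<open>h\<close> by
  \<open>g\<close> fixes its translate by \<open>g\<close>, so \<open>H\<close> is replaced by its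
  conjugate.\<close>

lemma regular_on_act:
  assumes s: "regular_on W H s" and W: "openin X W" and H: "H \<subseteq> carrier G" and g: "g \<in> carrier G"
    and sP: "s \<in> carrier families"
  shows "regular_on (act g ` W) {k \<in> carrier G. inv g \<otimes> (k \<otimes> g) \<in> H} (family_act g s)"
  unfolding regular_on_def
proof (intro ballI conjI impI)
  have X: "x \<in> topspace X" if "x \<in> W" for x using W openin_subset that by blast
  fix i assume i: "i \<in> I"
  then have "local_section X (D i) (act g ` W) (\<lambda>x. gact (D i) g (s (i, act (inv g) x)))"
    using local_section_gact[OF D, of i W "\<lambda>x. s (i, x)" g] s g by (auto simp: regular_on_def)
  then show "local_section X (D i) (act g ` W) (\<lambda>x. family_act g s (i, x))"
    by (rule local_section_cong) (auto simp: families_simps i X g)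
  fix k y assume k: "k \<in> {k \<in> carrier G. inv g \<otimes> (k \<otimes> g) \<in> H}"
    and y: "y \<in> act g ` W" "act k y \<in> act g ` W"
  obtain x where x: "x \<in> W" "y = act g x" using y by blast
  \<comment> \<open>The element of \<open>H\<close> with \<open>k g = g h\<close>; it reduces the
    claim at \<open>y = g x\<close> to regularity of \<open>s\<close> at \<open>x\<close>.\<close>
  let ?h = "inv g \<otimes> (k \<otimes> g)"
  have h: "?h \<in> H" "?h \<in> carrier G" "g \<otimes> ?h = k \<otimes> g"
    using k H g by (auto simp flip: m_assoc)
  have hx: "act ?h x = act (inv g) (act k y)" using x k g X by (simp add: act_mult)
  then have hxW: "act ?h x \<in> W" using y(2) g X by auto
  have "gact (D i) k (family_act g s (i, y)) = gact (D i) (k \<otimes> g) (s (i, x))"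
    using x X g k i sP by (simp add: families_simps gact_mult[OF D] families_closed)
  also have "\<dots> = gact (D i) g (gact (D i) ?h (s (i, x)))"
    using gact_mult[OF D[OF i] g h(2) families_closed(1)[OF sP i X[OF x(1)]]] by (simp only: h(3))
  also have "gact (D i) ?h (s (i, x)) = s (i, act ?h x)"
    using s i h hxW x by (simp add: regular_on_def)
  also have "gact (D i) g (s (i, act ?h x)) = family_act g s (i, act k y)"
    using x X g k i by (simp add: families_simps hx)
  finally show "gact (D i) k (family_act g s (i, y)) = family_act g s (i, act k y)" .
qed

lemma null_germ_minus:
  assumes "null_germ x s" "null_germ x t" "s \<in> carrier families" "t \<in> carrier families"
  shows "null_germ x (s \<ominus>\<^bsub>families\<^esub> t)"
proof -
  obtain W V where W: "openin X W" "x \<in> W" "\<And>i y. i \<in> I \<Longrightarrow> y \<in> W \<Longrightarrow> s (i, y) = szero (D i) y"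
    and V: "openin X V" "x \<in> V" "\<And>i y. i \<in> I \<Longrightarrow> y \<in> V \<Longrightarrow> t (i, y) = szero (D i) y"
    using assms(1,2) unfolding null_germ_def by blast
  have "(s \<ominus>\<^bsub>families\<^esub> t) (i, y) = szero (D i) y" if "i \<in> I" "y \<in> W \<inter> V" for i y
    using that W V openin_subset[OF W(1)] assms(3,4)
    by (auto simp: families_simps sminus_self[OF D] szero_closed[OF D] subset_iff)
  then show ?thesis
    unfolding null_germ_def using W V by (intro exI[of _ "W \<inter> V"]) auto
qed

lemma null_germ_smult:
  assumes "null_germ x s" "r \<in> carrier R"
  shows "null_germ x (r \<odot>\<^bsub>families\<^esub> s)"
proof -
  obtain W where W: "openin X W" "x \<in> W" "\<And>i y. i \<in> I \<Longrightarrow> y \<in> W \<Longrightarrow> s (i, y) = szero (D i) y"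
    using assms(1) unfolding null_germ_def by blast
  have "(r \<odot>\<^bsub>families\<^esub> s) (i, y) = szero (D i) y" if "i \<in> I" "y \<in> W" for i y
    using that W openin_subset[OF W(1)] assms(2)
    by (auto simp: families_simps ssmult_zero[OF D] subset_iff)
  then show ?thesis unfolding null_germ_def using W by blast
qed

lemma null_germ_act:
  assumes "null_germ x s" "g \<in> carrier G"
  shows "null_germ (act g x) (family_act g s)"
proof -
  obtain W where W: "openin X W" "x \<in> W" "\<And>i y. i \<in> I \<Longrightarrow> y \<in> W \<Longrightarrow> s (i, y) = szero (D i) y"
    using assms(1) unfolding null_germ_def by blast
  have "family_act g s (i, y) = szero (D i) y" if "i \<in> I" "y \<in> act g ` W" for i y
    using that W openin_subset[OF W(1)] assms(2)
    by (auto simp: families_simps gact_szero[OF D] subset_iff)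
  then show ?thesis
    unfolding null_germ_def using W open_act_image(1)[OF assms(2) W(1)] by blast
qed

end

text \<open>The closure properties that make the admissible families at a point a submodule and let
  \<open>G\<close> permute these submodules. \<open>C_mono\<close> allows passage to a common
  neighbourhood of two families.\<close>

locale section_condition = sheaf_family G T X act R I D
  for G :: "('g, 'z) monoid_scheme" (structure) and T and X :: "'x topology" and act
    and R :: "('r, 'y) ring_scheme" and I :: "'i set" and D :: "'i \<Rightarrow> ('g, 'r, 'x, 'e) gsheaf" +
  fixes C :: "'x set \<Rightarrow> ('i \<times> 'x \<Rightarrow> 'e) \<Rightarrow> bool"
  assumes C_mono: "C W s \<Longrightarrow> W' \<subseteq> W \<Longrightarrow> C W' s"
    and C_zero: "W \<subseteq> topspace X \<Longrightarrow> C W \<zero>\<^bsub>families\<^esub>"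
    and C_minus: "W \<subseteq> topspace X \<Longrightarrow> s \<in> carrier families \<Longrightarrow> t \<in> carrier families \<Longrightarrow>
      C W s \<Longrightarrow> C W t \<Longrightarrow> C W (s \<ominus>\<^bsub>families\<^esub> t)"
    and C_smult: "W \<subseteq> topspace X \<Longrightarrow> s \<in> carrier families \<Longrightarrow> r \<in> carrier R \<Longrightarrow>
      C W s \<Longrightarrow> C W (r \<odot>\<^bsub>families\<^esub> s)"
    and C_act: "W \<subseteq> topspace X \<Longrightarrow> s \<in> carrier families \<Longrightarrow> g \<in> carrier G \<Longrightarrow>
      C W s \<Longrightarrow> C (act g ` W) (family_act g s)"
begin

abbreviation "A \<equiv> admissible C"

lemma A_families: "s \<in> A x \<Longrightarrow> s \<in> carrier families"
  by (simp add: admissible_def)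

lemma A_E:
  assumes "s \<in> A x"
  obtains W H where "openin X W" "x \<in> W" "openin T H" "\<one> \<in> H" "H \<subseteq> carrier G" "W \<subseteq> topspace X"
    "regular_on W H s" "C W s"
proof -
  obtain W H where W: "openin X W" "x \<in> W" "openin T H" "\<one> \<in> H" "regular_on W H s" "C W s"
    using assms unfolding admissible_def by blast
  show thesis
    using that[OF W(1-4) _ _ W(5,6)] openin_subset[OF W(1)] openin_subset[OF W(3)] topspace_eq by blast
qed

lemma A_I:
  "s \<in> carrier families \<Longrightarrow> openin X W \<Longrightarrow> x \<in> W \<Longrightarrow> openin T H \<Longrightarrow> \<one> \<in> H \<Longrightarrow> regular_on W H s \<Longrightarrow>
    C W s \<Longrightarrow> s \<in> A x"
  unfolding admissible_def by blast

lemma A_zero': "x \<in> topspace X \<Longrightarrow> \<zero>\<^bsub>families\<^esub> \<in> A x"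
  using left_module_families C_zero[of "topspace X"] regular_on_zero[of "topspace X" "carrier G"]
    openin_topspace[of T]
  by (intro A_I[of _ "topspace X" _ "carrier G"])
    (auto simp: left_module_def abelian_group_def abelian_monoid.zero_closed topspace_eq)

lemma A_minus':
  assumes s: "s \<in> A x" and t: "t \<in> A x"
  shows "s \<ominus>\<^bsub>families\<^esub> t \<in> A x"
proof -
  interpret left_module R families by (rule left_module_families)
  obtain W H where W: "openin X W" "x \<in> W" "openin T H" "\<one> \<in> H" "H \<subseteq> carrier G" "W \<subseteq> topspace X"
    "regular_on W H s" "C W s" using s by (rule A_E)
  obtain W' H' where W': "openin X W'" "x \<in> W'" "openin T H'" "\<one> \<in> H'" "H' \<subseteq> carrier G" "W' \<subseteq> topspace X"
    "regular_on W' H' t" "C W' t" using t by (rule A_E)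
  have o: "openin X (W \<inter> W')" using W W' by blast
  have "regular_on (W \<inter> W') (H \<inter> H') s" using W(7) o by (rule regular_on_mono) auto
  moreover have "regular_on (W \<inter> W') (H \<inter> H') t" using W'(7) o by (rule regular_on_mono) auto
  moreover have "C (W \<inter> W') s" using W(8) by (rule C_mono) blast
  moreover have "C (W \<inter> W') t" using W'(8) by (rule C_mono) blast
  ultimately show ?thesis
    using W W' o A_families[OF s] A_families[OF t]
    by (intro A_I[of _ "W \<inter> W'" _ "H \<inter> H'"] regular_on_minus C_minus) auto
qed

lemma A_smult':
  assumes r: "r \<in> carrier R" and s: "s \<in> A x"
  shows "r \<odot>\<^bsub>families\<^esub> s \<in> A x"
proof -
  interpret left_module R families by (rule left_module_families)
  obtain W H where W: "openin X W" "x \<in> W" "openin T H" "\<one> \<in> H" "H \<subseteq> carrier G" "W \<subseteq> topspace X"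
    "regular_on W H s" "C W s" using s by (rule A_E)
  then show ?thesis
    using A_families[OF s] r by (intro A_I[of _ W _ H] regular_on_smult C_smult) (auto intro: smult_closed)
qed

lemma A_act':
  assumes g: "g \<in> carrier G" and s: "s \<in> A x"
  shows "family_act g s \<in> A (act g x)"
proof -
  obtain W H where W: "openin X W" "x \<in> W" "openin T H" "\<one> \<in> H" "H \<subseteq> carrier G" "W \<subseteq> topspace X"
    "regular_on W H s" "C W s" using s by (rule A_E)
  have "continuous_map T T (\<lambda>k. k \<otimes> g)"
    using continuous_map_compose[OF _ continuous_mult, of T "\<lambda>k. (k, g)"] g
    by (simp add: o_def continuous_map_pairwise topspace_eq)
  then have "continuous_map T T (\<lambda>k. inv g \<otimes> (k \<otimes> g))"
    using continuous_map_compose[OF _ continuous_mult, of T "\<lambda>k. (inv g, k \<otimes> g)"] g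
    by (simp add: o_def continuous_map_pairwise topspace_eq)
  then have "openin T {k \<in> topspace T. inv g \<otimes> (k \<otimes> g) \<in> H}"
    using W(3) by (rule openin_continuous_map_preimage)
  then have "openin T {k \<in> carrier G. inv g \<otimes> (k \<otimes> g) \<in> H}" by (simp add: topspace_eq)
  then show ?thesis
    using W g A_families[OF s] open_act_image(1)[OF g W(1)]
    by (intro A_I[of _ "act g ` W" _ "{k \<in> carrier G. inv g \<otimes> (k \<otimes> g) \<in> H}"])
      (auto simp: family_act_closed intro: regular_on_act C_act)
qed

text \<open>The witnesses for \<open>x\<close> are witnesses for every point of \<open>W\<close>;
  this makes admissibility an open condition.\<close>

lemma A_neighbourhood:
  assumes "s \<in> A x"
  obtains W where "openin X W" "x \<in> W" "\<And>y. y \<in> W \<Longrightarrow> s \<in> A y"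
    "\<And>i. i \<in> I \<Longrightarrow> local_section X (D i) W (\<lambda>x. s (i, x))" "C W s"
proof -
  obtain W H where W: "openin X W" "x \<in> W" "openin T H" "\<one> \<in> H"
    "regular_on W H s" "C W s" using assms by (rule A_E)
  then have "s \<in> A y" if "y \<in> W" for y using A_I A_families[OF assms] that by blast
  then show thesis using W that unfolding regular_on_def by blast
qed

lemma A_open': "openin X {x \<in> topspace X. s \<in> A x}"
proof (subst openin_subopen, safe)
  fix x assume "x \<in> topspace X" "s \<in> A x"
  then obtain W where "openin X W" "x \<in> W" "\<And>y. y \<in> W \<Longrightarrow> s \<in> A y" using A_neighbourhood by metis
  then show "\<exists>W. openin X W \<and> x \<in> W \<and> W \<subseteq> {x \<in> topspace X. s \<in> A x}"
    using openin_subset by (intro exI[of _ W]) blast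
qed

end

text \<open>\<open>B_null\<close> says that classes depend on germs only. Together with regularity
  of admissible families it yields the continuity axiom of
  \<open>sheaf_presentation\<close>.\<close>

locale family_quotient = section_condition G T X act R I D C
  for G :: "('g, 'z) monoid_scheme" (structure) and T and X :: "'x topology" and act
    and R :: "('r, 'y) ring_scheme" and I :: "'i set" and D :: "'i \<Rightarrow> ('g, 'r, 'x, 'e) gsheaf"
    and C +
  fixes B :: "'x \<Rightarrow> ('i \<times> 'x \<Rightarrow> 'e) set" and val :: "('i \<times> 'x \<Rightarrow> 'e) \<Rightarrow> 'x \<Rightarrow> 'u"
  assumes B_A: "x \<in> topspace X \<Longrightarrow> s \<in> B x \<Longrightarrow> s \<in> admissible C x"
    and B_null: "x \<in> topspace X \<Longrightarrow> s \<in> admissible C x \<Longrightarrow> null_germ x s \<Longrightarrow> s \<in> B x"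
    and B_minus: "x \<in> topspace X \<Longrightarrow> s \<in> B x \<Longrightarrow> t \<in> B x \<Longrightarrow> s \<ominus>\<^bsub>families\<^esub> t \<in> B x"
    and B_smult: "x \<in> topspace X \<Longrightarrow> r \<in> carrier R \<Longrightarrow> s \<in> B x \<Longrightarrow> r \<odot>\<^bsub>families\<^esub> s \<in> B x"
    and B_act: "x \<in> topspace X \<Longrightarrow> g \<in> carrier G \<Longrightarrow> s \<in> B x \<Longrightarrow> family_act g s \<in> B (act g x)"
    and B_open: "openin X {x \<in> topspace X. s \<in> B x}"
    and val_eq: "x \<in> topspace X \<Longrightarrow> y \<in> topspace X \<Longrightarrow> s \<in> admissible C x \<Longrightarrow> t \<in> admissible C y \<Longrightarrow>
      val s x = val t y \<longleftrightarrow> x = y \<and> s \<ominus>\<^bsub>families\<^esub> t \<in> B x"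
begin

text \<open>If \<open>s\<close> is equivariant on \<open>W\<close> for elements of \<open>H\<close>,
  then its translate by \<open>h\<close> coincides with \<open>s\<close> on the part of
  \<open>W\<close> that is also a translate of \<open>W\<close>. The further shrinking to
  \<open>H1\<close> and \<open>W1\<close> ensures that \<open>act h y\<close> belongs to this
  part.\<close>

lemma A_continuous':
  assumes x: "x \<in> topspace X" and s: "s \<in> A x"
  shows "\<exists>H W. openin T H \<and> \<one> \<in> H \<and> openin X W \<and> x \<in> W \<and>
    (\<forall>h \<in> H. \<forall>y \<in> W. family_act h s \<ominus>\<^bsub>families\<^esub> s \<in> B (act h y))"
proof -
  note sP = A_families[OF s]
  obtain W H where W: "openin X W" "x \<in> W" "openin T H" "\<one> \<in> H" "H \<subseteq> carrier G" "W \<subseteq> topspace X"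
    "regular_on W H s" "C W s" using s by (rule A_E)
  have "openin (prod_topology T X) {w \<in> topspace (prod_topology T X). (\<lambda>(g, x). act g x) w \<in> W}"
    using continuous_act W(1) by (rule openin_continuous_map_preimage)
  moreover have "(\<one>, x) \<in> {w \<in> topspace (prod_topology T X). (\<lambda>(g, x). act g x) w \<in> W}"
    using W x by (simp add: topspace_eq)
  ultimately obtain H1 W1 where HW: "openin T H1" "openin X W1" "\<one> \<in> H1" "x \<in> W1"
    "H1 \<times> W1 \<subseteq> {w \<in> topspace (prod_topology T X). (\<lambda>(g, x). act g x) w \<in> W}"
    by (rule openin_prod_topologyE)
  have "family_act h s \<ominus>\<^bsub>families\<^esub> s \<in> B (act h y)" if h: "h \<in> H" "h \<in> H1" and y: "y \<in> W" "y \<in> W1" for h y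
  proof -
    have hG: "h \<in> carrier G" and yX: "y \<in> topspace X" using h y W by auto
    have hy: "act h y \<in> W" using subsetD[OF HW(5), of "(h, y)"] h y by simp
    have A: "s \<in> A y" "s \<in> A (act h y)" using A_I[OF sP W(1) _ W(3,4,7,8)] y hy by auto
    have d: "family_act h s \<ominus>\<^bsub>families\<^esub> s \<in> A (act h y)"
      using A_minus'[OF A_act'[OF hG A(1)] A(2)] .
    have "null_germ (act h y) (family_act h s \<ominus>\<^bsub>families\<^esub> s)"
      unfolding null_germ_def
    \<comment> \<open>A point \<open>z = h w\<close> here has \<open>w\<close> and
      \<open>h w\<close> in \<open>W\<close>, so regularity reads \<open>h s(w) = s(z)\<close>, and
      the left side is the translated family at \<open>z\<close>.\<close>
    proof (intro exI[of _ "act h ` W \<inter> W"] conjI ballI)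
      show "openin X (act h ` W \<inter> W)" using open_act_image[OF hG W(1)] W(1) by blast
      show "act h y \<in> act h ` W \<inter> W" using hy y by blast
      fix i z assume i: "i \<in> I" and z: "z \<in> act h ` W \<inter> W"
      then obtain w where w: "w \<in> W" "z = act h w" by blast
      have "family_act h s (i, z) = s (i, z)"
        using w z W i h hG by (auto simp: families_simps regular_on_def)
      then show "(family_act h s \<ominus>\<^bsub>families\<^esub> s) (i, z) = szero (D i) z"
        using i z W(6) sP hG
        by (auto simp: families_simps family_act_closed sminus_self[OF D] families_closed)
    qed
    then show ?thesis using B_null d hG yX by simp
  qed
  then show ?thesis
    using W HW by (intro exI[of _ "H \<inter> H1"] exI[of _ "W \<inter> W1"]) auto
qed

sublocale sheaf_presentation G T X act R families family_act A B val
proof (rule sheaf_presentation.intro[OF group_space_axioms sheaf_presentation_axioms.intro])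
  show "\<zero>\<^bsub>families\<^esub> \<in> B x" if "x \<in> topspace X" for x
    using that by (intro B_null A_zero')
      (auto simp: null_germ_def families_simps intro!: exI[of _ "topspace X"])
qed (assumption | rule left_module_families family_act_linear family_act_one family_act_mult A_families B_A
    A_minus' B_minus A_smult' B_smult A_act' B_act A_open' B_open A_continuous' val_eq)+

end

section \<open>Limits of sheaves\<close>

text \<open>Only the underlying graph of a diagram is recorded, as cones and cocones refer to single
  arrows. Pairs of sheaves and the empty diagram are treated as graphs without arrows.\<close>

locale sheaf_diagram = sheaf_family G T X act R I D
  for G :: "('g, 'z) monoid_scheme" (structure) and T and X :: "'x topology" and act
    and R :: "('r, 'y) ring_scheme" and I :: "'i set" and D :: "'i \<Rightarrow> ('g, 'r, 'x, 'e) gsheaf" +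
  fixes Ar :: "'j set" and dm cd :: "'j \<Rightarrow> 'i" and d :: "'j \<Rightarrow> 'e \<Rightarrow> 'e"
  assumes dm: "u \<in> Ar \<Longrightarrow> dm u \<in> I" and cd: "u \<in> Ar \<Longrightarrow> cd u \<in> I"
    and d: "u \<in> Ar \<Longrightarrow> d u \<in> sheaf_maps G X R (D (dm u)) (D (cd u))"
begin

definition compatible :: "'x set \<Rightarrow> ('i \<times> 'x \<Rightarrow> 'e) \<Rightarrow> bool" where
  "compatible W s \<longleftrightarrow> (\<forall>u \<in> Ar. \<forall>x \<in> W. d u (s (dm u, x)) = s (cd u, x))"

definition null_families :: "'x \<Rightarrow> ('i \<times> 'x \<Rightarrow> 'e) set" where
  "null_families x = {s \<in> admissible compatible x. null_germ x s}"

lemmas d_simps = sheaf_map_closed[OF D[OF dm] D[OF cd] d] sheaf_map_proj[OF D[OF dm] D[OF cd] d]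
  sheaf_map_gact[OF D[OF dm] D[OF cd] d] sheaf_map_sadd[OF D[OF dm] D[OF cd] d]
  sheaf_map_ssmult[OF D[OF dm] D[OF cd] d] sheaf_map_szero[OF D[OF dm] D[OF cd] d]
  sheaf_map_sminus[OF D[OF dm] D[OF cd] d]

lemma compatible_mono: "compatible W s \<Longrightarrow> W' \<subseteq> W \<Longrightarrow> compatible W' s"
  by (auto simp: compatible_def)

lemma compatible_zero: "W \<subseteq> topspace X \<Longrightarrow> compatible W \<zero>\<^bsub>families\<^esub>"
  by (auto simp: compatible_def families_simps dm cd d_simps subset_iff)

lemma compatible_minus:
  assumes "W \<subseteq> topspace X" "s \<in> carrier families" "t \<in> carrier families" "compatible W s" "compatible W t"
  shows "compatible W (s \<ominus>\<^bsub>families\<^esub> t)"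
  unfolding compatible_def
proof (intro ballI)
  fix u x assume u: "u \<in> Ar" and x: "x \<in> W"
  then have "d u (s (dm u, x)) = s (cd u, x)" "d u (t (dm u, x)) = t (cd u, x)" "x \<in> topspace X"
    using assms by (auto simp: compatible_def)
  with u show "d u ((s \<ominus>\<^bsub>families\<^esub> t) (dm u, x)) = (s \<ominus>\<^bsub>families\<^esub> t) (cd u, x)"
    using assms(2,3) by (simp add: families_simps dm cd d_simps families_closed)
qed

lemma compatible_smult:
  assumes "W \<subseteq> topspace X" "s \<in> carrier families" "r \<in> carrier R" "compatible W s"
  shows "compatible W (r \<odot>\<^bsub>families\<^esub> s)"
  unfolding compatible_def
proof (intro ballI)
  fix u x assume u: "u \<in> Ar" and x: "x \<in> W"
  then have "d u (s (dm u, x)) = s (cd u, x)" "x \<in> topspace X"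
    using assms by (auto simp: compatible_def)
  with u show "d u ((r \<odot>\<^bsub>families\<^esub> s) (dm u, x)) = (r \<odot>\<^bsub>families\<^esub> s) (cd u, x)"
    using assms(2,3) by (simp add: families_simps dm cd d_simps families_closed)
qed

lemma compatible_act:
  assumes "W \<subseteq> topspace X" "s \<in> carrier families" "g \<in> carrier G" "compatible W s"
  shows "compatible (act g ` W) (family_act g s)"
  unfolding compatible_def
proof (intro ballI)
  fix u y assume u: "u \<in> Ar" and "y \<in> act g ` W"
  then obtain x where x: "x \<in> W" "y = act g x" by blast
  then have "d u (s (dm u, x)) = s (cd u, x)" "x \<in> topspace X"
    using assms u by (auto simp: compatible_def)
  with u x show "d u (family_act g s (dm u, y)) = family_act g s (cd u, y)"
    using assms(2,3) by (simp add: families_simps dm cd families_closed d_simps)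
qed

sublocale section_condition G T X act R I D compatible
  using compatible_mono compatible_zero compatible_minus compatible_smult compatible_act
  by unfold_locales

end

text \<open>Naming the classes by \<open>val\<close> is kept as an assumption, so that the
  construction of the limit is separate from the cardinality estimate in
  \<open>limit_names\<close>.\<close>

locale diagram_limit = sheaf_diagram G T X act R I D Ar dm cd d
  for G :: "('g, 'z) monoid_scheme" (structure) and T and X :: "'x topology" and act
    and R :: "('r, 'y) ring_scheme" and I :: "'i set" and D :: "'i \<Rightarrow> ('g, 'r, 'x, 'e) gsheaf"
    and Ar :: "'j set" and dm cd d +
  fixes val :: "('i \<times> 'x \<Rightarrow> 'e) \<Rightarrow> 'x \<Rightarrow> 'e"
  assumes limit_val_eq: "x \<in> topspace X \<Longrightarrow> y \<in> topspace X \<Longrightarrow> s \<in> admissible compatible x \<Longrightarrow>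
    t \<in> admissible compatible y \<Longrightarrow>
      val s x = val t y \<longleftrightarrow> x = y \<and> s \<ominus>\<^bsub>families\<^esub> t \<in> null_families x"
begin

sublocale family_quotient G T X act R I D compatible null_families val
proof
  show "s \<ominus>\<^bsub>families\<^esub> t \<in> null_families x" if "s \<in> null_families x" "t \<in> null_families x" for x s t
    using that by (auto simp: null_families_def A_families intro!: A_minus' null_germ_minus)
  show "r \<odot>\<^bsub>families\<^esub> s \<in> null_families x" if "r \<in> carrier R" "s \<in> null_families x" for x r s
    using that by (auto simp: null_families_def intro!: A_smult' null_germ_smult)
  show "family_act g s \<in> null_families (act g x)" if "g \<in> carrier G" "s \<in> null_families x" for x g s
    using that by (auto simp: null_families_def intro!: A_act' null_germ_act)
  fix s
  have "openin X {x \<in> topspace X. null_germ x s}"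
  proof (subst openin_subopen, safe)
    fix x assume "x \<in> topspace X" "null_germ x s"
    then obtain W where W: "openin X W" "x \<in> W" "\<forall>i\<in>I. \<forall>y\<in>W. s (i, y) = szero (D i) y"
      unfolding null_germ_def by blast
    then have "W \<subseteq> {x \<in> topspace X. null_germ x s}"
      using openin_subset[OF W(1)] unfolding null_germ_def by blast
    with W show "\<exists>W. openin X W \<and> x \<in> W \<and> W \<subseteq> {x \<in> topspace X. null_germ x s}" by blast
  qed
  moreover have "{x \<in> topspace X. s \<in> null_families x} =
      {x \<in> topspace X. s \<in> A x} \<inter> {x \<in> topspace X. null_germ x s}"
    by (auto simp: null_families_def)
  ultimately show "openin X {x \<in> topspace X. s \<in> null_families x}" using A_open' by (simp add: openin_Int)
qed (auto simp: null_families_def limit_val_eq)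

definition limit_proj :: "'i \<Rightarrow> 'e \<Rightarrow> 'e" where
  "limit_proj i = (\<lambda>e\<in>germs. fst (rep e) (i, snd (rep e)))"

lemma limit_proj_val:
  assumes i: "i \<in> I" and x: "x \<in> topspace X" and s: "s \<in> A x"
  shows "limit_proj i (val s x) = s (i, x)"
proof -
  let ?s = "fst (rep (val s x))"
  note r = rep_val[OF x s]
  have "(?s \<ominus>\<^bsub>families\<^esub> s) (i, x) = szero (D i) x"
    using r(3) i unfolding null_families_def null_germ_def by blast
  then have "?s (i, x) = s (i, x)"
    using i x A_families[OF r(2)] A_families[OF s]
      sminus_eq_zero_iff[OF D[OF i], of "?s (i, x)" "s (i, x)"]
    by (simp add: families_simps families_closed)
  then show ?thesis using x s r by (simp add: limit_proj_def)
qed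

lemma limit_proj_map:
  assumes i: "i \<in> I"
  shows "limit_proj i \<in> sheaf_maps G X R quotient_sheaf (D i)"
proof (rule sheaf_mapsI[OF sheaf_quotient D[OF i]])
  show "limit_proj i \<in> extensional (topspace (total quotient_sheaf))"
    unfolding topspace_quotient by (simp add: limit_proj_def)
  show "continuous_map (total quotient_sheaf) (total (D i)) (limit_proj i)"
  proof (rule continuous_map_from_total[OF sheaf_quotient])
    fix e assume "e \<in> topspace (total quotient_sheaf)"
    then obtain s x where x: "x \<in> topspace X" "s \<in> A x" "e = val s x" by (auto elim!: germsE)
    obtain W where W: "openin X W" "x \<in> W" "\<And>y. y \<in> W \<Longrightarrow> s \<in> A y"
      "\<And>i. i \<in> I \<Longrightarrow> local_section X (D i) W (\<lambda>x. s (i, x))" using x(2) by (rule A_neighbourhood) blast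
    have "limit_proj i (val s y) = s (i, y)" if "y \<in> W" for y
      using limit_proj_val[OF i _ W(3)] that openin_subset[OF W(1)] by blast
    then have "continuous_map (subtopology X W) (total (D i)) (\<lambda>y. limit_proj i (val s y))"
      using local_sectionD(3)[OF W(4)[OF i]] by (auto elim!: continuous_map_eq)
    then show "\<exists>W t. local_section X quotient_sheaf W t \<and> proj quotient_sheaf e \<in> W \<and>
        t (proj quotient_sheaf e) = e \<and> continuous_map (subtopology X W) (total (D i)) (\<lambda>y. limit_proj i (t y))"
      using W x val_local_section[OF W(1,3)] by (intro exI[of _ W] exI[of _ "val s"]) (simp add: proj_quotient)
  qed
  show "proj (D i) (limit_proj i e) = proj quotient_sheaf e" if "e \<in> topspace (total quotient_sheaf)" for e
    using that i by (auto simp: limit_proj_val proj_quotient A_families families_closed elim!: germsE)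
  show "limit_proj i (gact quotient_sheaf g e) = gact (D i) g (limit_proj i e)"
    if "g \<in> carrier G" "e \<in> topspace (total quotient_sheaf)" for g e
    using that i by (auto simp: gact_quotient limit_proj_val A_act' families_simps elim!: germsE)
  show "limit_proj i (ssmult quotient_sheaf r e) = ssmult (D i) r (limit_proj i e)"
    if "r \<in> carrier R" "e \<in> topspace (total quotient_sheaf)" for r e
    using that i by (auto simp: ssmult_quotient limit_proj_val A_smult families_simps elim!: germsE)
  show "limit_proj i (sadd quotient_sheaf a b) = sadd (D i) (limit_proj i a) (limit_proj i b)"
    if "a \<in> topspace (total quotient_sheaf)" "b \<in> topspace (total quotient_sheaf)"
      "proj quotient_sheaf a = proj quotient_sheaf b" for a b
    using that i by (auto simp: proj_quotient sadd_quotient limit_proj_val A_add families_simps elim!: germsE)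
qed

lemma limit_proj_compatible:
  assumes u: "u \<in> Ar" and e: "e \<in> germs"
  shows "d u (limit_proj (dm u) e) = limit_proj (cd u) e"
proof -
  obtain s x where x: "x \<in> topspace X" "s \<in> A x" "e = val s x" using e by (rule germsE)
  obtain W where "x \<in> W" "compatible W s" using x(2) by (rule A_neighbourhood)
  then show ?thesis using x u by (simp add: limit_proj_val dm cd compatible_def)
qed

section \<open>The universal property of the limit\<close>

context
  fixes M :: "('g, 'r, 'x, 'e) gsheaf" and \<mu> :: "'i \<Rightarrow> 'e \<Rightarrow> 'e"
  assumes M: "sheaf M" and \<mu>: "\<And>i. i \<in> I \<Longrightarrow> \<mu> i \<in> sheaf_maps G X R M (D i)"
    and cone: "\<And>u m. u \<in> Ar \<Longrightarrow> m \<in> topspace (total M) \<Longrightarrow> d u (\<mu> (dm u) m) = \<mu> (cd u) m"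
begin

text \<open>The family \<open>s\<close> expresses the section \<open>t\<close> of \<open>M\<close>
  through the cone \<open>\<mu>\<close>. The induced map will send \<open>t y\<close> to the germ of
  \<open>s\<close> at \<open>y\<close>.\<close>

definition lifts :: "('i \<times> 'x \<Rightarrow> 'e) \<Rightarrow> 'x set \<Rightarrow> ('x \<Rightarrow> 'e) \<Rightarrow> bool" where
  "lifts s W t \<longleftrightarrow> local_section X M W t \<and> (\<forall>y \<in> W. s \<in> A y \<and> (\<forall>i \<in> I. s (i, y) = \<mu> i (t y)))"

text \<open>The neighbourhood \<open>H\<close> found for one section of \<open>M\<close> works for
  all components \<open>\<mu> i\<close> of it simultaneously, since these are equivariant maps.
  Hence the uniform condition in \<open>regular_on\<close> excludes no cone.\<close>

lemma lifts_exist: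
  assumes m: "m \<in> topspace (total M)"
  shows "\<exists>s W t. lifts s W t \<and> proj M m \<in> W \<and> t (proj M m) = m"
proof -
  obtain W t H where t: "local_section X M W t" "proj M m \<in> W" "t (proj M m) = m"
    and H: "openin T H" "\<one> \<in> H" "\<And>h x. h \<in> H \<Longrightarrow> x \<in> W \<Longrightarrow> gact M h (t x) = t (act h x)"
    using equivariant_section_through[OF M m] by metis
  have HG: "H \<subseteq> carrier G" using openin_subset[OF H(1)] topspace_eq by simp
  note tW = local_sectionD[OF t(1)]
  \<comment> \<open>Extension by zero off \<open>W\<close> is discontinuous in general, but families
    are global and only their behaviour near a point matters.\<close>
  define s where "s = (\<lambda>(i, x)\<in>I \<times> topspace X. if x \<in> W then \<mu> i (t x) else szero (D i) x)"
  have sW: "s (i, x) = \<mu> i (t x)" if "i \<in> I" "x \<in> W" for i x using that tW(2) by (auto simp: s_def)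
  have s: "s \<in> carrier families"
    using tW by (auto simp: families_carrier s_def szero_closed[OF D] sheaf_map_closed[OF M D \<mu>] sheaf_map_proj[OF M D \<mu>])
  have "regular_on W H s"
    unfolding regular_on_def
  proof (intro ballI conjI impI)
    fix i assume i: "i \<in> I"
    show "local_section X (D i) W (\<lambda>x. s (i, x))"
      using sheaf_map_section[OF M D[OF i] \<mu>[OF i] t(1)] by (rule local_section_cong) (simp add: sW i)
    fix h x assume "h \<in> H" "x \<in> W" "act h x \<in> W"
    then show "gact (D i) h (s (i, x)) = s (i, act h x)"
      using i HG tW(4) H(3) sheaf_map_gact[OF M D[OF i] \<mu>[OF i], of h "t x"] by (auto simp: sW)
  qed
  moreover have "compatible W s"
    unfolding compatible_def using sW tW(4) by (simp add: cone dm cd)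
  ultimately have "s \<in> A y" if "y \<in> W" for y using A_I[OF s tW(1) that H(1,2)] by blast
  then show ?thesis unfolding lifts_def using t sW by blast
qed

text \<open>Two sections of \<open>M\<close> with the same value agree on a neighbourhood, where the
  lifted families then have the same components; so their difference has zero germ.\<close>

lemma lifts_unique:
  assumes s: "lifts s W t" "x \<in> W" and s': "lifts s' W' t'" "x \<in> W'" and eq: "t x = t' x"
  shows "val s x = val s' x"
proof -
  have t: "local_section X M W t" "local_section X M W' t'" using s s' by (auto simp: lifts_def)
  have x: "x \<in> topspace X" using local_sectionD(2)[OF t(1)] s(2) by blast
  have A: "s \<in> A x" "s' \<in> A x" using s s' by (auto simp: lifts_def)
  have "null_germ x (s \<ominus>\<^bsub>families\<^esub> s')"
    unfolding null_germ_def
  proof (intro exI[of _ "{x \<in> W \<inter> W'. t x = t' x}"] conjI ballI)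
    show "openin X {x \<in> W \<inter> W'. t x = t' x}" using openin_sections_agree[OF M t] .
    show "x \<in> {x \<in> W \<inter> W'. t x = t' x}" using s s' eq by simp
    fix i y assume i: "i \<in> I" and y: "y \<in> {x \<in> W \<inter> W'. t x = t' x}"
    then have "s (i, y) = s' (i, y)" using s s' by (simp add: lifts_def)
    moreover have "y \<in> topspace X" using y local_sectionD(2)[OF t(1)] by blast
    ultimately show "(s \<ominus>\<^bsub>families\<^esub> s') (i, y) = szero (D i) y"
      using i A_families[OF A(1)] A_families[OF A(2)]
      by (simp add: families_simps sminus_self[OF D] families_closed)
  qed
  then show ?thesis using A x by (intro val_eqI) (auto simp: null_families_def intro: A_minus')
qed

definition limit_lift :: "'e \<Rightarrow> 'e" where
  "limit_lift = (\<lambda>m\<in>topspace (total M).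
     val (SOME s. \<exists>W t. lifts s W t \<and> proj M m \<in> W \<and> t (proj M m) = m) (proj M m))"

lemma limit_lift_eq:
  assumes s: "lifts s W t" and x: "x \<in> W"
  shows "limit_lift (t x) = val s x"
proof -
  have t: "local_section X M W t" using s by (simp add: lifts_def)
  have m: "t x \<in> topspace (total M)" "proj M (t x) = x" using local_sectionD[OF t] x by auto
  let ?P = "\<lambda>s. \<exists>W t'. lifts s W t' \<and> x \<in> W \<and> t' x = t x"
  have "?P (SOME s. ?P s)" using s x by (intro someI[of ?P]) blast
  then obtain W' t' where "lifts (SOME s. ?P s) W' t'" "x \<in> W'" "t' x = t x" by blast
  from lifts_unique[OF this(1,2) s x this(3)] show ?thesis
    using m by (simp add: limit_lift_def)
qed

lemma lifts_cases:
  assumes "m \<in> topspace (total M)"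
  obtains s W t where "lifts s W t" "proj M m \<in> W" "t (proj M m) = m" "local_section X M W t"
    "s \<in> A (proj M m)" "limit_lift m = val s (proj M m)"
proof -
  obtain s W t where s: "lifts s W t" "proj M m \<in> W" "t (proj M m) = m" using lifts_exist[OF assms] by blast
  show thesis
    using that[OF s] limit_lift_eq[OF s(1,2)] s by (simp add: lifts_def)
qed

text \<open>For each operation, applying it to both the family and the section again gives a lift;
  \<open>limit_lift_eq\<close> then evaluates the map on the result. Continuity holds because along
  a section the map is \<open>val s\<close>.\<close>

lemma limit_lift_map: "limit_lift \<in> sheaf_maps G X R M quotient_sheaf"
proof (rule sheaf_mapsI[OF M sheaf_quotient])
  show "limit_lift \<in> extensional (topspace (total M))" by (simp add: limit_lift_def)
  show "continuous_map (total M) (total quotient_sheaf) limit_lift"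
  proof (rule continuous_map_from_total[OF M])
    fix m assume m: "m \<in> topspace (total M)"
    obtain s W t where s: "lifts s W t" "proj M m \<in> W" "t (proj M m) = m" using lifts_exist[OF m] by blast
    then have t: "local_section X M W t" "\<And>y. y \<in> W \<Longrightarrow> s \<in> A y" by (auto simp: lifts_def)
    have "continuous_map (subtopology X W) (total quotient_sheaf) (\<lambda>x. limit_lift (t x))"
      using val_continuous[OF local_sectionD(1)[OF t(1)] t(2)]
      by (rule continuous_map_eq) (auto simp: limit_lift_eq[OF s(1)])
    then show "\<exists>W t. local_section X M W t \<and> proj M m \<in> W \<and> t (proj M m) = m \<and>
        continuous_map (subtopology X W) (total quotient_sheaf) (\<lambda>x. limit_lift (t x))"
      using s t by blast
  qed
  fix m assume m: "m \<in> topspace (total M)"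
  obtain s W t where s: "lifts s W t" "proj M m \<in> W" "t (proj M m) = m" "local_section X M W t"
    "s \<in> A (proj M m)" "limit_lift m = val s (proj M m)" using m by (rule lifts_cases)
  have x: "proj M m \<in> topspace X" using proj_closed[OF M m] .
  note W = local_sectionD[OF s(4)]
  have sW: "s \<in> A y" "\<And>i. i \<in> I \<Longrightarrow> s (i, y) = \<mu> i (t y)" if "y \<in> W" for y
    using s(1) that by (auto simp: lifts_def)
  show "proj quotient_sheaf (limit_lift m) = proj M m" using s x by (simp add: proj_quotient)
  show "limit_lift (gact M g m) = gact quotient_sheaf g (limit_lift m)" if g: "g \<in> carrier G" for g
  proof -
    have "lifts (family_act g s) (act g ` W) (\<lambda>y. gact M g (t (act (inv g) y)))"
      unfolding lifts_def
    proof (intro conjI ballI)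
      show "local_section X M (act g ` W) (\<lambda>y. gact M g (t (act (inv g) y)))"
        using local_section_gact[OF M s(4) g] .
      fix y assume "y \<in> act g ` W"
      then obtain z where z: "z \<in> W" "y = act g z" by blast
      then have zX: "z \<in> topspace X" using W by blast
      show "family_act g s \<in> A y" using A_act'[OF g] sW z by blast
      show "family_act g s (i, y) = \<mu> i (gact M g (t (act (inv g) y)))" if "i \<in> I" for i
        using that z zX g sW W(4) by (simp add: families_simps sheaf_map_gact[OF M D \<mu>])
    qed
    from limit_lift_eq[OF this, of "act g (proj M m)"] show ?thesis
      using s x g m by (simp add: gact_quotient)
  qed
  show "limit_lift (ssmult M r m) = ssmult quotient_sheaf r (limit_lift m)" if r: "r \<in> carrier R" for r
  proof -
    have "lifts (r \<odot>\<^bsub>families\<^esub> s) W (\<lambda>y. ssmult M r (t y))"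
      unfolding lifts_def
    proof (intro conjI ballI)
      show "local_section X M W (\<lambda>y. ssmult M r (t y))" using local_section_smult[OF M s(4) r] .
      fix y assume y: "y \<in> W"
      then show "r \<odot>\<^bsub>families\<^esub> s \<in> A y" using A_smult'[OF r] sW by blast
      show "(r \<odot>\<^bsub>families\<^esub> s) (i, y) = \<mu> i (ssmult M r (t y))" if "i \<in> I" for i
        using that y r sW W(2,4) by (simp add: families_simps sheaf_map_ssmult[OF M D \<mu>] subset_iff)
    qed
    from limit_lift_eq[OF this, of "proj M m"] show ?thesis
      using s x r by (simp add: ssmult_quotient)
  qed
  fix n assume n: "n \<in> topspace (total M)" and mn: "proj M m = proj M n"
  obtain s' W' t' where s': "lifts s' W' t'" "proj M n \<in> W'" "t' (proj M n) = n" "local_section X M W' t'"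
    "s' \<in> A (proj M n)" "limit_lift n = val s' (proj M n)" using n by (rule lifts_cases)
  have o: "openin X (W \<inter> W')" using W(1) local_sectionD(1)[OF s'(4)] by blast
  have "lifts (s \<oplus>\<^bsub>families\<^esub> s') (W \<inter> W') (\<lambda>y. sadd M (t y) (t' y))"
    unfolding lifts_def
  proof (intro conjI ballI)
    show "local_section X M (W \<inter> W') (\<lambda>y. sadd M (t y) (t' y))"
      using s(4) s'(4) o by (intro local_section_add[OF M]) (auto intro: local_section_subset)
    fix y assume y: "y \<in> W \<inter> W'"
    then have A: "s \<in> A y" "s' \<in> A y" "y \<in> topspace X" using s s' W(2) by (auto simp: lifts_def)
    then show "s \<oplus>\<^bsub>families\<^esub> s' \<in> A y" by (intro A_add)
    show "(s \<oplus>\<^bsub>families\<^esub> s') (i, y) = \<mu> i (sadd M (t y) (t' y))" if i: "i \<in> I" for i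
    proof -
      have "s (i, y) = \<mu> i (t y)" "s' (i, y) = \<mu> i (t' y)" using s(1) s'(1) y i by (auto simp: lifts_def)
      then show ?thesis
        using i y A(3) W(4,5) local_sectionD(4,5)[OF s'(4)]
        by (simp add: families_simps sheaf_map_sadd[OF M D \<mu>])
    qed
  qed
  from limit_lift_eq[OF this, of "proj M m"] show "limit_lift (sadd M m n) = sadd quotient_sheaf (limit_lift m) (limit_lift n)"
    using s s' x mn by (simp add: sadd_quotient)
qed

text \<open>For uniqueness let \<open>h\<close> be any solution and \<open>val s\<close> name one of
  its values. Then \<open>h\<close> along a section of \<open>M\<close> and \<open>val s\<close> are
  sections of the limit with a common value, so they agree nearby; applying the projections shows
  that \<open>s\<close> lifts the section there, and \<open>limit_lift_eq\<close> identifies the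
  value.\<close>

theorem limit_universal:
  "\<exists>!h. h \<in> sheaf_maps G X R M quotient_sheaf \<and>
     (\<forall>i \<in> I. \<forall>m \<in> topspace (total M). limit_proj i (h m) = \<mu> i m)"
proof (rule ex1I[of _ limit_lift])
  show "limit_lift \<in> sheaf_maps G X R M quotient_sheaf \<and>
     (\<forall>i \<in> I. \<forall>m \<in> topspace (total M). limit_proj i (limit_lift m) = \<mu> i m)"
  proof (intro conjI limit_lift_map ballI)
    fix i m assume i: "i \<in> I" and m: "m \<in> topspace (total M)"
    obtain s W t where "lifts s W t" "proj M m \<in> W" "t (proj M m) = m" "local_section X M W t"
      "s \<in> A (proj M m)" "limit_lift m = val s (proj M m)" using m by (rule lifts_cases)
    then show "limit_proj i (limit_lift m) = \<mu> i m"
      using i proj_closed[OF M m] by (auto simp: limit_proj_val lifts_def)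
  qed
  fix h assume "h \<in> sheaf_maps G X R M quotient_sheaf \<and>
     (\<forall>i \<in> I. \<forall>m \<in> topspace (total M). limit_proj i (h m) = \<mu> i m)"
  then have h: "h \<in> sheaf_maps G X R M quotient_sheaf"
    and hp: "\<And>i m. i \<in> I \<Longrightarrow> m \<in> topspace (total M) \<Longrightarrow> limit_proj i (h m) = \<mu> i m" by auto
  show "h = limit_lift"
  proof (rule extensionalityI[of _ "topspace (total M)"])
    fix m assume m: "m \<in> topspace (total M)"
    have hm: "h m \<in> germs" "proj quotient_sheaf (h m) = proj M m"
      using sheaf_map_closed[OF M sheaf_quotient h m] sheaf_map_proj[OF M sheaf_quotient h m] by auto
    then obtain s where x: "proj M m \<in> topspace X" and s: "s \<in> A (proj M m)" "h m = val s (proj M m)"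
      by (auto simp: proj_quotient elim!: germsE)
    obtain V where V: "openin X V" "proj M m \<in> V" "\<And>y. y \<in> V \<Longrightarrow> s \<in> A y"
      using s(1) by (rule A_neighbourhood) blast
    obtain W t where t: "local_section X M W t" "proj M m \<in> W" "t (proj M m) = m"
      using section_homeo_through[OF M m] m by (metis imageI)
    let ?Y = "{y \<in> W \<inter> V. h (t y) = val s y}"
    have Y: "openin X ?Y"
      using openin_sections_agree[OF sheaf_quotient sheaf_map_section[OF M sheaf_quotient h t(1)]
        val_local_section[OF V(1,3)]] .
    have "lifts s ?Y t"
      unfolding lifts_def
    proof (intro conjI ballI)
      show "local_section X M ?Y t" using local_section_subset[OF t(1) Y] by blast
      fix y assume y: "y \<in> ?Y"
      then show "s \<in> A y" using V by blast
      have "y \<in> topspace X" "t y \<in> topspace (total M)" using y local_sectionD(2,4)[OF t(1)] by auto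
      then show "s (i, y) = \<mu> i (t y)" if "i \<in> I" for i
        using hp[OF that, of "t y"] y V(3)[of y] that by (simp add: limit_proj_val)
    qed
    from limit_lift_eq[OF this, of "proj M m"] show "h m = limit_lift m" using s t V by simp
  qed (use sheaf_map_ext[OF M sheaf_quotient h] in \<open>simp_all add: limit_lift_def\<close>)
qed

end

end

section \<open>Quotients of direct sums\<close>

lemma finsum_additive:
  assumes "abelian_monoid M" "abelian_monoid N" "finite F" "g \<in> F \<rightarrow> carrier M"
    and f: "\<And>x. x \<in> carrier M \<Longrightarrow> f x \<in> carrier N" "f \<zero>\<^bsub>M\<^esub> = \<zero>\<^bsub>N\<^esub>"
      "\<And>x y. x \<in> carrier M \<Longrightarrow> y \<in> carrier M \<Longrightarrow> f (x \<oplus>\<^bsub>M\<^esub> y) = f x \<oplus>\<^bsub>N\<^esub> f y"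
  shows "f (finsum M g F) = finsum N (\<lambda>i. f (g i)) F"
proof -
  interpret M: abelian_monoid M by fact
  interpret N: abelian_monoid N by fact
  from assms(3,4) show ?thesis
  proof (induction F rule: finite_induct)
    case (insert i F)
    then have "g \<in> F \<rightarrow> carrier M" "g i \<in> carrier M" by auto
    with insert f show ?case
      by (simp add: M.finsum_insert N.finsum_insert Pi_iff M.finsum_closed)
  qed (simp add: f M.finsum_empty N.finsum_empty)
qed

locale finite_sums = sheaf_family G T X act R I D
  for G :: "('g, 'z) monoid_scheme" (structure) and T and X :: "'x topology" and act
    and R :: "('r, 'y) ring_scheme" and I :: "'i set" and D :: "'i \<Rightarrow> ('g, 'r, 'x, 'e) gsheaf"
begin

definition finite_support :: "'x set \<Rightarrow> ('i \<times> 'x \<Rightarrow> 'e) \<Rightarrow> bool" where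
  "finite_support W s \<longleftrightarrow> finite {i \<in> I. \<exists>x \<in> W. s (i, x) \<noteq> szero (D i) x}"

text \<open>Used with a single index and with its complement, to split off one component of a family
  in an induction on its support.\<close>

definition restrict_family :: "'i set \<Rightarrow> ('i \<times> 'x \<Rightarrow> 'e) \<Rightarrow> ('i \<times> 'x \<Rightarrow> 'e)" where
  "restrict_family S s = (\<lambda>(i, x)\<in>I \<times> topspace X. if i \<in> S then s (i, x) else szero (D i) x)"

sublocale section_condition G T X act R I D finite_support
proof
  show "finite_support W' s" if "finite_support W s" "W' \<subseteq> W" for W W' s
    using that(1) unfolding finite_support_def by (rule rev_finite_subset) (use that(2) in auto)
  show "finite_support W \<zero>\<^bsub>families\<^esub>" if "W \<subseteq> topspace X" for W
  proof -
    have "{i \<in> I. \<exists>x \<in> W. \<zero>\<^bsub>families\<^esub> (i, x) \<noteq> szero (D i) x} = {}"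
      using that by (auto simp: families_simps subset_iff)
    then show ?thesis unfolding finite_support_def by (metis finite.emptyI)
  qed
  show "finite_support W (s \<ominus>\<^bsub>families\<^esub> t)"
    if "W \<subseteq> topspace X" "s \<in> carrier families" "t \<in> carrier families" "finite_support W s" "finite_support W t" for W s t
  proof -
    have "{i \<in> I. \<exists>x \<in> W. (s \<ominus>\<^bsub>families\<^esub> t) (i, x) \<noteq> szero (D i) x} \<subseteq>
      {i \<in> I. \<exists>x \<in> W. s (i, x) \<noteq> szero (D i) x} \<union> {i \<in> I. \<exists>x \<in> W. t (i, x) \<noteq> szero (D i) x}"
    proof (rule subsetI, rule ccontr)
      fix i assume "i \<in> {i \<in> I. \<exists>x \<in> W. (s \<ominus>\<^bsub>families\<^esub> t) (i, x) \<noteq> szero (D i) x}"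
        and "i \<notin> {i \<in> I. \<exists>x \<in> W. s (i, x) \<noteq> szero (D i) x} \<union> {i \<in> I. \<exists>x \<in> W. t (i, x) \<noteq> szero (D i) x}"
      then obtain x where x: "i \<in> I" "x \<in> W" "(s \<ominus>\<^bsub>families\<^esub> t) (i, x) \<noteq> szero (D i) x"
        "s (i, x) = szero (D i) x" "t (i, x) = szero (D i) x" by auto
      moreover have "x \<in> topspace X" using x(2) that(1) by blast
      ultimately show False
        using that by (simp add: families_simps sminus_self[OF D] szero_closed[OF D])
    qed
    then show ?thesis using that(4,5) unfolding finite_support_def by (meson finite_UnI rev_finite_subset)
  qed
  show "finite_support W (r \<odot>\<^bsub>families\<^esub> s)"
    if "W \<subseteq> topspace X" "s \<in> carrier families" "r \<in> carrier R" "finite_support W s" for W s r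
  proof -
    have "{i \<in> I. \<exists>x \<in> W. (r \<odot>\<^bsub>families\<^esub> s) (i, x) \<noteq> szero (D i) x} \<subseteq>
      {i \<in> I. \<exists>x \<in> W. s (i, x) \<noteq> szero (D i) x}"
      using that(1,3) by (force simp: families_simps subset_iff ssmult_zero[OF D])
    then show ?thesis using that(4) unfolding finite_support_def by (rule finite_subset)
  qed
  show "finite_support (act g ` W) (family_act g s)"
    if "W \<subseteq> topspace X" "s \<in> carrier families" "g \<in> carrier G" "finite_support W s" for W s g
  proof -
    have "{i \<in> I. \<exists>x \<in> act g ` W. family_act g s (i, x) \<noteq> szero (D i) x} \<subseteq>
      {i \<in> I. \<exists>x \<in> W. s (i, x) \<noteq> szero (D i) x}"
    proof (rule subsetI, rule ccontr)
      fix i assume "i \<in> {i \<in> I. \<exists>x \<in> act g ` W. family_act g s (i, x) \<noteq> szero (D i) x}"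
        and "i \<notin> {i \<in> I. \<exists>x \<in> W. s (i, x) \<noteq> szero (D i) x}"
      then obtain x where x: "i \<in> I" "x \<in> W" "family_act g s (i, act g x) \<noteq> szero (D i) (act g x)"
        "s (i, x) = szero (D i) x" by auto
      moreover have "x \<in> topspace X" using x(2) that(1) by blast
      ultimately show False
        using that by (simp add: families_simps gact_szero[OF D])
    qed
    then show ?thesis using that(4) unfolding finite_support_def by (rule finite_subset)
  qed
qed

lemma restrict_family_simps [simp]:
  "i \<in> I \<Longrightarrow> x \<in> topspace X \<Longrightarrow> restrict_family S s (i, x) = (if i \<in> S then s (i, x) else szero (D i) x)"
  by (simp add: restrict_family_def)

lemma restrict_family_closed: "s \<in> carrier families \<Longrightarrow> restrict_family S s \<in> carrier families"
  by (auto simp: families_carrier restrict_family_def szero_closed[OF D])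

lemma restrict_family_admissible:
  assumes s: "s \<in> A x"
  shows "restrict_family S s \<in> A x"
proof -
  obtain W H where W: "openin X W" "x \<in> W" "openin T H" "\<one> \<in> H" "H \<subseteq> carrier G" "W \<subseteq> topspace X"
    "regular_on W H s" "finite_support W s" using s by (rule A_E)
  note z = regular_on_zero[OF W(1,5)]
  have X: "x \<in> topspace X" if "x \<in> W" for x using that W(6) by blast
  have "regular_on W H (restrict_family S s)"
    unfolding regular_on_def
  proof (intro ballI conjI impI)
    fix i assume i: "i \<in> I"
    show "local_section X (D i) W (\<lambda>x. restrict_family S s (i, x))"
    proof (cases "i \<in> S")
      case True
      have "local_section X (D i) W (\<lambda>x. s (i, x))" using W(7) i by (simp add: regular_on_def)
      then show ?thesis by (rule local_section_cong) (simp add: i X True)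
    next
      case False
      show ?thesis
        using local_section_zero[OF D[OF i] W(1)] by (rule local_section_cong) (simp add: i X False)
    qed
    fix h x assume "h \<in> H" "x \<in> W" "act h x \<in> W"
    then show "gact (D i) h (restrict_family S s (i, x)) = restrict_family S s (i, act h x)"
      using W(5,7) i X[of x] X[of "act h x"] by (auto simp: regular_on_def gact_szero[OF D])
  qed
  moreover have "{i \<in> I. \<exists>x \<in> W. restrict_family S s (i, x) \<noteq> szero (D i) x} \<subseteq> {i \<in> I. \<exists>x \<in> W. s (i, x) \<noteq> szero (D i) x}"
    using X by (auto split: if_splits)
  then have "finite_support W (restrict_family S s)"
    using W(8) unfolding finite_support_def by (rule finite_subset)
  ultimately show ?thesis
    using W A_families[OF s] restrict_family_closed by (intro A_I[of _ W _ H])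
qed

text \<open>A locally equivariant section through \<open>e\<close> in component \<open>i\<close>,
  with zero in the other components and off \<open>W\<close>. Such families represent the image of
  \<open>e\<close> in a sum.\<close>

lemma single_admissible:
  assumes i: "i \<in> I" and e: "e \<in> topspace (total (D i))"
  obtains s W where "s \<in> A (proj (D i) e)" "s (i, proj (D i) e) = e"
    "\<And>y. y \<in> W \<Longrightarrow> s \<in> A y" "local_section X (D i) W (\<lambda>x. s (i, x))" "proj (D i) e \<in> W"
    "\<And>j y. j \<in> I \<Longrightarrow> j \<noteq> i \<Longrightarrow> y \<in> W \<Longrightarrow> s (j, y) = szero (D j) y"
proof -
  obtain W t H where t: "local_section X (D i) W t" "proj (D i) e \<in> W" "t (proj (D i) e) = e"
    and H: "openin T H" "\<one> \<in> H" "\<And>h x. h \<in> H \<Longrightarrow> x \<in> W \<Longrightarrow> gact (D i) h (t x) = t (act h x)"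
    using equivariant_section_through[OF D[OF i] e] by metis
  have HG: "H \<subseteq> carrier G" using openin_subset[OF H(1)] topspace_eq by simp
  note W = local_sectionD[OF t(1)]
  define s where "s = (\<lambda>(j, x)\<in>I \<times> topspace X. if j = i \<and> x \<in> W then t x else szero (D j) x)"
  have sW: "s (i, x) = t x" if "x \<in> W" for x using that W(2) i by (auto simp: s_def)
  have s0: "s (j, x) = szero (D j) x" if "j \<in> I" "j \<noteq> i" "x \<in> topspace X" for j x using that by (auto simp: s_def)
  have s: "s \<in> carrier families" using W i by (auto simp: families_carrier s_def szero_closed[OF D])
  have "regular_on W H s"
    unfolding regular_on_def
  proof (intro ballI conjI impI)
    fix j assume j: "j \<in> I"
    show "local_section X (D j) W (\<lambda>x. s (j, x))"
    proof (cases "j = i")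
      case True
      then show ?thesis using local_section_cong[OF t(1)] sW by simp
    next
      case False
      show ?thesis
        using local_section_zero[OF D[OF j] W(1)] by (rule local_section_cong) (use s0 j False W(2) in auto)
    qed
    fix h x assume "h \<in> H" "x \<in> W" "act h x \<in> W"
    then show "gact (D j) h (s (j, x)) = s (j, act h x)"
      using H(3) HG W(2) s0 sW gact_szero[OF D[OF j]] j by (cases "j = i") (auto simp: subset_iff)
  qed
  moreover have "finite_support W s"
    unfolding finite_support_def by (rule finite_subset[of _ "{i}"]) (use s0 W(2) in auto)
  ultimately have A: "s \<in> A y" if "y \<in> W" for y using A_I[OF s W(1) that H(1,2)] by blast
  have sec: "local_section X (D i) W (\<lambda>x. s (i, x))" using local_section_cong[OF t(1)] sW by simp
  show thesis
    by (rule that[of s W]) (use A t(2,3) sW sec s0 W(2) in auto)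
qed

text \<open>On a neighbourhood of finite support only finitely many indices of \<open>S\<close> need
  attention; for each of them agreement with the zero section is open. Thus conditions on the values
  at one point spread to nearby points.\<close>

lemma vanishing_open:
  assumes s: "s \<in> A x" and zero: "\<And>i. i \<in> S \<Longrightarrow> i \<in> I \<and> s (i, x) = szero (D i) x"
  shows "\<exists>W. openin X W \<and> x \<in> W \<and> (\<forall>y \<in> W. s \<in> A y \<and> (\<forall>i \<in> S. s (i, y) = szero (D i) y))"
proof -
  obtain W where W: "openin X W" "x \<in> W" "\<And>y. y \<in> W \<Longrightarrow> s \<in> A y"
    "\<And>i. i \<in> I \<Longrightarrow> local_section X (D i) W (\<lambda>x. s (i, x))" "finite_support W s"
    using s by (rule A_neighbourhood) blast
  define F where "F = {i \<in> I. \<exists>x \<in> W. s (i, x) \<noteq> szero (D i) x} \<inter> S"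
  define Z where "Z i = {y \<in> W \<inter> W. s (i, y) = szero (D i) y}" for i
  define Y where "Y = W \<inter> (\<Inter>i \<in> F. Z i)"
  have "openin X (Z i)" if "i \<in> F" for i
    using openin_sections_agree[OF D W(4) local_section_zero[OF D W(1)]] that by (auto simp: F_def Z_def)
  moreover have "finite F" using W(5) by (simp add: F_def finite_support_def)
  ultimately have Y: "openin X Y"
    unfolding Y_def using W(1) by (cases "F = {}") (auto intro!: openin_Int openin_Inter)
  have x: "x \<in> Y" using W(2) zero by (auto simp: Y_def F_def Z_def)
  have z: "s (i, y) = szero (D i) y" if "y \<in> Y" "i \<in> S" for i y
    using that zero by (cases "i \<in> F") (auto simp: Y_def F_def Z_def)
  have "s \<in> A y" if "y \<in> Y" for y using W(3) that by (simp add: Y_def)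
  then show ?thesis using Y x z by blast
qed

lemma admissible_finite_support:
  assumes "s \<in> A x"
  shows "finite {i \<in> I. s (i, x) \<noteq> szero (D i) x}"
proof -
  obtain W where W: "x \<in> W" "finite_support W s" using assms by (rule A_neighbourhood)
  from W(2) show ?thesis unfolding finite_support_def by (rule rev_finite_subset) (use W(1) in auto)
qed

end

text \<open>By \<open>rel_zero\<close> the class of a family at \<open>x\<close> depends on its
  values at \<open>x\<close> alone, which is stronger than dependence on the germ and keeps the
  names finite. The relations are instantiated by a diagram for colimits and by a stable subset for
  quotients.\<close>

locale sheaf_sum_quotient = finite_sums G T X act R I D
  for G :: "('g, 'z) monoid_scheme" (structure) and T and X :: "'x topology" and act
    and R :: "('r, 'y) ring_scheme" and I :: "'i set" and D :: "'i \<Rightarrow> ('g, 'r, 'x, 'e) gsheaf" +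
  fixes B :: "'x \<Rightarrow> ('i \<times> 'x \<Rightarrow> 'e) set" and val :: "('i \<times> 'x \<Rightarrow> 'e) \<Rightarrow> 'x \<Rightarrow> 'e"
  assumes rel_A: "x \<in> topspace X \<Longrightarrow> s \<in> B x \<Longrightarrow> s \<in> A x"
    and rel_zero: "x \<in> topspace X \<Longrightarrow> s \<in> A x \<Longrightarrow> (\<And>i. i \<in> I \<Longrightarrow> s (i, x) = szero (D i) x) \<Longrightarrow> s \<in> B x"
    and rel_minus: "x \<in> topspace X \<Longrightarrow> s \<in> B x \<Longrightarrow> t \<in> B x \<Longrightarrow> s \<ominus>\<^bsub>families\<^esub> t \<in> B x"
    and rel_smult: "x \<in> topspace X \<Longrightarrow> r \<in> carrier R \<Longrightarrow> s \<in> B x \<Longrightarrow> r \<odot>\<^bsub>families\<^esub> s \<in> B x"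
    and rel_act: "x \<in> topspace X \<Longrightarrow> g \<in> carrier G \<Longrightarrow> s \<in> B x \<Longrightarrow> family_act g s \<in> B (act g x)"
    and rel_open: "openin X {x \<in> topspace X. s \<in> B x}"
    and sum_val_eq: "x \<in> topspace X \<Longrightarrow> y \<in> topspace X \<Longrightarrow> s \<in> A x \<Longrightarrow> t \<in> A y \<Longrightarrow>
      val s x = val t y \<longleftrightarrow> x = y \<and> s \<ominus>\<^bsub>families\<^esub> t \<in> B x"
begin

sublocale family_quotient G T X act R I D finite_support B val
proof
  show "s \<in> B x" if "x \<in> topspace X" "s \<in> A x" "null_germ x s" for x s
    using that by (intro rel_zero) (auto simp: null_germ_def)
qed (fact rel_A rel_minus rel_smult rel_act rel_open sum_val_eq)+

lemma val_cong:
  assumes x: "x \<in> topspace X" and s: "s \<in> A x" and t: "t \<in> A x" and eq: "\<And>i. i \<in> I \<Longrightarrow> s (i, x) = t (i, x)"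
  shows "val s x = val t x"
proof (rule val_eqI[OF x s t])
  show "s \<ominus>\<^bsub>families\<^esub> t \<in> B x"
    using x A_families[OF s] A_families[OF t]
    by (intro rel_zero A_minus' s t) (auto simp: families_simps eq sminus_self[OF D] families_closed)
qed

text \<open>The class of any family that has the value \<open>e\<close> in component
  \<open>i\<close> and zero in the others at the point below \<open>e\<close>; by
  \<open>val_cong\<close> all choices give the same class.\<close>

definition coproj :: "'i \<Rightarrow> 'e \<Rightarrow> 'e" where
  "coproj i = (\<lambda>e\<in>topspace (total (D i)). val (SOME s. s \<in> A (proj (D i) e) \<and> s (i, proj (D i) e) = e \<and>
     (\<forall>j \<in> I. j \<noteq> i \<longrightarrow> s (j, proj (D i) e) = szero (D j) (proj (D i) e))) (proj (D i) e))"

lemma coproj_val: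
  assumes i: "i \<in> I" and x: "x \<in> topspace X" and s: "s \<in> A x"
    and z: "\<And>j. j \<in> I \<Longrightarrow> j \<noteq> i \<Longrightarrow> s (j, x) = szero (D j) x"
  shows "coproj i (s (i, x)) = val s x"
proof -
  have e: "s (i, x) \<in> topspace (total (D i))" "proj (D i) (s (i, x)) = x"
    using families_closed[OF A_families[OF s] i x] by auto
  let ?P = "\<lambda>t. t \<in> A x \<and> t (i, x) = s (i, x) \<and> (\<forall>j \<in> I. j \<noteq> i \<longrightarrow> t (j, x) = szero (D j) x)"
  have P: "?P (SOME t. ?P t)" by (rule someI[of ?P s]) (use s z in simp)
  have "val (SOME t. ?P t) x = val s x"
  proof (rule val_cong[OF x _ s])
    fix j assume j: "j \<in> I"
    then show "(SOME t. ?P t) (j, x) = s (j, x)" using P z[OF j] by (cases "j = i") simp_all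
  qed (use P in simp)
  then show ?thesis using e by (simp add: coproj_def)
qed

lemma coproj_cases:
  assumes i: "i \<in> I" and e: "e \<in> topspace (total (D i))"
  obtains s W where "s \<in> A (proj (D i) e)" "s (i, proj (D i) e) = e"
    "\<And>y. y \<in> W \<Longrightarrow> s \<in> A y" "local_section X (D i) W (\<lambda>x. s (i, x))" "proj (D i) e \<in> W"
    "\<And>j y. j \<in> I \<Longrightarrow> j \<noteq> i \<Longrightarrow> y \<in> W \<Longrightarrow> s (j, y) = szero (D j) y"
    "\<And>y. y \<in> W \<Longrightarrow> coproj i (s (i, y)) = val s y"
proof -
  obtain s W where s: "s \<in> A (proj (D i) e)" "s (i, proj (D i) e) = e"
    "\<And>y. y \<in> W \<Longrightarrow> s \<in> A y" "local_section X (D i) W (\<lambda>x. s (i, x))" "proj (D i) e \<in> W"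
    "\<And>j y. j \<in> I \<Longrightarrow> j \<noteq> i \<Longrightarrow> y \<in> W \<Longrightarrow> s (j, y) = szero (D j) y"
    using single_admissible[OF i e] by blast
  then have "coproj i (s (i, y)) = val s y" if "y \<in> W" for y
    using coproj_val[OF i _ s(3)[OF that]] local_sectionD(2)[OF s(4)] that by blast
  with s show thesis using that by blast
qed

lemma coproj_map:
  assumes i: "i \<in> I"
  shows "coproj i \<in> sheaf_maps G X R (D i) quotient_sheaf"
proof (rule sheaf_mapsI[OF D[OF i] sheaf_quotient])
  show "coproj i \<in> extensional (topspace (total (D i)))" by (simp add: coproj_def)
  show "continuous_map (total (D i)) (total quotient_sheaf) (coproj i)"
  proof (rule continuous_map_from_total[OF D[OF i]])
    fix e assume "e \<in> topspace (total (D i))"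
    then obtain s W where s: "s \<in> A (proj (D i) e)" "s (i, proj (D i) e) = e"
    "\<And>y. y \<in> W \<Longrightarrow> s \<in> A y" "local_section X (D i) W (\<lambda>x. s (i, x))" "proj (D i) e \<in> W"
    "\<And>j y. j \<in> I \<Longrightarrow> j \<noteq> i \<Longrightarrow> y \<in> W \<Longrightarrow> s (j, y) = szero (D j) y"
    "\<And>y. y \<in> W \<Longrightarrow> coproj i (s (i, y)) = val s y" using coproj_cases[OF i] by blast
    have "continuous_map (subtopology X W) (total quotient_sheaf) (\<lambda>x. coproj i (s (i, x)))"
      using val_continuous[OF local_sectionD(1)[OF s(4)] s(3)] by (rule continuous_map_eq) (auto simp: s(7))
    then show "\<exists>W t. local_section X (D i) W t \<and> proj (D i) e \<in> W \<and> t (proj (D i) e) = e \<and>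
      continuous_map (subtopology X W) (total quotient_sheaf) (\<lambda>x. coproj i (t x))"
      using s by (intro exI[of _ W] exI[of _ "\<lambda>x. s (i, x)"]) simp
  qed
  fix a assume a: "a \<in> topspace (total (D i))"
  let ?x = "proj (D i) a"
  have x: "?x \<in> topspace X" using proj_closed[OF D[OF i] a] .
  obtain s W where s: "s \<in> A ?x" "s (i, ?x) = a" "?x \<in> W"
    "\<And>j y. j \<in> I \<Longrightarrow> j \<noteq> i \<Longrightarrow> y \<in> W \<Longrightarrow> s (j, y) = szero (D j) y"
    "\<And>y. y \<in> W \<Longrightarrow> coproj i (s (i, y)) = val s y" using coproj_cases[OF i a] by metis
  have ca: "coproj i a = val s ?x" using s(2,3,5) by metis
  show "proj quotient_sheaf (coproj i a) = ?x" using ca s(1) x by (simp add: proj_quotient)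
  show "coproj i (gact (D i) g a) = gact quotient_sheaf g (coproj i a)" if g: "g \<in> carrier G" for g
    using coproj_val[OF i act_closed[OF g x] A_act'[OF g s(1)]] s x g ca i
    by (simp add: gact_quotient families_simps gact_szero[OF D])
  show "coproj i (ssmult (D i) r a) = ssmult quotient_sheaf r (coproj i a)" if r: "r \<in> carrier R" for r
    using coproj_val[OF i x A_smult'[OF r s(1)]] s x r ca i
    by (simp add: ssmult_quotient families_simps ssmult_zero[OF D])
  fix b assume b: "b \<in> topspace (total (D i))" and ab: "?x = proj (D i) b"
  obtain t V where t: "t \<in> A ?x" "t (i, ?x) = b" "?x \<in> V"
    "\<And>j y. j \<in> I \<Longrightarrow> j \<noteq> i \<Longrightarrow> y \<in> V \<Longrightarrow> t (j, y) = szero (D j) y"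
    "\<And>y. y \<in> V \<Longrightarrow> coproj i (t (i, y)) = val t y" using coproj_cases[OF i b] unfolding ab by metis
  have cb: "coproj i b = val t ?x" using t(2,3,5) by metis
  show "coproj i (sadd (D i) a b) = sadd quotient_sheaf (coproj i a) (coproj i b)"
    using coproj_val[OF i x A_add[OF x s(1) t(1)]] s t x ca cb i
    by (simp add: sadd_quotient families_simps sadd_zero[OF D] szero_closed[OF D])
qed

text \<open>Subtracting the zero family changes nothing, so the criterion for equal names becomes
  membership of the representative itself in \<open>B\<close>. From this the kernel of a quotient
  map is read off.\<close>

lemma coproj_eq_zero_iff:
  assumes i: "i \<in> I" and e: "e \<in> topspace (total (D i))"
    and s: "s \<in> A (proj (D i) e)" "s (i, proj (D i) e) = e"
      "\<And>j. j \<in> I \<Longrightarrow> j \<noteq> i \<Longrightarrow> s (j, proj (D i) e) = szero (D j) (proj (D i) e)"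
  shows "coproj i e = szero quotient_sheaf (proj (D i) e) \<longleftrightarrow> s \<in> B (proj (D i) e)"
proof -
  let ?x = "proj (D i) e"
  have x: "?x \<in> topspace X" using proj_closed[OF D[OF i] e] .
  have "coproj i e = val s ?x" using coproj_val[OF i x s(1,3)] s(2) by simp
  moreover have "s \<ominus>\<^bsub>families\<^esub> \<zero>\<^bsub>families\<^esub> = s"
  proof (rule families_eqI)
    show "s \<ominus>\<^bsub>families\<^esub> \<zero>\<^bsub>families\<^esub> \<in> carrier families" "s \<in> carrier families"
      using A_families[OF A_minus'[OF s(1) A_zero'[OF x]]] A_families[OF s(1)] by auto
    show "(s \<ominus>\<^bsub>families\<^esub> \<zero>\<^bsub>families\<^esub>) (j, y) = s (j, y)" if "j \<in> I" "y \<in> topspace X" for j y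
      using that A_families[OF s(1)] A_families[OF A_zero'[OF x]] families_closed[OF A_families[OF s(1)] that]
        sminus_zero_right[OF D[OF that(1)], of "s (j, y)"]
      by (simp add: families_simps)
  qed
  ultimately show ?thesis
    using val_eq[OF x x s(1) A_zero'[OF x]] x by (simp add: szero_quotient)
qed

text \<open>Classes depend on values at a point only. If \<open>g\<close> fixes the point and every
  element of the stalks above it, the translated family has the same values there. This keeps
  colimits of Weyl sheaves inside the Weyl sheaves.\<close>

lemma gact_quotient_fixed:
  assumes g: "g \<in> carrier G" and e: "e \<in> topspace (total quotient_sheaf)"
    and fix_x: "act g (proj quotient_sheaf e) = proj quotient_sheaf e"
    and fixed: "\<And>i a. i \<in> I \<Longrightarrow> a \<in> topspace (total (D i)) \<Longrightarrow> proj (D i) a = proj quotient_sheaf e \<Longrightarrow>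
      gact (D i) g a = a"
  shows "gact quotient_sheaf g e = e"
proof -
  obtain s x where x: "x \<in> topspace X" and s: "s \<in> A x" and es: "e = val s x" using e by (auto elim!: germsE)
  have gx: "act g x = x" using fix_x x s es by (simp add: proj_quotient)
  then have "act (inv g) x = x" using act_inv(2)[OF g x] by simp
  then have "val (family_act g s) x = val s x"
    using A_act'[OF g s] fixed families_closed[OF A_families[OF s] _ x] x s es
    by (intro val_cong[OF x]) (auto simp: gx families_simps proj_quotient)
  then show ?thesis using g x s es by (simp add: gact_quotient gx)
qed

text \<open>Every class is a finite sum of classes supported in one component. The induction removes
  one index of the support at \<open>x\<close> at a time; indices outside \<open>I\<close>
  contribute the zero class.\<close>

lemma sheaf_maps_agree_on_coproj:
  assumes M: "sheaf M" and h: "h \<in> sheaf_maps G X R quotient_sheaf M"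
    and h': "h' \<in> sheaf_maps G X R quotient_sheaf M"
    and eq: "\<And>i e. i \<in> I \<Longrightarrow> e \<in> topspace (total (D i)) \<Longrightarrow> h (coproj i e) = h' (coproj i e)"
  shows "h = h'"
proof (rule extensionalityI[of _ germs])
  note Q = sheaf_quotient
  fix e assume "e \<in> germs"
  then obtain s x where x: "x \<in> topspace X" and s: "s \<in> A x" and e: "e = val s x" by (rule germsE)
  have "h (val s x) = h' (val s x)"
    if "finite F" "s \<in> A x" "\<And>i. i \<in> I - F \<Longrightarrow> s (i, x) = szero (D i) x" for F s
    using that
  proof (induction F arbitrary: s rule: finite_induct)
    case empty
    then have "val s x = szero quotient_sheaf x"
      using val_cong[OF x empty(1) A_zero'[OF x]] x by (simp add: szero_quotient families_simps)
    then show ?case using x sheaf_map_szero[OF Q M h x] sheaf_map_szero[OF Q M h' x] by simp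
  next
    case (insert i F)
    note s = insert.prems(1)
    have p: "restrict_family {i} s \<in> A x" "restrict_family (- {i}) s \<in> A x" using restrict_family_admissible[OF s] by auto
    have split: "val s x = sadd quotient_sheaf (val (restrict_family {i} s) x) (val (restrict_family (- {i}) s) x)"
      unfolding sadd_quotient[OF x p]
      using A_families[OF s] x
      by (intro val_cong[OF x s A_add[OF x p]])
        (auto simp: families_simps sadd_zero[OF D] families_closed)
    have 2: "h (val (restrict_family (- {i}) s) x) = h' (val (restrict_family (- {i}) s) x)"
      by (rule insert.IH[OF p(2)]) (use insert.prems(2) x in auto)
    have 1: "h (val (restrict_family {i} s) x) = h' (val (restrict_family {i} s) x)"
    proof (cases "i \<in> I")
      case True
      then have "coproj i (restrict_family {i} s (i, x)) = val (restrict_family {i} s) x"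
        using x by (intro coproj_val p(1)) auto
      then show ?thesis
        using eq[OF True, of "restrict_family {i} s (i, x)"] families_closed[OF A_families[OF p(1)] True x] by simp
    next
      case False
      then have "restrict_family {i} s (j, x) = \<zero>\<^bsub>families\<^esub> (j, x)" if "j \<in> I" for j
        using that x by (auto simp: families_simps)
      then have "val (restrict_family {i} s) x = szero quotient_sheaf x"
        using val_cong[OF x p(1) A_zero'[OF x]] x by (simp add: szero_quotient)
      then show ?thesis using x sheaf_map_szero[OF Q M h x] sheaf_map_szero[OF Q M h' x] by simp
    qed
    show ?case
      using 1 2 p x unfolding split
      by (simp add: sheaf_map_sadd[OF Q M h] sheaf_map_sadd[OF Q M h'] proj_quotient)
  qed
  moreover have "finite {i \<in> I. s (i, x) \<noteq> szero (D i) x}" using admissible_finite_support[OF s] .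
  ultimately show "h e = h' e" unfolding e using s by blast
qed (use sheaf_map_ext[OF sheaf_quotient M] h h' in auto)

section \<open>The universal property of quotients of sums\<close>

context
  fixes M :: "('g, 'r, 'x, 'e) gsheaf" and \<mu> :: "'i \<Rightarrow> 'e \<Rightarrow> 'e"
  assumes M: "sheaf M" and \<mu>: "\<And>i. i \<in> I \<Longrightarrow> \<mu> i \<in> sheaf_maps G X R (D i) M"
begin

text \<open>For a fixed finite \<open>F\<close> this is linear in \<open>s\<close> and continuous in
  \<open>x\<close>; \<open>total_sum\<close> is the canonical value, taken over the support at
  \<open>x\<close>. Passing between the two by \<open>total_sum_eq\<close> gives
  \<open>total_sum\<close> both properties.\<close>

definition partial_sum :: "'i set \<Rightarrow> ('i \<times> 'x \<Rightarrow> 'e) \<Rightarrow> 'x \<Rightarrow> 'e" where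
  "partial_sum F s x = finsum (stalk M x) (\<lambda>i. \<mu> i (s (i, x))) F"

definition total_sum :: "('i \<times> 'x \<Rightarrow> 'e) \<Rightarrow> 'x \<Rightarrow> 'e" where
  "total_sum s x = partial_sum {i \<in> I. s (i, x) \<noteq> szero (D i) x} s x"

lemmas \<mu>_simps = sheaf_map_closed[OF D M \<mu>] sheaf_map_proj[OF D M \<mu>]
  sheaf_map_gact[OF D M \<mu>] sheaf_map_sadd[OF D M \<mu>]
  sheaf_map_ssmult[OF D M \<mu>] sheaf_map_szero[OF D M \<mu>]

lemma \<mu>_stalk:
  "s \<in> carrier families \<Longrightarrow> x \<in> topspace X \<Longrightarrow> F \<subseteq> I \<Longrightarrow> (\<lambda>i. \<mu> i (s (i, x))) \<in> F \<rightarrow> carrier (stalk M x)"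
  by (auto simp: \<mu>_simps families_closed subset_iff)

lemma partial_sum_closed:
  assumes "s \<in> carrier families" "x \<in> topspace X" "F \<subseteq> I"
  shows "partial_sum F s x \<in> topspace (total M)" "proj M (partial_sum F s x) = x"
proof -
  interpret abelian_group "stalk M x" using stalk_abelian_group[OF M assms(2)] .
  show "partial_sum F s x \<in> topspace (total M)" "proj M (partial_sum F s x) = x"
    using finsum_closed[OF \<mu>_stalk[OF assms]] by (auto simp: partial_sum_def)
qed

lemma partial_sum_linear:
  assumes x: "x \<in> topspace X" and F: "F \<subseteq> I" "finite F"
  shows "R_linear R families (stalk M x) (\<lambda>s. partial_sum F s x)"
  unfolding R_linear_def
proof (intro conjI funcsetI ballI)
  interpret left_module R "stalk M x" using stalk_left_module[OF M x] .
  interpret fam: left_module R families by (rule left_module_families)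
  show "partial_sum F s x \<in> carrier (stalk M x)" if "s \<in> carrier families" for s
    using partial_sum_closed[OF that x F(1)] by simp
  show "partial_sum F (s \<oplus>\<^bsub>families\<^esub> t) x = partial_sum F s x \<oplus>\<^bsub>stalk M x\<^esub> partial_sum F t x"
    if s: "s \<in> carrier families" and t: "t \<in> carrier families" for s t
  proof -
    have "partial_sum F (s \<oplus>\<^bsub>families\<^esub> t) x = (\<Oplus>\<^bsub>stalk M x\<^esub>i\<in>F. \<mu> i (s (i, x)) \<oplus>\<^bsub>stalk M x\<^esub> \<mu> i (t (i, x)))"
      unfolding partial_sum_def
    proof (rule M.finsum_cong')
      show "\<mu> i ((s \<oplus>\<^bsub>families\<^esub> t) (i, x)) = \<mu> i (s (i, x)) \<oplus>\<^bsub>stalk M x\<^esub> \<mu> i (t (i, x))" if "i \<in> F" for i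
        using that s t x F by (auto simp: families_simps families_closed \<mu>_simps subset_iff)
    qed (use \<mu>_stalk[OF s x F(1)] \<mu>_stalk[OF t x F(1)] in \<open>auto intro!: M.a_closed simp del: stalk_simps\<close>)
    also have "\<dots> = partial_sum F s x \<oplus>\<^bsub>stalk M x\<^esub> partial_sum F t x"
      unfolding partial_sum_def using \<mu>_stalk[OF s x F(1)] \<mu>_stalk[OF t x F(1)] by (rule M.finsum_addf)
    finally show ?thesis .
  qed
  show "partial_sum F (r \<odot>\<^bsub>families\<^esub> s) x = r \<odot>\<^bsub>stalk M x\<^esub> partial_sum F s x"
    if r: "r \<in> carrier R" and s: "s \<in> carrier families" for r s
  proof -
    have "r \<odot>\<^bsub>stalk M x\<^esub> partial_sum F s x = (\<Oplus>\<^bsub>stalk M x\<^esub>i\<in>F. r \<odot>\<^bsub>stalk M x\<^esub> \<mu> i (s (i, x)))"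
      unfolding partial_sum_def
      by (rule finsum_additive[OF M.abelian_monoid_axioms M.abelian_monoid_axioms F(2) \<mu>_stalk[OF s x F(1)]])
        (use r in \<open>auto intro: smult_closed smult_r_null smult_r_distr simp del: stalk_simps\<close>)
    also have "\<dots> = partial_sum F (r \<odot>\<^bsub>families\<^esub> s) x"
      unfolding partial_sum_def
    proof (rule M.finsum_cong')
      show "r \<odot>\<^bsub>stalk M x\<^esub> \<mu> i (s (i, x)) = \<mu> i ((r \<odot>\<^bsub>families\<^esub> s) (i, x))" if "i \<in> F" for i
        using that s r x F by (auto simp: families_simps families_closed \<mu>_simps subset_iff)
    qed (use \<mu>_stalk[OF fam.smult_closed[OF r s] x F(1)] in auto)
    finally show ?thesis by simp
  qed
qed

lemma partial_sum_act:
  assumes g: "g \<in> carrier G" and s: "s \<in> carrier families" and x: "x \<in> topspace X" and F: "F \<subseteq> I" "finite F"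
  shows "partial_sum F (family_act g s) (act g x) = gact M g (partial_sum F s x)"
proof -
  have gx: "act g x \<in> topspace X" using g x by simp
  have ab: "abelian_group (stalk M x)" "abelian_group (stalk M (act g x))"
    using stalk_abelian_group[OF M] x gx by auto
  interpret N: abelian_group "stalk M (act g x)" by fact
  have "gact M g (partial_sum F s x) = (\<Oplus>\<^bsub>stalk M (act g x)\<^esub>i\<in>F. gact M g (\<mu> i (s (i, x))))"
    unfolding partial_sum_def
  proof (rule finsum_additive[OF _ _ F(2) \<mu>_stalk[OF s x F(1)]])
  qed (use ab g x gact_linear[OF M g x] R_linear_zero[OF ab gact_linear[OF M g x]] in
      \<open>auto simp: R_linear_def abelian_group_def simp del: stalk_simps\<close>)
  also have "\<dots> = partial_sum F (family_act g s) (act g x)"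
    unfolding partial_sum_def
  proof (rule N.finsum_cong')
    show "gact M g (\<mu> i (s (i, x))) = \<mu> i (family_act g s (i, act g x))" if "i \<in> F" for i
      using that s g x F by (auto simp: families_simps families_closed \<mu>_simps subset_iff)
  qed (use \<mu>_stalk[OF family_act_closed[OF g s] gx F(1)] in auto)
  finally show ?thesis by simp
qed

lemma partial_sum_section:
  assumes F: "finite F" "F \<subseteq> I" and W: "openin X W" and s: "s \<in> carrier families"
    and sec: "\<And>i. i \<in> I \<Longrightarrow> local_section X (D i) W (\<lambda>x. s (i, x))"
  shows "local_section X M W (partial_sum F s)"
  using F
proof (induction F rule: finite_induct)
  case empty
  have "partial_sum {} s x = szero M x" if "x \<in> W" for x
    using that abelian_monoid.finsum_empty[of "stalk M x"] stalk_abelian_group[OF M, of x] openin_subset[OF W]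
    by (auto simp: partial_sum_def abelian_group_def)
  then show ?case using local_section_cong[OF local_section_zero[OF M W]] by simp
next
  case (insert i F)
  have "partial_sum (insert i F) s x = sadd M (\<mu> i (s (i, x))) (partial_sum F s x)" if "x \<in> W" for x
  proof -
    have x: "x \<in> topspace X" using that openin_subset[OF W] by blast
    interpret abelian_group "stalk M x" using stalk_abelian_group[OF M x] .
    show ?thesis using insert \<mu>_stalk[OF s x, of F] \<mu>_stalk[OF s x, of "insert i F"]
      by (simp add: partial_sum_def finsum_insert Pi_iff)
  qed
  moreover have "local_section X M W (\<lambda>x. sadd M (\<mu> i (s (i, x))) (partial_sum F s x))"
    using insert sheaf_map_section[OF D M \<mu> sec] by (intro local_section_add[OF M]) auto
  ultimately show ?case using local_section_cong by force
qed

lemma total_sum_eq: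
  assumes s: "s \<in> carrier families" and x: "x \<in> topspace X" and F: "finite F" "F \<subseteq> I"
    and z: "\<And>i. i \<in> I \<Longrightarrow> i \<notin> F \<Longrightarrow> s (i, x) = szero (D i) x"
  shows "total_sum s x = partial_sum F s x"
proof -
  interpret abelian_group "stalk M x" using stalk_abelian_group[OF M x] .
  show ?thesis
    unfolding total_sum_def partial_sum_def
    using \<mu>_stalk[OF s x F(2)] F z x
    by (intro add.finprod_mono_neutral_cong_left[folded finsum_def]) (auto simp: \<mu>_simps)
qed

text \<open>The union of the supports is one finite index set for both families, which reduces
  additivity to that of \<open>partial_sum\<close>.\<close>

lemma total_sum_two:
  assumes s: "s \<in> A x" and t: "t \<in> A x" and x: "x \<in> topspace X"
  obtains F where "finite F" "F \<subseteq> I" "total_sum s x = partial_sum F s x" "total_sum t x = partial_sum F t x"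
    "\<And>i. i \<in> I \<Longrightarrow> i \<notin> F \<Longrightarrow> s (i, x) = szero (D i) x \<and> t (i, x) = szero (D i) x"
proof -
  let ?F = "{i \<in> I. s (i, x) \<noteq> szero (D i) x} \<union> {i \<in> I. t (i, x) \<noteq> szero (D i) x}"
  have F: "finite ?F" "?F \<subseteq> I" using admissible_finite_support s t by auto
  then have "total_sum s x = partial_sum ?F s x" "total_sum t x = partial_sum ?F t x"
    using A_families s t x by (auto intro!: total_sum_eq)
  then show thesis using F that[of ?F] by blast
qed

lemma total_sum_add:
  assumes s: "s \<in> A x" and t: "t \<in> A x" and x: "x \<in> topspace X"
  shows "total_sum (s \<oplus>\<^bsub>families\<^esub> t) x = sadd M (total_sum s x) (total_sum t x)"
proof -
  obtain F where F: "finite F" "F \<subseteq> I" "total_sum s x = partial_sum F s x" "total_sum t x = partial_sum F t x"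
    "\<And>i. i \<in> I \<Longrightarrow> i \<notin> F \<Longrightarrow> s (i, x) = szero (D i) x \<and> t (i, x) = szero (D i) x"
    using s t x by (rule total_sum_two) blast
  have "total_sum (s \<oplus>\<^bsub>families\<^esub> t) x = partial_sum F (s \<oplus>\<^bsub>families\<^esub> t) x"
    using F(5) x by (intro total_sum_eq A_families[OF A_add[OF x s t]] F)
      (auto simp: families_simps sadd_zero[OF D] szero_closed[OF D])
  then show ?thesis
    using partial_sum_linear[OF x F(2,1)] A_families[OF s] A_families[OF t] F(3,4) by (simp add: R_linear_def)
qed

lemma total_sum_minus:
  assumes s: "s \<in> A x" and t: "t \<in> A x" and x: "x \<in> topspace X"
  shows "total_sum (s \<ominus>\<^bsub>families\<^esub> t) x = sminus M (total_sum s x) (total_sum t x)"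
proof -
  obtain F where F: "finite F" "F \<subseteq> I" "total_sum s x = partial_sum F s x" "total_sum t x = partial_sum F t x"
    "\<And>i. i \<in> I \<Longrightarrow> i \<notin> F \<Longrightarrow> s (i, x) = szero (D i) x \<and> t (i, x) = szero (D i) x"
    using s t x by (rule total_sum_two) blast
  have "total_sum (s \<ominus>\<^bsub>families\<^esub> t) x = partial_sum F (s \<ominus>\<^bsub>families\<^esub> t) x"
    using F(5) x A_families[OF s] A_families[OF t] by (intro total_sum_eq A_families[OF A_minus'[OF s t]] F)
      (auto simp: families_simps sminus_self[OF D] szero_closed[OF D])
  also have "\<dots> = partial_sum F s x \<ominus>\<^bsub>stalk M x\<^esub> partial_sum F t x"
    using R_linear_minus[OF _ stalk_abelian_group[OF M x] partial_sum_linear[OF x F(2,1)]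
        A_families[OF s] A_families[OF t]] left_module_families by (simp add: left_module_def)
  finally show ?thesis using F(3,4) partial_sum_closed[OF A_families[OF s] x F(2)] sminus_stalk[OF M] by simp
qed

lemma total_sum_smult:
  assumes s: "s \<in> A x" and r: "r \<in> carrier R" and x: "x \<in> topspace X"
  shows "total_sum (r \<odot>\<^bsub>families\<^esub> s) x = ssmult M r (total_sum s x)"
proof -
  obtain F where F: "finite F" "F \<subseteq> I" "total_sum s x = partial_sum F s x"
    "\<And>i. i \<in> I \<Longrightarrow> i \<notin> F \<Longrightarrow> s (i, x) = szero (D i) x"
    using total_sum_two[OF s s x] by metis
  have "total_sum (r \<odot>\<^bsub>families\<^esub> s) x = partial_sum F (r \<odot>\<^bsub>families\<^esub> s) x"
    using F(4) x r by (intro total_sum_eq A_families[OF A_smult'[OF r s]] F)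
      (auto simp: families_simps ssmult_zero[OF D])
  then show ?thesis
    using partial_sum_linear[OF x F(2,1)] A_families[OF s] r F(3) by (simp add: R_linear_def)
qed

lemma total_sum_act:
  assumes s: "s \<in> A x" and g: "g \<in> carrier G" and x: "x \<in> topspace X"
  shows "total_sum (family_act g s) (act g x) = gact M g (total_sum s x)"
proof -
  obtain F where F: "finite F" "F \<subseteq> I" "total_sum s x = partial_sum F s x"
    "\<And>i. i \<in> I \<Longrightarrow> i \<notin> F \<Longrightarrow> s (i, x) = szero (D i) x"
    using total_sum_two[OF s s x] by metis
  have "total_sum (family_act g s) (act g x) = partial_sum F (family_act g s) (act g x)"
    using F(4) x g by (intro total_sum_eq A_families[OF A_act'[OF g s]] F)
      (auto simp: families_simps gact_szero[OF D])
  then show ?thesis using partial_sum_act[OF g A_families[OF s] x F(2,1)] F(3) by simp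
qed

lemma total_sum_closed:
  assumes "s \<in> A x" "x \<in> topspace X"
  shows "total_sum s x \<in> topspace (total M)" "proj M (total_sum s x) = x"
  using partial_sum_closed[OF A_families[OF assms(1)] assms(2)] by (auto simp: total_sum_def)

lemma total_sum_single:
  assumes i: "i \<in> I" and x: "x \<in> topspace X" and s: "s \<in> A x"
    and z: "\<And>j. j \<in> I \<Longrightarrow> j \<noteq> i \<Longrightarrow> s (j, x) = szero (D j) x"
  shows "total_sum s x = \<mu> i (s (i, x))"
proof -
  interpret abelian_group "stalk M x" using stalk_abelian_group[OF M x] .
  have "total_sum s x = partial_sum {i} s x"
    using i z by (intro total_sum_eq A_families[OF s] x) auto
  then show ?thesis
    using \<mu>_stalk[OF A_families[OF s] x, of "{i}"] i
      finsum_insert[of "{}" i "\<lambda>i. \<mu> i (s (i, x))"] r_zero[of "\<mu> i (s (i, x))"]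
    by (simp add: partial_sum_def finsum_empty)
qed

lemma total_sum_zero:
  assumes x: "x \<in> topspace X" and s: "s \<in> A x" and z: "\<And>i. i \<in> I \<Longrightarrow> s (i, x) = szero (D i) x"
  shows "total_sum s x = szero M x"
proof -
  interpret abelian_group "stalk M x" using stalk_abelian_group[OF M x] .
  have "total_sum s x = partial_sum {} s x"
    using z by (intro total_sum_eq A_families[OF s] x) auto
  then show ?thesis by (simp add: partial_sum_def finsum_empty)
qed

text \<open>The map is \<open>total_sum\<close> on representatives; \<open>kill\<close> makes it
  independent of the representative, and uniqueness holds because the classes from single components
  generate.\<close>

theorem sum_quotient_universal:
  assumes kill: "\<And>x s. x \<in> topspace X \<Longrightarrow> s \<in> B x \<Longrightarrow> total_sum s x = szero M x"
  shows "\<exists>!h. h \<in> sheaf_maps G X R quotient_sheaf M \<and>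
     (\<forall>i \<in> I. \<forall>e \<in> topspace (total (D i)). h (coproj i e) = \<mu> i e)"
proof -
  let ?h = "\<lambda>e\<in>germs. total_sum (fst (rep e)) (snd (rep e))"
  have hv: "?h (val s x) = total_sum s x" if x: "x \<in> topspace X" and s: "s \<in> A x" for s x
  proof -
    note r = rep_val[OF x s]
    have "sminus M (total_sum (fst (rep (val s x))) x) (total_sum s x) = szero M x"
      using total_sum_minus[OF r(2) s x] kill[OF x r(3)] by simp
    then have "total_sum (fst (rep (val s x))) x = total_sum s x"
      using sminus_eq_zero_iff[OF M] total_sum_closed[OF r(2) x] total_sum_closed[OF s x] by metis
    then show ?thesis using x s r by simp
  qed
  have h: "?h \<in> sheaf_maps G X R quotient_sheaf M"
  proof (rule sheaf_mapsI[OF sheaf_quotient M])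
    show "?h \<in> extensional (topspace (total quotient_sheaf))" unfolding topspace_quotient by simp
    show "continuous_map (total quotient_sheaf) (total M) ?h"
    proof (rule continuous_map_from_total[OF sheaf_quotient])
      fix e assume "e \<in> topspace (total quotient_sheaf)"
      then obtain s x where x: "x \<in> topspace X" "s \<in> A x" "e = val s x" by (auto elim!: germsE)
      obtain W where W: "openin X W" "x \<in> W" "\<And>y. y \<in> W \<Longrightarrow> s \<in> A y"
        "\<And>i. i \<in> I \<Longrightarrow> local_section X (D i) W (\<lambda>x. s (i, x))" "finite_support W s"
        using x(2) by (rule A_neighbourhood) blast
      \<comment> \<open>The support on all of \<open>W\<close>, not at a single point: near the
        given point the map is one fixed finite sum of sections.\<close>
      let ?F = "{i \<in> I. \<exists>x \<in> W. s (i, x) \<noteq> szero (D i) x}"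
      have F: "finite ?F" "?F \<subseteq> I" using W(5) by (auto simp: finite_support_def)
      have "?h (val s y) = partial_sum ?F s y" if "y \<in> W" for y
      proof -
        have "y \<in> topspace X" using that openin_subset[OF W(1)] by blast
        then show ?thesis
          unfolding hv[OF \<open>y \<in> topspace X\<close> W(3)[OF that]] using that
          by (intro total_sum_eq A_families[OF x(2)] F) auto
      qed
      moreover have "local_section X M W (partial_sum ?F s)"
        by (rule partial_sum_section[OF F W(1) A_families[OF x(2)]]) (rule W(4))
      ultimately have "local_section X M W (\<lambda>y. ?h (val s y))"
        by (metis (no_types, lifting) local_section_cong)
      then have "continuous_map (subtopology X W) (total M) (\<lambda>y. ?h (val s y))"
        by (rule local_sectionD(3))
      then show "\<exists>W t. local_section X quotient_sheaf W t \<and> proj quotient_sheaf e \<in> W \<and>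
        t (proj quotient_sheaf e) = e \<and> continuous_map (subtopology X W) (total M) (\<lambda>y. ?h (t y))"
        using W x val_local_section[OF W(1,3)] by (intro exI[of _ W] exI[of _ "val s"]) (simp add: proj_quotient)
    qed
  qed (auto simp: hv proj_quotient gact_quotient sadd_quotient ssmult_quotient total_sum_closed total_sum_act
      total_sum_add total_sum_smult A_act' A_add A_smult' simp del: restrict_apply elim!: germsE)
  have hc: "?h (coproj i e) = \<mu> i e" if i: "i \<in> I" and e: "e \<in> topspace (total (D i))" for i e
  proof -
    obtain s W where s: "s \<in> A (proj (D i) e)" "s (i, proj (D i) e) = e" "proj (D i) e \<in> W"
      "\<And>j y. j \<in> I \<Longrightarrow> j \<noteq> i \<Longrightarrow> y \<in> W \<Longrightarrow> s (j, y) = szero (D j) y"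
      "\<And>y. y \<in> W \<Longrightarrow> coproj i (s (i, y)) = val s y" using coproj_cases[OF i e] by metis
    have "coproj i e = val s (proj (D i) e)" using s(2,3,5) by metis
    then have "?h (coproj i e) = total_sum s (proj (D i) e)"
      using hv[OF proj_closed[OF D[OF i] e] s(1)] by simp
    then show ?thesis
      using total_sum_single[OF i proj_closed[OF D[OF i] e] s(1)] s(2-4) by simp
  qed
  show ?thesis
  proof (rule ex1I[of _ ?h])
    show "?h \<in> sheaf_maps G X R quotient_sheaf M \<and>
      (\<forall>i \<in> I. \<forall>e \<in> topspace (total (D i)). ?h (coproj i e) = \<mu> i e)" using h hc by blast
    show "h' = ?h" if "h' \<in> sheaf_maps G X R quotient_sheaf M \<and>
      (\<forall>i \<in> I. \<forall>e \<in> topspace (total (D i)). h' (coproj i e) = \<mu> i e)" for h'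
      using that hc by (intro sheaf_maps_agree_on_coproj[OF M _ h]) auto
  qed
qed

end

end

section \<open>Cardinality of the set of germs\<close>

lemma infinite_times_lepoll:
  assumes "infinite U" "A \<lesssim> U" "B \<lesssim> U"
  shows "A \<times> B \<lesssim> U"
proof -
  have "U \<times> U \<approx> U"
    using card_of_Times_same_infinite[OF assms(1)] by (simp add: eqpoll_iff_card_of_ordIso)
  then show ?thesis
    by (rule lepoll_trans2[OF times_lepoll_mono[OF assms(2,3)]])
qed

text \<open>Finite sets are underlying sets of lists. A list is folded into one element of
  \<open>U\<close> by a pairing function, and its length is recorded through a copy of the natural
  numbers in \<open>U\<close>, because the folding is injective only among lists of equal
  length.\<close>

lemma infinite_Fpow_lepoll:
  fixes U :: "'u set"
  assumes U: "infinite U" and A: "A \<lesssim> U"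
  shows "Fpow A \<lesssim> U"
proof -
  obtain f where f: "inj_on f (U \<times> U)" "f ` (U \<times> U) \<subseteq> U"
    using infinite_times_lepoll[OF U lepoll_refl lepoll_refl] unfolding lepoll_def by blast
  obtain a where a: "a \<in> U" using U by fastforce
  obtain k :: "nat \<Rightarrow> 'u" where k: "inj k" "range k \<subseteq> U" using infinite_countable_subset[OF U] by blast
  define enc where "enc = rec_list a (\<lambda>x _ e. f (x, e))"
  have enc: "enc [] = a" "enc (x # xs) = f (x, enc xs)" for x xs by (simp_all add: enc_def)
  have cl: "xs \<in> lists U \<Longrightarrow> enc xs \<in> U" for xs
    using f(2) a by (induction xs) (auto simp: enc)
  have inj: "xs \<in> lists U \<Longrightarrow> ys \<in> lists U \<Longrightarrow> length xs = length ys \<Longrightarrow> enc xs = enc ys \<Longrightarrow> xs = ys" for xs ys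
  proof (induction xs arbitrary: ys)
    case (Cons x xs)
    then obtain y zs where ys: "ys = y # zs" by (cases ys) auto
    have "(x, enc xs) = (y, enc zs)"
      using Cons.prems ys f(1) cl by (intro inj_onD[OF f(1)]) (auto simp: enc)
    then show ?case using Cons ys by auto
  qed simp
  have "inj_on (\<lambda>xs. f (k (length xs), enc xs)) (lists U)"
  proof (rule inj_onI)
    fix xs ys assume xs: "xs \<in> lists U" "ys \<in> lists U" "f (k (length xs), enc xs) = f (k (length ys), enc ys)"
    then have "(k (length xs), enc xs) = (k (length ys), enc ys)"
      using cl k(2) by (intro inj_onD[OF f(1)]) auto
    then have "length xs = length ys" "enc xs = enc ys" using k(1) by (auto dest: injD)
    then show "xs = ys" using inj xs by blast
  qed
  moreover have "(\<lambda>xs. f (k (length xs), enc xs)) ` lists U \<subseteq> U"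
  proof (rule image_subsetI)
    fix xs assume "xs \<in> lists U"
    then have "(k (length xs), enc xs) \<in> U \<times> U" using cl k(2) by blast
    then show "f (k (length xs), enc xs) \<in> U" using f(2) by blast
  qed
  ultimately have lists: "lists U \<lesssim> U" unfolding lepoll_def by blast
  have "Fpow U \<subseteq> set ` lists U"
  proof
    fix F assume "F \<in> Fpow U"
    then have F: "F \<subseteq> U" "finite F" by (auto simp: Fpow_def)
    from finite_list[OF F(2)] obtain xs where "set xs = F" by blast
    with F(1) show "F \<in> set ` lists U" by auto
  qed
  then have FU: "Fpow U \<lesssim> U" using lepoll_trans[OF subset_image_lepoll lists] by blast
  obtain g where g: "inj_on g A" "g ` A \<subseteq> U" using A unfolding lepoll_def by blast
  have "inj_on ((`) g) (Fpow A)"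
    using g(1) by (auto simp: inj_on_def Fpow_def inj_on_image_eq_iff)
  moreover have "(`) g ` Fpow A \<subseteq> Fpow U" using g(2) by (auto simp: Fpow_def)
  ultimately have "Fpow A \<lesssim> Fpow U" unfolding lepoll_def by blast
  then show ?thesis using FU by (rule lepoll_trans)
qed

text \<open>A relation \<open>code\<close> between classes and elements of a small set that determines the class suffices
  to name the classes by elements of \<open>U\<close>.\<close>

lemma class_names_exist:
  fixes U :: "'u set" and E :: "'x \<Rightarrow> 's \<Rightarrow> 's \<Rightarrow> bool"
  assumes codes: "codes \<lesssim> U"
    and ex: "\<And>x s. x \<in> X \<Longrightarrow> s \<in> A x \<Longrightarrow> \<exists>c \<in> codes. code c x s"
    and unique: "\<And>c x y s t. c \<in> codes \<Longrightarrow> x \<in> X \<Longrightarrow> y \<in> X \<Longrightarrow> s \<in> A x \<Longrightarrow> t \<in> A y \<Longrightarrow> code c x s \<Longrightarrow> code c y t \<Longrightarrow>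
      x = y \<and> E x s t"
    and refl: "\<And>x s. x \<in> X \<Longrightarrow> s \<in> A x \<Longrightarrow> E x s s"
    and sym: "\<And>x s t. x \<in> X \<Longrightarrow> s \<in> A x \<Longrightarrow> t \<in> A x \<Longrightarrow> E x s t \<Longrightarrow> E x t s"
    and trans: "\<And>x s t u. x \<in> X \<Longrightarrow> s \<in> A x \<Longrightarrow> t \<in> A x \<Longrightarrow> u \<in> A x \<Longrightarrow> E x s t \<Longrightarrow> E x t u \<Longrightarrow> E x s u"
  shows "\<exists>val. (\<forall>x \<in> X. \<forall>s \<in> A x. val s x \<in> U) \<and>
    (\<forall>x \<in> X. \<forall>y \<in> X. \<forall>s \<in> A x. \<forall>t \<in> A y. val s x = val t y \<longleftrightarrow> x = y \<and> E x s t)"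
proof -
  obtain f where f: "inj_on f codes" "f ` codes \<subseteq> U" using codes unfolding lepoll_def by blast
  \<comment> \<open>All codes of all members of the class of \<open>s\<close>. This set depends on
    the class only, so the choice operator picks the same code for equivalent families, even if
    \<open>code\<close> itself relates them to different elements.\<close>
  define Q where "Q s x c \<longleftrightarrow> c \<in> codes \<and> (\<exists>t \<in> A x. E x s t \<and> code c x t)" for s x c
  define pick where "pick s x = (SOME c. Q s x c)" for s x
  have pick: "Q s x (pick s x)" if "x \<in> X" "s \<in> A x" for s x
  proof -
    have "\<exists>c. Q s x c" using ex[OF that] refl[OF that] that unfolding Q_def by blast
    then show ?thesis unfolding pick_def by (rule someI_ex)
  qed
  show ?thesis
  proof (intro exI[of _ "\<lambda>s x. f (pick s x)"] conjI ballI iffI)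
    show "f (pick s x) \<in> U" if "x \<in> X" "s \<in> A x" for x s
      using pick[OF that] f(2) unfolding Q_def by blast
    fix x y s t assume x: "x \<in> X" and y: "y \<in> X" and s: "s \<in> A x" and t: "t \<in> A y"
    {
      assume "f (pick s x) = f (pick t y)"
      then have eq: "pick s x = pick t y"
        using pick[OF x s] pick[OF y t] f(1) unfolding Q_def by (blast dest: inj_onD)
      obtain s' where s': "s' \<in> A x" "E x s s'" "code (pick s x) x s'" using pick[OF x s] unfolding Q_def by blast
      obtain t' where t': "t' \<in> A y" "E y t t'" "code (pick s x) y t'"
        using pick[OF y t] unfolding Q_def eq by blast
      have "pick s x \<in> codes" using pick[OF x s] unfolding Q_def by blast
      from unique[OF this x y s'(1) t'(1) s'(3) t'(3)] have xy: "x = y" "E x s' t'" by auto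
      have "E x s t'" using trans[OF x s s'(1) _ s'(2) xy(2)] t'(1) xy(1) by simp
      moreover have "E x t' t" using sym[OF x _ _ t'(2)[folded xy(1)]] t t'(1) xy(1) by simp
      ultimately have "E x s t" using trans[OF x s] t t'(1) xy(1) by blast
      then show "x = y" "E x s t" using xy by auto
    }
    assume "x = y \<and> E x s t"
    then have xy: "x = y" and st: "E x s t" by auto
    \<comment> \<open>Equivalent families satisfy the same predicate, hence the choice made in
      \<open>pick\<close> is literally the same.\<close>
    have "Q s x c \<longleftrightarrow> Q t x c" for c
      unfolding Q_def using trans[OF x _ _ _ sym[OF x s _ st]] trans[OF x _ _ _ st] s t xy by blast
    then have "pick s x = pick t y" by (simp add: pick_def xy)
    then show "f (pick s x) = f (pick t y)" by simp
  qed
qed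

lemma (in left_module) difference_equivalence:
  assumes B: "\<And>x. x \<in> B \<Longrightarrow> x \<in> carrier M" "\<zero>\<^bsub>M\<^esub> \<in> B"
    and minus: "\<And>x y. x \<in> B \<Longrightarrow> y \<in> B \<Longrightarrow> x \<ominus>\<^bsub>M\<^esub> y \<in> B"
  shows "s \<in> carrier M \<Longrightarrow> s \<ominus>\<^bsub>M\<^esub> s \<in> B"
    "s \<in> carrier M \<Longrightarrow> t \<in> carrier M \<Longrightarrow> s \<ominus>\<^bsub>M\<^esub> t \<in> B \<Longrightarrow> t \<ominus>\<^bsub>M\<^esub> s \<in> B"
    "s \<in> carrier M \<Longrightarrow> t \<in> carrier M \<Longrightarrow> u \<in> carrier M \<Longrightarrow> s \<ominus>\<^bsub>M\<^esub> t \<in> B \<Longrightarrow> t \<ominus>\<^bsub>M\<^esub> u \<in> B \<Longrightarrow> s \<ominus>\<^bsub>M\<^esub> u \<in> B"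
proof -
  show 1: "s \<ominus>\<^bsub>M\<^esub> s \<in> B" if "s \<in> carrier M" for s using that B(2) by (simp add: M.r_neg a_minus_def)
  show 2: "t \<ominus>\<^bsub>M\<^esub> s \<in> B" if "s \<in> carrier M" "t \<in> carrier M" "s \<ominus>\<^bsub>M\<^esub> t \<in> B" for s t
    using minus[OF B(2) that(3)] that by (simp add: a_minus_def M.minus_add M.a_ac)
  show "s \<ominus>\<^bsub>M\<^esub> u \<in> B" if s: "s \<in> carrier M" "t \<in> carrier M" "u \<in> carrier M" "s \<ominus>\<^bsub>M\<^esub> t \<in> B" "t \<ominus>\<^bsub>M\<^esub> u \<in> B"
  proof -
    have "(s \<ominus>\<^bsub>M\<^esub> t) \<ominus>\<^bsub>M\<^esub> (u \<ominus>\<^bsub>M\<^esub> t) = (s \<ominus>\<^bsub>M\<^esub> u) \<oplus>\<^bsub>M\<^esub> (t \<oplus>\<^bsub>M\<^esub> \<ominus>\<^bsub>M\<^esub> t)"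
      using s(1-3) by (simp add: a_minus_def M.minus_add M.a_ac del: M.r_neg)
    also have "\<dots> = s \<ominus>\<^bsub>M\<^esub> u" using s(1-3) by (simp add: M.r_neg)
    finally show ?thesis using minus[OF s(4) 2[OF s(2,3,5)]] by simp
  qed
qed

section \<open>Existence of limits, colimits and quotients\<close>

text \<open>Points and basic sets enter the names of germs and must therefore be no more numerous
  than \<open>U\<close>. Basic sets are compact as well as open, so that a section over one of them
  is described by finitely many sheets.\<close>

locale small_space = group_space G T X act R
  for G :: "('g, 'z) monoid_scheme" (structure) and T and X :: "'x topology" and act
    and R :: "('r, 'y) ring_scheme" +
  fixes U :: "'e set" and base :: "'x set set"
  assumes U: "infinite U" and X_lepoll: "topspace X \<lesssim> U"
    and base_lepoll: "base \<lesssim> U" and base_open: "b \<in> base \<Longrightarrow> openin X b"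
    and base_compact: "b \<in> base \<Longrightarrow> compactin X b"
    and base_nbhd: "openin X W \<Longrightarrow> x \<in> W \<Longrightarrow> \<exists>b \<in> base. x \<in> b \<and> b \<subseteq> W"
begin

text \<open>A class at \<open>x\<close> is determined by the values at \<open>x\<close>, and only
  finitely many are nonzero; so \<open>x\<close> and a finite subset of \<open>I \<times> U\<close>
  form a code. The systems \<open>A\<close> and \<open>B\<close> are left abstract in order to serve
  colimits and quotients alike.\<close>

lemma colimit_names:
  assumes fam: "sheaf_family G T X act R I D" and DU: "\<And>i. i \<in> I \<Longrightarrow> topspace (total (D i)) \<subseteq> U"
    and I: "I \<lesssim> U"
    and A: "\<And>x s. s \<in> A x \<Longrightarrow> s \<in> carrier (sheaf_family.families X I D)"
      "\<And>x s. x \<in> topspace X \<Longrightarrow> s \<in> A x \<Longrightarrow> finite {i \<in> I. s (i, x) \<noteq> szero (D i) x}"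
    and B: "\<And>x s. x \<in> topspace X \<Longrightarrow> s \<in> B x \<Longrightarrow> s \<in> A x"
      "\<And>x s t. x \<in> topspace X \<Longrightarrow> s \<in> B x \<Longrightarrow> t \<in> B x \<Longrightarrow> s \<ominus>\<^bsub>sheaf_family.families X I D\<^esub> t \<in> B x"
      "\<And>x s t. x \<in> topspace X \<Longrightarrow> s \<in> A x \<Longrightarrow> t \<in> A x \<Longrightarrow> (\<And>i. i \<in> I \<Longrightarrow> s (i, x) = t (i, x)) \<Longrightarrow>
         s \<ominus>\<^bsub>sheaf_family.families X I D\<^esub> t \<in> B x"
      "\<And>x. x \<in> topspace X \<Longrightarrow> \<zero>\<^bsub>sheaf_family.families X I D\<^esub> \<in> B x"
  shows "\<exists>val. (\<forall>x \<in> topspace X. \<forall>s \<in> A x. val s x \<in> U) \<and>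
    (\<forall>x \<in> topspace X. \<forall>y \<in> topspace X. \<forall>s \<in> A x. \<forall>t \<in> A y.
       val s x = val t y \<longleftrightarrow> x = y \<and> s \<ominus>\<^bsub>sheaf_family.families X I D\<^esub> t \<in> B x)"
proof -
  interpret sheaf_family G T X act R I D by fact
  interpret P: left_module R families by (rule left_module_families)
  define code where "code c x s \<longleftrightarrow> c = (x, {(i, s (i, x)) | i. i \<in> I \<and> s (i, x) \<noteq> szero (D i) x})"
    for c :: "'x \<times> ('a \<times> 'e) set" and x s
  show ?thesis
  proof (rule class_names_exist[where code = code and codes = "topspace X \<times> Fpow (I \<times> U)"])
    show "topspace X \<times> Fpow (I \<times> U) \<lesssim> U"
      by (intro infinite_times_lepoll infinite_Fpow_lepoll U X_lepoll I lepoll_refl)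
    show "\<exists>c\<in>topspace X \<times> Fpow (I \<times> U). code c x s" if x: "x \<in> topspace X" and s: "s \<in> A x" for x s
    proof -
      have "{(i, s (i, x)) | i. i \<in> I \<and> s (i, x) \<noteq> szero (D i) x} = (\<lambda>i. (i, s (i, x))) ` {i \<in> I. s (i, x) \<noteq> szero (D i) x}"
        by auto
      then have "{(i, s (i, x)) | i. i \<in> I \<and> s (i, x) \<noteq> szero (D i) x} \<in> Fpow (I \<times> U)"
        using A(2)[OF x s] families_closed(1)[OF A(1)[OF s] _ x] DU unfolding Fpow_def by auto
      then show ?thesis using x unfolding code_def by blast
    qed
    show "x = y \<and> s \<ominus>\<^bsub>families\<^esub> t \<in> B x"
      if x: "x \<in> topspace X" "y \<in> topspace X" and st: "s \<in> A x" "t \<in> A y" and c: "code c x s" "code c y t" for c x y s t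
    proof -
      have xy: "x = y" and eq: "{(i, s (i, x)) | i. i \<in> I \<and> s (i, x) \<noteq> szero (D i) x} =
          {(i, t (i, y)) | i. i \<in> I \<and> t (i, y) \<noteq> szero (D i) y}"
        using c unfolding code_def by auto
      \<comment> \<open>An index missing from the coded set has the value zero, so the set
        determines the zero components as well.\<close>
      have "s (i, x) = t (i, x)" if i: "i \<in> I" for i
      proof -
        have "(s (i, x) \<noteq> szero (D i) x \<and> v = s (i, x)) \<longleftrightarrow> (t (i, x) \<noteq> szero (D i) x \<and> v = t (i, x))" for v
          using eq[unfolded set_eq_iff, rule_format, of "(i, v)"] i xy by auto
        then show ?thesis by metis
      qed
      then show ?thesis using B(3)[OF x(1)] st xy by blast
    qed
    fix x s assume x: "x \<in> topspace X" and s: "s \<in> A x"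
    note equiv = P.difference_equivalence[of "B x", OF A(1)[OF B(1)[OF x]] B(4)[OF x] B(2)[OF x]]
    show "s \<ominus>\<^bsub>families\<^esub> s \<in> B x" by (rule equiv(1)[OF _ _ _ A(1)[OF s]])
    fix t assume t: "t \<in> A x"
    show "t \<ominus>\<^bsub>families\<^esub> s \<in> B x" if "s \<ominus>\<^bsub>families\<^esub> t \<in> B x"
      by (rule equiv(2)[OF _ _ _ A(1)[OF s] A(1)[OF t] that])
    fix u assume u: "u \<in> A x"
    show "s \<ominus>\<^bsub>families\<^esub> u \<in> B x" if "s \<ominus>\<^bsub>families\<^esub> t \<in> B x" "t \<ominus>\<^bsub>families\<^esub> u \<in> B x"
      by (rule equiv(3)[OF _ _ _ A(1)[OF s] A(1)[OF t] A(1)[OF u] that])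
  qed
qed

text \<open>Over a compact basic neighbourhood a section is covered by finitely many sheets \<open>V i e\<close>, each of which
  the projection embeds.  The names \<open>e\<close> of the sheets and the basic sets where they apply determine the
  section, so each germ is coded by a point, a basic set and a map from \<open>I\<close> to \<open>Fpow (U \<times> base)\<close>.\<close>

lemma limit_names:
  assumes diag: "sheaf_diagram G T X act R I D Ar dm cd d" and DU: "\<And>i. i \<in> I \<Longrightarrow> topspace (total (D i)) \<subseteq> U"
    and I: "(I \<rightarrow>\<^sub>E U) \<lesssim> U"
  shows "\<exists>val. (\<forall>x \<in> topspace X. \<forall>s \<in> sheaf_family.admissible G T X act I D (sheaf_diagram.compatible Ar dm cd d) x. val s x \<in> U) \<and>
    diagram_limit G T X act R I D Ar dm cd d val"
proof -
  interpret sheaf_diagram G T X act R I D Ar dm cd d by fact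
  interpret P: left_module R families by (rule left_module_families)
  have "\<exists>V. openin (total (D i)) V \<and> e \<in> V \<and> inj_on (proj (D i)) V" if "i \<in> I" "e \<in> topspace (total (D i))" for i e
    using section_homeo_through[OF D[OF that(1)] that(2)] by metis
  \<comment> \<open>One sheet is fixed for each element before any family is considered; a name
    \<open>e\<close> then denotes the same sheet for all sections that are to be compared.\<close>
  then obtain V where V: "\<And>i e. i \<in> I \<Longrightarrow> e \<in> topspace (total (D i)) \<Longrightarrow>
      openin (total (D i)) (V i e) \<and> e \<in> V i e \<and> inj_on (proj (D i)) (V i e)" by metis
  define traces where "traces i b F s \<longleftrightarrow> (\<forall>y \<in> b. (\<exists>(e, b') \<in> F. y \<in> b') \<and>
      (\<forall>(e, b') \<in> F. y \<in> b' \<longrightarrow> e \<in> topspace (total (D i)) \<and> s (i, y) \<in> V i e))"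
    for i and b :: "'x set" and F :: "('e \<times> 'x set) set" and s
  define code where "code c x s \<longleftrightarrow> fst c = x \<and> x \<in> fst (snd c) \<and>
      (\<forall>i \<in> I. traces i (fst (snd c)) (snd (snd c) i) s)"
    for c :: "'x \<times> 'x set \<times> ('a \<Rightarrow> ('e \<times> 'x set) set)" and x s
  have "\<exists>val. (\<forall>x \<in> topspace X. \<forall>s \<in> A x. val s x \<in> U) \<and>
    (\<forall>x \<in> topspace X. \<forall>y \<in> topspace X. \<forall>s \<in> A x. \<forall>t \<in> A y.
       val s x = val t y \<longleftrightarrow> x = y \<and> s \<ominus>\<^bsub>families\<^esub> t \<in> null_families x)"
  proof (rule class_names_exist[where code = code and codes = "topspace X \<times> base \<times> (I \<rightarrow>\<^sub>E Fpow (U \<times> base))"])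
    have "Fpow (U \<times> base) \<lesssim> U"
      by (intro infinite_Fpow_lepoll infinite_times_lepoll U lepoll_refl base_lepoll)
    \<comment> \<open>Here smallness of the index set enters: for every index a finite set of names
      is needed, and functions from \<open>I\<close> into a set no larger than \<open>U\<close> are
      bounded by the assumption \<open>I\<close>.\<close>
    then have "(I \<rightarrow>\<^sub>E Fpow (U \<times> base)) \<lesssim> U" by (rule lepoll_trans[OF lepoll_funcset_right I])
    then show "topspace X \<times> base \<times> (I \<rightarrow>\<^sub>E Fpow (U \<times> base)) \<lesssim> U"
      by (intro infinite_times_lepoll U X_lepoll base_lepoll)
    show "\<exists>c \<in> topspace X \<times> base \<times> (I \<rightarrow>\<^sub>E Fpow (U \<times> base)). code c x s" if x: "x \<in> topspace X" and s: "s \<in> A x" for x s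
    proof -
      obtain W where W: "openin X W" "x \<in> W" "\<And>i. i \<in> I \<Longrightarrow> local_section X (D i) W (\<lambda>x. s (i, x))"
        using s by (rule A_neighbourhood) blast
      obtain b where b: "b \<in> base" "x \<in> b" "b \<subseteq> W" using base_nbhd[OF W(1,2)] by blast
      have "\<exists>F \<in> Fpow (U \<times> base). traces i b F s" if i: "i \<in> I" for i
      proof -
        note sec = local_section_subset[OF W(3)[OF i] base_open[OF b(1)] b(3)]
        have "\<exists>b'. b' \<in> base \<and> y \<in> b' \<and> b' \<subseteq> {z \<in> b. s (i, z) \<in> V i (s (i, y))}" if y: "y \<in> b" for y
        proof -
          have "s (i, y) \<in> topspace (total (D i))" using local_sectionD(4)[OF sec y] .
          then have "openin X {z \<in> b. s (i, z) \<in> V i (s (i, y))}" "y \<in> {z \<in> b. s (i, z) \<in> V i (s (i, y))}"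
            using V[OF i] y local_sectionD(1,3)[OF sec] by (auto intro!: openin_continuous_map_preimage_subtopology)
          then show ?thesis using base_nbhd by meson
        qed
        then obtain c where c: "\<And>y. y \<in> b \<Longrightarrow> c y \<in> base \<and> y \<in> c y \<and> c y \<subseteq> {z \<in> b. s (i, z) \<in> V i (s (i, y))}"
          by metis
        \<comment> \<open>The basic neighbourhoods \<open>c y\<close> on which the section stays in
          the sheet of \<open>s (i, y)\<close> cover the compact set \<open>b\<close>; the centres
          of a finite subcover give the names.\<close>
        have "\<exists>\<F>. finite \<F> \<and> \<F> \<subseteq> c ` b \<and> b \<subseteq> \<Union> \<F>"
          by (rule compactinD[OF base_compact[OF b(1)]]) (use base_open c in blast)+
        then obtain \<F> where \<F>: "finite \<F>" "\<F> \<subseteq> c ` b" "b \<subseteq> \<Union> \<F>" by blast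
        obtain Y where Y: "finite Y" "Y \<subseteq> b" "\<F> = c ` Y" using finite_subset_image[OF \<F>(1,2)] by blast
        have cover: "\<exists>z \<in> Y. y \<in> c z" if "y \<in> b" for y using \<F>(3) that unfolding Y(3) by blast
        have "(\<lambda>y. (s (i, y), c y)) ` Y \<in> Fpow (U \<times> base)"
          using Y(1,2) c local_sectionD(4)[OF sec] DU[OF i] unfolding Fpow_def by blast
        moreover have "(\<exists>(e, b) \<in> (\<lambda>y. (s (i, y), c y)) ` Y. y \<in> b) \<and>
          (\<forall>(e, b') \<in> (\<lambda>y. (s (i, y), c y)) ` Y. y \<in> b' \<longrightarrow> e \<in> topspace (total (D i)) \<and> s (i, y) \<in> V i e)"
          if y: "y \<in> b" for y
          using Y(2) c local_sectionD(4)[OF sec] cover[OF y] by fastforce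
        ultimately show ?thesis unfolding traces_def by blast
      qed
      then obtain F where F: "\<And>i. i \<in> I \<Longrightarrow> F i \<in> Fpow (U \<times> base) \<and> traces i b (F i) s" by metis
      have "code (x, b, restrict F I) x s" unfolding code_def using F b(2) by simp
      moreover have "(x, b, restrict F I) \<in> topspace X \<times> base \<times> (I \<rightarrow>\<^sub>E Fpow (U \<times> base))" using F b(1) x by auto
      ultimately show ?thesis by blast
    qed
    show "x = y \<and> s \<ominus>\<^bsub>families\<^esub> t \<in> null_families x"
      if x: "x \<in> topspace X" "y \<in> topspace X" and st: "s \<in> A x" "t \<in> A y" and c: "code c x s" "code c y t"
      and cc: "c \<in> topspace X \<times> base \<times> (I \<rightarrow>\<^sub>E Fpow (U \<times> base))" for c x y s t
    proof -
      obtain b F where cF: "c = (x, b, F)" and b: "b \<in> base" using cc c unfolding code_def by (cases c) auto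
      have xy: "x = y" "x \<in> b" using c cF by (auto simp: code_def)
      have bX: "openin X b" "b \<subseteq> topspace X" using base_open[OF b] openin_subset by blast+
      have P: "s \<in> carrier families" "t \<in> carrier families" using A_families st by auto
      have "s (i, z) = t (i, z)" if i: "i \<in> I" and z: "z \<in> b" for i z
      proof -
        have tr: "traces i b (F i) s" "traces i b (F i) t" using c i by (auto simp: code_def cF)
        obtain e b' where e: "(e, b') \<in> F i" "z \<in> b'" using tr(1) z unfolding traces_def by blast
        then have st: "s (i, z) \<in> V i e" "t (i, z) \<in> V i e" "e \<in> topspace (total (D i))"
          using tr z unfolding traces_def by blast+
        have zX: "z \<in> topspace X" using z bX(2) by blast
        \<comment> \<open>Both values lie over \<open>z\<close> and in one sheet, hence coincide.
          Since this holds on all of \<open>b\<close>, the difference has zero germ at every point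
          of \<open>b\<close>.\<close>
        have "inj_on (proj (D i)) (V i e)" using V[OF i st(3)] by blast
        from inj_onD[OF this, of "s (i, z)" "t (i, z)"] show ?thesis
          using families_closed(2)[OF P(1) i zX] families_closed(2)[OF P(2) i zX] st(1,2) by simp
      qed
      then have "null_germ x (s \<ominus>\<^bsub>families\<^esub> t)"
        unfolding null_germ_def using bX xy(2) P
        by (intro exI[of _ b]) (auto simp: families_simps sminus_self[OF D] families_closed subset_iff)
      then show ?thesis using xy(1) A_minus' st by (simp add: null_families_def)
    qed
    have null: "\<zero>\<^bsub>families\<^esub> \<in> null_families x" if "x \<in> topspace X" for x
      using that A_zero'[OF that] openin_topspace[of X] unfolding null_families_def null_germ_def
      by (auto simp: families_simps intro!: exI[of _ "topspace X"])
    have minus: "s \<ominus>\<^bsub>families\<^esub> t \<in> null_families x" if "s \<in> null_families x" "t \<in> null_families x" for x s t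
      using that by (auto simp: null_families_def A_families intro!: A_minus' null_germ_minus)
    note equiv = P.difference_equivalence[of "null_families _", OF _ null minus]
    show "s \<ominus>\<^bsub>families\<^esub> s \<in> null_families x" if "x \<in> topspace X" "s \<in> A x" for x s
      by (rule equiv(1)) (use that in \<open>auto simp: null_families_def A_families\<close>)
    show "t \<ominus>\<^bsub>families\<^esub> s \<in> null_families x"
      if "x \<in> topspace X" "s \<in> A x" "t \<in> A x" "s \<ominus>\<^bsub>families\<^esub> t \<in> null_families x" for x s t
      by (rule equiv(2)) (use that in \<open>auto simp: null_families_def A_families\<close>)
    show "s \<ominus>\<^bsub>families\<^esub> u \<in> null_families x"
      if "x \<in> topspace X" "s \<in> A x" "t \<in> A x" "u \<in> A x" "s \<ominus>\<^bsub>families\<^esub> t \<in> null_families x"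
        "t \<ominus>\<^bsub>families\<^esub> u \<in> null_families x" for x s t u
      by (rule equiv(3)[where t = t]) (use that in \<open>auto simp: null_families_def A_families\<close>)
  qed
  then obtain val where vals: "\<forall>x \<in> topspace X. \<forall>s \<in> A x. val s x \<in> U"
    "\<forall>x \<in> topspace X. \<forall>y \<in> topspace X. \<forall>s \<in> A x. \<forall>t \<in> A y.
       val s x = val t y \<longleftrightarrow> x = y \<and> s \<ominus>\<^bsub>families\<^esub> t \<in> null_families x" by (elim exE conjE)
  note val = vals[rule_format]
  have "diagram_limit G T X act R I D Ar dm cd d val"
    by unfold_locales (rule val(2))
  with vals(1) show ?thesis by (intro exI[of _ val] conjI)
qed

text \<open>The limit itself has total space in \<open>U\<close>, yet its universal property is
  tested against sheaves with arbitrary total space in the type; this is what makes it a limit in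
  larger universes.\<close>

theorem limit_exists:
  assumes diag: "sheaf_diagram G T X act R I D Ar dm cd d" and DU: "\<And>i. i \<in> I \<Longrightarrow> topspace (total (D i)) \<subseteq> U"
    and I: "(I \<rightarrow>\<^sub>E U) \<lesssim> U"
  obtains L \<pi> where "sheaf L" "topspace (total L) \<subseteq> U" "\<And>i. i \<in> I \<Longrightarrow> \<pi> i \<in> sheaf_maps G X R L (D i)"
    "\<And>u e. u \<in> Ar \<Longrightarrow> e \<in> topspace (total L) \<Longrightarrow> d u (\<pi> (dm u) e) = \<pi> (cd u) e"
    "\<And>M \<mu>. sheaf M \<Longrightarrow> (\<And>i. i \<in> I \<Longrightarrow> \<mu> i \<in> sheaf_maps G X R M (D i)) \<Longrightarrow>
      (\<And>u m. u \<in> Ar \<Longrightarrow> m \<in> topspace (total M) \<Longrightarrow> d u (\<mu> (dm u) m) = \<mu> (cd u) m) \<Longrightarrow>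
      \<exists>!h. h \<in> sheaf_maps G X R M L \<and> (\<forall>i \<in> I. \<forall>m \<in> topspace (total M). \<pi> i (h m) = \<mu> i m)"
proof -
  interpret sheaf_diagram G T X act R I D Ar dm cd d by fact
  have "\<exists>val. (\<forall>x \<in> topspace X. \<forall>s \<in> A x. val s x \<in> U) \<and> diagram_limit G T X act R I D Ar dm cd d val"
    by (rule limit_names[OF diag DU I])
  then obtain val where vals: "\<forall>x \<in> topspace X. \<forall>s \<in> A x. val s x \<in> U"
    and lim: "diagram_limit G T X act R I D Ar dm cd d val" by (elim exE conjE)
  note val = vals[rule_format]
  interpret diagram_limit G T X act R I D Ar dm cd d val by (rule lim)
  show thesis
  proof (rule that[of quotient_sheaf limit_proj])
    show "topspace (total quotient_sheaf) \<subseteq> U" using val by (auto elim!: germsE)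
    show "d u (limit_proj (dm u) e) = limit_proj (cd u) e" if "u \<in> Ar" "e \<in> topspace (total quotient_sheaf)" for u e
      using limit_proj_compatible that by simp
    show "\<exists>!h. h \<in> sheaf_maps G X R M quotient_sheaf \<and> (\<forall>i \<in> I. \<forall>m \<in> topspace (total M). limit_proj i (h m) = \<mu> i m)"
      if "sheaf M" "\<And>i. i \<in> I \<Longrightarrow> \<mu> i \<in> sheaf_maps G X R M (D i)"
        "\<And>u m. u \<in> Ar \<Longrightarrow> m \<in> topspace (total M) \<Longrightarrow> d u (\<mu> (dm u) m) = \<mu> (cd u) m" for M \<mu>
      using that by (rule limit_universal)
  qed (fact sheaf_quotient limit_proj_map)+
qed

end

section \<open>The relations of a colimit\<close>

context sheaf_diagram
begin

sublocale sums: finite_sums G T X act R I D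
  by unfold_locales

text \<open>The relations are imposed stalk by stalk: by \<open>zero\<close> only the values at \<open>x\<close> matter, so that finitely many
  elements of \<open>U\<close> suffice to name a class.\<close>

inductive relation :: "'x \<Rightarrow> ('i \<times> 'x \<Rightarrow> 'e) \<Rightarrow> bool" where
  zero: "s \<in> sums.A x \<Longrightarrow> (\<And>i. i \<in> I \<Longrightarrow> s (i, x) = szero (D i) x) \<Longrightarrow> relation x s"
| arrow: "u \<in> Ar \<Longrightarrow> s \<in> sums.A x \<Longrightarrow> t \<in> sums.A x \<Longrightarrow>
    (\<And>i. i \<in> I - {dm u} \<Longrightarrow> s (i, x) = szero (D i) x) \<Longrightarrow>
    (\<And>i. i \<in> I - {cd u} \<Longrightarrow> t (i, x) = szero (D i) x) \<Longrightarrow>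
    t (cd u, x) = d u (s (dm u, x)) \<Longrightarrow> relation x (s \<ominus>\<^bsub>families\<^esub> t)"
| minus: "relation x s \<Longrightarrow> relation x t \<Longrightarrow> relation x (s \<ominus>\<^bsub>families\<^esub> t)"
| smult: "r \<in> carrier R \<Longrightarrow> relation x s \<Longrightarrow> relation x (r \<odot>\<^bsub>families\<^esub> s)"

lemma relation_A: "relation x s \<Longrightarrow> s \<in> sums.A x"
  by (induction rule: relation.induct) (auto intro: sums.A_minus' sums.A_smult')

lemma family_act_minus:
  "g \<in> carrier G \<Longrightarrow> s \<in> carrier families \<Longrightarrow> t \<in> carrier families \<Longrightarrow>
    family_act g (s \<ominus>\<^bsub>families\<^esub> t) = family_act g s \<ominus>\<^bsub>families\<^esub> family_act g t"
  using left_module_families R_linear_minus[OF _ _ family_act_linear] by (auto simp: left_module_def)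

lemma relation_act:
  assumes g: "g \<in> carrier G"
  shows "relation x s \<Longrightarrow> x \<in> topspace X \<Longrightarrow> relation (act g x) (family_act g s)"
proof (induction rule: relation.induct)
  case (zero s x)
  then show ?case using g
    by (intro relation.zero sums.A_act') (auto simp: families_simps gact_szero[OF D])
next
  case (arrow u s x t)
  note P = sums.A_families[OF arrow(2)] sums.A_families[OF arrow(3)]
  have "relation (act g x) (family_act g s \<ominus>\<^bsub>families\<^esub> family_act g t)"
  proof (rule relation.arrow[OF arrow(1)])
    show "family_act g t (cd u, act g x) = d u (family_act g s (dm u, act g x))"
      using arrow g P by (simp add: families_simps dm cd d_simps families_closed)
  qed (use arrow g in \<open>auto simp: families_simps gact_szero[OF D] intro: sums.A_act'\<close>)
  then show ?case using g P by (simp add: family_act_minus)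
next
  case (minus x s t)
  then show ?case
    using relation.minus g sums.A_families[OF relation_A] by (simp add: family_act_minus)
next
  case (smult r x s)
  then show ?case
    using relation.smult family_act_linear[OF g] sums.A_families[OF relation_A] unfolding R_linear_def by metis
qed

text \<open>A relation at a point is a relation at nearby points: vanishing of components is open by
  \<open>vanishing_open\<close>, and the equation along an arrow is an agreement of two sections.
  This gives openness of the relations required of a presentation.\<close>

lemma relation_nbhd:
  "relation x s \<Longrightarrow> x \<in> topspace X \<Longrightarrow> \<exists>W. openin X W \<and> x \<in> W \<and> (\<forall>y \<in> W. relation y s)"
proof (induction rule: relation.induct)
  case (zero s x)
  from sums.vanishing_open[OF zero(1), of I] zero(2) obtain W where "openin X W" "x \<in> W"
    "\<forall>y \<in> W. s \<in> sums.A y \<and> (\<forall>i \<in> I. s (i, y) = szero (D i) y)" by blast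
  then show ?case by (intro exI[of _ W]) (auto intro: relation.zero)
next
  case (arrow u s x t)
  from sums.vanishing_open[OF arrow(2), of "I - {dm u}"] arrow(4) obtain W where W: "openin X W" "x \<in> W"
    "\<forall>y \<in> W. s \<in> sums.A y \<and> (\<forall>i \<in> I - {dm u}. s (i, y) = szero (D i) y)" by blast
  from sums.vanishing_open[OF arrow(3), of "I - {cd u}"] arrow(5) obtain V where V: "openin X V" "x \<in> V"
    "\<forall>y \<in> V. t \<in> sums.A y \<and> (\<forall>i \<in> I - {cd u}. t (i, y) = szero (D i) y)" by blast
  obtain W' where W': "openin X W'" "x \<in> W'" "\<And>i. i \<in> I \<Longrightarrow> local_section X (D i) W' (\<lambda>x. s (i, x))"
    using arrow(2) by (rule sums.A_neighbourhood) blast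
  obtain V' where V': "openin X V'" "x \<in> V'" "\<And>i. i \<in> I \<Longrightarrow> local_section X (D i) V' (\<lambda>x. t (i, x))"
    using arrow(3) by (rule sums.A_neighbourhood) blast
  have dmu: "dm u \<in> I" and cdu: "cd u \<in> I" using arrow(1) dm cd by auto
  \<comment> \<open>The image under the arrow of the component of \<open>s\<close> is again a
    section, so it can be compared with the component of \<open>t\<close> on an open set.\<close>
  have "local_section X (D (cd u)) W' (\<lambda>x. d u (s (dm u, x)))"
    using sheaf_map_section[OF D[OF dmu] D[OF cdu] d[OF arrow(1)] W'(3)[OF dmu]] .
  from openin_sections_agree[OF D[OF cdu] V'(3)[OF cdu] this]
  have "openin X {y \<in> V' \<inter> W'. t (cd u, y) = d u (s (dm u, y))}" .
  then have "openin X (W \<inter> V \<inter> {y \<in> V' \<inter> W'. t (cd u, y) = d u (s (dm u, y))})"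
    using W(1) V(1) by blast
  moreover have "relation y (s \<ominus>\<^bsub>families\<^esub> t)"
    if y: "y \<in> W \<inter> V \<inter> {y \<in> V' \<inter> W'. t (cd u, y) = d u (s (dm u, y))}" for y
    using y W(3) V(3) by (intro relation.arrow[OF arrow(1)]) auto
  moreover have "x \<in> W \<inter> V \<inter> {y \<in> V' \<inter> W'. t (cd u, y) = d u (s (dm u, y))}"
    using W(2) V(2) W'(2) V'(2) arrow(6) by simp
  ultimately show ?case by (intro exI conjI ballI)
next
  case (minus x s t)
  then obtain W V where "openin X W" "x \<in> W" "\<forall>y \<in> W. relation y s" "openin X V" "x \<in> V" "\<forall>y \<in> V. relation y t"
    by blast
  then show ?case using relation.minus by (intro exI[of _ "W \<inter> V"]) auto
next
  case (smult r x s)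
  then obtain W where "openin X W" "x \<in> W" "\<forall>y \<in> W. relation y s" by blast
  then show ?case using smult(1) by (intro exI[of _ W]) (auto intro: relation.smult)
qed

end

context small_space
begin

text \<open>The last clause records, besides the universal property, that an element fixing a point
  and the stalks of the diagram there fixes the stalk of the colimit; it shows that colimits of Weyl
  sheaves are Weyl.\<close>

theorem colimit_exists:
  assumes diag: "sheaf_diagram G T X act R I D Ar dm cd d" and DU: "\<And>i. i \<in> I \<Longrightarrow> topspace (total (D i)) \<subseteq> U"
    and I: "I \<lesssim> U"
  obtains L \<iota> where "sheaf L" "topspace (total L) \<subseteq> U" "\<And>i. i \<in> I \<Longrightarrow> \<iota> i \<in> sheaf_maps G X R (D i) L"
    "\<And>u e. u \<in> Ar \<Longrightarrow> e \<in> topspace (total (D (dm u))) \<Longrightarrow> \<iota> (cd u) (d u e) = \<iota> (dm u) e"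
    "\<And>M \<mu>. sheaf M \<Longrightarrow> (\<And>i. i \<in> I \<Longrightarrow> \<mu> i \<in> sheaf_maps G X R (D i) M) \<Longrightarrow>
      (\<And>u e. u \<in> Ar \<Longrightarrow> e \<in> topspace (total (D (dm u))) \<Longrightarrow> \<mu> (cd u) (d u e) = \<mu> (dm u) e) \<Longrightarrow>
      \<exists>!h. h \<in> sheaf_maps G X R L M \<and> (\<forall>i \<in> I. \<forall>e \<in> topspace (total (D i)). h (\<iota> i e) = \<mu> i e)"
    "\<And>g e. g \<in> carrier G \<Longrightarrow> e \<in> topspace (total L) \<Longrightarrow> act g (proj L e) = proj L e \<Longrightarrow>
      (\<And>i a. i \<in> I \<Longrightarrow> a \<in> topspace (total (D i)) \<Longrightarrow> proj (D i) a = proj L e \<Longrightarrow> gact (D i) g a = a) \<Longrightarrow>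
      gact L g e = e"
proof -
  interpret sheaf_diagram G T X act R I D Ar dm cd d by fact
  let ?B = "\<lambda>x. {s. relation x s}"
  have agree: "s \<ominus>\<^bsub>families\<^esub> t \<in> ?B x"
    if "x \<in> topspace X" "s \<in> sums.A x" "t \<in> sums.A x" "\<And>i. i \<in> I \<Longrightarrow> s (i, x) = t (i, x)" for x s t
    using that sums.A_families[OF that(2)] sums.A_families[OF that(3)]
    by (auto simp: families_simps sminus_self[OF D] families_closed intro!: relation.zero sums.A_minus')
  have "\<exists>val. (\<forall>x \<in> topspace X. \<forall>s \<in> sums.A x. val s x \<in> U) \<and>
    (\<forall>x \<in> topspace X. \<forall>y \<in> topspace X. \<forall>s \<in> sums.A x. \<forall>t \<in> sums.A y.
       val s x = val t y \<longleftrightarrow> x = y \<and> s \<ominus>\<^bsub>families\<^esub> t \<in> ?B x)"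
  proof (rule colimit_names[OF sheaf_family_axioms DU I])
    show "\<zero>\<^bsub>families\<^esub> \<in> ?B x" if "x \<in> topspace X" for x
      using that by (auto simp: families_simps intro!: relation.zero sums.A_zero')
  qed (use agree relation_A in \<open>auto intro: sums.A_families sums.admissible_finite_support relation.minus\<close>)
  then obtain val where vals: "\<forall>x \<in> topspace X. \<forall>s \<in> sums.A x. val s x \<in> U"
    "\<forall>x \<in> topspace X. \<forall>y \<in> topspace X. \<forall>s \<in> sums.A x. \<forall>t \<in> sums.A y.
       val s x = val t y \<longleftrightarrow> x = y \<and> s \<ominus>\<^bsub>families\<^esub> t \<in> ?B x" by (elim exE conjE)
  note val = vals[rule_format]
  interpret Q: sheaf_sum_quotient G T X act R I D ?B val
  proof
    show "openin X {x \<in> topspace X. s \<in> ?B x}" for s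
    proof (subst openin_subopen, safe)
      fix x assume "x \<in> topspace X" "relation x s"
      then obtain W where "openin X W" "x \<in> W" "\<forall>y \<in> W. relation y s" using relation_nbhd by blast
      then show "\<exists>W. openin X W \<and> x \<in> W \<and> W \<subseteq> {x \<in> topspace X. s \<in> ?B x}"
        using openin_subset by (intro exI[of _ W]) blast
    qed
  qed (use val(2) relation_A relation_act in \<open>auto intro: relation.intros\<close>)
  show thesis
  proof (rule that[of Q.quotient_sheaf Q.coproj])
    show "topspace (total Q.quotient_sheaf) \<subseteq> U" using val(1) by (auto elim!: Q.germsE)
    show "Q.coproj (cd u) (d u e) = Q.coproj (dm u) e" if u: "u \<in> Ar" and e: "e \<in> topspace (total (D (dm u)))" for u e
    proof -
      let ?x = "proj (D (dm u)) e"
      have x: "?x \<in> topspace X" using proj_closed[OF D[OF dm[OF u]] e] .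
      have de: "d u e \<in> topspace (total (D (cd u)))" "proj (D (cd u)) (d u e) = ?x" using u e by (auto simp: d_simps)
      obtain s W where s: "s \<in> sums.A ?x" "s (dm u, ?x) = e" "?x \<in> W"
        "\<And>j y. j \<in> I \<Longrightarrow> j \<noteq> dm u \<Longrightarrow> y \<in> W \<Longrightarrow> s (j, y) = szero (D j) y"
        using sums.single_admissible[OF dm[OF u] e] by metis
      obtain t V where t: "t \<in> sums.A ?x" "t (cd u, ?x) = d u e" "?x \<in> V"
        "\<And>j y. j \<in> I \<Longrightarrow> j \<noteq> cd u \<Longrightarrow> y \<in> V \<Longrightarrow> t (j, y) = szero (D j) y"
        using sums.single_admissible[OF cd[OF u] de(1)] unfolding de(2) by metis
      \<comment> \<open>At this point \<open>s\<close> carries \<open>e\<close> in component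
        \<open>dm u\<close> and \<open>t\<close> its image in component \<open>cd u\<close>, with
        zero elsewhere: the generating relation of the arrow \<open>u\<close>.\<close>
      have "relation ?x (s \<ominus>\<^bsub>families\<^esub> t)" using s t by (intro relation.arrow[OF u]) auto
      then have "val s ?x = val t ?x" using val(2)[OF x x s(1) t(1)] by simp
      moreover have "Q.coproj (dm u) e = val s ?x"
        using Q.coproj_val[OF dm[OF u] x s(1)] s(2,3,4) by simp
      moreover have "Q.coproj (cd u) (d u e) = val t ?x"
        using Q.coproj_val[OF cd[OF u] x t(1)] t(2,3,4) by simp
      ultimately show ?thesis by simp
    qed
    show "\<exists>!h. h \<in> sheaf_maps G X R Q.quotient_sheaf M \<and>
        (\<forall>i \<in> I. \<forall>e \<in> topspace (total (D i)). h (Q.coproj i e) = \<mu> i e)"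
      if M: "sheaf M" and \<mu>: "\<And>i. i \<in> I \<Longrightarrow> \<mu> i \<in> sheaf_maps G X R (D i) M"
        and cocone: "\<And>u e. u \<in> Ar \<Longrightarrow> e \<in> topspace (total (D (dm u))) \<Longrightarrow> \<mu> (cd u) (d u e) = \<mu> (dm u) e" for M \<mu>
    proof (rule Q.sum_quotient_universal[OF M \<mu>])
      fix x s assume "x \<in> topspace X" "s \<in> ?B x"
      then have "relation x s" "x \<in> topspace X" by auto
      \<comment> \<open>The cocone condition kills the generators coming from arrows, and the
        families with zero sum are closed under the operations that generate the relations.\<close>
      then show "Q.total_sum M \<mu> s x = szero M x"
      proof (induction rule: relation.induct)
        case (zero s x)
        then show ?case using Q.total_sum_zero[OF M \<mu>] by blast
      next
        case (arrow u s x t)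
        have "Q.total_sum M \<mu> s x = \<mu> (dm u) (s (dm u, x))"
          using arrow by (intro Q.total_sum_single[OF M \<mu>] dm) auto
        moreover have "Q.total_sum M \<mu> t x = \<mu> (cd u) (t (cd u, x))"
          using arrow by (intro Q.total_sum_single[OF M \<mu>] cd) auto
        moreover have sm: "s (dm u, x) \<in> topspace (total (D (dm u)))"
          using families_closed(1)[OF sums.A_families[OF arrow(2)] dm[OF arrow(1)] arrow(7)] .
        ultimately have eq: "Q.total_sum M \<mu> s x = Q.total_sum M \<mu> t x"
          using arrow(6) cocone[OF arrow(1) sm] by simp
        show ?case
          using Q.total_sum_minus[OF M \<mu> arrow(2,3,7)] Q.total_sum_closed[OF M \<mu> arrow(3,7)] sminus_self[OF M]
          by (simp add: eq)
      next
        case (minus x s t)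
        then show ?case
          using Q.total_sum_minus[OF M \<mu> relation_A[OF minus.hyps(1)] relation_A[OF minus.hyps(2)] minus.prems]
            sminus_self[OF M] szero_closed[OF M] by simp
      next
        case (smult r x s)
        then show ?case
          using Q.total_sum_smult[OF M \<mu> relation_A[OF smult.hyps(2)] smult.hyps(1) smult.prems] ssmult_zero[OF M]
          by simp
      qed
    qed
    show "gact Q.quotient_sheaf g e = e"
      if "g \<in> carrier G" "e \<in> topspace (total Q.quotient_sheaf)"
        "act g (proj Q.quotient_sheaf e) = proj Q.quotient_sheaf e"
        "\<And>i a. i \<in> I \<Longrightarrow> a \<in> topspace (total (D i)) \<Longrightarrow> proj (D i) a = proj Q.quotient_sheaf e \<Longrightarrow> gact (D i) g a = a" for g e
      using that by (rule Q.gact_quotient_fixed)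
  qed (fact Q.sheaf_quotient Q.coproj_map)+
qed

text \<open>The construction for sums with a single index, the relations at \<open>x\<close> being
  the families whose value at \<open>x\<close> lies in \<open>S\<close>. The exact description of
  the elements sent to zero is what later identifies kernels of cokernels.\<close>

theorem quotient_exists:
  assumes F: "sheaf F" and FU: "topspace (total F) \<subseteq> U" and S: "stable_subset F S"
  obtains Q q where "sheaf Q" "topspace (total Q) \<subseteq> U" "q \<in> sheaf_maps G X R F Q"
    "q ` topspace (total F) = topspace (total Q)"
    "\<And>e. e \<in> topspace (total F) \<Longrightarrow> q e = szero Q (proj F e) \<longleftrightarrow> e \<in> S"
    "\<And>M \<mu>. sheaf M \<Longrightarrow> \<mu> \<in> sheaf_maps G X R F M \<Longrightarrow> (\<And>e. e \<in> S \<Longrightarrow> \<mu> e = szero M (proj F e)) \<Longrightarrow>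
      \<exists>!h. h \<in> sheaf_maps G X R Q M \<and> (\<forall>e \<in> topspace (total F). h (q e) = \<mu> e)"
proof -
  have Sc: "szero F x \<in> S" if "x \<in> topspace X" for x using S that by (auto simp: stable_subset_def)
  interpret finite_sums G T X act R "{()}" "\<lambda>_. F"
    by (intro finite_sums.intro sheaf_family.intro group_space_axioms sheaf_family_axioms.intro F)
  define B where "B x = {s \<in> A x. s ((), x) \<in> S}" for x
  have Bm: "s \<ominus>\<^bsub>families\<^esub> t \<in> B x" if "x \<in> topspace X" "s \<in> B x" "t \<in> B x" for x s t
    using that S A_families by (auto simp: B_def families_simps families_closed stable_subset_def intro!: A_minus')
  have "\<exists>val. (\<forall>x \<in> topspace X. \<forall>s \<in> A x. val s x \<in> U) \<and>
    (\<forall>x \<in> topspace X. \<forall>y \<in> topspace X. \<forall>s \<in> A x. \<forall>t \<in> A y.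
       val s x = val t y \<longleftrightarrow> x = y \<and> s \<ominus>\<^bsub>families\<^esub> t \<in> B x)"
  proof (rule colimit_names[OF sheaf_family_axioms FU])
    show "{()} \<lesssim> U" using U by (intro finite_lepoll_infinite) auto
    show "s \<ominus>\<^bsub>families\<^esub> t \<in> B x"
      if "x \<in> topspace X" "s \<in> A x" "t \<in> A x" "\<And>i. i \<in> {()} \<Longrightarrow> s (i, x) = t (i, x)" for x s t
      using that A_families[OF that(2)] A_families[OF that(3)] Sc
      by (auto simp: B_def families_simps families_closed sminus_self[OF F] intro!: A_minus')
    show "\<zero>\<^bsub>families\<^esub> \<in> B x" if "x \<in> topspace X" for x
      using that Sc by (auto simp: B_def families_simps intro!: A_zero')
  qed (use Bm in \<open>auto simp: B_def A_families\<close>)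
  then obtain val where vals: "\<forall>x \<in> topspace X. \<forall>s \<in> A x. val s x \<in> U"
    "\<forall>x \<in> topspace X. \<forall>y \<in> topspace X. \<forall>s \<in> A x. \<forall>t \<in> A y.
       val s x = val t y \<longleftrightarrow> x = y \<and> s \<ominus>\<^bsub>families\<^esub> t \<in> B x" by (elim exE conjE)
  note val = vals[rule_format]
  interpret Q: sheaf_sum_quotient G T X act R "{()}" "\<lambda>_. F" B val
  proof
    show "openin X {x \<in> topspace X. s \<in> B x}" for s
    proof (subst openin_subopen, safe)
      fix x assume x: "x \<in> topspace X" "s \<in> B x"
      then have s: "s \<in> A x" "s ((), x) \<in> S" by (auto simp: B_def)
      obtain W where W: "openin X W" "x \<in> W" "\<And>y. y \<in> W \<Longrightarrow> s \<in> A y"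
        "local_section X F W (\<lambda>x. s ((), x))" using s(1) by (rule A_neighbourhood) blast
      \<comment> \<open>Openness of \<open>S\<close> spreads a relation from \<open>x\<close> to
        nearby points.\<close>
      have "openin X {y \<in> W. s ((), y) \<in> S}"
        using local_sectionD(1,3)[OF W(4)] S by (intro openin_continuous_map_preimage_subtopology) (auto simp: stable_subset_def)
      moreover have "{y \<in> W. s ((), y) \<in> S} \<subseteq> {x \<in> topspace X. s \<in> B x}"
        using W(3) openin_subset[OF W(1)] by (auto simp: B_def)
      ultimately show "\<exists>W. openin X W \<and> x \<in> W \<and> W \<subseteq> {x \<in> topspace X. s \<in> B x}"
        using W(2) s(2) by blast
    qed
    show "family_act g s \<in> B (act g x)" if "x \<in> topspace X" "g \<in> carrier G" "s \<in> B x" for x g s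
      using that S by (auto simp: B_def families_simps stable_subset_def intro!: A_act')
    show "r \<odot>\<^bsub>families\<^esub> s \<in> B x" if "x \<in> topspace X" "r \<in> carrier R" "s \<in> B x" for x r s
      using that S by (auto simp: B_def families_simps stable_subset_def intro!: A_smult')
  qed (use val(2) Bm Sc in \<open>auto simp: B_def\<close>)
  have single: "\<exists>s. s \<in> A (proj F e) \<and> s ((), proj F e) = e" if "e \<in> topspace (total F)" for e
    using single_admissible[of "()" e] that by auto
  show thesis
  proof (rule that[of Q.quotient_sheaf "Q.coproj ()"])
    show "topspace (total Q.quotient_sheaf) \<subseteq> U" using val(1) by (auto elim!: Q.germsE)
    show q: "Q.coproj () \<in> sheaf_maps G X R F Q.quotient_sheaf" using Q.coproj_map[of "()"] by simp
    show "Q.coproj () ` topspace (total F) = topspace (total Q.quotient_sheaf)"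
    proof (intro equalityI subsetI)
      fix e assume "e \<in> topspace (total Q.quotient_sheaf)"
      then obtain s x where x: "x \<in> topspace X" "s \<in> A x" "e = val s x" by (auto elim!: Q.germsE)
      then have "Q.coproj () (s ((), x)) = e" using Q.coproj_val[of "()" x s] by simp
      then show "e \<in> Q.coproj () ` topspace (total F)"
        using families_closed(1)[OF A_families[OF x(2)] _ x(1), of "()"] by auto
    qed (use sheaf_map_closed[OF F Q.sheaf_quotient q] in blast)
    show "Q.coproj () e = szero Q.quotient_sheaf (proj F e) \<longleftrightarrow> e \<in> S" if e: "e \<in> topspace (total F)" for e
    proof -
      obtain s where "s \<in> A (proj F e)" "s ((), proj F e) = e" using single[OF e] by blast
      then show ?thesis using Q.coproj_eq_zero_iff[of "()" e s] e by (simp add: B_def)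
    qed
    show "\<exists>!h. h \<in> sheaf_maps G X R Q.quotient_sheaf M \<and> (\<forall>e \<in> topspace (total F). h (Q.coproj () e) = \<mu> e)"
      if M: "sheaf M" and \<mu>: "\<mu> \<in> sheaf_maps G X R F M" and kill: "\<And>e. e \<in> S \<Longrightarrow> \<mu> e = szero M (proj F e)" for M \<mu>
    proof -
      have "Q.total_sum M (\<lambda>_. \<mu>) s x = szero M x" if x: "x \<in> topspace X" and s: "s \<in> B x" for x s
        using Q.total_sum_single[OF M \<mu>, of "()" x s] s x kill[of "s ((), x)"]
          families_closed(2)[OF A_families, of s x "()" x] by (simp add: B_def)
      then show ?thesis using Q.sum_quotient_universal[OF M \<mu>] by simp
    qed
  qed (fact Q.sheaf_quotient)
qed

end

section \<open>Profinite groups and their closed subgroups\<close>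

context topological_group
begin

lemma continuous_mult_compose:
  assumes "continuous_map Z T a" "continuous_map Z T b"
  shows "continuous_map Z T (\<lambda>z. a z \<otimes> b z)"
  using continuous_map_compose[OF _ continuous_mult, of Z "\<lambda>z. (a z, b z)"] assms
  by (simp add: continuous_map_pairwise o_def)

lemma continuous_inv_compose: "continuous_map Z T a \<Longrightarrow> continuous_map Z T (\<lambda>z. inv (a z))"
  using continuous_map_compose[OF _ continuous_inv] by (simp add: o_def)

lemma continuous_const: "g \<in> carrier G \<Longrightarrow> continuous_map Z T (\<lambda>_. g)"
  by (simp add: topspace_eq)

lemma openin_carrier: "openin T W \<Longrightarrow> W \<subseteq> carrier G"
  using openin_subset topspace_eq by blast

lemma set_multI: "h \<in> H \<Longrightarrow> k \<in> K \<Longrightarrow> h \<otimes> k \<in> H <#> K"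
  unfolding set_mult_def by blast

lemma set_multE:
  assumes "x \<in> H <#> K"
  obtains h k where "h \<in> H" "k \<in> K" "x = h \<otimes> k"
  using assms unfolding set_mult_def by blast

lemma openin_r_coset:
  assumes W: "openin T W" and g: "g \<in> carrier G"
  shows "openin T (W #> g)"
proof -
  have "W #> g = {y \<in> topspace T. y \<otimes> inv g \<in> W}"
    using openin_carrier[OF W] g by (force simp: r_coset_def topspace_eq m_assoc subset_iff)
  moreover have "openin T {y \<in> topspace T. y \<otimes> inv g \<in> W}"
    using g by (intro openin_continuous_map_preimage[OF _ W] continuous_mult_compose continuous_const
        inv_closed continuous_map_id[unfolded id_def])
  ultimately show ?thesis by simp
qed

lemma openin_set_mult:
  assumes W: "openin T W" and K: "K \<subseteq> carrier G"
  shows "openin T (W <#> K)"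
proof -
  have "W <#> K = (\<Union>k\<in>K. W #> k)" by (auto simp: set_mult_def r_coset_def)
  then show ?thesis using openin_r_coset[OF W] K by (auto intro!: openin_Union)
qed

text \<open>The subgroup is the union of the right translates of \<open>W\<close> by its own
  elements.\<close>

lemma open_subgroup_if_nbhd:
  assumes H: "subgroup H G" and W: "openin T W" "\<one> \<in> W" "W \<subseteq> H"
  shows "openin T H"
proof -
  interpret H: subgroup H G by fact
  have "W <#> H \<subseteq> H" using W(3) by (auto simp: set_mult_def)
  moreover have "H \<subseteq> W <#> H" using W(2) H.subset by (force simp: set_mult_def)
  ultimately have "W <#> H = H" by blast
  then show ?thesis using openin_set_mult[OF W(1) H.subset] by simp
qed

text \<open>The complement is stable under left multiplication by the subgroup, hence a union of
  translates of an open set.\<close>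

lemma open_subgroup_closed:
  assumes H: "subgroup H G" and o: "openin T H"
  shows "closedin T H"
proof -
  interpret H: subgroup H G by fact
  have "carrier G - H = H <#> (carrier G - H)"
  proof (intro equalityI subsetI)
    show "y \<in> H <#> (carrier G - H)" if "y \<in> carrier G - H" for y
      using set_multI[OF H.one_closed that] that by simp
    fix y assume "y \<in> H <#> (carrier G - H)"
    then obtain h g where hg: "h \<in> H" "g \<in> carrier G" "g \<notin> H" "y = h \<otimes> g" by (auto elim: set_multE)
    have "g \<in> H" if "y \<in> H"
      using H.m_closed[OF H.m_inv_closed[OF hg(1)] that] hg by (simp add: m_assoc[symmetric])
    then show "y \<in> carrier G - H" using hg by auto
  qed
  then have "openin T (carrier G - H)" using openin_set_mult[OF o, of "carrier G - H"] by simp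
  then show ?thesis using H.subset by (simp add: closedin_def topspace_eq)
qed

lemma subgroup_normal_set_mult:
  assumes N: "N \<lhd> G" and K: "subgroup K G"
  shows "subgroup (N <#> K) G"
proof -
  interpret N: normal N G by fact
  interpret K: subgroup K G by fact
  show ?thesis
  proof (rule subgroupI)
    show "N <#> K \<subseteq> carrier G" using setmult_subset_G N.subset K.subset by blast
    show "N <#> K \<noteq> {}" unfolding set_mult_def using N.one_closed K.one_closed by blast
  next
    fix a assume "a \<in> N <#> K"
    then obtain n k where a: "n \<in> N" "k \<in> K" "a = n \<otimes> k" by (rule set_multE)
    have "inv k \<otimes> inv n \<otimes> k \<in> N" using N.inv_op_closed1 a by simp
    moreover have "inv a = (inv k \<otimes> inv n \<otimes> k) \<otimes> inv k" using a by (simp add: inv_mult_group m_assoc)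
    ultimately show "inv a \<in> N <#> K" using a set_multI by simp
    fix b assume "b \<in> N <#> K"
    then obtain m l where b: "m \<in> N" "l \<in> K" "b = m \<otimes> l" by (rule set_multE)
    have "n \<otimes> (k \<otimes> m \<otimes> inv k) \<in> N" using N.inv_op_closed2 a b by simp
    moreover have "a \<otimes> b = (n \<otimes> (k \<otimes> m \<otimes> inv k)) \<otimes> (k \<otimes> l)"
      using a b by (simp add: m_assoc inv_solve_left)
    ultimately show "a \<otimes> b \<in> N <#> K" using a b set_multI by simp
  qed
qed

text \<open>The condition that defines the basic neighbourhoods becomes equality of images in the
  quotient by \<open>N\<close>, where conjugation can be computed coset by coset.\<close>

lemma normal_set_mult_eq_iff:
  assumes N: "N \<lhd> G" and L: "L \<subseteq> carrier G" and K: "K \<subseteq> carrier G"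
  shows "N <#> L = N <#> K \<longleftrightarrow> (\<lambda>a. N #> a) ` L = (\<lambda>a. N #> a) ` K"
proof -
  have sN: "subgroup N G" using N by (simp add: normal_imp_subgroup)
  have un: "N <#> S = \<Union> ((\<lambda>a. N #> a) ` S)" for S by (auto simp: set_mult_def r_coset_def)
  have sub: "(\<lambda>a. N #> a) ` S \<subseteq> (\<lambda>a. N #> a) ` S'"
    if "N <#> S = N <#> S'" "S \<subseteq> carrier G" "S' \<subseteq> carrier G" for S S'
  proof (rule image_subsetI)
    fix a assume a: "a \<in> S"
    then have aG: "a \<in> carrier G" using that(2) by blast
    have "a \<in> \<Union> ((\<lambda>a. N #> a) ` S)" using rcos_self[OF aG sN] a by blast
    then have "a \<in> \<Union> ((\<lambda>a. N #> a) ` S')" using that(1) by (simp only: un)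
    then obtain k where k: "k \<in> S'" "a \<in> N #> k" by blast
    then have "k \<in> carrier G" using that(3) by blast
    from repr_independence[OF k(2) this sN] show "N #> a \<in> (\<lambda>a. N #> a) ` S'" using k(1) by (rule image_eqI[OF sym])
  qed
  show ?thesis
  proof
    assume "N <#> L = N <#> K"
    then show "(\<lambda>a. N #> a) ` L = (\<lambda>a. N #> a) ` K"
      by (intro equalityI sub L K) simp_all
  qed (simp add: un)
qed

lemma set_mult_absorb:
  assumes N: "subgroup N G" and M: "subgroup M G" and NM: "N \<subseteq> M" and K: "K \<subseteq> carrier G"
  shows "M <#> (N <#> K) = M <#> K"
proof -
  interpret N: subgroup N G by fact
  interpret M: subgroup M G by fact
  have "M <#> N = M"
    using NM N.subset M.subset by (auto simp: set_mult_def)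
  then show ?thesis using set_mult_assoc[OF M.subset N.subset K] by simp
qed

end

section \<open>Open normal subgroups of a profinite group\<close>

context profinite_group
begin

abbreviation "ON \<equiv> {N. N \<lhd> G \<and> openin T N}"

text \<open>Components and quasi-components agree in a compact Hausdorff space, so \<open>\<one>\<close> has a clopen neighbourhood
  \<open>V \<subseteq> W\<close>.  The elements that preserve \<open>V\<close> under right translation form an open subgroup, and its
  conjugates intersect in an open normal one.\<close>

lemma open_normal_nbhd:
  assumes W: "openin T W" "\<one> \<in> W"
  obtains N where "N \<lhd> G" "openin T N" "N \<subseteq> W"
proof -
  have lc: "locally_compact_space T" using compact compact_imp_locally_compact_space by blast
  have one: "\<one> \<in> topspace T" by (simp add: topspace_eq)
  obtain x where "connected_component_of_set T \<one> \<subseteq> {x}"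
    using totally_disconnected connectedin_connected_component_of unfolding totally_disconnected_space_def by metis
  moreover have "\<one> \<in> connected_component_of_set T \<one>" using one by (simp add: connected_component_of_refl)
  ultimately have cc: "connected_component_of_set T \<one> = {\<one>}" by blast
  have C: "{\<one>} \<in> connected_components_of T"
    using one cc unfolding connected_components_of_def by (metis imageI)
  obtain V V' where V: "openin T V" "openin T V'" "disjnt V V'" "V \<union> V' = topspace T" "{\<one>} \<subseteq> V" "V \<subseteq> W"
    using wilder_locally_compact_component_thm[OF lc Hausdorff C _ W(1)] W(2) one by auto
  have "V = topspace T - V'" using V(1,3,4) openin_subset by (auto simp: disjnt_iff)
  then have "closedin T V" using V(2) by blast
  then have cV: "compactin T V" using compact closedin_compact_space by blast
  have VG: "V \<subseteq> carrier G" using V(1) openin_carrier by blast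
  define H where "H = {x \<in> carrier G. \<forall>v \<in> V. v \<otimes> x \<in> V \<and> v \<otimes> inv x \<in> V}"
  have H: "subgroup H G"
  proof (rule subgroupI)
    show "H \<noteq> {}" using VG V(5) by (auto simp: H_def intro!: exI[of _ \<one>] simp: subset_iff)
    show "inv a \<in> H" if "a \<in> H" for a using that by (simp add: H_def)
    show "a \<otimes> b \<in> H" if a: "a \<in> H" and b: "b \<in> H" for a b
    proof -
      have ab: "a \<in> carrier G" "b \<in> carrier G" using a b by (auto simp: H_def)
      have "v \<otimes> (a \<otimes> b) \<in> V \<and> v \<otimes> inv (a \<otimes> b) \<in> V" if v: "v \<in> V" for v
      proof -
        have vG: "v \<in> carrier G" using v VG by blast
        have "(v \<otimes> a) \<otimes> b \<in> V" "(v \<otimes> inv b) \<otimes> inv a \<in> V" using a b v by (auto simp: H_def)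
        then show ?thesis using ab vG by (simp add: m_assoc inv_mult_group)
      qed
      then show ?thesis using ab by (simp add: H_def)
    qed
  qed (auto simp: H_def)
  have HV: "H \<subseteq> V" using V(5) by (force simp: H_def)
  have "continuous_map (prod_topology T T) T (\<lambda>z. fst z \<otimes> snd z)"
    "continuous_map (prod_topology T T) T (\<lambda>z. fst z \<otimes> inv (snd z))"
    by (intro continuous_mult_compose continuous_inv_compose continuous_map_fst continuous_map_snd)+
  then have "openin (prod_topology T T) ({z \<in> topspace (prod_topology T T). fst z \<otimes> snd z \<in> V} \<inter>
      {z \<in> topspace (prod_topology T T). fst z \<otimes> inv (snd z) \<in> V})"
    using V(1) by (intro openin_Int openin_continuous_map_preimage)
  \<comment> \<open>Compactness of \<open>V\<close> yields one neighbourhood \<open>Q\<close> of the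
    identity whose elements and their inverses translate all of \<open>V\<close> into
    \<open>V\<close>; it lies in \<open>H\<close> and makes \<open>H\<close> open.\<close>
  from tube_lemma_left[OF this cV one] obtain P Q where PQ: "openin T Q" "V \<subseteq> P" "\<one> \<in> Q"
    "P \<times> Q \<subseteq> {z \<in> topspace (prod_topology T T). fst z \<otimes> snd z \<in> V} \<inter>
      {z \<in> topspace (prod_topology T T). fst z \<otimes> inv (snd z) \<in> V}"
    using VG by (auto simp: topspace_eq subset_iff)
  have "Q \<subseteq> H" using PQ openin_carrier[OF PQ(1)] by (fastforce simp: H_def)
  then have oH: "openin T H" using open_subgroup_if_nbhd[OF H PQ(1,3)] by blast
  define N where "N = {x \<in> carrier G. \<forall>g \<in> carrier G. g \<otimes> x \<otimes> inv g \<in> H}"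
  interpret H: subgroup H G by (rule H)
  have N: "subgroup N G"
  proof (rule subgroupI)
    show "N \<noteq> {}" by (auto simp: N_def intro!: exI[of _ \<one>])
    show "inv a \<in> N" if "a \<in> N" for a
    proof -
      have "inv (g \<otimes> a \<otimes> inv g) \<in> H" if "g \<in> carrier G" for g
        using \<open>a \<in> N\<close> that by (auto simp: N_def)
      moreover have "inv (g \<otimes> a \<otimes> inv g) = g \<otimes> inv a \<otimes> inv g" if "g \<in> carrier G" for g
        using \<open>a \<in> N\<close> that by (simp add: N_def inv_mult_group m_assoc)
      ultimately show ?thesis using that by (simp add: N_def)
    qed
    show "a \<otimes> b \<in> N" if a: "a \<in> N" and b: "b \<in> N" for a b
    proof -
      have ab: "a \<in> carrier G" "b \<in> carrier G" using a b by (auto simp: N_def)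
      have "g \<otimes> (a \<otimes> b) \<otimes> inv g \<in> H" if g: "g \<in> carrier G" for g
      proof -
        have "(g \<otimes> a \<otimes> inv g) \<otimes> (g \<otimes> b \<otimes> inv g) \<in> H" using a b g by (auto simp: N_def)
        moreover have "(g \<otimes> a \<otimes> inv g) \<otimes> (g \<otimes> b \<otimes> inv g) = g \<otimes> (a \<otimes> b) \<otimes> inv g"
          using ab g by (simp add: m_assoc inv_solve_left) (simp flip: m_assoc)
        ultimately show ?thesis by simp
      qed
      then show ?thesis using ab by (simp add: N_def)
    qed
  qed (auto simp: N_def)
  have NH: "N \<subseteq> H" by (auto simp: N_def dest!: bspec[of _ _ \<one>])
  have normal: "N \<lhd> G"
    unfolding normal_inv_iff
  proof (intro conjI N ballI)
    fix x h assume x: "x \<in> carrier G" and h: "h \<in> N"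
    have "g \<otimes> (x \<otimes> h \<otimes> inv x) \<otimes> inv g \<in> H" if g: "g \<in> carrier G" for g
    proof -
      have "(g \<otimes> x) \<otimes> h \<otimes> inv (g \<otimes> x) \<in> H" using h x g by (simp add: N_def)
      then show ?thesis using h x g by (simp add: N_def m_assoc inv_mult_group)
    qed
    then show "x \<otimes> h \<otimes> inv x \<in> N" using h x by (simp add: N_def)
  qed
  \<comment> \<open>Compactness of \<open>G\<close> is what keeps the intersection of all conjugates
    open: a tube around \<open>G\<close> times the identity gives a neighbourhood all of whose
    conjugates lie in \<open>H\<close>.\<close>
  have "continuous_map (prod_topology T T) T (\<lambda>z. fst z \<otimes> snd z \<otimes> inv (fst z))"
    by (intro continuous_mult_compose continuous_inv_compose continuous_map_fst continuous_map_snd)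
  then have "openin (prod_topology T T) {z \<in> topspace (prod_topology T T). fst z \<otimes> snd z \<otimes> inv (fst z) \<in> H}"
    using oH by (intro openin_continuous_map_preimage)
  moreover have "topspace T \<times> {\<one>} \<subseteq> {z \<in> topspace (prod_topology T T). fst z \<otimes> snd z \<otimes> inv (fst z) \<in> H}"
    by (auto simp: topspace_eq)
  moreover have "compactin T (topspace T)" using compact by (simp add: compact_space_def)
  ultimately have "\<exists>P' Q'. openin T P' \<and> openin T Q' \<and> topspace T \<subseteq> P' \<and> \<one> \<in> Q' \<and>
      P' \<times> Q' \<subseteq> {z \<in> topspace (prod_topology T T). fst z \<otimes> snd z \<otimes> inv (fst z) \<in> H}"
    using one by (intro tube_lemma_left)
  then obtain P' Q' where PQ': "openin T Q'" "topspace T \<subseteq> P'" "\<one> \<in> Q'"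
    "P' \<times> Q' \<subseteq> {z \<in> topspace (prod_topology T T). fst z \<otimes> snd z \<otimes> inv (fst z) \<in> H}"
    by (elim exE conjE)
  have "Q' \<subseteq> N"
  proof
    fix x assume x: "x \<in> Q'"
    have "g \<otimes> x \<otimes> inv g \<in> H" if "g \<in> carrier G" for g
      using subsetD[OF PQ'(4), of "(g, x)"] PQ'(2) x that by (auto simp: topspace_eq)
    then show "x \<in> N" using openin_carrier[OF PQ'(1)] x by (auto simp: N_def)
  qed
  then have "openin T N" using open_subgroup_if_nbhd[OF N PQ'(1,3)] by blast
  then show thesis using that normal NH HV V(6) by blast
qed

lemma closed_subgroupsD:
  assumes "K \<in> closed_subgroups G T"
  shows "subgroup K G" "closedin T K" "K \<subseteq> carrier G" "compactin T K"
  using assms closedin_compact_space[OF compact] subgroup.subset by (auto simp: closed_subgroups_def)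

lemma open_normal_Int:
  assumes "N \<in> ON" "M \<in> ON"
  shows "N \<inter> M \<in> ON"
  using assms normal_subgroup_intersect by blast

lemma set_mult_closed_subgroup:
  assumes N: "N \<in> ON" and K: "K \<in> closed_subgroups G T"
  shows "N <#> K \<in> closed_subgroups G T"
  using N subgroup_normal_set_mult[of N K] closed_subgroupsD[OF K] open_subgroup_closed openin_set_mult[of N K]
  by (auto simp: closed_subgroups_def)

lemma subset_set_mult:
  assumes "N \<in> ON" "K \<subseteq> carrier G"
  shows "K \<subseteq> N <#> K"
proof
  fix k assume "k \<in> K"
  moreover have "\<one> \<in> N" using assms normal_imp_subgroup subgroup.one_closed by blast
  ultimately show "k \<in> N <#> K" using set_multI[of \<one> N k K] assms(2) by auto
qed

lemma set_mult_refine: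
  assumes "N \<in> ON" "M \<in> ON" "N \<subseteq> M" "K \<subseteq> carrier G"
  shows "M <#> (N <#> K) = M <#> K"
  using assms set_mult_absorb by (auto simp: normal_imp_subgroup)

text \<open>The identity satisfies the open condition that \<open>inv y \<otimes> x\<close> avoids
  \<open>K\<close>; an open normal subgroup inside it keeps \<open>x\<close> away from the product.
  Hence \<open>K\<close> is the intersection of its products with open normal subgroups.\<close>

lemma open_normal_avoiding:
  assumes K: "K \<in> closed_subgroups G T" and x: "x \<in> carrier G" "x \<notin> K"
  obtains N where "N \<in> ON" "x \<notin> N <#> K"
proof -
  note K' = closed_subgroupsD[OF K]
  let ?W = "{y \<in> topspace T. inv y \<otimes> x \<in> carrier G - K}"
  have "openin T (carrier G - K)" using K'(2) by (auto simp: closedin_def topspace_eq)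
  then have "openin T ?W"
    using x by (intro openin_continuous_map_preimage[of T T] continuous_mult_compose continuous_inv_compose
        continuous_const continuous_map_id[unfolded id_def])
  moreover have "\<one> \<in> ?W" using x by (simp add: topspace_eq)
  ultimately obtain N where N: "N \<lhd> G" "openin T N" "N \<subseteq> ?W" by (rule open_normal_nbhd)
  have "x \<notin> N <#> K"
  proof
    assume "x \<in> N <#> K"
    then obtain n k where nk: "n \<in> N" "k \<in> K" "x = n \<otimes> k" by (rule set_multE)
    then have "n \<in> carrier G" "k \<in> carrier G" using N(3) K'(3) by (auto simp: topspace_eq)
    then have "inv n \<otimes> x = k" using nk by (simp flip: m_assoc)
    then show False using nk N(3) by auto
  qed
  then show thesis using N that by blast
qed

text \<open>The tube lemma along the compact set \<open>K\<close> shows that a neighbourhood of the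
  identity multiplies \<open>K\<close> into \<open>W\<close>.\<close>

lemma open_normal_product_subset:
  assumes K: "K \<in> closed_subgroups G T" and W: "openin T W" "K \<subseteq> W"
  obtains N where "N \<in> ON" "N <#> K \<subseteq> W"
proof -
  note K' = closed_subgroupsD[OF K]
  have "openin (prod_topology T T) {z \<in> topspace (prod_topology T T). fst z \<otimes> snd z \<in> W}"
    using W(1) by (intro openin_continuous_map_preimage[of _ T] continuous_mult_compose continuous_map_fst continuous_map_snd)
  from tube_lemma_right[OF this K'(4), of \<one>] obtain P Q where PQ: "openin T P" "\<one> \<in> P" "K \<subseteq> Q"
    "P \<times> Q \<subseteq> {z \<in> topspace (prod_topology T T). fst z \<otimes> snd z \<in> W}"
    using W(2) K'(3) by (auto simp: topspace_eq subset_iff)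
  obtain N where N: "N \<lhd> G" "openin T N" "N \<subseteq> P" using open_normal_nbhd[OF PQ(1,2)] by blast
  have "N <#> K \<subseteq> W"
  proof
    fix x assume "x \<in> N <#> K"
    then obtain n k where nk: "n \<in> N" "k \<in> K" "x = n \<otimes> k" by (rule set_multE)
    then have "(n, k) \<in> P \<times> Q" using N(3) PQ(3) by blast
    then have "(n, k) \<in> {z \<in> topspace (prod_topology T T). fst z \<otimes> snd z \<in> W}" using PQ(4) by blast
    then show "x \<in> W" using nk by simp
  qed
  then show thesis using N that by blast
qed

section \<open>The space of closed subgroups\<close>

abbreviation "SG \<equiv> subgroup_space G T"

lemma subgroup_nbhd_self: "K \<in> closed_subgroups G T \<Longrightarrow> K \<in> subgroup_nbhd G T N K"
  by (simp add: subgroup_nbhd_def)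

lemma topspace_subgroup_space [simp]: "topspace SG = closed_subgroups G T"
proof -
  have "carrier G \<lhd> G" using normal_inv_iff subgroup_self by auto
  moreover have "openin T (carrier G)" using openin_topspace[of T] by (simp add: topspace_eq)
  ultimately have "K \<in> \<Union> {subgroup_nbhd G T N K | N K. N \<lhd> G \<and> openin T N \<and> K \<in> closed_subgroups G T}"
    if "K \<in> closed_subgroups G T" for K
    using subgroup_nbhd_self[OF that, of "carrier G"] that by blast
  then show ?thesis
    unfolding subgroup_space_def topology_generated_by_topspace by (auto simp: subgroup_nbhd_def)
qed

lemma openin_subgroup_nbhd: "N \<in> ON \<Longrightarrow> K \<in> closed_subgroups G T \<Longrightarrow> openin SG (subgroup_nbhd G T N K)"
  unfolding subgroup_space_def by (intro topology_generated_by_Basis) blast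

text \<open>The generated topology is analysed by induction on its generation. Intersections are
  handled by \<open>N \<inter> M\<close>, since \<open>N \<inter> M\<close> determines the products
  with both; a generator centred elsewhere equals the one centred at its member
  \<open>K\<close>.\<close>

lemma subgroup_nbhd_basis:
  assumes "openin SG W" "K \<in> W"
  shows "\<exists>N. N \<in> ON \<and> subgroup_nbhd G T N K \<subseteq> W"
proof -
  have KG: "K \<in> closed_subgroups G T" using assms openin_subset topspace_subgroup_space by blast
  have "generate_topology_on {subgroup_nbhd G T N K | N K. N \<lhd> G \<and> openin T N \<and> K \<in> closed_subgroups G T} W"
    using assms(1) unfolding subgroup_space_def openin_topology_generated_by_iff .
  then show ?thesis using assms(2)
  proof induction
    case (Int a b)
    then obtain N M where NM: "N \<in> ON" "subgroup_nbhd G T N K \<subseteq> a" "M \<in> ON" "subgroup_nbhd G T M K \<subseteq> b" by blast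
    have ON: "N \<inter> M \<in> ON" using open_normal_Int NM by blast
    have "subgroup_nbhd G T (N \<inter> M) K \<subseteq> subgroup_nbhd G T N K \<inter> subgroup_nbhd G T M K"
    proof
      fix L assume "L \<in> subgroup_nbhd G T (N \<inter> M) K"
      then have L: "L \<in> closed_subgroups G T" "(N \<inter> M) <#> L = (N \<inter> M) <#> K" by (auto simp: subgroup_nbhd_def)
      have "N <#> L = N <#> K" "M <#> L = M <#> K"
        using set_mult_refine[OF ON NM(1), of L] set_mult_refine[OF ON NM(1), of K]
          set_mult_refine[OF ON NM(3), of L] set_mult_refine[OF ON NM(3), of K]
          closed_subgroupsD(3)[OF L(1)] closed_subgroupsD(3)[OF KG] L(2) by auto
      then show "L \<in> subgroup_nbhd G T N K \<inter> subgroup_nbhd G T M K" using L(1) by (simp add: subgroup_nbhd_def)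
    qed
    then show ?case using ON NM by blast
  next
    case (UN \<K>)
    from UN.prems obtain k where k: "k \<in> \<K>" "K \<in> k" by blast
    from UN.IH[OF k] obtain N where "N \<in> ON" "subgroup_nbhd G T N K \<subseteq> k" by (elim exE conjE)
    then show ?case using k(1) by (intro exI[of _ N] conjI) auto
  next
    case (Basis s)
    from Basis.hyps obtain N K0 where N: "s = subgroup_nbhd G T N K0" "N \<in> ON" by auto
    then have "subgroup_nbhd G T N K = s" using Basis.prems by (auto simp: subgroup_nbhd_def)
    then show ?case using N(2) by (intro exI[of _ N] conjI) simp_all
  qed auto
qed

text \<open>For fixed \<open>N\<close> the neighbourhoods are the fibres of \<open>K\<close> mapped
  to \<open>N <#> K\<close>, so the complement is a union of other neighbourhoods.\<close>

lemma closedin_subgroup_nbhd: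
  assumes N: "N \<in> ON"
  shows "closedin SG (subgroup_nbhd G T N K)"
proof -
  have "closed_subgroups G T - subgroup_nbhd G T N K =
      \<Union> (subgroup_nbhd G T N ` (closed_subgroups G T - subgroup_nbhd G T N K))"
    by (auto simp: subgroup_nbhd_def)
  moreover have "openin SG (\<Union> (subgroup_nbhd G T N ` (closed_subgroups G T - subgroup_nbhd G T N K)))"
    using openin_subgroup_nbhd[OF N] by auto
  ultimately show ?thesis by (auto simp: closedin_def subgroup_nbhd_def)
qed

text \<open>Compactness leaves finitely many cosets of the open subgroup \<open>N\<close>, and each
  product is a union of such cosets.\<close>

lemma finite_open_normal_products:
  assumes N: "N \<in> ON"
  shows "finite {N <#> K | K. K \<in> closed_subgroups G T}"
proof -
  interpret N: normal N G using N by blast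
  have sN: "subgroup N G" by (rule N.subgroup_axioms)
  have un: "N <#> S = \<Union> ((\<lambda>a. N #> a) ` S)" for S by (auto simp: set_mult_def r_coset_def)
  have "\<exists>\<F>. finite \<F> \<and> \<F> \<subseteq> (\<lambda>a. N #> a) ` carrier G \<and> topspace T \<subseteq> \<Union> \<F>"
  proof (rule compactinD)
    show "compactin T (topspace T)" using compact by (simp add: compact_space_def)
    show "openin T C" if "C \<in> (\<lambda>a. N #> a) ` carrier G" for C using that openin_r_coset N by blast
    show "topspace T \<subseteq> \<Union> ((\<lambda>a. N #> a) ` carrier G)" using rcos_self[OF _ sN] by (auto simp: topspace_eq)
  qed
  then obtain \<F> where F: "finite \<F>" "\<F> \<subseteq> (\<lambda>a. N #> a) ` carrier G" "topspace T \<subseteq> \<Union> \<F>" by blast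
  have "N #> a \<in> \<F>" if a: "a \<in> carrier G" for a
  proof -
    obtain C where C: "C \<in> \<F>" "a \<in> C" using F(3) a by (auto simp: topspace_eq)
    then obtain b where "b \<in> carrier G" "C = N #> b" using F(2) by blast
    then have "C = N #> a" using repr_independence[OF _ _ sN] C(2) by blast
    then show ?thesis using C(1) by simp
  qed
  then have img: "(\<lambda>a. N #> a) ` K \<in> Pow \<F>" if "K \<in> closed_subgroups G T" for K
    using closed_subgroupsD(3)[OF that] by blast
  have "{N <#> K | K. K \<in> closed_subgroups G T} \<subseteq> Union ` Pow \<F>"
  proof
    fix L assume "L \<in> {N <#> K | K. K \<in> closed_subgroups G T}"
    then obtain K where K: "K \<in> closed_subgroups G T" "L = N <#> K" by blast
    have "L = \<Union> ((\<lambda>a. N #> a) ` K)" by (simp only: K(2) un)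
    then show "L \<in> Union ` Pow \<F>" using img[OF K(1)] by (rule image_eqI)
  qed
  then show ?thesis by (rule finite_subset) (use F(1) in simp)
qed

lemma openin_prod_discrete:
  assumes "S \<subseteq> P \<times> Q"
  shows "openin (prod_topology (discrete_topology P) (discrete_topology Q)) S"
  unfolding openin_prod_topology_alt
proof (intro allI impI)
  fix x y assume "(x, y) \<in> S"
  then show "\<exists>U V. openin (discrete_topology P) U \<and> openin (discrete_topology Q) V \<and> x \<in> U \<and> y \<in> V \<and> U \<times> V \<subseteq> S"
    using assms by (intro exI[of _ "{x}"] exI[of _ "{y}"]) auto
qed

text \<open>The space of closed subgroups is the inverse limit of the finite discrete spaces
  \<open>{N <#> K}\<close>, hence a continuous image of a closed subspace of their product.\<close>

lemma compact_subgroup_space: "compact_space SG"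
proof -
  define H where "H N = {N <#> K | K. K \<in> closed_subgroups G T}" for N
  define PT where "PT = product_topology (\<lambda>N. discrete_topology (H N)) ON"
  define Z where "Z = {c \<in> topspace PT. \<forall>N \<in> ON. \<forall>M \<in> ON. N \<subseteq> M \<longrightarrow> M <#> c N = c M}"
  have Hc: "L \<in> closed_subgroups G T" if "L \<in> H N" "N \<in> ON" for L N
    using that set_mult_closed_subgroup unfolding H_def by blast
  have "compact_space PT"
    unfolding PT_def using finite_open_normal_products
    by (simp add: compact_space_product_topology compact_space_discrete_topology H_def)
  moreover have "closedin PT Z"
  proof -
    have "closedin PT {c \<in> topspace PT. M <#> c N = c M}" if "N \<in> ON" "M \<in> ON" for N M
    proof -
      have "continuous_map PT (prod_topology (discrete_topology (H N)) (discrete_topology (H M))) (\<lambda>c. (c N, c M))"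
        unfolding PT_def using that by (auto simp: continuous_map_pairwise o_def intro: continuous_map_product_projection)
      moreover have "closedin (prod_topology (discrete_topology (H N)) (discrete_topology (H M)))
          {z \<in> H N \<times> H M. M <#> fst z = snd z}"
        unfolding closedin_def by (auto intro!: openin_prod_discrete)
      ultimately have "closedin PT {c \<in> topspace PT. (c N, c M) \<in> {z \<in> H N \<times> H M. M <#> fst z = snd z}}"
        by (rule closedin_continuous_map_preimage)
      moreover have "{c \<in> topspace PT. (c N, c M) \<in> {z \<in> H N \<times> H M. M <#> fst z = snd z}} =
          {c \<in> topspace PT. M <#> c N = c M}"
        using that by (auto simp: PT_def PiE_iff)
      ultimately show ?thesis by simp
    qed
    then have "closedin PT (\<Inter> (insert (topspace PT)
        {{c \<in> topspace PT. M <#> c N = c M} | N M. N \<in> ON \<and> M \<in> ON \<and> N \<subseteq> M}))"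
      by (intro closedin_Inter) auto
    moreover have "\<Inter> (insert (topspace PT)
        {{c \<in> topspace PT. M <#> c N = c M} | N M. N \<in> ON \<and> M \<in> ON \<and> N \<subseteq> M}) = Z"
      by (auto simp: Z_def)
    ultimately show ?thesis by simp
  qed
  ultimately have cZ: "compactin PT Z" using closedin_compact_space by blast
  \<comment> \<open>The subgroup belonging to a compatible system is the intersection of its
    members. Its surjectivity onto closed subgroups is the statement that \<open>K\<close> is the
    intersection of the sets \<open>N <#> K\<close>.\<close>
  define \<Psi> where "\<Psi> c = (\<Inter>N\<in>ON. c N)" for c :: "'a set \<Rightarrow> 'a set"
  have carrier_ON: "carrier G \<in> ON"
    using normal_inv_iff subgroup_self openin_topspace[of T] by (auto simp: topspace_eq)
  have \<Psi>: "\<Psi> c \<in> closed_subgroups G T" "\<And>N. N \<in> ON \<Longrightarrow> N <#> \<Psi> c = c N" if c: "c \<in> Z" for c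
  proof -
    have cl: "c N \<in> closed_subgroups G T" if "N \<in> ON" for N
      using c that Hc unfolding Z_def PT_def by (auto simp: PiE_iff)
    have step: "M <#> c N = c M" if "N \<in> ON" "M \<in> ON" "N \<subseteq> M" for N M
      using c that unfolding Z_def by blast
    have mono: "c N \<subseteq> c M" if "N \<in> ON" "M \<in> ON" "N \<subseteq> M" for N M
      using subset_set_mult[OF that(2), of "c N"] step[OF that] closed_subgroupsD(3)[OF cl[OF that(1)]] by simp
    have "subgroup (\<Psi> c) G" unfolding \<Psi>_def
      using cl closed_subgroupsD(1) carrier_ON by (intro subgroups_Inter) auto
    moreover have "closedin T (\<Psi> c)" unfolding \<Psi>_def
      using cl closed_subgroupsD(2) carrier_ON by (intro closedin_Inter) auto
    ultimately show "\<Psi> c \<in> closed_subgroups G T" by (simp add: closed_subgroups_def)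
    fix N assume N: "N \<in> ON"
    have sN: "subgroup N G" using N normal_imp_subgroup by blast
    show "N <#> \<Psi> c = c N"
    proof (intro equalityI subsetI)
      fix h assume "h \<in> N <#> \<Psi> c"
      then obtain n l where "n \<in> N" "l \<in> \<Psi> c" "h = n \<otimes> l" by (rule set_multE)
      moreover from this have "l \<in> c N" using N unfolding \<Psi>_def by blast
      ultimately show "h \<in> c N" using set_multI[of n N l "c N"] step[OF N N] by simp
    next
      fix h assume h: "h \<in> c N"
      then have hG: "h \<in> carrier G" using closed_subgroupsD(3)[OF cl[OF N]] by blast
      have cc: "closedin T (N #> h)"
      proof -
        have "N #> h = {y \<in> topspace T. y \<otimes> inv h \<in> N}"
          using subgroup.subset[OF sN] hG by (force simp: r_coset_def topspace_eq m_assoc subset_iff)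
        moreover have "closedin T {y \<in> topspace T. y \<otimes> inv h \<in> N}"
          using hG open_subgroup_closed[OF sN] N by (intro closedin_continuous_map_preimage[of T T]
              continuous_mult_compose continuous_const inv_closed continuous_map_id[unfolded id_def]) auto
        ultimately show ?thesis by simp
      qed
      \<comment> \<open>The hard inclusion: an element of the coset of \<open>h\<close> common to
        all members of the system. Compactness of the coset reduces it to finitely many members, and
        a smaller \<open>M0\<close> inside \<open>N\<close> and all of their indices supplies the
        element, because \<open>c N\<close> is the product of \<open>N\<close> with
        \<open>c M0\<close>.\<close>
      have "(N #> h) \<inter> \<Inter> (c ` ON) \<noteq> {}"
      proof -
        have "compactin T (N #> h)" using closedin_compact_space[OF compact cc] .
        moreover have "(N #> h) \<inter> \<Inter> \<F> \<noteq> {}" if F: "finite \<F>" "\<F> \<subseteq> c ` ON" for \<F>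
        proof -
          obtain \<M> where M: "finite \<M>" "\<M> \<subseteq> ON" "\<F> = c ` \<M>" using finite_subset_image[OF F] by blast
          have "\<exists>M0 \<in> ON. M0 \<subseteq> N \<and> (\<forall>M \<in> \<M>. M0 \<subseteq> M)" using M(1,2)
          proof (induction \<M> rule: finite_induct)
            case empty
            then show ?case using N by blast
          next
            case (insert M \<M>)
            then obtain M0 where "M0 \<in> ON" "M0 \<subseteq> N" "\<forall>M \<in> \<M>. M0 \<subseteq> M" by auto
            then show ?case using open_normal_Int[of M0 M] insert.prems by (intro bexI[of _ "M0 \<inter> M"]) auto
          qed
          then obtain M0 where M0: "M0 \<in> ON" "M0 \<subseteq> N" "\<And>M. M \<in> \<M> \<Longrightarrow> M0 \<subseteq> M" by blast
          have "h \<in> N <#> c M0" using h step[OF M0(1) N M0(2)] by simp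
          then obtain n l where nl: "n \<in> N" "l \<in> c M0" "h = n \<otimes> l" by (rule set_multE)
          have G: "n \<in> carrier G" "l \<in> carrier G"
            using nl subgroup.subset[OF sN] closed_subgroupsD(3)[OF cl[OF M0(1)]] by auto
          have "l = inv n \<otimes> h" using nl G by (simp flip: m_assoc)
          then have "l \<in> N #> h" using nl subgroup.m_inv_closed[OF sN] by (auto simp: r_coset_def)
          moreover have "l \<in> c M" if "M \<in> \<M>" for M
            using mono[OF M0(1) _ M0(3)[OF that]] M(2) that nl(2) by blast
          ultimately show ?thesis using M(3) by blast
        qed
        moreover have "closedin T C" if "C \<in> c ` ON" for C using that cl closed_subgroupsD(2) by blast
        ultimately show ?thesis unfolding compactin_fip by blast
      qed
      then obtain l where l: "l \<in> N #> h" "l \<in> \<Psi> c" unfolding \<Psi>_def by blast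
      then obtain n where n: "n \<in> N" "l = n \<otimes> h" by (auto simp: r_coset_def)
      then have "h = inv n \<otimes> l" using hG subgroup.subset[OF sN] by (simp add: subset_iff flip: m_assoc)
      then show "h \<in> N <#> \<Psi> c" using l(2) n(1) subgroup.m_inv_closed[OF sN] set_multI by simp
    qed
  qed
  have "\<Psi> ` Z = closed_subgroups G T"
  proof (intro equalityI subsetI)
    fix K assume K: "K \<in> closed_subgroups G T"
    let ?c = "\<lambda>N\<in>ON. N <#> K"
    have "?c \<in> Z"
      unfolding Z_def PT_def using K set_mult_refine[OF _ _ _ closed_subgroupsD(3)[OF K]] by (auto simp: H_def)
    moreover have "\<Psi> ?c = K"
    proof (intro equalityI subsetI)
      show "x \<in> \<Psi> ?c" if "x \<in> K" for x
        unfolding \<Psi>_def using that subset_set_mult[OF _ closed_subgroupsD(3)[OF K]] by auto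
      fix x assume x: "x \<in> \<Psi> ?c"
      then have "x \<in> carrier G <#> K" using carrier_ON unfolding \<Psi>_def by auto
      then have xG: "x \<in> carrier G" using setmult_subset_G[of "carrier G" K] closed_subgroupsD(3)[OF K] by blast
      show "x \<in> K"
      proof (rule ccontr)
        assume "x \<notin> K"
        then obtain N where "N \<in> ON" "x \<notin> N <#> K" using open_normal_avoiding[OF K xG] by blast
        then show False using x unfolding \<Psi>_def by auto
      qed
    qed
    ultimately show "K \<in> \<Psi> ` Z" by blast
  qed (use \<Psi>(1) in blast)
  moreover have "continuous_map (subtopology PT Z) SG \<Psi>"
    unfolding continuous_map_pointwise
  proof (intro conjI ballI allI impI)
    show "\<Psi> \<in> topspace (subtopology PT Z) \<rightarrow> topspace SG" using \<Psi>(1) by auto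
    fix c W assume c: "c \<in> topspace (subtopology PT Z)" and W: "openin SG W" "\<Psi> c \<in> W"
    obtain N where N: "N \<in> ON" "subgroup_nbhd G T N (\<Psi> c) \<subseteq> W" using subgroup_nbhd_basis[OF W] by blast
    have "c N \<in> H N" using c N by (auto simp: PT_def PiE_iff)
    \<comment> \<open>As \<open>\<Psi> c\<close> has product \<open>c N\<close> with
      \<open>N\<close>, the neighbourhood given by \<open>N\<close> pulls back to a condition on the
      single discrete coordinate \<open>N\<close>.\<close>
    then have "openin PT {c' \<in> topspace PT. c' N \<in> {c N}}"
      unfolding PT_def using N
      by (intro openin_continuous_map_preimage[OF continuous_map_product_projection]) auto
    then have "openin (subtopology PT Z) (Z \<inter> {c' \<in> topspace PT. c' N \<in> {c N}})"
      by (rule openin_subtopology_Int2)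
    moreover have "\<Psi> c' \<in> W" if "c' \<in> Z \<inter> {c' \<in> topspace PT. c' N \<in> {c N}}" for c'
      using that c N \<Psi>[of c'] \<Psi>(2)[of c N] by (auto simp: subgroup_nbhd_def)
    ultimately show "\<exists>V. openin (subtopology PT Z) V \<and> c \<in> V \<and> (\<forall>c'\<in>V. \<Psi> c' \<in> W)"
      using c by (intro exI[of _ "Z \<inter> {c' \<in> topspace PT. c' N \<in> {c N}}"]) auto
  qed
  ultimately show ?thesis
    using image_compactin[of "subtopology PT Z" Z SG \<Psi>] cZ by (simp add: compact_space_def compactin_subtopology)
qed

section \<open>Conjugation of closed subgroups\<close>

lemma conj_eq:
  assumes g: "g \<in> carrier G" and K: "K \<subseteq> carrier G"
  shows "g <# K #> inv g = {y \<in> carrier G. inv g \<otimes> y \<otimes> g \<in> K}"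
proof (intro equalityI subsetI)
  fix y assume "y \<in> g <# K #> inv g"
  then obtain k where k: "k \<in> K" "y = g \<otimes> k \<otimes> inv g" by (auto simp: l_coset_def r_coset_def)
  moreover have "k \<in> carrier G" using k K by blast
  ultimately have "inv g \<otimes> y \<otimes> g = k" using g by (simp add: m_assoc) (simp flip: m_assoc)
  then show "y \<in> {y \<in> carrier G. inv g \<otimes> y \<otimes> g \<in> K}" using k g \<open>k \<in> carrier G\<close> by simp
next
  fix y assume y: "y \<in> {y \<in> carrier G. inv g \<otimes> y \<otimes> g \<in> K}"
  then have "y = g \<otimes> (inv g \<otimes> y \<otimes> g) \<otimes> inv g" using g by (simp add: m_assoc) (simp flip: m_assoc)
  then show "y \<in> g <# K #> inv g" using y unfolding l_coset_def r_coset_def by blast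
qed

lemma conj_closed_subgroup:
  assumes g: "g \<in> carrier G" and K: "K \<in> closed_subgroups G T"
  shows "g <# K #> inv g \<in> closed_subgroups G T"
proof -
  have "closedin T {y \<in> topspace T. inv g \<otimes> y \<otimes> g \<in> K}"
    using g closed_subgroupsD(2)[OF K]
    by (intro closedin_continuous_map_preimage[of T T] continuous_mult_compose continuous_const inv_closed
        continuous_map_id[unfolded id_def])
  then show ?thesis
    using subgroup_conjugation_is_surj2[OF g closed_subgroupsD(1)[OF K]] conj_eq[OF g closed_subgroupsD(3)[OF K]]
    by (simp add: closed_subgroups_def topspace_eq)
qed

lemma subgroup_conj_simps:
  assumes "K \<in> closed_subgroups G T"
  shows "subgroup_conj G T g K = g <# K #> inv g"
    "g \<in> carrier G \<Longrightarrow> subgroup_conj G T g K = {y \<in> carrier G. inv g \<otimes> y \<otimes> g \<in> K}"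
    "g \<in> carrier G \<Longrightarrow> subgroup_conj G T g K \<in> closed_subgroups G T"
  using assms conj_eq closed_subgroupsD(3) conj_closed_subgroup by (auto simp: subgroup_conj_def)

lemma subgroup_conj_self:
  assumes K: "K \<in> closed_subgroups G T" and k: "k \<in> K"
  shows "subgroup_conj G T k K = K"
proof -
  interpret K: subgroup K G using closed_subgroupsD(1)[OF K] .
  have "inv k \<otimes> y \<otimes> k \<in> K \<longleftrightarrow> y \<in> K" if "y \<in> carrier G" for y
  proof
    assume "inv k \<otimes> y \<otimes> k \<in> K"
    then have "k \<otimes> (inv k \<otimes> y \<otimes> k) \<otimes> inv k \<in> K" using k by simp
    moreover have "k \<otimes> (inv k \<otimes> y \<otimes> k) \<otimes> inv k = y"
      using that k by (simp add: m_assoc) (simp flip: m_assoc)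
    ultimately show "y \<in> K" by simp
  qed (use k in simp)
  then show ?thesis using K k K.subset by (auto simp: subgroup_conj_simps(2))
qed

text \<open>Modulo an open normal \<open>N\<close>, the conjugate of \<open>L\<close> by
  \<open>h\<close> depends only on the coset of \<open>h\<close> and the image of \<open>L\<close>.
  So the coset of \<open>g\<close> times the neighbourhood of \<open>K\<close> given by
  \<open>N\<close> is carried into the neighbourhood of the conjugate given by the same
  \<open>N\<close>.\<close>

lemma continuous_subgroup_conj: "continuous_action G T SG (subgroup_conj G T)"
  unfolding continuous_action_def
proof
  show "group_action G (topspace SG) (subgroup_conj G T)"
  proof (rule group_actionI)
    show "subgroup_conj G T g \<in> extensional (topspace SG)" for g by (simp add: subgroup_conj_def)
    show "subgroup_conj G T \<one> K = K" if "K \<in> topspace SG" for K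
      using that closed_subgroupsD(3)[of K] by (auto simp: subgroup_conj_simps(2))
    show "subgroup_conj G T (g \<otimes> h) K = subgroup_conj G T g (subgroup_conj G T h K)"
      if "g \<in> carrier G" "h \<in> carrier G" "K \<in> topspace SG" for g h K
    proof -
      have K: "K \<in> closed_subgroups G T" using that(3) by simp
      have "subgroup_conj G T g (subgroup_conj G T h K) = {y \<in> carrier G. inv g \<otimes> y \<otimes> g \<in> {y \<in> carrier G. inv h \<otimes> y \<otimes> h \<in> K}}"
        by (rule trans[OF subgroup_conj_simps(2)[OF subgroup_conj_simps(3)[OF K that(2)] that(1)]])
          (simp only: subgroup_conj_simps(2)[OF K that(2)])
      also have "\<dots> = subgroup_conj G T (g \<otimes> h) K"
        unfolding subgroup_conj_simps(2)[OF K m_closed[OF that(1,2)]] using that by (auto simp: inv_mult_group m_assoc)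
      finally show ?thesis by simp
    qed
  qed (auto simp: is_group subgroup_conj_simps(3))
  show "continuous_map (prod_topology T SG) SG (\<lambda>(g, K). subgroup_conj G T g K)"
    unfolding continuous_map_pointwise
  proof (intro conjI ballI allI impI)
    show "(\<lambda>(g, K). subgroup_conj G T g K) \<in> topspace (prod_topology T SG) \<rightarrow> topspace SG"
      by (auto simp: subgroup_conj_simps(3) topspace_eq)
    fix z W assume z: "z \<in> topspace (prod_topology T SG)" and W: "openin SG W"
      "(\<lambda>(g, K). subgroup_conj G T g K) z \<in> W"
    obtain g K where gK: "z = (g, K)" "g \<in> carrier G" "K \<in> closed_subgroups G T"
      using z by (auto simp: topspace_eq)
    obtain N where N: "N \<in> ON" "subgroup_nbhd G T N (subgroup_conj G T g K) \<subseteq> W"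
      using subgroup_nbhd_basis[OF W(1), of "subgroup_conj G T g K"] W(2) gK by auto
    interpret N: normal N G using N by blast
    \<comment> \<open>Normality lets the coset of \<open>h l h^-1\<close> be computed from cosets;
      the right side mentions \<open>h\<close> and \<open>L\<close> only through their images modulo
      \<open>N\<close>.\<close>
    have img: "(\<lambda>a. N #> a) ` (h <# L #> inv h) = (\<lambda>C. (N #> h) <#> C <#> (N #> inv h)) ` (\<lambda>a. N #> a) ` L"
      if "h \<in> carrier G" "L \<in> closed_subgroups G T" for h L
    proof -
      have "h <# L #> inv h = (\<lambda>l. h \<otimes> l \<otimes> inv h) ` L" by (auto simp: l_coset_def r_coset_def)
      then show ?thesis
        using that closed_subgroupsD(3)[OF that(2)] by (auto simp: image_image N.rcos_sum subset_iff intro!: image_cong)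
    qed
    have "subgroup_conj G T h L \<in> W" if h: "h \<in> N #> g" and L: "L \<in> subgroup_nbhd G T N K" for h L
    proof -
      have hG: "h \<in> carrier G" using h gK(2) r_coset_subset_G[OF N.subset] by blast
      have LG: "L \<in> closed_subgroups G T" "N <#> L = N <#> K" using L by (auto simp: subgroup_nbhd_def)
      have eq: "N #> h = N #> g" using repr_independence[OF h gK(2) N.subgroup_axioms] by simp
      have eq': "N #> inv h = N #> inv g" using N.rcos_inv[OF hG] N.rcos_inv[OF gK(2)] eq by simp
      have "(\<lambda>a. N #> a) ` L = (\<lambda>a. N #> a) ` K"
        using normal_set_mult_eq_iff[OF N.normal_axioms] LG closed_subgroupsD(3) gK(3) by blast
      then have "(\<lambda>a. N #> a) ` (h <# L #> inv h) = (\<lambda>a. N #> a) ` (g <# K #> inv g)"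
        unfolding img[OF hG LG(1)] img[OF gK(2,3)] eq eq' by simp
      then have "N <#> (h <# L #> inv h) = N <#> (g <# K #> inv g)"
        using normal_set_mult_eq_iff[OF N.normal_axioms] closed_subgroupsD(3)[OF conj_closed_subgroup[OF hG LG(1)]]
          closed_subgroupsD(3)[OF conj_closed_subgroup[OF gK(2,3)]] by blast
      then have "subgroup_conj G T h L \<in> subgroup_nbhd G T N (subgroup_conj G T g K)"
        using hG LG(1) gK by (simp add: subgroup_nbhd_def subgroup_conj_simps(1) conj_closed_subgroup)
      then show ?thesis using N(2) by blast
    qed
    moreover have "openin (prod_topology T SG) ((N #> g) \<times> subgroup_nbhd G T N K)"
      unfolding openin_prod_Times_iff using openin_r_coset[of N g] openin_subgroup_nbhd[OF N(1) gK(3)] N(1) gK(2) by blast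
    moreover have "z \<in> (N #> g) \<times> subgroup_nbhd G T N K"
      using gK rcos_self[OF gK(2) N.subgroup_axioms] subgroup_nbhd_self by blast
    ultimately show "\<exists>V. openin (prod_topology T SG) V \<and> z \<in> V \<and>
        (\<forall>w\<in>V. (\<lambda>(g, K). subgroup_conj G T g K) w \<in> W)"
      by (intro exI[of _ "(N #> g) \<times> subgroup_nbhd G T N K"]) auto
  qed
qed

end

section \<open>Weyl sheaves\<close>

text \<open>The bound on the number of closed subgroups covers both the points of the space and its
  compact open basic sets, as required by \<open>small_space\<close>.\<close>

locale weyl_universe = profinite_group G T
  for G :: "('g, 'z) monoid_scheme" (structure) and T +
  fixes R :: "('r, 'y) ring_scheme" and U :: "'e set"
  assumes R: "ring R" and infinite_U: "infinite U" and SG_lepoll: "closed_subgroups G T \<lesssim> U"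
begin

sublocale small_space G T SG "subgroup_conj G T" R U
  "{subgroup_nbhd G T N K | N K. N \<in> ON \<and> K \<in> closed_subgroups G T}"
proof (intro small_space.intro group_space.intro small_space_axioms.intro group_space_axioms.intro)
  show "topological_group G T" by (rule topological_group_axioms)
  have "{subgroup_nbhd G T N K | N K. N \<in> ON \<and> K \<in> closed_subgroups G T} \<subseteq>
      (\<lambda>(N, K). subgroup_nbhd G T N K) ` (closed_subgroups G T \<times> closed_subgroups G T)"
  proof
    fix b assume "b \<in> {subgroup_nbhd G T N K | N K. N \<in> ON \<and> K \<in> closed_subgroups G T}"
    then obtain N K where NK: "b = subgroup_nbhd G T N K" "N \<in> ON" "K \<in> closed_subgroups G T" by blast
    \<comment> \<open>An open subgroup is closed, so basic sets are indexed by pairs of closed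
      subgroups and \<open>SG_lepoll\<close> counts them.\<close>
    have "N \<in> closed_subgroups G T"
      using NK(2) open_subgroup_closed[of N] normal_imp_subgroup[of N] by (auto simp: closed_subgroups_def)
    then show "b \<in> (\<lambda>(N, K). subgroup_nbhd G T N K) ` (closed_subgroups G T \<times> closed_subgroups G T)"
      using NK by auto
  qed
  then show "{subgroup_nbhd G T N K | N K. N \<in> ON \<and> K \<in> closed_subgroups G T} \<lesssim> U"
    by (rule lepoll_trans[OF subset_image_lepoll infinite_times_lepoll[OF infinite_U SG_lepoll SG_lepoll]])
  show "compactin SG b" if "b \<in> {subgroup_nbhd G T N K | N K. N \<in> ON \<and> K \<in> closed_subgroups G T}" for b
    using that closedin_compact_space[OF compact_subgroup_space closedin_subgroup_nbhd] by blast
  show "openin SG b" if "b \<in> {subgroup_nbhd G T N K | N K. N \<in> ON \<and> K \<in> closed_subgroups G T}" for b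
    using that openin_subgroup_nbhd by blast
  show "\<exists>b\<in>{subgroup_nbhd G T N K | N K. N \<in> ON \<and> K \<in> closed_subgroups G T}. K \<in> b \<and> b \<subseteq> W"
    if W: "openin SG W" "K \<in> W" for W K
  proof -
    have K: "K \<in> closed_subgroups G T" using openin_subset[OF W(1)] W(2) by auto
    obtain N where "N \<in> ON" "subgroup_nbhd G T N K \<subseteq> W" using subgroup_nbhd_basis[OF W] by (elim exE conjE)
    then show ?thesis using K subgroup_nbhd_self[OF K, of N] by (intro bexI[of _ "subgroup_nbhd G T N K"]) auto
  qed
  show "topspace SG \<lesssim> U" using SG_lepoll by simp
qed (rule R infinite_U continuous_subgroup_conj)+

lemma proj_subgroup: "sheaf E \<Longrightarrow> e \<in> topspace (total E) \<Longrightarrow> proj E e \<in> closed_subgroups G T"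
  using proj_closed[of E e] by simp

lemma stabiliser_fixes:
  assumes "sheaf E" "e \<in> topspace (total E)" "k \<in> proj E e"
  shows "k \<in> carrier G" "subgroup_conj G T k (proj E e) = proj E e"
  using subgroup_conj_self[OF proj_subgroup[OF assms(1,2)] assms(3)]
    closed_subgroupsD(3)[OF proj_subgroup[OF assms(1,2)]] assms(3) by auto

lemma weyl_setI:
  assumes E: "sheaf E" and "e \<in> topspace (total E)" "\<And>k. k \<in> proj E e \<Longrightarrow> gact E k e = e"
  shows "e \<in> weyl_set E"
  using assms by (simp add: weyl_set_def)

lemma weyl_setD: "e \<in> weyl_set E \<Longrightarrow> e \<in> topspace (total E)"
  "e \<in> weyl_set E \<Longrightarrow> k \<in> proj E e \<Longrightarrow> gact E k e = e"
  by (auto simp: weyl_set_def)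

text \<open>A section \<open>t\<close> through a fixed point \<open>e\<close> over \<open>K\<close>
  is equivariant at \<open>K\<close> for all elements of \<open>K\<close>. By compactness this holds
  for an open \<open>P\<close> around \<open>K\<close> and all points near \<open>K\<close>. Every
  \<open>L\<close> with the same product as \<open>K\<close> with a small \<open>N\<close> is
  contained in \<open>P\<close>, so \<open>L\<close> acts on the value of \<open>t\<close> at
  \<open>L\<close> as on the point \<open>L\<close>, that is, trivially.\<close>

lemma openin_weyl_set:
  assumes E: "sheaf E"
  shows "openin (total E) (weyl_set E)"
proof (subst openin_subopen, safe)
  fix e assume e: "e \<in> weyl_set E"
  note eE = weyl_setD(1)[OF e]
  let ?K = "proj E e"
  have K: "?K \<in> closed_subgroups G T" using proj_subgroup[OF E eE] .
  obtain V t where t: "local_section SG E V t" "?K \<in> V" "t ?K = e"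
    using section_homeo_through[OF E eE] eE by (metis imageI)
  let ?S = "{(g, L) \<in> carrier G \<times> V. subgroup_conj G T g L \<in> V \<and> gact E g (t L) = t (subgroup_conj G T g L)}"
  have "?K \<times> {?K} \<subseteq> ?S"
    using t weyl_setD(2)[OF e] stabiliser_fixes[OF E eE] by auto
  moreover have "?K \<in> topspace SG" using K by simp
  ultimately have "\<exists>P Q. openin T P \<and> openin SG Q \<and> ?K \<subseteq> P \<and> ?K \<in> Q \<and> P \<times> Q \<subseteq> ?S"
    using openin_section_equivariant[OF E t(1)] closed_subgroupsD(4)[OF K] by (intro tube_lemma_left)
  then obtain P Q where PQ: "openin T P" "openin SG Q" "?K \<subseteq> P" "?K \<in> Q" "P \<times> Q \<subseteq> ?S" by (elim exE conjE)
  obtain N where N: "N \<in> ON" "N <#> ?K \<subseteq> P" using open_normal_product_subset[OF K PQ(1,3)] .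
  let ?Y = "subgroup_nbhd G T N ?K \<inter> Q"
  have Y: "openin SG ?Y" using openin_subgroup_nbhd[OF N(1) K] PQ(2) by blast
  \<comment> \<open>The identity belongs to \<open>K\<close> and thus to \<open>P\<close>, so the
    tube already confines \<open>Q\<close> to \<open>V\<close>.\<close>
  have YV: "?Y \<subseteq> V"
  proof
    fix L assume "L \<in> ?Y"
    moreover have "\<one> \<in> P" using PQ(3) subgroup.one_closed[OF closed_subgroupsD(1)[OF K]] by blast
    ultimately show "L \<in> V" using subsetD[OF PQ(5), of "(\<one>, L)"] by auto
  qed
  have "t L \<in> weyl_set E" if L: "L \<in> ?Y" for L
  proof (rule weyl_setI[OF E])
    have LV: "L \<in> V" using L YV by blast
    show tL: "t L \<in> topspace (total E)" using local_sectionD(4)[OF t(1) LV] .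
    fix l assume "l \<in> proj E (t L)"
    then have l: "l \<in> L" using local_sectionD(5)[OF t(1) LV] by simp
    have LG: "L \<in> closed_subgroups G T" "N <#> L = N <#> ?K" using L by (auto simp: subgroup_nbhd_def)
    \<comment> \<open>\<open>L\<close> lies in \<open>N <#> L\<close>, which equals
      \<open>N <#> ?K\<close> and is contained in \<open>P\<close>.\<close>
    then have "l \<in> P" using subset_set_mult[OF N(1) closed_subgroupsD(3)[OF LG(1)]] l N(2) by auto
    then have "gact E l (t L) = t (subgroup_conj G T l L)" using subsetD[OF PQ(5), of "(l, L)"] L by auto
    then show "gact E l (t L) = t L" using subgroup_conj_self[OF LG(1) l] by simp
  qed
  then have "t ` ?Y \<subseteq> weyl_set E" by (intro image_subsetI)
  moreover have "e \<in> t ` ?Y" using t(3) PQ(4) subgroup_nbhd_self[OF K, of N] by (intro image_eqI[of e t ?K]) auto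
  ultimately show "\<exists>O'. openin (total E) O' \<and> e \<in> O' \<and> O' \<subseteq> weyl_set E"
    using openin_section_image[OF E t(1) Y YV] by (intro exI conjI)
qed

lemma stable_weyl_set:
  assumes E: "sheaf E"
  shows "stable_subset E (weyl_set E)"
  unfolding stable_subset_def
proof (intro conjI ballI impI openin_weyl_set E)
  fix K assume K: "K \<in> topspace SG"
  show "szero E K \<in> weyl_set E"
  proof (rule weyl_setI[OF E])
    show "szero E K \<in> topspace (total E)" using szero_closed(1)[OF E K] .
    fix k assume "k \<in> proj E (szero E K)"
    then show "gact E k (szero E K) = szero E K"
      using stabiliser_fixes[OF E szero_closed(1)[OF E K], of k] gact_szero[OF E _ K, of k] szero_closed(2)[OF E K] by simp
  qed
next
  fix a b assume a: "a \<in> weyl_set E" and b: "b \<in> weyl_set E" and ab: "proj E a = proj E b"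
  note m = weyl_setD(1)[OF a] weyl_setD(1)[OF b]
  show "sminus E a b \<in> weyl_set E"
  proof (rule weyl_setI[OF E])
    show "sminus E a b \<in> topspace (total E)" using sminus_closed(1)[OF E m ab] .
    fix k assume "k \<in> proj E (sminus E a b)"
    then have "k \<in> proj E b" "k \<in> proj E a" using sminus_closed(2)[OF E m ab] ab by auto
    then show "gact E k (sminus E a b) = sminus E a b"
      using gact_sminus[OF E _ m ab, of k] weyl_setD(2)[OF a] weyl_setD(2)[OF b] stabiliser_fixes(1)[OF E m(2)] by simp
  qed
next
  fix r a assume r: "r \<in> carrier R" and a: "a \<in> weyl_set E"
  note m = weyl_setD(1)[OF a]
  show "ssmult E r a \<in> weyl_set E"
  proof (rule weyl_setI[OF E])
    show "ssmult E r a \<in> topspace (total E)" using ssmult_closed(1)[OF E r m] .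
    fix k assume "k \<in> proj E (ssmult E r a)"
    then have "k \<in> proj E a" using ssmult_closed(2)[OF E r m] by simp
    then show "gact E k (ssmult E r a) = ssmult E r a"
      using gact_ssmult[OF E _ r m, of k] weyl_setD(2)[OF a] stabiliser_fixes(1)[OF E m] by simp
  qed
next
  fix g a assume g: "g \<in> carrier G" and a: "a \<in> weyl_set E"
  note m = weyl_setD(1)[OF a]
  show "gact E g a \<in> weyl_set E"
  proof (rule weyl_setI[OF E])
    show ga: "gact E g a \<in> topspace (total E)" using gact_closed(1)[OF E g m] .
    fix k assume "k \<in> proj E (gact E g a)"
    then have k: "k \<in> carrier G" "inv g \<otimes> k \<otimes> g \<in> proj E a"
      using gact_closed(2)[OF E g m] subgroup_conj_simps(2)[OF proj_subgroup[OF E m] g] by auto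
    have "gact E k (gact E g a) = gact E (k \<otimes> g) a" using gact_mult[OF E k(1) g m] by simp
    \<comment> \<open>The translate lies over the conjugate subgroup; moving \<open>k\<close> past
      \<open>g\<close> produces an element of the original subgroup, which fixes
      \<open>a\<close>.\<close>
    also have "k \<otimes> g = g \<otimes> (inv g \<otimes> k \<otimes> g)" using k(1) g by (simp flip: m_assoc)
    also have "gact E \<dots> a = gact E g (gact E (inv g \<otimes> k \<otimes> g) a)" using gact_mult[OF E g _ m] k(1) g by simp
    finally show "gact E k (gact E g a) = gact E g a" using weyl_setD(2)[OF a k(2)] by simp
  qed
qed

section \<open>Weyl sheaves as subsheaves of fixed points\<close>

lemma weyl_sheaf_subsheaf: "weyl_sheaf G R E = subsheaf G R E (weyl_set E)"
  by (simp add: weyl_sheaf_def subsheaf_def Let_def)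

lemma sheaf_weyl: "sheaf E \<Longrightarrow> sheaf (weyl_sheaf G R E)"
  unfolding weyl_sheaf_subsheaf by (intro sheaf_subsheaf stable_weyl_set)

lemma topspace_weyl: "topspace (total (weyl_sheaf G R E)) = weyl_set E"
  by (auto simp: weyl_sheaf_subsheaf dest: weyl_setD(1))

lemma is_weylD: "is_weyl G T E \<Longrightarrow> sheaf E \<Longrightarrow> e \<in> topspace (total E) \<Longrightarrow> k \<in> proj E e \<Longrightarrow> gact E k e = e"
  using proj_subgroup[of E e] unfolding is_weyl_def by auto

lemma is_weylI: "(\<And>e k. e \<in> topspace (total E) \<Longrightarrow> k \<in> proj E e \<Longrightarrow> gact E k e = e) \<Longrightarrow> is_weyl G T E"
  unfolding is_weyl_def by auto

lemma weyl_set_is_weyl: "sheaf E \<Longrightarrow> is_weyl G T E \<Longrightarrow> weyl_set E = topspace (total E)"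
  by (auto intro!: weyl_setI intro: is_weylD dest: weyl_setD(1))

lemma is_weyl_subsheaf:
  assumes E: "sheaf E" and "W \<subseteq> weyl_set E"
  shows "is_weyl G T (subsheaf G R E W)"
proof (rule is_weylI)
  fix e k assume e: "e \<in> topspace (total (subsheaf G R E W))" and k: "k \<in> proj (subsheaf G R E W) e"
  then have eW: "e \<in> W" by simp
  then have "e \<in> weyl_set E" "k \<in> proj E e" using assms(2) k by auto
  then show "gact (subsheaf G R E W) k e = e"
    using stabiliser_fixes(1)[OF E weyl_setD(1)] weyl_setD(2) eW by simp
qed

lemma is_weyl_weyl: "sheaf E \<Longrightarrow> is_weyl G T (weyl_sheaf G R E)"
  unfolding weyl_sheaf_subsheaf by (intro is_weyl_subsheaf order_refl)

text \<open>The extensionality clauses of \<open>equivariant_sheaf\<close> make this an equality of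
  records and not merely an isomorphism. It gives strict idempotence of the composite
  functor.\<close>

lemma subsheaf_topspace:
  assumes E: "sheaf E"
  shows "subsheaf G R E (topspace (total E)) = E"
proof (rule gsheaf.equality)
  let ?S = "subsheaf G R E (topspace (total E))"
  show "total ?S = total E" by simp
  show "proj ?S = proj E"
    using equivariant_sheaf.proj_ext[OF E] by (simp add: subsheaf_def extensional_restrict)
  show "gact ?S = gact E"
  proof
    fix g
    have "gact E g \<in> extensional (topspace (total E))" if "g \<in> carrier G"
      using group_action.bij_prop0[OF group_action_gact[OF E] that] by (simp add: Bij_def)
    moreover have "gact E g = undefined" if "g \<notin> carrier G"
      using equivariant_sheaf.gact_ext[OF E] that by (simp add: extensional_def)
    ultimately show "gact ?S g = gact E g" by (auto simp: subsheaf_def extensional_restrict)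
  qed
  show "sadd ?S = sadd E"
    using equivariant_sheaf.sadd_ext[OF E] by (auto simp: subsheaf_def fun_eq_iff fibre_product_def)
  show "ssmult ?S = ssmult E"
  proof
    fix r
    have "ssmult E r = undefined" if "r \<notin> carrier R"
      using equivariant_sheaf.ssmult_ext(1)[OF E] that by (simp add: extensional_def)
    then show "ssmult ?S r = ssmult E r"
      using equivariant_sheaf.ssmult_ext(2)[OF E, of r] by (auto simp: subsheaf_def extensional_restrict)
  qed
qed (simp_all add: subsheaf_def)

lemma weyl_sheaf_id: "sheaf E \<Longrightarrow> is_weyl G T E \<Longrightarrow> weyl_sheaf G R E = E"
  by (simp add: weyl_sheaf_subsheaf weyl_set_is_weyl subsheaf_topspace)

lemma sheaf_map_weyl_set:
  assumes E: "sheaf E" and F: "sheaf F" and f: "f \<in> sheaf_maps G SG R E F" and e: "e \<in> weyl_set E"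
  shows "f e \<in> weyl_set F"
proof (rule weyl_setI[OF F])
  note m = weyl_setD(1)[OF e]
  show "f e \<in> topspace (total F)" using sheaf_map_closed[OF E F f m] .
  fix k assume "k \<in> proj F (f e)"
  then have k: "k \<in> proj E e" using sheaf_map_proj[OF E F f m] by simp
  then show "gact F k (f e) = f e"
    using sheaf_map_gact[OF E F f _ m, of k] stabiliser_fixes(1)[OF E m k] weyl_setD(2)[OF e k] by simp
qed

text \<open>An element fixed by \<open>K\<close> has a fixed image under an equivariant map over the
  base. So both sets consist of the same functions, and the adjunction merely changes the recorded
  codomain.\<close>

lemma sheaf_maps_weyl_target:
  assumes M: "sheaf M" "is_weyl G T M" and E: "sheaf E"
  shows "sheaf_maps G SG R M (weyl_sheaf G R E) = sheaf_maps G SG R M E"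
proof (intro equalityI subsetI)
  fix f assume f: "f \<in> sheaf_maps G SG R M E"
  show "f \<in> sheaf_maps G SG R M (weyl_sheaf G R E)"
    unfolding weyl_sheaf_subsheaf
    by (rule sheaf_maps_into_subsheaf[OF M(1) E stable_weyl_set[OF E] f])
      (use sheaf_map_weyl_set[OF M(1) E f] weyl_set_is_weyl[OF M] in auto)
next
  fix f assume f: "f \<in> sheaf_maps G SG R M (weyl_sheaf G R E)"
  note S = sheaf_weyl[OF E]
  have cl: "f m \<in> weyl_set E" if "m \<in> topspace (total M)" for m
    using sheaf_map_closed[OF M(1) S f that] by (simp add: topspace_weyl)
  have "compose (topspace (total M)) (\<lambda>e\<in>weyl_set E. e) f \<in> sheaf_maps G SG R M E"
    using sheaf_maps_comp[OF M(1) S E f] sheaf_maps_inclusion[OF E stable_weyl_set[OF E]]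
    unfolding weyl_sheaf_subsheaf by blast
  moreover have "compose (topspace (total M)) (\<lambda>e\<in>weyl_set E. e) f = f"
    using cl sheaf_map_ext[OF M(1) S f] by (auto simp: compose_def fun_eq_iff extensional_def)
  ultimately show "f \<in> sheaf_maps G SG R M E" by simp
qed

lemma sheaf_maps_weyl:
  assumes E: "sheaf E" and F: "sheaf F" and f: "f \<in> sheaf_maps G SG R E F"
  shows "restrict f (weyl_set E) \<in> sheaf_maps G SG R (weyl_sheaf G R E) (weyl_sheaf G R F)"
proof -
  have "restrict f (weyl_set E) \<in> sheaf_maps G SG R (weyl_sheaf G R E) F"
    using sheaf_maps_from_subsheaf[OF F E stable_weyl_set[OF E] f] by (simp add: weyl_sheaf_subsheaf)
  then show ?thesis using sheaf_maps_weyl_target[OF sheaf_weyl[OF E] is_weyl_weyl[OF E] F] by simp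
qed

section \<open>The categories of sheaves and Weyl sheaves\<close>

text \<open>The set \<open>V\<close> is a parameter independent of the fixed \<open>U\<close>, so
  that limits and colimits with total space in \<open>U\<close> can be tested in larger
  universes.\<close>

abbreviation "\<S> V \<equiv> gsheaf_cat G T R V"
abbreviation "\<W> V \<equiv> weyl_cat G T R V"

lemma S_Obj: "E \<in> Obj (\<S> V) \<longleftrightarrow> sheaf E \<and> topspace (total E) \<subseteq> V"
  and S_Arr: "(E, f, F) \<in> Arr (\<S> V) \<longleftrightarrow> E \<in> Obj (\<S> V) \<and> F \<in> Obj (\<S> V) \<and> f \<in> sheaf_maps G SG R E F"
  and S_simps: "Dom (\<S> V) (E, f, F) = E" "Cod (\<S> V) (E, f, F) = F"
    "Idt (\<S> V) E = (E, (\<lambda>e \<in> topspace (total E). e), E)"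
    "(F', g, H) \<cdot>\<^bsub>\<S> V\<^esub> (E, f, F) = (E, compose (topspace (total E)) g f, H)"
  by (auto simp: gsheaf_cat_def sheaf_cat_def Let_def)

lemma W_Obj: "E \<in> Obj (\<W> V) \<longleftrightarrow> sheaf E \<and> topspace (total E) \<subseteq> V \<and> is_weyl G T E"
  and W_Arr: "(E, f, F) \<in> Arr (\<W> V) \<longleftrightarrow> E \<in> Obj (\<W> V) \<and> F \<in> Obj (\<W> V) \<and> f \<in> sheaf_maps G SG R E F"
  and W_simps: "Dom (\<W> V) (E, f, F) = E" "Cod (\<W> V) (E, f, F) = F"
    "Idt (\<W> V) E = (E, (\<lambda>e \<in> topspace (total E). e), E)"
    "(F', g, H) \<cdot>\<^bsub>\<W> V\<^esub> (E, f, F) = (E, compose (topspace (total E)) g f, H)"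
  by (auto simp: weyl_cat_def full_subcategory_def gsheaf_cat_def sheaf_cat_def Let_def)

lemma S_Hom: "m \<in> Hom (\<S> V) E F \<longleftrightarrow>
    (\<exists>f. m = (E, f, F)) \<and> E \<in> Obj (\<S> V) \<and> F \<in> Obj (\<S> V) \<and> fst (snd m) \<in> sheaf_maps G SG R E F"
  by (cases m) (auto simp: Hom_def S_Arr S_simps)

lemma W_Hom: "m \<in> Hom (\<W> V) E F \<longleftrightarrow>
    (\<exists>f. m = (E, f, F)) \<and> E \<in> Obj (\<W> V) \<and> F \<in> Obj (\<W> V) \<and> fst (snd m) \<in> sheaf_maps G SG R E F"
  by (cases m) (auto simp: Hom_def W_Arr W_simps)

lemma W_HomI: "E \<in> Obj (\<W> V) \<Longrightarrow> F \<in> Obj (\<W> V) \<Longrightarrow> f \<in> sheaf_maps G SG R E F \<Longrightarrow> (E, f, F) \<in> Hom (\<W> V) E F"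
  by (simp add: W_Hom)

lemma S_HomI: "E \<in> Obj (\<S> V) \<Longrightarrow> F \<in> Obj (\<S> V) \<Longrightarrow> f \<in> sheaf_maps G SG R E F \<Longrightarrow> (E, f, F) \<in> Hom (\<S> V) E F"
  by (simp add: S_Hom)

lemma W_HomE:
  assumes "m \<in> Hom (\<W> V) E F"
  obtains f where "m = (E, f, F)" "f \<in> sheaf_maps G SG R E F" "sheaf E" "sheaf F"
    "E \<in> Obj (\<W> V)" "F \<in> Obj (\<W> V)"
  using assms by (auto simp: W_Hom W_Obj)

lemma S_HomE:
  assumes "m \<in> Hom (\<S> V) E F"
  obtains f where "m = (E, f, F)" "f \<in> sheaf_maps G SG R E F" "sheaf E" "sheaf F"
    "E \<in> Obj (\<S> V)" "F \<in> Obj (\<S> V)"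
  using assms by (auto simp: S_Hom S_Obj)

lemma W_S_Obj: "E \<in> Obj (\<W> V) \<longleftrightarrow> E \<in> Obj (\<S> V) \<and> is_weyl G T E"
  by (auto simp: W_Obj S_Obj)

lemma W_S_Hom: "E \<in> Obj (\<W> V) \<Longrightarrow> F \<in> Obj (\<W> V) \<Longrightarrow> Hom (\<W> V) E F = Hom (\<S> V) E F"
  by (auto simp: W_Hom S_Hom W_S_Obj)

lemma W_S_Cmp: "(\<cdot>\<^bsub>\<W> V\<^esub>) = (\<cdot>\<^bsub>\<S> V\<^esub>)" "Idt (\<W> V) = Idt (\<S> V)"
  by (simp_all add: weyl_cat_def full_subcategory_def)

lemma compose_sheaf_map_assoc:
  assumes "f \<in> sheaf_maps G SG R E F" "sheaf E" "sheaf F"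
  shows "compose (topspace (total E)) (compose (topspace (total F)) h g) f =
    compose (topspace (total E)) h (compose (topspace (total E)) g f)"
  using sheaf_map_closed[OF assms(2,3,1)] by (auto simp: compose_def fun_eq_iff)

lemma category_S: "category (\<S> V)"
proof
  show "Dom (\<S> V) f \<in> Obj (\<S> V)" "Cod (\<S> V) f \<in> Obj (\<S> V)" if "f \<in> Arr (\<S> V)" for f
    using that by (cases f; simp add: S_Arr S_simps)+
  show "Idt (\<S> V) a \<in> Hom (\<S> V) a a" if "a \<in> Obj (\<S> V)" for a
    using that sheaf_maps_id[of a] by (auto simp: S_simps S_Obj intro!: S_HomI)
next
  fix f g a b c assume f: "f \<in> Hom (\<S> V) a b" and g: "g \<in> Hom (\<S> V) b c"
  obtain f' where f': "f = (a, f', b)" "f' \<in> sheaf_maps G SG R a b" "sheaf a" "sheaf b"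
    "a \<in> Obj (\<S> V)" "b \<in> Obj (\<S> V)" using f by (rule S_HomE)
  obtain g' where g': "g = (b, g', c)" "g' \<in> sheaf_maps G SG R b c" "sheaf b" "sheaf c"
    "b \<in> Obj (\<S> V)" "c \<in> Obj (\<S> V)" using g by (rule S_HomE)
  show "g \<cdot>\<^bsub>\<S> V\<^esub> f \<in> Hom (\<S> V) a c"
    using f' g' sheaf_maps_comp[of a b c f' g'] by (auto simp: S_simps intro!: S_HomI)
  fix h d assume "h \<in> Hom (\<S> V) c d"
  then obtain h' where h': "h = (c, h', d)" by (auto simp: S_Hom)
  show "(h \<cdot>\<^bsub>\<S> V\<^esub> g) \<cdot>\<^bsub>\<S> V\<^esub> f = h \<cdot>\<^bsub>\<S> V\<^esub> (g \<cdot>\<^bsub>\<S> V\<^esub> f)"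
    using compose_sheaf_map_assoc[OF f'(2-4)] by (simp add: f'(1) g'(1) h' S_simps)
next
  fix f a b assume f: "f \<in> Hom (\<S> V) a b"
  obtain f' where f': "f = (a, f', b)" "f' \<in> sheaf_maps G SG R a b" "sheaf a" "sheaf b"
    "a \<in> Obj (\<S> V)" "b \<in> Obj (\<S> V)" using f by (rule S_HomE)
  have ext: "f' \<in> extensional (topspace (total a))" using sheaf_map_ext[OF f'(3,4,2)] .
  show "f \<cdot>\<^bsub>\<S> V\<^esub> Idt (\<S> V) a = f" "Idt (\<S> V) b \<cdot>\<^bsub>\<S> V\<^esub> f = f"
    using ext sheaf_map_closed[OF f'(3,4,2)]
    by (auto simp: f'(1) S_simps compose_def fun_eq_iff extensional_def)
qed

lemma category_full_subcategory:
  assumes "category C"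
  shows "category (full_subcategory C S)"
proof -
  interpret category C by fact
  have H: "f \<in> Hom (full_subcategory C S) a b \<longleftrightarrow> f \<in> Hom C a b \<and> a \<in> S \<and> b \<in> S" for f a b
    by (auto simp: Hom_def full_subcategory_def)
  show ?thesis
  proof
    show "Dom (full_subcategory C S) f \<in> Obj (full_subcategory C S)"
      "Cod (full_subcategory C S) f \<in> Obj (full_subcategory C S)" if "f \<in> Arr (full_subcategory C S)" for f
      using that Dom_Obj Cod_Obj by (auto simp: full_subcategory_def)
    show "Idt (full_subcategory C S) a \<in> Hom (full_subcategory C S) a a" if "a \<in> Obj (full_subcategory C S)" for a
      using that Idt_Hom unfolding H by (auto simp: full_subcategory_def)
    show "g \<cdot>\<^bsub>full_subcategory C S\<^esub> f \<in> Hom (full_subcategory C S) a c"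
      if "f \<in> Hom (full_subcategory C S) a b" "g \<in> Hom (full_subcategory C S) b c" for f g a b c
      using that Cmp_Hom unfolding H by (auto simp: full_subcategory_def)
    show "(h \<cdot>\<^bsub>full_subcategory C S\<^esub> g) \<cdot>\<^bsub>full_subcategory C S\<^esub> f =
        h \<cdot>\<^bsub>full_subcategory C S\<^esub> (g \<cdot>\<^bsub>full_subcategory C S\<^esub> f)"
      if "f \<in> Hom (full_subcategory C S) a b" "g \<in> Hom (full_subcategory C S) b c"
        "h \<in> Hom (full_subcategory C S) c d" for f g h a b c d
      using that Cmp_assoc unfolding H by (auto simp: full_subcategory_def)
    show "f \<cdot>\<^bsub>full_subcategory C S\<^esub> Idt (full_subcategory C S) a = f"
      "Idt (full_subcategory C S) b \<cdot>\<^bsub>full_subcategory C S\<^esub> f = f"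
      if "f \<in> Hom (full_subcategory C S) a b" for f a b
      using that Cmp_Idt_right Cmp_Idt_left unfolding H by (auto simp: full_subcategory_def)
  qed
qed

lemma category_W: "category (\<W> V)"
  unfolding weyl_cat_def by (rule category_full_subcategory[OF category_S])

section \<open>The inclusion and Weyl functors and their adjunction\<close>

lemma inc_simps [simp]: "OMap inc_functor a = a" "AMap inc_functor f = f"
  by (simp_all add: inc_functor_def)

lemma weyl_simps: "OMap (weyl_functor G R) E = weyl_sheaf G R E"
  "AMap (weyl_functor G R) (E, f, F) = (weyl_sheaf G R E, restrict f (weyl_set E), weyl_sheaf G R F)"
  by (simp_all add: weyl_functor_def)

lemma inc_is_functor: "is_functor (\<W> V) (\<S> V) inc_functor"
  unfolding is_functor_def is_functor_axioms_def
  using category_W category_S by (auto simp: W_S_Cmp W_S_Obj W_Hom S_Hom)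

lemma weyl_Obj: "E \<in> Obj (\<S> V) \<Longrightarrow> weyl_sheaf G R E \<in> Obj (\<W> V)"
  by (auto simp: S_Obj W_Obj sheaf_weyl is_weyl_weyl topspace_weyl dest: weyl_setD(1))

lemma weyl_is_functor: "is_functor (\<S> V) (\<W> V) (weyl_functor G R)"
  unfolding is_functor_def is_functor_axioms_def
proof (intro conjI category_S category_W allI impI)
  show "OMap (weyl_functor G R) a \<in> Obj (\<W> V)" if "a \<in> Obj (\<S> V)" for a
    using weyl_Obj that by (simp add: weyl_simps)
  show "AMap (weyl_functor G R) (Idt (\<S> V) a) = Idt (\<W> V) (OMap (weyl_functor G R) a)" if "a \<in> Obj (\<S> V)" for a
    by (auto simp: weyl_simps S_simps W_simps topspace_weyl fun_eq_iff dest: weyl_setD(1))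
  fix f a b assume f: "f \<in> Hom (\<S> V) a b"
  obtain f' where f': "f = (a, f', b)" "f' \<in> sheaf_maps G SG R a b" "sheaf a" "sheaf b"
    "a \<in> Obj (\<S> V)" "b \<in> Obj (\<S> V)" using f by (rule S_HomE)
  show "AMap (weyl_functor G R) f \<in> Hom (\<W> V) (OMap (weyl_functor G R) a) (OMap (weyl_functor G R) b)"
    using f' by (auto simp: weyl_simps intro!: W_HomI weyl_Obj sheaf_maps_weyl)
  fix g c assume "g \<in> Hom (\<S> V) b c"
  then obtain g' where g': "g = (b, g', c)" by (auto simp: S_Hom)
  show "AMap (weyl_functor G R) (g \<cdot>\<^bsub>\<S> V\<^esub> f) =
      AMap (weyl_functor G R) g \<cdot>\<^bsub>\<W> V\<^esub> AMap (weyl_functor G R) f"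
    using sheaf_map_weyl_set[OF f'(3,4,2)]
    by (auto simp: f'(1) g' S_simps W_simps weyl_simps topspace_weyl compose_def fun_eq_iff dest: weyl_setD(1))
qed

lemma weyl_functor_id:
  assumes "m \<in> Hom (\<W> V) E F"
  shows "AMap (weyl_functor G R) m = m"
proof -
  obtain f where f: "m = (E, f, F)" "f \<in> sheaf_maps G SG R E F" "sheaf E" "sheaf F"
    "E \<in> Obj (\<W> V)" "F \<in> Obj (\<W> V)" using assms by (rule W_HomE)
  have w: "is_weyl G T E" "is_weyl G T F" using f(5,6) by (auto simp: W_Obj)
  have "restrict f (weyl_set E) = f"
    using sheaf_map_ext[OF f(3,4,2)] weyl_set_is_weyl[OF f(3) w(1)] by (simp add: extensional_restrict)
  then show ?thesis using f w by (simp add: weyl_simps weyl_sheaf_id)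
qed

text \<open>The bijection keeps the underlying function and replaces the codomain by its subsheaf of
  fixed points. In naturality the restriction made by the Weyl functor is invisible, since
  \<open>h'\<close> after \<open>u'\<close> takes values in \<open>weyl_set d\<close>.\<close>

theorem inc_left_adjoint: "left_adjoint (\<W> V) (\<S> V) inc_functor (weyl_functor G R)"
  unfolding left_adjoint_def
proof (intro conjI inc_is_functor weyl_is_functor exI ballI)
  let ?\<phi> = "\<lambda>c d m. (c, fst (snd m), weyl_sheaf G R d)"
  fix c d assume c: "c \<in> Obj (\<W> V)" and d: "d \<in> Obj (\<S> V)"
  have c': "sheaf c" "is_weyl G T c" "c \<in> Obj (\<S> V)" and d': "sheaf d" using c d by (auto simp: W_Obj S_Obj)
  have wd: "weyl_sheaf G R d \<in> Obj (\<W> V)" using weyl_Obj d .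
  note eq = sheaf_maps_weyl_target[OF c'(1,2) d']
  show "bij_betw (?\<phi> c d) (Hom (\<S> V) (OMap inc_functor c) d) (Hom (\<W> V) c (OMap (weyl_functor G R) d))"
    unfolding inc_simps weyl_simps
  proof (rule bij_betw_byWitness[where f' = "\<lambda>m. (c, fst (snd m), d)"])
    show "\<forall>m\<in>Hom (\<S> V) c d. (c, fst (snd (c, fst (snd m), weyl_sheaf G R d)), d) = m"
      by (intro ballI, erule S_HomE) simp
    show "\<forall>m\<in>Hom (\<W> V) c (weyl_sheaf G R d). (c, fst (snd (c, fst (snd m), d)), weyl_sheaf G R d) = m"
      by (intro ballI, erule W_HomE) simp
    show "?\<phi> c d ` Hom (\<S> V) c d \<subseteq> Hom (\<W> V) c (weyl_sheaf G R d)"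
      by (intro image_subsetI W_HomI c wd, erule S_HomE) (simp add: eq)
    show "(\<lambda>m. (c, fst (snd m), d)) ` Hom (\<W> V) c (weyl_sheaf G R d) \<subseteq> Hom (\<S> V) c d"
      by (intro image_subsetI S_HomI c'(3) d, erule W_HomE) (simp add: eq)
  qed
  fix c'' d'' u v h assume c'': "c'' \<in> Obj (\<W> V)" and d'': "d'' \<in> Obj (\<S> V)" and u: "u \<in> Hom (\<W> V) c'' c"
    and v: "v \<in> Hom (\<S> V) d d''" and h: "h \<in> Hom (\<S> V) (OMap inc_functor c) d"
  obtain u' where u': "u = (c'', u', c)" "u' \<in> sheaf_maps G SG R c'' c" "sheaf c''" using u by (rule W_HomE)
  obtain v' where v': "v = (d, v', d'')" using v by (rule S_HomE)
  have "h \<in> Hom (\<S> V) c d" using h by simp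
  then obtain h' where h': "h = (c, h', d)" "h' \<in> sheaf_maps G SG R c d" by (rule S_HomE)
  have "h' (u' x) \<in> weyl_set d" "u' x \<in> topspace (total c)" if "x \<in> topspace (total c'')" for x
    using sheaf_map_weyl_set[OF c'(1) d' h'(2)] sheaf_map_closed[OF u'(3) c'(1) u'(2) that] weyl_set_is_weyl[OF c'(1,2)]
    by auto
  then show "?\<phi> c'' d'' (v \<cdot>\<^bsub>\<S> V\<^esub> h \<cdot>\<^bsub>\<S> V\<^esub> AMap inc_functor u) =
      AMap (weyl_functor G R) v \<cdot>\<^bsub>\<W> V\<^esub> ?\<phi> c d h \<cdot>\<^bsub>\<W> V\<^esub> u"
    by (simp add: u'(1) v' h'(1) S_simps W_simps weyl_simps compose_def restrict_def fun_eq_iff)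
qed

theorem weyl_idempotent: "idempotent_functor (\<S> V) (functor_comp inc_functor (weyl_functor G R))"
  unfolding idempotent_functor_def
proof
  let ?F = "functor_comp inc_functor (weyl_functor G R)"
  have F: "OMap ?F a = OMap (weyl_functor G R) a" "AMap ?F f = AMap (weyl_functor G R) f" for a f
    by (simp_all add: functor_comp_def)
  interpret W: is_functor "\<S> V" "\<W> V" "weyl_functor G R" by (rule weyl_is_functor)
  show "is_functor (\<S> V) (\<S> V) ?F"
    unfolding is_functor_def is_functor_axioms_def F
  proof (intro conjI category_S allI impI)
    show "OMap (weyl_functor G R) a \<in> Obj (\<S> V)" if "a \<in> Obj (\<S> V)" for a
      using W.OMap_Obj[OF that] by (simp add: W_S_Obj)
    show "AMap (weyl_functor G R) f \<in> Hom (\<S> V) (OMap (weyl_functor G R) a) (OMap (weyl_functor G R) b)"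
      if "f \<in> Hom (\<S> V) a b" for f a b
      using W.AMap_Hom[OF that] by (auto simp: W_Hom S_Hom W_S_Obj)
  qed (use W.AMap_Idt W.AMap_Cmp in \<open>simp_all add: W_S_Cmp\<close>)
  have wo: "OMap (weyl_functor G R) (OMap (weyl_functor G R) a) = OMap (weyl_functor G R) a" if "a \<in> Obj (\<S> V)" for a
    using that weyl_sheaf_id[OF sheaf_weyl is_weyl_weyl, of a] by (simp add: weyl_simps S_Obj)
  show "functors_agree (\<S> V) (functor_comp ?F ?F) ?F"
    unfolding functors_agree_def
  proof (intro conjI ballI)
    show "OMap (functor_comp ?F ?F) a = OMap ?F a" if "a \<in> Obj (\<S> V)" for a
      using wo[OF that] by (simp add: functor_comp_def)
    fix f assume "f \<in> Arr (\<S> V)"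
    then have "f \<in> Hom (\<S> V) (Dom (\<S> V) f) (Cod (\<S> V) f)" by (simp add: Hom_def)
    from weyl_functor_id[OF W.AMap_Hom[OF this]] show "AMap (functor_comp ?F ?F) f = AMap ?F f"
      by (simp add: functor_comp_def)
  qed
qed

theorem inc_fully_faithful: "fully_faithful (\<W> V) (\<S> V) inc_functor"
  unfolding fully_faithful_def
proof (intro conjI ballI inc_is_functor)
  fix a b assume "a \<in> Obj (\<W> V)" "b \<in> Obj (\<W> V)"
  from W_S_Hom[OF this] show "bij_betw (AMap inc_functor) (Hom (\<W> V) a b) (Hom (\<S> V) (OMap inc_functor a) (OMap inc_functor b))"
    by (simp add: inc_functor_def bij_betw_def)
qed

section \<open>Limits and colimits of Weyl sheaves\<close>

text \<open>A right adjoint preserves limits, and the Weyl functor leaves the diagram unchanged. The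
  diagram is assumed componentwise for the given \<open>V\<close>, so that a functor into
  \<open>\<W> U\<close> can be used in a larger universe.\<close>

lemma limit_weyl:
  assumes J: "category J" and D: "\<And>i. i \<in> Obj J \<Longrightarrow> OMap D i \<in> Obj (\<W> V)"
    and Du: "\<And>u. u \<in> Arr J \<Longrightarrow> AMap D u \<in> Hom (\<W> V) (OMap D (Dom J u)) (OMap D (Cod J u))"
    and lim: "is_limit (\<S> V) J (functor_comp inc_functor D) L \<pi>"
  shows "is_limit (\<W> V) J D (OMap (weyl_functor G R) L) (\<lambda>i. AMap (weyl_functor G R) (\<pi> i))"
proof -
  let ?F = "weyl_functor G R"
  interpret W: is_functor "\<S> V" "\<W> V" ?F by (rule weyl_is_functor)
  interpret J: category J by (rule J)
  have inc: "OMap (functor_comp inc_functor D) i = OMap D i" "AMap (functor_comp inc_functor D) u = AMap D u" for i u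
    by (simp_all add: functor_comp_def)
  have L: "L \<in> Obj (\<S> V)" and \<pi>: "\<And>i. i \<in> Obj J \<Longrightarrow> \<pi> i \<in> Hom (\<S> V) L (OMap D i)"
    and cone: "\<And>u. u \<in> Arr J \<Longrightarrow> AMap D u \<cdot>\<^bsub>\<S> V\<^esub> \<pi> (Dom J u) = \<pi> (Cod J u)"
    and univ: "\<And>M \<mu>. is_cone (\<S> V) J (functor_comp inc_functor D) M \<mu> \<Longrightarrow>
      \<exists>!h. h \<in> Hom (\<S> V) M L \<and> (\<forall>i \<in> Obj J. \<pi> i \<cdot>\<^bsub>\<S> V\<^esub> h = \<mu> i)"
    using lim unfolding is_limit_def is_cone_def inc by auto
  have oD: "OMap ?F (OMap D i) = OMap D i" if "i \<in> Obj J" for i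
    using D[OF that] by (simp add: W_Obj weyl_simps weyl_sheaf_id)
  have \<pi>W: "AMap ?F (\<pi> i) \<in> Hom (\<W> V) (OMap ?F L) (OMap D i)" if "i \<in> Obj J" for i
    using W.AMap_Hom[OF \<pi>[OF that]] oD[OF that] by simp
  have sub: "m \<in> Hom (\<S> V) a b" if "m \<in> Hom (\<W> V) a b" for m a b
    using that by (auto simp: W_Hom S_Hom W_S_Obj)
  show ?thesis
    unfolding is_limit_def
  proof (intro conjI allI impI)
    show "is_cone (\<W> V) J D (OMap ?F L) (\<lambda>i. AMap ?F (\<pi> i))"
      unfolding is_cone_def
    proof (intro conjI ballI W.OMap_Obj L \<pi>W)
      fix u assume u: "u \<in> Arr J"
      have "AMap ?F (AMap D u \<cdot>\<^bsub>\<S> V\<^esub> \<pi> (Dom J u)) = AMap ?F (AMap D u) \<cdot>\<^bsub>\<W> V\<^esub> AMap ?F (\<pi> (Dom J u))"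
        using W.AMap_Cmp[OF \<pi>[OF J.Dom_Obj[OF u]] sub[OF Du[OF u]]] .
      then show "AMap D u \<cdot>\<^bsub>\<W> V\<^esub> AMap ?F (\<pi> (Dom J u)) = AMap ?F (\<pi> (Cod J u))"
        using cone[OF u] weyl_functor_id[OF Du[OF u]] by simp
    qed
    fix M \<mu> assume c: "is_cone (\<W> V) J D M \<mu>"
    then have M: "M \<in> Obj (\<W> V)" and \<mu>: "\<And>i. i \<in> Obj J \<Longrightarrow> \<mu> i \<in> Hom (\<W> V) M (OMap D i)"
      by (auto simp: is_cone_def)
    have "is_cone (\<S> V) J (functor_comp inc_functor D) M \<mu>"
      using c sub unfolding is_cone_def inc by (auto simp: W_S_Obj W_S_Cmp)
    from ex1E[OF univ[OF this]] obtain h where h: "h \<in> Hom (\<S> V) M L" "\<And>i. i \<in> Obj J \<Longrightarrow> \<pi> i \<cdot>\<^bsub>\<S> V\<^esub> h = \<mu> i"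
      and uniq: "\<And>h'. h' \<in> Hom (\<S> V) M L \<Longrightarrow> (\<forall>i \<in> Obj J. \<pi> i \<cdot>\<^bsub>\<S> V\<^esub> h' = \<mu> i) \<Longrightarrow> h' = h" by metis
    have oM: "OMap ?F M = M" using M by (simp add: W_Obj weyl_simps weyl_sheaf_id)
    have Mw: "sheaf M" "is_weyl G T M" using M by (auto simp: W_Obj)
    have Ls: "sheaf L" using L by (simp add: S_Obj)
    show "\<exists>!h. h \<in> Hom (\<W> V) M (OMap ?F L) \<and> (\<forall>i \<in> Obj J. AMap ?F (\<pi> i) \<cdot>\<^bsub>\<W> V\<^esub> h = \<mu> i)"
    proof (rule ex1I[of _ "AMap ?F h"])
      show "AMap ?F h \<in> Hom (\<W> V) M (OMap ?F L) \<and> (\<forall>i \<in> Obj J. AMap ?F (\<pi> i) \<cdot>\<^bsub>\<W> V\<^esub> AMap ?F h = \<mu> i)"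
      proof (intro conjI ballI)
        show "AMap ?F h \<in> Hom (\<W> V) M (OMap ?F L)" using W.AMap_Hom[OF h(1)] oM by simp
        show "AMap ?F (\<pi> i) \<cdot>\<^bsub>\<W> V\<^esub> AMap ?F h = \<mu> i" if i: "i \<in> Obj J" for i
          using W.AMap_Cmp[OF h(1) \<pi>[OF i]] h(2)[OF i] weyl_functor_id[OF \<mu>[OF i]] by simp
      qed
      fix k assume k: "k \<in> Hom (\<W> V) M (OMap ?F L) \<and> (\<forall>i \<in> Obj J. AMap ?F (\<pi> i) \<cdot>\<^bsub>\<W> V\<^esub> k = \<mu> i)"
      then have "k \<in> Hom (\<W> V) M (OMap ?F L)" by blast
      then obtain k' where k': "k = (M, k', weyl_sheaf G R L)" "k' \<in> sheaf_maps G SG R M (weyl_sheaf G R L)"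
        unfolding weyl_simps by (rule W_HomE)
      \<comment> \<open>A map into the subsheaf is a map into \<open>L\<close>, so the uniqueness
        clause for all sheaves applies to it.\<close>
      have kS: "(M, k', L) \<in> Hom (\<S> V) M L"
        using k'(2) sheaf_maps_weyl_target[OF Mw Ls] M L by (auto simp: W_S_Obj intro!: S_HomI)
      have kw: "k' x \<in> weyl_set L" if "x \<in> topspace (total M)" for x
        using sheaf_map_closed[OF Mw(1) sheaf_weyl[OF Ls] k'(2) that] by (simp add: topspace_weyl)
      have "\<pi> i \<cdot>\<^bsub>\<S> V\<^esub> (M, k', L) = \<mu> i" if i: "i \<in> Obj J" for i
      proof -
        obtain p where p: "\<pi> i = (L, p, OMap D i)" using \<pi>[OF i] by (rule S_HomE)
        have "AMap ?F (\<pi> i) \<cdot>\<^bsub>\<W> V\<^esub> k = \<mu> i" using k i by blast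
        moreover have "compose (topspace (total M)) (restrict p (weyl_set L)) k' = compose (topspace (total M)) p k'"
          using kw by (auto simp: compose_def fun_eq_iff)
        ultimately show ?thesis using oD[OF i] by (simp add: p k'(1) weyl_simps W_simps S_simps)
      qed
      then have "(M, k', L) = h" using uniq[OF kS] by blast
      moreover have "restrict k' (weyl_set M) = k'"
        using sheaf_map_ext[OF Mw(1) sheaf_weyl[OF Ls] k'(2)] weyl_set_is_weyl[OF Mw] by (simp add: extensional_restrict)
      ultimately show "k = AMap ?F h" using k'(1) oM by (auto simp: weyl_simps)
    qed
  qed
qed

end

text \<open>Objects embed into arrows by their identities, which carries the bound on functions from
  the arrows over to the objects.\<close>

lemma small_category_Obj_lepoll:
  assumes U: "infinite U" and small: "small_category U J"
  shows "(Obj J \<rightarrow>\<^sub>E U) \<lesssim> U" "Obj J \<lesssim> U"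
proof -
  interpret category J using small by (simp add: small_category_def)
  have dom: "Dom J (Idt J a) = a" "Idt J a \<in> Arr J" if "a \<in> Obj J" for a
    using Idt_Hom[OF that] by (auto simp: Hom_def)
  have "inj_on (Idt J) (Obj J)" by (rule inj_on_inverseI[of _ "Dom J"]) (rule dom)
  then have "Obj J \<lesssim> Arr J" using dom(2) unfolding lepoll_def by blast
  moreover have "U \<noteq> {}" using U by auto
  ultimately have "(Obj J \<rightarrow>\<^sub>E U) \<lesssim> (Arr J \<rightarrow>\<^sub>E U)" by (intro lepoll_funcset_left)
  then show 1: "(Obj J \<rightarrow>\<^sub>E U) \<lesssim> U"
    by (rule lepoll_trans) (use small in \<open>simp add: small_category_def\<close>)
  obtain a where a: "a \<in> U" using U by fastforce
  obtain b where b: "b \<in> U" "b \<noteq> a" using U infinite_imp_nonempty[of "U - {a}"] by auto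
  \<comment> \<open>Indicator functions with two distinct values of \<open>U\<close> embed the
    objects into the functions on them.\<close>
  let ?\<delta> = "\<lambda>i. \<lambda>j\<in>Obj J. if j = i then a else b"
  have "inj_on ?\<delta> (Obj J)"
  proof (rule inj_onI)
    fix i j assume "i \<in> Obj J" "?\<delta> i = ?\<delta> j"
    from fun_cong[OF this(2), of i] this(1) show "i = j" using b(2) by (auto split: if_splits)
  qed
  moreover have "?\<delta> ` Obj J \<subseteq> (Obj J \<rightarrow>\<^sub>E U)" using a b by auto
  ultimately have "Obj J \<lesssim> (Obj J \<rightarrow>\<^sub>E U)" unfolding lepoll_def by blast
  then show "Obj J \<lesssim> U" using 1 by (rule lepoll_trans)
qed

context weyl_universe
begin

lemma W_comp_eq_iff:
  assumes "k \<in> extensional (topspace (total E))"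
  shows "(F', g, H) \<cdot>\<^bsub>\<W> V\<^esub> (E, f, F) = (E, k, H) \<longleftrightarrow> (\<forall>e \<in> topspace (total E). g (f e) = k e)"
  using assms by (auto simp: W_simps compose_def fun_eq_iff extensional_def)

lemma S_comp_eq_iff:
  assumes "k \<in> extensional (topspace (total E))"
  shows "(F', g, H) \<cdot>\<^bsub>\<S> V\<^esub> (E, f, F) = (E, k, H) \<longleftrightarrow> (\<forall>e \<in> topspace (total E). g (f e) = k e)"
  using assms by (auto simp: S_simps compose_def fun_eq_iff extensional_def)

lemma functor_W_diagram:
  assumes "is_functor J (\<W> U) D"
  shows "sheaf_diagram G T SG (subgroup_conj G T) R (Obj J) (OMap D) (Arr J) (Dom J) (Cod J) (\<lambda>u. fst (snd (AMap D u)))"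
    and "i \<in> Obj J \<Longrightarrow> OMap D i \<in> Obj (\<W> U)"
    and "u \<in> Arr J \<Longrightarrow> AMap D u \<in> Hom (\<W> U) (OMap D (Dom J u)) (OMap D (Cod J u))"
proof -
  interpret F: is_functor J "\<W> U" D by fact
  show Obj: "OMap D i \<in> Obj (\<W> U)" if "i \<in> Obj J" for i using F.OMap_Obj[OF that] .
  show Hom: "AMap D u \<in> Hom (\<W> U) (OMap D (Dom J u)) (OMap D (Cod J u))" if "u \<in> Arr J" for u
    using that by (intro F.AMap_Hom) (simp add: Hom_def)
  show "sheaf_diagram G T SG (subgroup_conj G T) R (Obj J) (OMap D) (Arr J) (Dom J) (Cod J) (\<lambda>u. fst (snd (AMap D u)))"
  proof (intro sheaf_diagram.intro sheaf_family.intro sheaf_family_axioms.intro sheaf_diagram_axioms.intro group_space_axioms)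
    show "sheaf (OMap D i)" if "i \<in> Obj J" for i using Obj[OF that] by (simp add: W_Obj)
    show "Dom J u \<in> Obj J" "Cod J u \<in> Obj J" if "u \<in> Arr J" for u
      using F.source.Dom_Obj[OF that] F.source.Cod_Obj[OF that] .
    show "fst (snd (AMap D u)) \<in> sheaf_maps G SG R (OMap D (Dom J u)) (OMap D (Cod J u))" if "u \<in> Arr J" for u
      using Hom[OF that] unfolding W_Hom by blast
  qed
qed

lemma W_Obj_mono: "E \<in> Obj (\<W> U) \<Longrightarrow> U \<subseteq> V \<Longrightarrow> E \<in> Obj (\<W> V)"
  by (auto simp: W_Obj)

lemma functor_AMap_eq:
  assumes "is_functor J (\<W> U) D" "u \<in> Arr J"
  shows "AMap D u = (OMap D (Dom J u), fst (snd (AMap D u)), OMap D (Cod J u))"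
  using functor_W_diagram(3)[OF assms] unfolding W_Hom by auto

text \<open>One object and one cone serve every \<open>V\<close>, because the universal property in
  \<open>limit_exists\<close> admits sheaves with any total space.\<close>

theorem limits_exist:
  assumes small: "small_category U J" and D: "is_functor J (\<W> U) D"
  obtains L \<pi> where "\<And>V. U \<subseteq> V \<Longrightarrow> is_limit (\<S> V) J (functor_comp inc_functor D) L \<pi>"
proof -
  note diag = functor_W_diagram(1)[OF D] and obj = functor_W_diagram(2)[OF D] and AM = functor_AMap_eq[OF D]
  interpret J: category J using small by (simp add: small_category_def)
  have sub: "topspace (total (OMap D i)) \<subseteq> U" if "i \<in> Obj J" for i using obj[OF that] by (simp add: W_Obj)
  let ?d = "\<lambda>u. fst (snd (AMap D u))"
  obtain L p where L: "sheaf L" "topspace (total L) \<subseteq> U"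
    and p: "\<And>i. i \<in> Obj J \<Longrightarrow> p i \<in> sheaf_maps G SG R L (OMap D i)"
    and cone: "\<And>u e. u \<in> Arr J \<Longrightarrow> e \<in> topspace (total L) \<Longrightarrow> ?d u (p (Dom J u) e) = p (Cod J u) e"
    and univ: "\<And>M \<mu>. sheaf M \<Longrightarrow> (\<And>i. i \<in> Obj J \<Longrightarrow> \<mu> i \<in> sheaf_maps G SG R M (OMap D i)) \<Longrightarrow>
      (\<And>u m. u \<in> Arr J \<Longrightarrow> m \<in> topspace (total M) \<Longrightarrow> ?d u (\<mu> (Dom J u) m) = \<mu> (Cod J u) m) \<Longrightarrow>
      \<exists>!h. h \<in> sheaf_maps G SG R M L \<and> (\<forall>i \<in> Obj J. \<forall>m \<in> topspace (total M). p i (h m) = \<mu> i m)"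
    by (rule limit_exists[OF diag sub small_category_Obj_lepoll(1)[OF infinite_U small]]) blast+
  have "is_limit (\<S> V) J (functor_comp inc_functor D) L (\<lambda>i. (L, p i, OMap D i))" if UV: "U \<subseteq> V" for V
    unfolding is_limit_def
  proof (intro conjI allI impI)
    have inc: "OMap (functor_comp inc_functor D) i = OMap D i" "AMap (functor_comp inc_functor D) u = AMap D u" for i u
      by (simp_all add: functor_comp_def)
    have LV: "L \<in> Obj (\<S> V)" using L UV by (auto simp: S_Obj)
    have DV: "OMap D i \<in> Obj (\<S> V)" if "i \<in> Obj J" for i
      using W_Obj_mono[OF obj[OF that] UV] by (simp add: W_S_Obj)
    have Ds: "sheaf (OMap D i)" if "i \<in> Obj J" for i using DV[OF that] by (simp add: S_Obj)
    have ext: "f \<in> extensional (topspace (total M))" if "f \<in> sheaf_maps G SG R M N" for M N :: "('g, 'r, 'g set, 'e) gsheaf" and f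
      using that by (simp add: sheaf_maps_def)
    show "is_cone (\<S> V) J (functor_comp inc_functor D) L (\<lambda>i. (L, p i, OMap D i))"
      unfolding is_cone_def inc
    proof (intro conjI ballI LV S_HomI DV p)
      fix u assume u: "u \<in> Arr J"
      show "AMap D u \<cdot>\<^bsub>\<S> V\<^esub> (L, p (Dom J u), OMap D (Dom J u)) = (L, p (Cod J u), OMap D (Cod J u))"
        by (subst AM[OF u], subst S_comp_eq_iff[OF ext[OF p[OF J.Cod_Obj[OF u]]]]) (use cone[OF u] in blast)
    qed
    fix M \<mu> assume c: "is_cone (\<S> V) J (functor_comp inc_functor D) M \<mu>"
    let ?m = "\<lambda>i. fst (snd (\<mu> i))"
    have M: "M \<in> Obj (\<S> V)" and \<mu>: "\<And>i. i \<in> Obj J \<Longrightarrow> \<mu> i \<in> Hom (\<S> V) M (OMap D i)"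
      and compat: "\<And>u. u \<in> Arr J \<Longrightarrow> AMap D u \<cdot>\<^bsub>\<S> V\<^esub> \<mu> (Dom J u) = \<mu> (Cod J u)"
      using c unfolding is_cone_def inc by blast+
    have Ms: "sheaf M" using M by (simp add: S_Obj)
    have eq: "\<mu> i = (M, ?m i, OMap D i)" and m: "?m i \<in> sheaf_maps G SG R M (OMap D i)" if "i \<in> Obj J" for i
      using \<mu>[OF that] unfolding S_Hom by auto
    have "?d u (?m (Dom J u) x) = ?m (Cod J u) x" if u: "u \<in> Arr J" and x: "x \<in> topspace (total M)" for u x
    proof -
      note E = eq[OF J.Dom_Obj[OF u]] eq[OF J.Cod_Obj[OF u]] and m' = m[OF J.Cod_Obj[OF u]]
      have "(OMap D (Dom J u), ?d u, OMap D (Cod J u)) \<cdot>\<^bsub>\<S> V\<^esub> (M, ?m (Dom J u), OMap D (Dom J u))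
          = (M, ?m (Cod J u), OMap D (Cod J u))"
        using compat[OF u] by (simp flip: E AM[OF u])
      then show ?thesis using x unfolding S_comp_eq_iff[OF ext[OF m']] by blast
    qed
    from univ[OF Ms m this] obtain h where
      h': "h \<in> sheaf_maps G SG R M L \<and> (\<forall>i \<in> Obj J. \<forall>x \<in> topspace (total M). p i (h x) = ?m i x)"
      and uniq: "\<forall>h'. h' \<in> sheaf_maps G SG R M L \<and> (\<forall>i \<in> Obj J. \<forall>x \<in> topspace (total M). p i (h' x) = ?m i x) \<longrightarrow> h' = h"
      by (rule ex1E)
    note h = conjunct1[OF h'] bspec[OF conjunct2[OF h']]
    show "\<exists>!h. h \<in> Hom (\<S> V) M L \<and> (\<forall>i \<in> Obj J. (L, p i, OMap D i) \<cdot>\<^bsub>\<S> V\<^esub> h = \<mu> i)"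
    proof (rule ex1I[of _ "(M, h, L)"])
      show "(M, h, L) \<in> Hom (\<S> V) M L \<and> (\<forall>i \<in> Obj J. (L, p i, OMap D i) \<cdot>\<^bsub>\<S> V\<^esub> (M, h, L) = \<mu> i)"
      proof (intro conjI ballI S_HomI M LV h(1))
        fix i assume i: "i \<in> Obj J"
        show "(L, p i, OMap D i) \<cdot>\<^bsub>\<S> V\<^esub> (M, h, L) = \<mu> i"
          by (subst eq[OF i], subst S_comp_eq_iff[OF ext[OF m[OF i]]]) (use h(2)[OF i] in blast)
      qed
      fix k assume k: "k \<in> Hom (\<S> V) M L \<and> (\<forall>i \<in> Obj J. (L, p i, OMap D i) \<cdot>\<^bsub>\<S> V\<^esub> k = \<mu> i)"
      obtain k' where k': "k = (M, k', L)" "k' \<in> sheaf_maps G SG R M L" using conjunct1[OF k] by (rule S_HomE)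
      have "\<forall>x \<in> topspace (total M). p i (k' x) = ?m i x" if i: "i \<in> Obj J" for i
      proof -
        have "(L, p i, OMap D i) \<cdot>\<^bsub>\<S> V\<^esub> (M, k', L) = \<mu> i" using conjunct2[OF k] i by (simp add: k'(1))
        then have "(L, p i, OMap D i) \<cdot>\<^bsub>\<S> V\<^esub> (M, k', L) = (M, ?m i, OMap D i)" by (simp flip: eq[OF i])
        then show ?thesis unfolding S_comp_eq_iff[OF ext[OF m[OF i]]] .
      qed
      then have "k' = h" using k'(2) uniq[rule_format, of k'] by simp
      then show "k = (M, h, L)" using k'(1) by simp
    qed
  qed
  then show ?thesis by (rule that)
qed

theorem colimits_exist:
  assumes small: "small_category U J" and D: "is_functor J (\<W> U) D"
  obtains L \<iota> where "\<And>V. U \<subseteq> V \<Longrightarrow> is_colimit (\<W> V) J D L \<iota>"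
proof -
  note diag = functor_W_diagram(1)[OF D] and obj = functor_W_diagram(2)[OF D] and AM = functor_AMap_eq[OF D]
  interpret J: category J using small by (simp add: small_category_def)
  have sub: "topspace (total (OMap D i)) \<subseteq> U" if "i \<in> Obj J" for i using obj[OF that] by (simp add: W_Obj)
  have Ds: "sheaf (OMap D i)" "is_weyl G T (OMap D i)" if "i \<in> Obj J" for i using obj[OF that] by (simp_all add: W_Obj)
  let ?d = "\<lambda>u. fst (snd (AMap D u))"
  obtain L p where L: "sheaf L" "topspace (total L) \<subseteq> U"
    and p: "\<And>i. i \<in> Obj J \<Longrightarrow> p i \<in> sheaf_maps G SG R (OMap D i) L"
    and cocone: "\<And>u e. u \<in> Arr J \<Longrightarrow> e \<in> topspace (total (OMap D (Dom J u))) \<Longrightarrow> p (Cod J u) (?d u e) = p (Dom J u) e"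
    and univ: "\<And>M \<mu>. sheaf M \<Longrightarrow> (\<And>i. i \<in> Obj J \<Longrightarrow> \<mu> i \<in> sheaf_maps G SG R (OMap D i) M) \<Longrightarrow>
      (\<And>u e. u \<in> Arr J \<Longrightarrow> e \<in> topspace (total (OMap D (Dom J u))) \<Longrightarrow> \<mu> (Cod J u) (?d u e) = \<mu> (Dom J u) e) \<Longrightarrow>
      \<exists>!h. h \<in> sheaf_maps G SG R L M \<and> (\<forall>i \<in> Obj J. \<forall>e \<in> topspace (total (OMap D i)). h (p i e) = \<mu> i e)"
    and fixed: "\<And>g e. g \<in> carrier G \<Longrightarrow> e \<in> topspace (total L) \<Longrightarrow> subgroup_conj G T g (proj L e) = proj L e \<Longrightarrow>
      (\<And>i a. i \<in> Obj J \<Longrightarrow> a \<in> topspace (total (OMap D i)) \<Longrightarrow> proj (OMap D i) a = proj L e \<Longrightarrow>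
        gact (OMap D i) g a = a) \<Longrightarrow> gact L g e = e"
    by (rule colimit_exists[OF diag sub small_category_Obj_lepoll(2)[OF infinite_U small]]) blast+
  \<comment> \<open>Elements of a subgroup normalise it and act trivially on the stalks of the Weyl
    sheaves in the diagram; the last clause of \<open>colimit_exists\<close> transfers this to
    \<open>L\<close>.\<close>
  have weyl: "is_weyl G T L"
  proof (rule is_weylI)
    fix e k assume e: "e \<in> topspace (total L)" and k: "k \<in> proj L e"
    show "gact L k e = e"
      using stabiliser_fixes[OF L(1) e k] e k by (intro fixed is_weylD[OF Ds(2,1)]) auto
  qed
  have "is_colimit (\<W> V) J D L (\<lambda>i. (OMap D i, p i, L))" if UV: "U \<subseteq> V" for V
    unfolding is_colimit_def
  proof (intro conjI allI impI)
    have LV: "L \<in> Obj (\<W> V)" using L weyl UV by (auto simp: W_Obj)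
    have DV: "OMap D i \<in> Obj (\<W> V)" if "i \<in> Obj J" for i
      using W_Obj_mono[OF obj[OF that] UV] .
    have ext: "f \<in> extensional (topspace (total M))" if "f \<in> sheaf_maps G SG R M N" for M N :: "('g, 'r, 'g set, 'e) gsheaf" and f
      using that by (simp add: sheaf_maps_def)
    show "is_cocone (\<W> V) J D L (\<lambda>i. (OMap D i, p i, L))"
      unfolding is_cocone_def
    proof (intro conjI ballI LV W_HomI DV p)
      fix u assume u: "u \<in> Arr J"
      show "(OMap D (Cod J u), p (Cod J u), L) \<cdot>\<^bsub>\<W> V\<^esub> AMap D u = (OMap D (Dom J u), p (Dom J u), L)"
        by (subst AM[OF u], subst W_comp_eq_iff[OF ext[OF p[OF J.Dom_Obj[OF u]]]]) (use cocone[OF u] in blast)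
    qed
    fix M \<mu> assume c: "is_cocone (\<W> V) J D M \<mu>"
    let ?m = "\<lambda>i. fst (snd (\<mu> i))"
    have M: "M \<in> Obj (\<W> V)" and \<mu>: "\<And>i. i \<in> Obj J \<Longrightarrow> \<mu> i \<in> Hom (\<W> V) (OMap D i) M"
      and compat: "\<And>u. u \<in> Arr J \<Longrightarrow> \<mu> (Cod J u) \<cdot>\<^bsub>\<W> V\<^esub> AMap D u = \<mu> (Dom J u)"
      using c unfolding is_cocone_def by blast+
    have Ms: "sheaf M" using M by (simp add: W_Obj)
    have eq: "\<mu> i = (OMap D i, ?m i, M)" and m: "?m i \<in> sheaf_maps G SG R (OMap D i) M" if "i \<in> Obj J" for i
      using \<mu>[OF that] unfolding W_Hom by auto
    have "?m (Cod J u) (?d u x) = ?m (Dom J u) x" if u: "u \<in> Arr J" and x: "x \<in> topspace (total (OMap D (Dom J u)))" for u x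
    proof -
      note E = eq[OF J.Dom_Obj[OF u]] eq[OF J.Cod_Obj[OF u]] and m' = m[OF J.Dom_Obj[OF u]]
      have "(OMap D (Cod J u), ?m (Cod J u), M) \<cdot>\<^bsub>\<W> V\<^esub> (OMap D (Dom J u), ?d u, OMap D (Cod J u))
          = (OMap D (Dom J u), ?m (Dom J u), M)"
        using compat[OF u] by (simp flip: E AM[OF u])
      then show ?thesis using x unfolding W_comp_eq_iff[OF ext[OF m']] by blast
    qed
    from univ[OF Ms m this] obtain h where
      h': "h \<in> sheaf_maps G SG R L M \<and> (\<forall>i \<in> Obj J. \<forall>x \<in> topspace (total (OMap D i)). h (p i x) = ?m i x)"
      and uniq: "\<forall>h'. h' \<in> sheaf_maps G SG R L M \<and> (\<forall>i \<in> Obj J. \<forall>x \<in> topspace (total (OMap D i)). h' (p i x) = ?m i x) \<longrightarrow> h' = h"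
      by (rule ex1E)
    note h = conjunct1[OF h'] bspec[OF conjunct2[OF h']]
    show "\<exists>!h. h \<in> Hom (\<W> V) L M \<and> (\<forall>i \<in> Obj J. h \<cdot>\<^bsub>\<W> V\<^esub> (OMap D i, p i, L) = \<mu> i)"
    proof (rule ex1I[of _ "(L, h, M)"])
      show "(L, h, M) \<in> Hom (\<W> V) L M \<and> (\<forall>i \<in> Obj J. (L, h, M) \<cdot>\<^bsub>\<W> V\<^esub> (OMap D i, p i, L) = \<mu> i)"
      proof (intro conjI ballI W_HomI M LV h(1))
        fix i assume i: "i \<in> Obj J"
        show "(L, h, M) \<cdot>\<^bsub>\<W> V\<^esub> (OMap D i, p i, L) = \<mu> i"
          by (subst eq[OF i], subst W_comp_eq_iff[OF ext[OF m[OF i]]]) (use h(2)[OF i] in blast)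
      qed
      fix k assume k: "k \<in> Hom (\<W> V) L M \<and> (\<forall>i \<in> Obj J. k \<cdot>\<^bsub>\<W> V\<^esub> (OMap D i, p i, L) = \<mu> i)"
      obtain k' where k': "k = (L, k', M)" "k' \<in> sheaf_maps G SG R L M" using conjunct1[OF k] by (rule W_HomE)
      have "\<forall>x \<in> topspace (total (OMap D i)). k' (p i x) = ?m i x" if i: "i \<in> Obj J" for i
      proof -
        have "(L, k', M) \<cdot>\<^bsub>\<W> V\<^esub> (OMap D i, p i, L) = \<mu> i" using conjunct2[OF k] i by (simp add: k'(1))
        then have "(L, k', M) \<cdot>\<^bsub>\<W> V\<^esub> (OMap D i, p i, L) = (OMap D i, ?m i, M)" by (simp flip: eq[OF i])
        then show ?thesis unfolding W_comp_eq_iff[OF ext[OF m[OF i]]] .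
      qed
      then have "k' = h" using k'(2) uniq[rule_format, of k'] by simp
      then show "k = (L, h, M)" using k'(1) by simp
    qed
  qed
  then show ?thesis by (rule that)
qed

end

section \<open>Weyl sheaves form an abelian category\<close>

context group_space
begin

lemma sadd_assoc:
  assumes E: "sheaf E" and "a \<in> topspace (total E)" "b \<in> topspace (total E)" "c \<in> topspace (total E)"
    and "proj E a = x" "proj E b = x" "proj E c = x"
  shows "sadd E (sadd E a b) c = sadd E a (sadd E b c)"
proof -
  interpret abelian_group "stalk E x" using stalk_abelian_group[OF E] proj_closed[OF E assms(2)] assms(5) by simp
  show ?thesis using a_assoc[of a b c] assms by simp
qed

lemma sadd_commute:
  assumes E: "sheaf E" and "a \<in> topspace (total E)" "b \<in> topspace (total E)" "proj E a = proj E b"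
  shows "sadd E a b = sadd E b a"
proof -
  interpret abelian_group "stalk E (proj E b)" using stalk_abelian_group[OF E] proj_closed[OF E assms(3)] by simp
  show ?thesis using a_comm[of a b] assms by simp
qed

lemma sheaf_map_injI:
  assumes E: "sheaf E" and F: "sheaf F" and f: "f \<in> sheaf_maps G X R E F"
    and ker: "\<And>e. e \<in> topspace (total E) \<Longrightarrow> f e = szero F (proj E e) \<Longrightarrow> e = szero E (proj E e)"
  shows "inj_on f (topspace (total E))"
proof (rule inj_onI)
  fix a b assume a: "a \<in> topspace (total E)" and b: "b \<in> topspace (total E)" and eq: "f a = f b"
  have p: "proj E a = proj E b" using sheaf_map_proj[OF E F f a] sheaf_map_proj[OF E F f b] eq by simp
  have "f (sminus E a b) = szero F (proj E (sminus E a b))"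
    using sheaf_map_sminus[OF E F f a b p] sminus_self[OF F sheaf_map_closed[OF E F f b]] eq
      sheaf_map_proj[OF E F f b] sminus_closed(2)[OF E a b p] by simp
  then have "sminus E a b = szero E (proj E (sminus E a b))" by (rule ker[OF sminus_closed(1)[OF E a b p]])
  then show "a = b" using sminus_eq_zero_iff[OF E a b p] sminus_closed(2)[OF E a b p] by simp
qed

text \<open>The set-theoretic factorisation inherits all identities by injectivity of
  \<open>f\<close>. It is continuous because the preimage of an open set is the preimage under
  \<open>g\<close> of its image under \<open>f\<close>, and \<open>f\<close> is open.\<close>

lemma sheaf_maps_factor_injective:
  assumes E: "sheaf E" and F: "sheaf F" and M: "sheaf M"
    and f: "f \<in> sheaf_maps G X R E F" and inj: "inj_on f (topspace (total E))"
    and g: "g \<in> sheaf_maps G X R M F" and im: "g ` topspace (total M) \<subseteq> f ` topspace (total E)"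
  obtains h where "h \<in> sheaf_maps G X R M E" "\<And>m. m \<in> topspace (total M) \<Longrightarrow> f (h m) = g m"
proof
  let ?h = "\<lambda>m\<in>topspace (total M). inv_into (topspace (total E)) f (g m)"
  have h: "?h m \<in> topspace (total E)" "f (?h m) = g m" if "m \<in> topspace (total M)" for m
    using that im inv_into_into[of "g m" f "topspace (total E)"] f_inv_into_f[of "g m" f "topspace (total E)"] by auto
  show "f (?h m) = g m" if "m \<in> topspace (total M)" for m using h(2)[OF that] .
  have hI: "?h m = e" if "m \<in> topspace (total M)" "e \<in> topspace (total E)" "f e = g m" for m e
    using inj_onD[OF inj _ h(1)[OF that(1)] that(2)] h(2)[OF that(1)] that(3) by simp
  have pr: "proj E (?h m) = proj M m" if m: "m \<in> topspace (total M)" for m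
    using sheaf_map_proj[OF E F f h(1)[OF m]] sheaf_map_proj[OF M F g m] h(2)[OF m] by simp
  show "?h \<in> sheaf_maps G X R M E"
  proof (rule sheaf_mapsI[OF M E])
    show "continuous_map (total M) (total E) ?h"
      unfolding continuous_map_def
    proof (intro conjI allI impI Pi_I h(1))
      fix O' assume O: "openin (total E) O'"
      have "{m \<in> topspace (total M). ?h m \<in> O'} = {m \<in> topspace (total M). g m \<in> f ` O'}"
      proof (intro Collect_cong conj_cong refl iffI)
        fix m assume m: "m \<in> topspace (total M)"
        show "g m \<in> f ` O'" if "?h m \<in> O'" using that h(2)[OF m] by (metis imageI)
        assume "g m \<in> f ` O'"
        then obtain e where e: "e \<in> O'" "g m = f e" by blast
        have "?h m = e" using e openin_subset[OF O] by (intro hI m) auto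
        then show "?h m \<in> O'" using e(1) by simp
      qed
      then show "openin (total M) {m \<in> topspace (total M). ?h m \<in> O'}"
        using openin_continuous_map_preimage[OF sheaf_map_continuous[OF M F g] sheaf_map_open[OF E F f O]] by simp
    qed
    show "proj E (?h e) = proj M e" if "e \<in> topspace (total M)" for e using pr[OF that] .
    show "?h (gact M k e) = gact E k (?h e)" if "k \<in> carrier G" "e \<in> topspace (total M)" for k e
      using that h[OF that(2)] sheaf_map_gact[OF M F g that] sheaf_map_gact[OF E F f that(1) h(1)[OF that(2)]]
      by (intro hI gact_closed(1)[OF M] gact_closed(1)[OF E]) (auto simp del: restrict_apply restrict_apply')
    show "?h (sadd M a b) = sadd E (?h a) (?h b)"
      if "a \<in> topspace (total M)" "b \<in> topspace (total M)" "proj M a = proj M b" for a b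
    proof (rule hI)
      have p: "proj E (?h a) = proj E (?h b)" using pr[OF that(1)] pr[OF that(2)] that(3) by simp
      show "sadd M a b \<in> topspace (total M)" using sadd_closed(1)[OF M that] .
      show "sadd E (?h a) (?h b) \<in> topspace (total E)" using sadd_closed(1)[OF E h(1)[OF that(1)] h(1)[OF that(2)] p] .
      show "f (sadd E (?h a) (?h b)) = g (sadd M a b)"
        using sheaf_map_sadd[OF E F f h(1)[OF that(1)] h(1)[OF that(2)] p] sheaf_map_sadd[OF M F g that]
          h(2)[OF that(1)] h(2)[OF that(2)] by simp
    qed
    show "?h (ssmult M r a) = ssmult E r (?h a)" if "r \<in> carrier R" "a \<in> topspace (total M)" for r a
      using sheaf_map_ssmult[OF M F g that] sheaf_map_ssmult[OF E F f that(1) h(1)[OF that(2)]] h[OF that(2)] that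
      by (intro hI ssmult_closed(1)[OF M] ssmult_closed(1)[OF E]) (auto simp del: restrict_apply restrict_apply')
  qed simp
qed

text \<open>Elements with equal image under \<open>f\<close> differ by an element of its kernel, on
  which \<open>g\<close> vanishes. The preimage of an open set under the factor is the image under
  \<open>f\<close> of its preimage under \<open>g\<close>, hence open.\<close>

lemma sheaf_maps_factor_surjective:
  assumes E: "sheaf E" and F: "sheaf F" and M: "sheaf M"
    and f: "f \<in> sheaf_maps G X R E F" and surj: "f ` topspace (total E) = topspace (total F)"
    and g: "g \<in> sheaf_maps G X R E M"
    and ker: "\<And>e. e \<in> topspace (total E) \<Longrightarrow> f e = szero F (proj E e) \<Longrightarrow> g e = szero M (proj E e)"
  obtains h where "h \<in> sheaf_maps G X R F M" "\<And>e. e \<in> topspace (total E) \<Longrightarrow> h (f e) = g e"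
proof
  let ?h = "\<lambda>y\<in>topspace (total F). g (inv_into (topspace (total E)) f y)"
  have gf: "g a = g b" if a: "a \<in> topspace (total E)" and b: "b \<in> topspace (total E)" and eq: "f a = f b" for a b
  proof -
    have p: "proj E a = proj E b" using sheaf_map_proj[OF E F f a] sheaf_map_proj[OF E F f b] eq by simp
    have "f (sminus E a b) = szero F (proj E (sminus E a b))"
      using sheaf_map_sminus[OF E F f a b p] sminus_self[OF F sheaf_map_closed[OF E F f b]] eq
        sheaf_map_proj[OF E F f b] sminus_closed(2)[OF E a b p] by simp
    then have "g (sminus E a b) = szero M (proj E (sminus E a b))" by (rule ker[OF sminus_closed(1)[OF E a b p]])
    then have "sminus M (g a) (g b) = szero M (proj M (g b))"
      using sheaf_map_sminus[OF E M g a b p] sminus_closed(2)[OF E a b p] sheaf_map_proj[OF E M g b] by simp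
    then show "g a = g b"
      using sminus_eq_zero_iff[OF M sheaf_map_closed[OF E M g a] sheaf_map_closed[OF E M g b]]
        sheaf_map_proj[OF E M g a] sheaf_map_proj[OF E M g b] p by simp
  qed
  show hf: "?h (f e) = g e" if e: "e \<in> topspace (total E)" for e
  proof -
    have "f e \<in> f ` topspace (total E)" using e by blast
    then have "g (inv_into (topspace (total E)) f (f e)) = g e" by (intro gf inv_into_into f_inv_into_f e)
    then show ?thesis using sheaf_map_closed[OF E F f e] by simp
  qed
  have lift: "\<exists>e \<in> topspace (total E). y = f e" if "y \<in> topspace (total F)" for y using that surj by blast
  have pr: "proj M (?h y) = proj F y" if y: "y \<in> topspace (total F)" for y
  proof -
    obtain e where e: "e \<in> topspace (total E)" "y = f e" using lift[OF y] by blast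
    show ?thesis using hf[OF e(1)] sheaf_map_proj[OF E M g e(1)] sheaf_map_proj[OF E F f e(1)]
      unfolding e(2) by (simp del: restrict_apply restrict_apply')
  qed
  show "?h \<in> sheaf_maps G X R F M"
  proof (rule sheaf_mapsI[OF F M])
    show "continuous_map (total F) (total M) ?h"
      unfolding continuous_map_def
    proof (intro conjI allI impI Pi_I)
      show "?h y \<in> topspace (total M)" if y: "y \<in> topspace (total F)" for y
      proof -
        obtain e where e: "e \<in> topspace (total E)" "y = f e" using lift[OF y] by blast
        show ?thesis unfolding e(2) hf[OF e(1)] using sheaf_map_closed[OF E M g e(1)] .
      qed
      fix O' assume O: "openin (total M) O'"
      have "{y \<in> topspace (total F). ?h y \<in> O'} = f ` {e \<in> topspace (total E). g e \<in> O'}"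
      proof (intro equalityI subsetI)
        fix y assume y: "y \<in> {y \<in> topspace (total F). ?h y \<in> O'}"
        then obtain e where e: "e \<in> topspace (total E)" "y = f e" using lift[of y] by blast
        then have "g e \<in> O'" using y hf[OF e(1)] by (metis (mono_tags, lifting) mem_Collect_eq)
        then show "y \<in> f ` {e \<in> topspace (total E). g e \<in> O'}" using e by blast
      next
        fix y assume "y \<in> f ` {e \<in> topspace (total E). g e \<in> O'}"
        then obtain e where e: "e \<in> topspace (total E)" "g e \<in> O'" "y = f e" by blast
        then show "y \<in> {y \<in> topspace (total F). ?h y \<in> O'}"
          using hf[OF e(1)] sheaf_map_closed[OF E F f e(1)] by (simp del: restrict_apply restrict_apply')
      qed
      then show "openin (total F) {y \<in> topspace (total F). ?h y \<in> O'}"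
        using sheaf_map_open[OF E F f openin_continuous_map_preimage[OF sheaf_map_continuous[OF E M g] O]] by simp
    qed
    show "proj M (?h e) = proj F e" if "e \<in> topspace (total F)" for e using pr[OF that] .
    show "?h (gact F k y) = gact M k (?h y)" if k: "k \<in> carrier G" and y: "y \<in> topspace (total F)" for k y
    proof -
      obtain e where e: "e \<in> topspace (total E)" "y = f e" using lift[OF y] by blast
      show ?thesis unfolding e(2) sheaf_map_gact[OF E F f k e(1), symmetric] hf[OF e(1)]
          hf[OF gact_closed(1)[OF E k e(1)]] using sheaf_map_gact[OF E M g k e(1)] .
    qed
    show "?h (sadd F y z) = sadd M (?h y) (?h z)"
      if y: "y \<in> topspace (total F)" and z: "z \<in> topspace (total F)" and yz: "proj F y = proj F z" for y z
    proof -
      obtain a where a: "a \<in> topspace (total E)" "y = f a" using lift[OF y] by blast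
      obtain b where b: "b \<in> topspace (total E)" "z = f b" using lift[OF z] by blast
      have p: "proj E a = proj E b"
        using yz sheaf_map_proj[OF E F f a(1)] sheaf_map_proj[OF E F f b(1)] by (simp add: a(2) b(2))
      show ?thesis unfolding a(2) b(2) sheaf_map_sadd[OF E F f a(1) b(1) p, symmetric] hf[OF a(1)] hf[OF b(1)]
          hf[OF sadd_closed(1)[OF E a(1) b(1) p]] using sheaf_map_sadd[OF E M g a(1) b(1) p] .
    qed
    show "?h (ssmult F r y) = ssmult M r (?h y)" if r: "r \<in> carrier R" and y: "y \<in> topspace (total F)" for r y
    proof -
      obtain e where e: "e \<in> topspace (total E)" "y = f e" using lift[OF y] by blast
      show ?thesis unfolding e(2) sheaf_map_ssmult[OF E F f r e(1), symmetric] hf[OF e(1)]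
          hf[OF ssmult_closed(1)[OF E r e(1)]] using sheaf_map_ssmult[OF E M g r e(1)] .
    qed
  qed simp
qed

end

context weyl_universe
begin

section \<open>Addition of arrows, zero objects and zero arrows\<close>

lemma W_ArrE:
  assumes "m \<in> Arr (\<W> V)"
  obtains E f F where "m = (E, f, F)" "f \<in> sheaf_maps G SG R E F" "sheaf E" "sheaf F"
    "E \<in> Obj (\<W> V)" "F \<in> Obj (\<W> V)" "is_weyl G T E" "is_weyl G T F"
  using assms by (cases m) (auto simp: W_Arr W_Obj)

lemma W_comp:
  assumes "f \<in> sheaf_maps G SG R E F" "g \<in> sheaf_maps G SG R F H" "sheaf E" "sheaf F" "sheaf H"
  shows "(F, g, H) \<cdot>\<^bsub>\<W> V\<^esub> (E, f, F) = (E, compose (topspace (total E)) g f, H)"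
    "compose (topspace (total E)) g f \<in> sheaf_maps G SG R E H"
    "e \<in> topspace (total E) \<Longrightarrow> compose (topspace (total E)) g f e = g (f e)"
  using sheaf_maps_comp[OF assms(3-5,1,2)] by (simp_all add: W_simps compose_def)

lemma sheaf_maps_eqI:
  assumes "f \<in> sheaf_maps G SG R E F" "g \<in> sheaf_maps G SG R E F"
    and "\<And>e. e \<in> topspace (total E) \<Longrightarrow> f e = g e"
  shows "f = g"
  using assms(1,2) by (intro extensionalityI[of f "topspace (total E)" g]) (auto simp: sheaf_maps_def assms(3))

definition "add_arrows m n = (fst m, (\<lambda>e\<in>topspace (total (fst m)).
  sadd (snd (snd m)) (fst (snd m) e) (fst (snd n) e)), snd (snd m))"

lemma preadditive_W: "preadditive (\<W> U) add_arrows"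
  unfolding preadditive_def
proof (intro conjI ballI allI)
  fix E F assume EF: "E \<in> Obj (\<W> U)" "F \<in> Obj (\<W> U)"
  then have E: "sheaf E" and F: "sheaf F" by (simp_all add: W_Obj)
  let ?z = "(E, \<lambda>e\<in>topspace (total E). szero F (proj E e), F)"
  let ?H = "\<lparr>carrier = Hom (\<W> U) E F, monoid.mult = add_arrows, one = ?z\<rparr>"
  have "comm_group ?H"
  proof (rule comm_groupI)
    show "\<one>\<^bsub>?H\<^esub> \<in> carrier ?H" using W_HomI[OF EF sheaf_maps_zero[OF E F]] by simp
    fix m assume "m \<in> carrier ?H"
    then have "m \<in> Hom (\<W> U) E F" by simp
    then obtain f where f: "m = (E, f, F)" "f \<in> sheaf_maps G SG R E F" by (rule W_HomE)
    note fc = sheaf_map_closed[OF E F f(2)] sheaf_map_proj[OF E F f(2)]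
    show "\<one>\<^bsub>?H\<^esub> \<otimes>\<^bsub>?H\<^esub> m = m"
      using sheaf_map_ext[OF E F f(2)] fc sadd_zero(2)[OF F]
      by (auto simp: f(1) add_arrows_def fun_eq_iff extensional_def)
    let ?n = "\<lambda>e\<in>topspace (total E). sminus F ((\<lambda>e\<in>topspace (total E). szero F (proj E e)) e) (f e)"
    have n: "?n \<in> sheaf_maps G SG R E F" using sheaf_maps_minus[OF E F sheaf_maps_zero[OF E F] f(2)] .
    have "add_arrows (E, ?n, F) m = ?z"
      using fc sadd_sminus[OF F] szero_closed[OF F] proj_closed[OF E]
      by (auto simp: f(1) add_arrows_def fun_eq_iff)
    then show "\<exists>n \<in> carrier ?H. n \<otimes>\<^bsub>?H\<^esub> m = \<one>\<^bsub>?H\<^esub>" using W_HomI[OF EF n] by auto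
    fix n assume "n \<in> carrier ?H"
    then have "n \<in> Hom (\<W> U) E F" by simp
    then obtain g where g: "n = (E, g, F)" "g \<in> sheaf_maps G SG R E F" by (rule W_HomE)
    note gc = sheaf_map_closed[OF E F g(2)] sheaf_map_proj[OF E F g(2)]
    show "m \<otimes>\<^bsub>?H\<^esub> n \<in> carrier ?H"
      using W_HomI[OF EF sheaf_maps_add[OF E F f(2) g(2)]] by (simp add: add_arrows_def f(1) g(1))
    show "m \<otimes>\<^bsub>?H\<^esub> n = n \<otimes>\<^bsub>?H\<^esub> m"
      using sadd_commute[OF F fc(1) gc(1)] fc(2) gc(2) by (auto simp: f(1) g(1) add_arrows_def fun_eq_iff)
    fix k assume "k \<in> carrier ?H"
    then have "k \<in> Hom (\<W> U) E F" by simp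
    then obtain h where h: "k = (E, h, F)" "h \<in> sheaf_maps G SG R E F" by (rule W_HomE)
    note hc = sheaf_map_closed[OF E F h(2)] sheaf_map_proj[OF E F h(2)]
    show "(m \<otimes>\<^bsub>?H\<^esub> n) \<otimes>\<^bsub>?H\<^esub> k = m \<otimes>\<^bsub>?H\<^esub> (n \<otimes>\<^bsub>?H\<^esub> k)"
      using sadd_assoc[OF F fc(1) gc(1) hc(1)] fc(2) gc(2) hc(2)
      by (auto simp: f(1) g(1) h(1) add_arrows_def fun_eq_iff)
  qed
  then show "\<exists>z. comm_group \<lparr>carrier = Hom (\<W> U) E F, monoid.mult = add_arrows, one = z\<rparr>" ..
next
  fix E F H m m' n n' assume m: "m \<in> Hom (\<W> U) E F" "m' \<in> Hom (\<W> U) E F" and n: "n \<in> Hom (\<W> U) F H" "n' \<in> Hom (\<W> U) F H"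
  obtain f where f: "m = (E, f, F)" "f \<in> sheaf_maps G SG R E F" "sheaf E" "sheaf F" using m(1) by (rule W_HomE)
  obtain f' where f': "m' = (E, f', F)" "f' \<in> sheaf_maps G SG R E F" using m(2) by (rule W_HomE)
  obtain g where g: "n = (F, g, H)" "g \<in> sheaf_maps G SG R F H" "sheaf H" using n(1) by (rule W_HomE)
  obtain g' where g': "n' = (F, g', H)" "g' \<in> sheaf_maps G SG R F H" using n(2) by (rule W_HomE)
  note c = sheaf_map_closed[OF f(3,4,2)] sheaf_map_closed[OF f(3,4) f'(2)]
    sheaf_map_proj[OF f(3,4,2)] sheaf_map_proj[OF f(3,4) f'(2)]
  have "g (sadd F (f e) (f' e)) = sadd H (g (f e)) (g (f' e))" if "e \<in> topspace (total E)" for e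
    using sheaf_map_sadd[OF f(4) g(3,2) c(1,2)[OF that]] c(3,4)[OF that] by simp
  then show "n \<cdot>\<^bsub>\<W> U\<^esub> add_arrows m m' = add_arrows (n \<cdot>\<^bsub>\<W> U\<^esub> m) (n \<cdot>\<^bsub>\<W> U\<^esub> m')"
    by (auto simp: f(1) f'(1) g(1) W_simps add_arrows_def compose_def fun_eq_iff)
  show "add_arrows n n' \<cdot>\<^bsub>\<W> U\<^esub> m = add_arrows (n \<cdot>\<^bsub>\<W> U\<^esub> m) (n' \<cdot>\<^bsub>\<W> U\<^esub> m)"
    using c(1) by (auto simp: f(1) g(1) g'(1) W_simps add_arrows_def compose_def fun_eq_iff)
qed

text \<open>The colimit of the empty diagram has exactly one endomorphism, so its identity is the
  zero map and every element is zero.\<close>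

lemma zero_sheaf_exists:
  obtains Z where "Z \<in> Obj (\<W> U)" "\<And>e. e \<in> topspace (total Z) \<Longrightarrow> e = szero Z (proj Z e)"
proof -
  have diag: "sheaf_diagram G T SG (subgroup_conj G T) R {} (\<lambda>_ :: unit. undefined :: ('g, 'r, 'g set, 'e) gsheaf)
      ({} :: unit set) (\<lambda>_. ()) (\<lambda>_. ()) (\<lambda>_ e. e)"
    by (intro sheaf_diagram.intro sheaf_family.intro sheaf_family_axioms.intro sheaf_diagram_axioms.intro
        group_space_axioms) simp_all
  obtain Z where Z: "sheaf Z" "topspace (total Z) \<subseteq> U"
    and univ: "\<And>M. sheaf M \<Longrightarrow> \<exists>!h. h \<in> sheaf_maps G SG R Z M"
    and fixed: "\<And>g e. g \<in> carrier G \<Longrightarrow> e \<in> topspace (total Z) \<Longrightarrow> subgroup_conj G T g (proj Z e) = proj Z e \<Longrightarrow>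
      gact Z g e = e"
  proof (rule colimit_exists[OF diag])
    fix L \<iota> assume "sheaf L" "topspace (total L) \<subseteq> U"
      "\<And>(M :: ('g, 'r, 'g set, 'e) gsheaf) \<mu>. sheaf M \<Longrightarrow>
         (\<And>i :: unit. i \<in> {} \<Longrightarrow> \<mu> i \<in> sheaf_maps G SG R undefined M) \<Longrightarrow>
         (\<And>u e. u \<in> ({} :: unit set) \<Longrightarrow> e \<in> topspace (total (undefined :: ('g, 'r, 'g set, 'e) gsheaf)) \<Longrightarrow>
           \<mu> () e = \<mu> () e) \<Longrightarrow>
         \<exists>!h. h \<in> sheaf_maps G SG R L M \<and>
           (\<forall>i \<in> {}. \<forall>e \<in> topspace (total (undefined :: ('g, 'r, 'g set, 'e) gsheaf)). h (\<iota> i e) = \<mu> i e)"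
      "\<And>g e. g \<in> carrier G \<Longrightarrow> e \<in> topspace (total L) \<Longrightarrow> subgroup_conj G T g (proj L e) = proj L e \<Longrightarrow>
        (\<And>(i :: unit) a. i \<in> {} \<Longrightarrow> a \<in> topspace (total (undefined :: ('g, 'r, 'g set, 'e) gsheaf)) \<Longrightarrow>
          proj undefined a = proj L e \<Longrightarrow> gact undefined g a = a) \<Longrightarrow> gact L g e = e"
    note L = this
    show thesis
    proof (rule that[OF L(1,2)])
      show "\<exists>!h. h \<in> sheaf_maps G SG R L M" if "sheaf M" for M
        using L(3)[OF that, of "\<lambda>_ e. e"] by simp
      show "gact L g e = e"
        if "g \<in> carrier G" "e \<in> topspace (total L)" "subgroup_conj G T g (proj L e) = proj L e" for g e
        using L(4)[OF that] by simp
    qed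
  qed simp_all
  have "is_weyl G T Z"
    using stabiliser_fixes[OF Z(1)] by (intro is_weylI fixed) auto
  then have "Z \<in> Obj (\<W> U)" using Z by (simp add: W_Obj)
  moreover have "e = szero Z (proj Z e)" if e: "e \<in> topspace (total Z)" for e
  proof -
    have "(\<lambda>e\<in>topspace (total Z). e) = (\<lambda>e\<in>topspace (total Z). szero Z (proj Z e))"
      using ex1_implies_ex[OF univ[OF Z(1)]] univ[OF Z(1)] sheaf_maps_id[OF Z(1)] sheaf_maps_zero[OF Z(1) Z(1)] by blast
    from fun_cong[OF this, of e] show ?thesis using e by simp
  qed
  ultimately show ?thesis by (rule that)
qed

lemma zero_object_W:
  assumes Z: "Z \<in> Obj (\<W> U)" and zero: "\<And>e. e \<in> topspace (total Z) \<Longrightarrow> e = szero Z (proj Z e)"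
  shows "zero_object (\<W> U) Z"
  unfolding zero_object_def
proof (intro conjI ballI Z)
  fix E assume E: "E \<in> Obj (\<W> U)"
  have s: "sheaf Z" "sheaf E" using Z E by (simp_all add: W_Obj)
  show "\<exists>!m. m \<in> Hom (\<W> U) E Z"
  proof (rule ex1I, rule W_HomI[OF E Z sheaf_maps_zero[OF s(2,1)]])
    fix m assume "m \<in> Hom (\<W> U) E Z"
    then obtain f where f: "m = (E, f, Z)" "f \<in> sheaf_maps G SG R E Z" by (rule W_HomE)
    have "f = (\<lambda>e\<in>topspace (total E). szero Z (proj E e))"
      using zero[OF sheaf_map_closed[OF s(2,1) f(2)]] sheaf_map_proj[OF s(2,1) f(2)]
      by (intro sheaf_maps_eqI[OF f(2) sheaf_maps_zero[OF s(2,1)]]) simp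
    then show "m = (E, \<lambda>e\<in>topspace (total E). szero Z (proj E e), Z)" by (simp add: f(1))
  qed
  show "\<exists>!m. m \<in> Hom (\<W> U) Z E"
  proof (rule ex1I, rule W_HomI[OF Z E sheaf_maps_zero[OF s]])
    fix m assume "m \<in> Hom (\<W> U) Z E"
    then obtain f where f: "m = (Z, f, E)" "f \<in> sheaf_maps G SG R Z E" by (rule W_HomE)
    have "f e = szero E (proj Z e)" if "e \<in> topspace (total Z)" for e
      using sheaf_map_szero[OF s f(2) proj_closed[OF s(1) that]] zero[OF that] by simp
    then have "f = (\<lambda>e\<in>topspace (total Z). szero E (proj Z e))"
      by (intro sheaf_maps_eqI[OF f(2) sheaf_maps_zero[OF s]]) simp
    then show "m = (Z, \<lambda>e\<in>topspace (total Z). szero E (proj Z e), E)" by (simp add: f(1))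
  qed
qed

text \<open>A zero object is known only by its universal property, but its identity and its zero map
  must coincide; so each of its stalks consists of zero, and anything factoring through it
  vanishes.\<close>

lemma zero_arrow_iff:
  assumes EF: "E \<in> Obj (\<W> U)" "F \<in> Obj (\<W> U)" and f: "f \<in> sheaf_maps G SG R E F"
  shows "zero_arrow (\<W> U) (E, f, F) \<longleftrightarrow> (\<forall>e \<in> topspace (total E). f e = szero F (proj E e))"
proof
  have s: "sheaf E" "sheaf F" using EF by (simp_all add: W_Obj)
  show "\<forall>e \<in> topspace (total E). f e = szero F (proj E e)" if za: "zero_arrow (\<W> U) (E, f, F)"
  proof
    fix e assume e: "e \<in> topspace (total E)"
    obtain z m n where z: "zero_object (\<W> U) z" "m \<in> Hom (\<W> U) E z" "n \<in> Hom (\<W> U) z F"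
      "(E, f, F) = n \<cdot>\<^bsub>\<W> U\<^esub> m"
      using za unfolding zero_arrow_def W_simps(1,2) by (elim conjE exE)
    obtain g where g: "m = (E, g, z)" "g \<in> sheaf_maps G SG R E z" "sheaf z" "z \<in> Obj (\<W> U)" using z(2) by (rule W_HomE)
    obtain h where h: "n = (z, h, F)" "h \<in> sheaf_maps G SG R z F" using z(3) by (rule W_HomE)
    have "\<exists>!m. m \<in> Hom (\<W> U) z z" using z(1) g(4) by (simp add: zero_object_def)
    from ex1_implies_ex[OF this] this have "(z, \<lambda>e\<in>topspace (total z). e, z) = (z, \<lambda>e\<in>topspace (total z). szero z (proj z e), z)"
      using W_HomI[OF g(4,4) sheaf_maps_id[OF g(3)]] W_HomI[OF g(4,4) sheaf_maps_zero[OF g(3,3)]] by blast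
    then have id: "(\<lambda>e\<in>topspace (total z). e) = (\<lambda>e\<in>topspace (total z). szero z (proj z e))" by simp
    have ge: "g e = szero z (proj E e)"
      using fun_cong[OF id, of "g e"] sheaf_map_closed[OF s(1) g(3,2) e] sheaf_map_proj[OF s(1) g(3,2) e] by simp
    have "f e = h (g e)" using z(4) e by (simp add: g(1) h(1) W_simps compose_def)
    then show "f e = szero F (proj E e)"
      using sheaf_map_szero[OF g(3) s(2) h(2) proj_closed[OF s(1) e]] ge by simp
  qed
  assume zero: "\<forall>e \<in> topspace (total E). f e = szero F (proj E e)"
  obtain Z where Z: "Z \<in> Obj (\<W> U)" "\<And>e. e \<in> topspace (total Z) \<Longrightarrow> e = szero Z (proj Z e)"
    by (rule zero_sheaf_exists) blast
  have Zs: "sheaf Z" using Z(1) by (simp add: W_Obj)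
  let ?g = "\<lambda>e\<in>topspace (total E). szero Z (proj E e)" and ?h = "\<lambda>e\<in>topspace (total Z). szero F (proj Z e)"
  have "compose (topspace (total E)) ?h ?g = f"
  proof (rule sheaf_maps_eqI[OF sheaf_maps_comp[OF s(1) Zs s(2) sheaf_maps_zero[OF s(1) Zs] sheaf_maps_zero[OF Zs s(2)]] f])
    fix e assume e: "e \<in> topspace (total E)"
    then show "compose (topspace (total E)) ?h ?g e = f e"
      using szero_closed[OF Zs proj_closed[OF s(1) e]] zero by (simp add: compose_def)
  qed
  then have "(E, f, F) = (Z, ?h, F) \<cdot>\<^bsub>\<W> U\<^esub> (E, ?g, Z)" by (simp add: W_simps)
  moreover have "(E, f, F) \<in> Arr (\<W> U)" using EF f by (simp add: W_Arr)
  moreover have "(E, ?g, Z) \<in> Hom (\<W> U) E Z" "(Z, ?h, F) \<in> Hom (\<W> U) Z F"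
    using W_HomI[OF EF(1) Z(1) sheaf_maps_zero[OF s(1) Zs]] W_HomI[OF Z(1) EF(2) sheaf_maps_zero[OF Zs s(2)]] .
  moreover have "zero_object (\<W> U) Z" by (rule zero_object_W[OF Z])
  ultimately show "zero_arrow (\<W> U) (E, f, F)"
    unfolding zero_arrow_def W_simps(1,2) by (intro conjI exI) assumption+
qed

lemma zero_comp_iff:
  assumes "E \<in> Obj (\<W> U)" "F \<in> Obj (\<W> U)" "H \<in> Obj (\<W> U)"
    and "f \<in> sheaf_maps G SG R E F" "g \<in> sheaf_maps G SG R F H"
  shows "zero_arrow (\<W> U) ((F, g, H) \<cdot>\<^bsub>\<W> U\<^esub> (E, f, F)) \<longleftrightarrow>
    (\<forall>e \<in> topspace (total E). g (f e) = szero H (proj E e))"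
proof -
  have s: "sheaf E" "sheaf F" "sheaf H" using assms(1-3) by (simp_all add: W_Obj)
  show ?thesis
    unfolding W_comp(1)[OF assms(4,5) s] zero_arrow_iff[OF assms(1,3) W_comp(2)[OF assms(4,5) s]]
    by (simp add: compose_def)
qed

section \<open>Kernels and cokernels\<close>

lemma kernel_inclusion:
  assumes EF: "E \<in> Obj (\<W> U)" "F \<in> Obj (\<W> U)" and f: "f \<in> sheaf_maps G SG R E F"
  defines "W \<equiv> {e \<in> topspace (total E). f e = szero F (proj E e)}"
  shows "subsheaf G R E W \<in> Obj (\<W> U)" "(\<lambda>e\<in>W. e) \<in> sheaf_maps G SG R (subsheaf G R E W) E"
    "is_kernel (\<W> U) (E, f, F) (subsheaf G R E W, \<lambda>e\<in>W. e, E)"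
proof -
  have s: "sheaf E" "sheaf F" and w: "is_weyl G T E" and EU: "topspace (total E) \<subseteq> U" using EF by (simp_all add: W_Obj)
  have W: "stable_subset E W" unfolding W_def by (rule stable_subset_kernel[OF s f])
  have WE: "W \<subseteq> topspace (total E)" unfolding W_def by blast
  let ?K = "subsheaf G R E W"
  have tK: "topspace (total ?K) = W" using WE by auto
  have Ks: "sheaf ?K" by (rule sheaf_subsheaf[OF s(1) W])
  show K: "?K \<in> Obj (\<W> U)"
    using Ks tK WE EU is_weyl_subsheaf[OF s(1), of W] weyl_set_is_weyl[OF s(1) w] by (auto simp: W_Obj)
  show k: "(\<lambda>e\<in>W. e) \<in> sheaf_maps G SG R ?K E" by (rule sheaf_maps_inclusion[OF s(1) W])
  show "is_kernel (\<W> U) (E, f, F) (?K, \<lambda>e\<in>W. e, E)"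
    unfolding is_kernel_def W_simps(1,2)
  proof (intro conjI ballI impI)
    show "(E, f, F) \<in> Arr (\<W> U)" "(?K, \<lambda>e\<in>W. e, E) \<in> Arr (\<W> U)" using EF K f k by (simp_all add: W_Arr)
    show "zero_arrow (\<W> U) ((E, f, F) \<cdot>\<^bsub>\<W> U\<^esub> (?K, \<lambda>e\<in>W. e, E))"
      unfolding zero_comp_iff[OF K EF k f] tK using W_def by simp
    fix m assume m: "m \<in> Arr (\<W> U)" and c: "Cod (\<W> U) m = E \<and> zero_arrow (\<W> U) ((E, f, F) \<cdot>\<^bsub>\<W> U\<^esub> m)"
    obtain M g E' where g': "m = (M, g, E')" "g \<in> sheaf_maps G SG R M E'" "sheaf M" "M \<in> Obj (\<W> U)"
      using m by (rule W_ArrE)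
    have "E' = E" using c g'(1) by (simp add: W_simps)
    then have g: "m = (M, g, E)" "g \<in> sheaf_maps G SG R M E" using g' by simp_all
    have gW: "g x \<in> W" if x: "x \<in> topspace (total M)" for x
    proof -
      have "zero_arrow (\<W> U) ((E, f, F) \<cdot>\<^bsub>\<W> U\<^esub> (M, g, E))" using c g(1) by simp
      then have "f (g x) = szero F (proj M x)" using x unfolding zero_comp_iff[OF g'(4) EF g(2) f] by blast
      then show ?thesis
        using sheaf_map_closed[OF g'(3) s(1) g(2) x] sheaf_map_proj[OF g'(3) s(1) g(2) x] by (simp add: W_def)
    qed
    show "\<exists>!h. h \<in> Hom (\<W> U) (Dom (\<W> U) m) ?K \<and> (?K, \<lambda>e\<in>W. e, E) \<cdot>\<^bsub>\<W> U\<^esub> h = m"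
      unfolding g(1) W_simps
    proof (rule ex1I)
      have ext: "g \<in> extensional (topspace (total M))" by (rule sheaf_map_ext[OF g'(3) s(1) g(2)])
      show "(M, g, ?K) \<in> Hom (\<W> U) M ?K \<and> (?K, \<lambda>e\<in>W. e, E) \<cdot>\<^bsub>\<W> U\<^esub> (M, g, ?K) = (M, g, E)"
        using W_HomI[OF g'(4) K sheaf_maps_into_subsheaf[OF g'(3) s(1) W g(2) gW]] gW
        unfolding W_comp_eq_iff[OF ext] by simp
      fix n assume n: "n \<in> Hom (\<W> U) M ?K \<and> (?K, \<lambda>e\<in>W. e, E) \<cdot>\<^bsub>\<W> U\<^esub> n = (M, g, E)"
      obtain h where h: "n = (M, h, ?K)" "h \<in> sheaf_maps G SG R M ?K" using conjunct1[OF n] by (rule W_HomE)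
      have "\<forall>x \<in> topspace (total M). (\<lambda>e\<in>W. e) (h x) = g x"
        using conjunct2[OF n] unfolding h(1) W_comp_eq_iff[OF ext] .
      moreover have "h x \<in> W" if "x \<in> topspace (total M)" for x
        using sheaf_map_closed[OF g'(3) Ks h(2) that] tK by simp
      ultimately have "h x = g x" if "x \<in> topspace (total M)" for x using that by auto
      then have "h = g" using ext sheaf_map_ext[OF g'(3) Ks h(2)] by (intro extensionalityI)
      then show "n = (M, g, ?K)" by (simp add: h(1))
    qed
  qed simp
qed

text \<open>Besides the cokernel property, the elements killed by \<open>q\<close> are identified
  with the image of \<open>f\<close>. The arguments about monomorphisms and epimorphisms use this
  extra information.\<close>

lemma cokernel_quotient:
  assumes EF: "E \<in> Obj (\<W> U)" "F \<in> Obj (\<W> U)" and f: "f \<in> sheaf_maps G SG R E F"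
  obtains Q q where "Q \<in> Obj (\<W> U)" "q \<in> sheaf_maps G SG R F Q"
    "\<And>y. y \<in> topspace (total F) \<Longrightarrow> q y = szero Q (proj F y) \<longleftrightarrow> y \<in> f ` topspace (total E)"
    "is_cokernel (\<W> U) (E, f, F) (F, q, Q)"
proof -
  have s: "sheaf E" "sheaf F" and w: "is_weyl G T F" and FU: "topspace (total F) \<subseteq> U" using EF by (simp_all add: W_Obj)
  obtain Q q where Q: "sheaf Q" "topspace (total Q) \<subseteq> U" "q \<in> sheaf_maps G SG R F Q"
    "q ` topspace (total F) = topspace (total Q)"
    and qz: "\<And>y. y \<in> topspace (total F) \<Longrightarrow> q y = szero Q (proj F y) \<longleftrightarrow> y \<in> f ` topspace (total E)"
    and univ: "\<And>M \<mu>. sheaf M \<Longrightarrow> \<mu> \<in> sheaf_maps G SG R F M \<Longrightarrow>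
      (\<And>y. y \<in> f ` topspace (total E) \<Longrightarrow> \<mu> y = szero M (proj F y)) \<Longrightarrow>
      \<exists>!h. h \<in> sheaf_maps G SG R Q M \<and> (\<forall>y \<in> topspace (total F). h (q y) = \<mu> y)"
    by (rule quotient_exists[OF s(2) FU stable_subset_image[OF s f]]) blast
  have "is_weyl G T Q"
  proof (rule is_weylI)
    fix e k assume "e \<in> topspace (total Q)" and k: "k \<in> proj Q e"
    then obtain y where y: "y \<in> topspace (total F)" "e = q y" using Q(4) by blast
    then have k': "k \<in> proj F y" using k sheaf_map_proj[OF s(2) Q(1,3)] by simp
    show "gact Q k e = e"
      using sheaf_map_gact[OF s(2) Q(1,3) stabiliser_fixes(1)[OF s(2) y(1) k'] y(1)] is_weylD[OF w s(2) y(1) k']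
      by (simp add: y(2))
  qed
  then have QO: "Q \<in> Obj (\<W> U)" using Q by (simp add: W_Obj)
  have coker: "is_cokernel (\<W> U) (E, f, F) (F, q, Q)"
    unfolding is_cokernel_def W_simps(1,2)
  proof (intro conjI ballI impI)
    show "(E, f, F) \<in> Arr (\<W> U)" "(F, q, Q) \<in> Arr (\<W> U)" using EF QO f Q(3) by (simp_all add: W_Arr)
    show "zero_arrow (\<W> U) ((F, q, Q) \<cdot>\<^bsub>\<W> U\<^esub> (E, f, F))"
      unfolding zero_comp_iff[OF EF QO f Q(3)]
    proof
      fix e assume e: "e \<in> topspace (total E)"
      show "q (f e) = szero Q (proj E e)"
        using qz[OF sheaf_map_closed[OF s f e]] sheaf_map_proj[OF s f e] e by simp
    qed
    fix m assume m: "m \<in> Arr (\<W> U)" and c: "Dom (\<W> U) m = F \<and> zero_arrow (\<W> U) (m \<cdot>\<^bsub>\<W> U\<^esub> (E, f, F))"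
    obtain F' g M where g': "m = (F', g, M)" "g \<in> sheaf_maps G SG R F' M" "sheaf M" "M \<in> Obj (\<W> U)"
      using m by (rule W_ArrE)
    have "F' = F" using c g'(1) by (simp add: W_simps)
    then have g: "m = (F, g, M)" "g \<in> sheaf_maps G SG R F M" using g' by simp_all
    have gz: "g y = szero M (proj F y)" if y: "y \<in> f ` topspace (total E)" for y
    proof -
      obtain x where x: "x \<in> topspace (total E)" "y = f x" using y by blast
      have "zero_arrow (\<W> U) ((F, g, M) \<cdot>\<^bsub>\<W> U\<^esub> (E, f, F))" using c g(1) by simp
      then have "g (f x) = szero M (proj E x)" using x(1) unfolding zero_comp_iff[OF EF g'(4) f g(2)] by blast
      then show ?thesis using sheaf_map_proj[OF s f x(1)] x(2) by simp
    qed
    from univ[OF g'(3) g(2) gz] obtain h where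
      h: "h \<in> sheaf_maps G SG R Q M \<and> (\<forall>y \<in> topspace (total F). h (q y) = g y)"
      and uniq: "\<forall>h'. h' \<in> sheaf_maps G SG R Q M \<and> (\<forall>y \<in> topspace (total F). h' (q y) = g y) \<longrightarrow> h' = h"
      by (rule ex1E)
    show "\<exists>!h. h \<in> Hom (\<W> U) Q (Cod (\<W> U) m) \<and> h \<cdot>\<^bsub>\<W> U\<^esub> (F, q, Q) = m"
      unfolding g(1) W_simps
    proof (rule ex1I)
      have ext: "g \<in> extensional (topspace (total F))" by (rule sheaf_map_ext[OF s(2) g'(3) g(2)])
      show "(Q, h, M) \<in> Hom (\<W> U) Q M \<and> (Q, h, M) \<cdot>\<^bsub>\<W> U\<^esub> (F, q, Q) = (F, g, M)"
        unfolding W_comp_eq_iff[OF ext] using W_HomI[OF QO g'(4)] h by blast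
      fix n assume n: "n \<in> Hom (\<W> U) Q M \<and> n \<cdot>\<^bsub>\<W> U\<^esub> (F, q, Q) = (F, g, M)"
      obtain h' where h': "n = (Q, h', M)" "h' \<in> sheaf_maps G SG R Q M" using conjunct1[OF n] by (rule W_HomE)
      have "\<forall>y \<in> topspace (total F). h' (q y) = g y" using conjunct2[OF n] unfolding h'(1) W_comp_eq_iff[OF ext] .
      then have "h' = h" using uniq h'(2) by blast
      then show "n = (Q, h, M)" by (simp add: h'(1))
    qed
  qed simp
  show ?thesis by (rule that[OF QO Q(3) qz coker])
qed

text \<open>The inclusion of the kernel and the zero map have the same composite with
  \<open>f\<close>, so a monomorphism has zero kernel on every stalk.\<close>

lemma mono_arrow_inj:
  assumes EF: "E \<in> Obj (\<W> U)" "F \<in> Obj (\<W> U)" and f: "f \<in> sheaf_maps G SG R E F"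
    and mono: "mono_arrow (\<W> U) (E, f, F)"
  shows "inj_on f (topspace (total E))"
proof -
  have s: "sheaf E" "sheaf F" using EF by (simp_all add: W_Obj)
  let ?W = "{e \<in> topspace (total E). f e = szero F (proj E e)}"
  let ?K = "subsheaf G R E ?W"
  note K = kernel_inclusion(1,2)[OF EF f]
  have Ks: "sheaf ?K" using K(1) by (simp add: W_Obj)
  have tK: "topspace (total ?K) = ?W" by auto
  let ?z = "\<lambda>e\<in>topspace (total ?K). szero E (proj ?K e)"
  have z: "?z \<in> sheaf_maps G SG R ?K E" by (rule sheaf_maps_zero[OF Ks s(1)])
  have "compose (topspace (total ?K)) f (\<lambda>e\<in>?W. e) = compose (topspace (total ?K)) f ?z"
  proof
    fix e show "compose (topspace (total ?K)) f (\<lambda>e\<in>?W. e) e = compose (topspace (total ?K)) f ?z e"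
      using sheaf_map_szero[OF s f proj_closed[OF s(1)], of e] unfolding tK by (simp add: compose_def)
  qed
  then have "(E, f, F) \<cdot>\<^bsub>\<W> U\<^esub> (?K, \<lambda>e\<in>?W. e, E) = (E, f, F) \<cdot>\<^bsub>\<W> U\<^esub> (?K, ?z, E)" unfolding W_simps by simp
  then have "(?K, \<lambda>e\<in>?W. e, E) = (?K, ?z, E)"
    using mono W_HomI[OF K(1) EF(1) K(2)] W_HomI[OF K(1) EF(1) z] unfolding mono_arrow_def W_simps(1,2) by blast
  then have eq: "(\<lambda>e\<in>?W. e) = ?z" by blast
  show ?thesis
  proof (rule sheaf_map_injI[OF s f])
    fix e assume "e \<in> topspace (total E)" "f e = szero F (proj E e)"
    then have "e \<in> ?W" by blast
    with fun_cong[OF eq, of e] show "e = szero E (proj E e)" unfolding tK by simp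
  qed
qed

lemma mono_arrow_kernel:
  assumes "mono_arrow (\<W> U) m"
  shows "\<exists>n. is_kernel (\<W> U) n m"
proof -
  have "m \<in> Arr (\<W> U)" using assms by (simp add: mono_arrow_def)
  then obtain E f F where f: "m = (E, f, F)" "f \<in> sheaf_maps G SG R E F" "sheaf E" "sheaf F"
    "E \<in> Obj (\<W> U)" "F \<in> Obj (\<W> U)" by (rule W_ArrE)
  have inj: "inj_on f (topspace (total E))" using mono_arrow_inj[OF f(5,6,2)] assms f(1) by simp
  obtain Q q where Q: "Q \<in> Obj (\<W> U)" "q \<in> sheaf_maps G SG R F Q"
    "\<And>y. y \<in> topspace (total F) \<Longrightarrow> q y = szero Q (proj F y) \<longleftrightarrow> y \<in> f ` topspace (total E)"
    by (rule cokernel_quotient[OF f(5,6,2)]) blast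
  have "is_kernel (\<W> U) (F, q, Q) (E, f, F)"
    unfolding is_kernel_def W_simps(1,2)
  proof (intro conjI ballI impI)
    show "(F, q, Q) \<in> Arr (\<W> U)" "(E, f, F) \<in> Arr (\<W> U)" using f Q by (simp_all add: W_Arr)
    show "zero_arrow (\<W> U) ((F, q, Q) \<cdot>\<^bsub>\<W> U\<^esub> (E, f, F))"
      unfolding zero_comp_iff[OF f(5,6) Q(1) f(2) Q(2)]
    proof
      fix e assume e: "e \<in> topspace (total E)"
      show "q (f e) = szero Q (proj E e)"
        using Q(3)[OF sheaf_map_closed[OF f(3,4,2) e]] sheaf_map_proj[OF f(3,4,2) e] e by simp
    qed
    fix n assume n: "n \<in> Arr (\<W> U)" and c: "Cod (\<W> U) n = F \<and> zero_arrow (\<W> U) ((F, q, Q) \<cdot>\<^bsub>\<W> U\<^esub> n)"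
    obtain M g F' where g': "n = (M, g, F')" "g \<in> sheaf_maps G SG R M F'" "sheaf M" "M \<in> Obj (\<W> U)"
      using n by (rule W_ArrE)
    have "F' = F" using c g'(1) by (simp add: W_simps)
    then have g: "n = (M, g, F)" "g \<in> sheaf_maps G SG R M F" using g' by simp_all
    have "g x \<in> f ` topspace (total E)" if x: "x \<in> topspace (total M)" for x
    proof -
      have "zero_arrow (\<W> U) ((F, q, Q) \<cdot>\<^bsub>\<W> U\<^esub> (M, g, F))" using c g(1) by simp
      then have "q (g x) = szero Q (proj M x)" using x unfolding zero_comp_iff[OF g'(4) f(6) Q(1) g(2) Q(2)] by blast
      then show ?thesis
        using Q(3)[OF sheaf_map_closed[OF g'(3) f(4) g(2) x]] sheaf_map_proj[OF g'(3) f(4) g(2) x] by simp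
    qed
    then have "g ` topspace (total M) \<subseteq> f ` topspace (total E)" by blast
    then obtain h where h: "h \<in> sheaf_maps G SG R M E" "\<And>x. x \<in> topspace (total M) \<Longrightarrow> f (h x) = g x"
      by (rule sheaf_maps_factor_injective[OF f(3,4) g'(3) f(2) inj g(2)]) blast
    show "\<exists>!h. h \<in> Hom (\<W> U) (Dom (\<W> U) n) E \<and> (E, f, F) \<cdot>\<^bsub>\<W> U\<^esub> h = n"
      unfolding g(1) W_simps
    proof (rule ex1I)
      have ext: "g \<in> extensional (topspace (total M))" by (rule sheaf_map_ext[OF g'(3) f(4) g(2)])
      show "(M, h, E) \<in> Hom (\<W> U) M E \<and> (E, f, F) \<cdot>\<^bsub>\<W> U\<^esub> (M, h, E) = (M, g, F)"
        unfolding W_comp_eq_iff[OF ext] using W_HomI[OF g'(4) f(5) h(1)] h(2) by blast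
      fix k assume k: "k \<in> Hom (\<W> U) M E \<and> (E, f, F) \<cdot>\<^bsub>\<W> U\<^esub> k = (M, g, F)"
      obtain h' where h': "k = (M, h', E)" "h' \<in> sheaf_maps G SG R M E" using conjunct1[OF k] by (rule W_HomE)
      have e: "\<forall>x \<in> topspace (total M). f (h' x) = g x" using conjunct2[OF k] unfolding h'(1) W_comp_eq_iff[OF ext] .
      have "h' x = h x" if x: "x \<in> topspace (total M)" for x
        using inj_onD[OF inj _ sheaf_map_closed[OF g'(3) f(3) h'(2) x] sheaf_map_closed[OF g'(3) f(3) h(1) x]]
          e h(2)[OF x] x by simp
      then have "h' = h" by (rule sheaf_maps_eqI[OF h'(2) h(1)])
      then show "k = (M, h, E)" by (simp add: h'(1))
    qed
  qed simp
  then show ?thesis unfolding f(1) by (rule exI)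
qed

text \<open>The quotient map by the image and the zero map have the same composite with
  \<open>f\<close>; if they are equal, every element lies in the image.\<close>

lemma epi_arrow_surj:
  assumes EF: "E \<in> Obj (\<W> U)" "F \<in> Obj (\<W> U)" and f: "f \<in> sheaf_maps G SG R E F"
    and epi: "epi_arrow (\<W> U) (E, f, F)"
  shows "f ` topspace (total E) = topspace (total F)"
proof -
  have s: "sheaf E" "sheaf F" using EF by (simp_all add: W_Obj)
  obtain Q q where Q: "Q \<in> Obj (\<W> U)" "q \<in> sheaf_maps G SG R F Q"
    "\<And>y. y \<in> topspace (total F) \<Longrightarrow> q y = szero Q (proj F y) \<longleftrightarrow> y \<in> f ` topspace (total E)"
    by (rule cokernel_quotient[OF EF f]) blast
  have Qs: "sheaf Q" using Q(1) by (simp add: W_Obj)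
  let ?z = "\<lambda>y\<in>topspace (total F). szero Q (proj F y)"
  have z: "?z \<in> sheaf_maps G SG R F Q" by (rule sheaf_maps_zero[OF s(2) Qs])
  have "compose (topspace (total E)) q f = compose (topspace (total E)) ?z f"
  proof
    fix e show "compose (topspace (total E)) q f e = compose (topspace (total E)) ?z f e"
      using sheaf_map_closed[OF s f, of e] Q(3)[of "f e"] by (simp add: compose_def)
  qed
  then have "(F, q, Q) \<cdot>\<^bsub>\<W> U\<^esub> (E, f, F) = (F, ?z, Q) \<cdot>\<^bsub>\<W> U\<^esub> (E, f, F)" unfolding W_simps by simp
  then have "(F, q, Q) = (F, ?z, Q)"
    using epi W_HomI[OF EF(2) Q(1,2)] W_HomI[OF EF(2) Q(1) z] unfolding epi_arrow_def W_simps(1,2) by blast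
  then have eq: "q = ?z" by blast
  have "y \<in> f ` topspace (total E)" if y: "y \<in> topspace (total F)" for y
    using fun_cong[OF eq, of y] Q(3)[OF y] y by simp
  then show ?thesis using sheaf_map_closed[OF s f] by blast
qed

lemma epi_arrow_cokernel:
  assumes "epi_arrow (\<W> U) m"
  shows "\<exists>n. is_cokernel (\<W> U) n m"
proof -
  have "m \<in> Arr (\<W> U)" using assms by (simp add: epi_arrow_def)
  then obtain E f F where f: "m = (E, f, F)" "f \<in> sheaf_maps G SG R E F" "sheaf E" "sheaf F"
    "E \<in> Obj (\<W> U)" "F \<in> Obj (\<W> U)" by (rule W_ArrE)
  have surj: "f ` topspace (total E) = topspace (total F)" using epi_arrow_surj[OF f(5,6,2)] assms f(1) by simp
  let ?W = "{e \<in> topspace (total E). f e = szero F (proj E e)}"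
  let ?K = "subsheaf G R E ?W" and ?k = "\<lambda>e\<in>?W. e"
  note K = kernel_inclusion(1,2)[OF f(5,6,2)]
  have tK: "topspace (total ?K) = ?W" by auto
  have "is_cokernel (\<W> U) (?K, ?k, E) (E, f, F)"
    unfolding is_cokernel_def W_simps(1,2)
  proof (intro conjI ballI impI)
    show "(?K, ?k, E) \<in> Arr (\<W> U)" "(E, f, F) \<in> Arr (\<W> U)" using f K by (simp_all add: W_Arr)
    show "zero_arrow (\<W> U) ((E, f, F) \<cdot>\<^bsub>\<W> U\<^esub> (?K, ?k, E))"
      unfolding zero_comp_iff[OF K(1) f(5,6) K(2) f(2)] tK by simp
    fix n assume n: "n \<in> Arr (\<W> U)" and c: "Dom (\<W> U) n = E \<and> zero_arrow (\<W> U) (n \<cdot>\<^bsub>\<W> U\<^esub> (?K, ?k, E))"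
    obtain E' g M where g': "n = (E', g, M)" "g \<in> sheaf_maps G SG R E' M" "sheaf M" "M \<in> Obj (\<W> U)"
      using n by (rule W_ArrE)
    have "E' = E" using c g'(1) by (simp add: W_simps)
    then have g: "n = (E, g, M)" "g \<in> sheaf_maps G SG R E M" using g' by simp_all
    have "g e = szero M (proj E e)" if e: "e \<in> topspace (total E)" "f e = szero F (proj E e)" for e
    proof -
      have "zero_arrow (\<W> U) ((E, g, M) \<cdot>\<^bsub>\<W> U\<^esub> (?K, ?k, E))" using c g(1) by simp
      then have "\<forall>e \<in> ?W. g (?k e) = szero M (proj ?K e)"
        unfolding zero_comp_iff[OF K(1) f(5) g'(4) K(2) g(2)] tK .
      then show ?thesis using e by simp
    qed
    then obtain h where h: "h \<in> sheaf_maps G SG R F M" "\<And>e. e \<in> topspace (total E) \<Longrightarrow> h (f e) = g e"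
      by (rule sheaf_maps_factor_surjective[OF f(3,4) g'(3) f(2) surj g(2)]) blast+
    show "\<exists>!h. h \<in> Hom (\<W> U) F (Cod (\<W> U) n) \<and> h \<cdot>\<^bsub>\<W> U\<^esub> (E, f, F) = n"
      unfolding g(1) W_simps
    proof (rule ex1I)
      have ext: "g \<in> extensional (topspace (total E))" by (rule sheaf_map_ext[OF f(3) g'(3) g(2)])
      show "(F, h, M) \<in> Hom (\<W> U) F M \<and> (F, h, M) \<cdot>\<^bsub>\<W> U\<^esub> (E, f, F) = (E, g, M)"
        unfolding W_comp_eq_iff[OF ext] using W_HomI[OF f(6) g'(4) h(1)] h(2) by blast
      fix k assume k: "k \<in> Hom (\<W> U) F M \<and> k \<cdot>\<^bsub>\<W> U\<^esub> (E, f, F) = (E, g, M)"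
      obtain h' where h': "k = (F, h', M)" "h' \<in> sheaf_maps G SG R F M" using conjunct1[OF k] by (rule W_HomE)
      have e: "\<forall>e \<in> topspace (total E). h' (f e) = g e" using conjunct2[OF k] unfolding h'(1) W_comp_eq_iff[OF ext] .
      have "h' y = h y" if "y \<in> topspace (total F)" for y
      proof -
        have "y \<in> f ` topspace (total E)" using that surj by simp
        then show ?thesis using e h(2) by auto
      qed
      then have "h' = h" by (rule sheaf_maps_eqI[OF h'(2) h(1)])
      then show "k = (F, h, M)" by (simp add: h'(1))
    qed
  qed simp
  then show ?thesis unfolding f(1) by (rule exI)
qed

section \<open>Binary products and coproducts\<close>

lemma pair_diagram:
  assumes "E \<in> Obj (\<W> U)" "F \<in> Obj (\<W> U)"
  shows "sheaf_diagram G T SG (subgroup_conj G T) R (UNIV :: bool set) (\<lambda>b. if b then E else F)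
      ({} :: unit set) (\<lambda>_. undefined) (\<lambda>_. undefined) (\<lambda>_ e. e)"
  using assms
  by (intro sheaf_diagram.intro sheaf_family.intro sheaf_family_axioms.intro sheaf_diagram_axioms.intro
      group_space_axioms) (simp_all add: W_Obj)

text \<open>The limit of the pair is formed among all sheaves and then replaced by its fixed points;
  maps from a Weyl sheaf into either are the same functions.\<close>

lemma products_exist:
  assumes EF: "E \<in> Obj (\<W> U)" "F \<in> Obj (\<W> U)"
  shows "\<exists>P p q. is_product (\<W> U) E F P p q"
proof -
  have s: "sheaf E" "sheaf F" and EU: "topspace (total E) \<subseteq> U" "topspace (total F) \<subseteq> U" using EF by (simp_all add: W_Obj)
  let ?D = "\<lambda>b. if b then E else F"
  \<comment> \<open>Functions on the two-element index set are pairs, which gives the smallness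
    bound asked for by \<open>limit_exists\<close>.\<close>
  have "inj_on (\<lambda>h. (h True, h False)) (UNIV \<rightarrow>\<^sub>E U)"
    by (rule inj_onI, rule ext) (metis (full_types) Pair_inject)
  moreover have "(\<lambda>h. (h True, h False)) ` (UNIV \<rightarrow>\<^sub>E U) \<subseteq> U \<times> U" by auto
  ultimately have "((UNIV :: bool set) \<rightarrow>\<^sub>E U) \<lesssim> U \<times> U" unfolding lepoll_def by (intro exI conjI)
  then have B: "((UNIV :: bool set) \<rightarrow>\<^sub>E U) \<lesssim> U"
    by (rule lepoll_trans[OF _ infinite_times_lepoll[OF infinite_U lepoll_refl lepoll_refl]])
  have DU: "topspace (total (?D b)) \<subseteq> U" for b using EU by simp
  obtain L p where L: "sheaf L" "topspace (total L) \<subseteq> U"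
    and p': "\<And>b. b \<in> UNIV \<Longrightarrow> p b \<in> sheaf_maps G SG R L (?D b)"
    and univ': "\<And>M \<mu>. sheaf M \<Longrightarrow> (\<And>b. b \<in> UNIV \<Longrightarrow> \<mu> b \<in> sheaf_maps G SG R M (?D b)) \<Longrightarrow>
      (\<And>(u :: unit) m. u \<in> {} \<Longrightarrow> m \<in> topspace (total M) \<Longrightarrow> \<mu> undefined m = \<mu> undefined m) \<Longrightarrow>
      \<exists>!h. h \<in> sheaf_maps G SG R M L \<and> (\<forall>b \<in> UNIV. \<forall>m \<in> topspace (total M). p b (h m) = \<mu> b m)"
    by (rule limit_exists[OF pair_diagram[OF EF] DU B]) blast
  note p = p'[OF UNIV_I] and univ = univ'[OF _ _ refl]
  let ?P = "weyl_sheaf G R L"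
  let ?p = "\<lambda>b. restrict (p b) (weyl_set L)"
  have P: "?P \<in> Obj (\<W> U)" using L by (intro weyl_Obj) (simp add: S_Obj)
  have Ps: "sheaf ?P" by (rule sheaf_weyl[OF L(1)])
  have pP: "?p b \<in> sheaf_maps G SG R ?P (?D b)" for b
    unfolding weyl_sheaf_subsheaf using s by (intro sheaf_maps_from_subsheaf[OF _ L(1) stable_weyl_set[OF L(1)] p]) simp
  have "is_product (\<W> U) E F ?P (?P, ?p True, E) (?P, ?p False, F)"
    unfolding is_product_def
  proof (intro conjI allI ballI)
    show "(?P, ?p True, E) \<in> Hom (\<W> U) ?P E" using W_HomI[OF P EF(1)] pP[of True] by simp
    show "(?P, ?p False, F) \<in> Hom (\<W> U) ?P F" using W_HomI[OF P EF(2)] pP[of False] by simp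
    fix M m n assume m: "m \<in> Hom (\<W> U) M E" and n: "n \<in> Hom (\<W> U) M F"
    obtain f where f: "m = (M, f, E)" "f \<in> sheaf_maps G SG R M E" "sheaf M" "M \<in> Obj (\<W> U)" using m by (rule W_HomE)
    obtain g where g: "n = (M, g, F)" "g \<in> sheaf_maps G SG R M F" using n by (rule W_HomE)
    have Mw: "is_weyl G T M" using f(4) by (simp add: W_Obj)
    note T = sheaf_maps_weyl_target[OF f(3) Mw L(1)]
    have "(if b then f else g) \<in> sheaf_maps G SG R M (?D b)" for b using f(2) g(2) by simp
    from univ[OF f(3) this] obtain h where
      h: "h \<in> sheaf_maps G SG R M L \<and> (\<forall>b \<in> UNIV. \<forall>m \<in> topspace (total M). p b (h m) = (if b then f else g) m)"
      and uniq: "\<forall>h'. h' \<in> sheaf_maps G SG R M L \<and> (\<forall>b \<in> UNIV. \<forall>m \<in> topspace (total M). p b (h' m) = (if b then f else g) m) \<longrightarrow> h' = h"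
      by (rule ex1E)
    have cl: "k x \<in> weyl_set L" if "k \<in> sheaf_maps G SG R M L" "x \<in> topspace (total M)" for k x
      using that(1) sheaf_map_closed[OF f(3) Ps _ that(2), of k] unfolding T topspace_weyl by blast
    have ext: "f \<in> extensional (topspace (total M))" "g \<in> extensional (topspace (total M))"
      using sheaf_map_ext[OF f(3) s(1) f(2)] sheaf_map_ext[OF f(3) s(2) g(2)] .
    show "\<exists>!h. h \<in> Hom (\<W> U) M ?P \<and> (?P, ?p True, E) \<cdot>\<^bsub>\<W> U\<^esub> h = m \<and> (?P, ?p False, F) \<cdot>\<^bsub>\<W> U\<^esub> h = n"
      unfolding f(1) g(1)
    proof (rule ex1I)
      show "(M, h, ?P) \<in> Hom (\<W> U) M ?P \<and> (?P, ?p True, E) \<cdot>\<^bsub>\<W> U\<^esub> (M, h, ?P) = (M, f, E) \<and>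
          (?P, ?p False, F) \<cdot>\<^bsub>\<W> U\<^esub> (M, h, ?P) = (M, g, F)"
        unfolding W_comp_eq_iff[OF ext(1)] W_comp_eq_iff[OF ext(2)]
      proof (intro conjI ballI)
        show "(M, h, ?P) \<in> Hom (\<W> U) M ?P" using h by (intro W_HomI f(4) P) (simp add: T)
        fix x assume x: "x \<in> topspace (total M)"
        show "?p True (h x) = f x" "?p False (h x) = g x"
          using cl[OF conjunct1[OF h] x] bspec[OF bspec[OF conjunct2[OF h] UNIV_I] x, of True]
            bspec[OF bspec[OF conjunct2[OF h] UNIV_I] x, of False] by simp_all
      qed
      fix k assume k: "k \<in> Hom (\<W> U) M ?P \<and> (?P, ?p True, E) \<cdot>\<^bsub>\<W> U\<^esub> k = (M, f, E) \<and>
          (?P, ?p False, F) \<cdot>\<^bsub>\<W> U\<^esub> k = (M, g, F)"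
      obtain h' where h': "k = (M, h', ?P)" "h' \<in> sheaf_maps G SG R M ?P" using conjunct1[OF k] by (rule W_HomE)
      have hL: "h' \<in> sheaf_maps G SG R M L" using h'(2) by (simp add: T)
      have e: "(\<forall>x \<in> topspace (total M). ?p True (h' x) = f x) \<and> (\<forall>x \<in> topspace (total M). ?p False (h' x) = g x)"
        using conjunct2[OF k] unfolding h'(1) W_comp_eq_iff[OF ext(1)] W_comp_eq_iff[OF ext(2)] .
      have "p b (h' x) = (if b then f else g) x" if x: "x \<in> topspace (total M)" for b x
        using cl[OF hL x] e x by (auto split: if_splits)
      then have "h' = h" using uniq hL by blast
      then show "k = (M, h, ?P)" by (simp add: h'(1))
    qed
  qed
  then show ?thesis by (intro exI)
qed

lemma coproducts_exist:
  assumes EF: "E \<in> Obj (\<W> U)" "F \<in> Obj (\<W> U)"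
  shows "\<exists>P p q. is_coproduct (\<W> U) E F P p q"
proof -
  have s: "sheaf E" "sheaf F" and w: "is_weyl G T E" "is_weyl G T F"
    and EU: "topspace (total E) \<subseteq> U" "topspace (total F) \<subseteq> U" using EF by (simp_all add: W_Obj)
  let ?D = "\<lambda>b. if b then E else F"
  have DU: "topspace (total (?D b)) \<subseteq> U" for b using EU by simp
  have B: "(UNIV :: bool set) \<lesssim> U" using infinite_U by (intro finite_lepoll_infinite) simp_all
  obtain L p where L: "sheaf L" "topspace (total L) \<subseteq> U"
    and p': "\<And>b. b \<in> UNIV \<Longrightarrow> p b \<in> sheaf_maps G SG R (?D b) L"
    and univ': "\<And>M \<mu>. sheaf M \<Longrightarrow> (\<And>b. b \<in> UNIV \<Longrightarrow> \<mu> b \<in> sheaf_maps G SG R (?D b) M) \<Longrightarrow>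
      (\<And>(u :: unit) e. u \<in> {} \<Longrightarrow> e \<in> topspace (total (?D undefined)) \<Longrightarrow> \<mu> undefined e = \<mu> undefined e) \<Longrightarrow>
      \<exists>!h. h \<in> sheaf_maps G SG R L M \<and> (\<forall>b \<in> UNIV. \<forall>e \<in> topspace (total (?D b)). h (p b e) = \<mu> b e)"
    and fixed: "\<And>g e. g \<in> carrier G \<Longrightarrow> e \<in> topspace (total L) \<Longrightarrow> subgroup_conj G T g (proj L e) = proj L e \<Longrightarrow>
      (\<And>b a. b \<in> UNIV \<Longrightarrow> a \<in> topspace (total (?D b)) \<Longrightarrow> proj (?D b) a = proj L e \<Longrightarrow> gact (?D b) g a = a) \<Longrightarrow> gact L g e = e"
    by (rule colimit_exists[OF pair_diagram[OF EF] DU B]) blast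
  note p = p'[OF UNIV_I] and univ = univ'[OF _ _ refl]
  have "is_weyl G T L"
  proof (rule is_weylI)
    fix e k assume e: "e \<in> topspace (total L)" and k: "k \<in> proj L e"
    show "gact L k e = e"
    proof (rule fixed[OF stabiliser_fixes(1)[OF L(1) e k] e stabiliser_fixes(2)[OF L(1) e k]])
      fix b a assume "b \<in> (UNIV :: bool set)" "a \<in> topspace (total (?D b))" "proj (?D b) a = proj L e"
      then show "gact (?D b) k a = a" using is_weylD[OF w(1) s(1), of a k] is_weylD[OF w(2) s(2), of a k] k by (auto split: if_splits)
    qed
  qed
  then have P: "L \<in> Obj (\<W> U)" using L by (simp add: W_Obj)
  have "is_coproduct (\<W> U) E F L (E, p True, L) (F, p False, L)"
    unfolding is_coproduct_def
  proof (intro conjI allI ballI)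
    show "(E, p True, L) \<in> Hom (\<W> U) E L" using W_HomI[OF EF(1) P] p[of True] by simp
    show "(F, p False, L) \<in> Hom (\<W> U) F L" using W_HomI[OF EF(2) P] p[of False] by simp
    fix M m n assume m: "m \<in> Hom (\<W> U) E M" and n: "n \<in> Hom (\<W> U) F M"
    obtain f where f: "m = (E, f, M)" "f \<in> sheaf_maps G SG R E M" "sheaf M" "M \<in> Obj (\<W> U)" using m by (rule W_HomE)
    obtain g where g: "n = (F, g, M)" "g \<in> sheaf_maps G SG R F M" using n by (rule W_HomE)
    have "(if b then f else g) \<in> sheaf_maps G SG R (?D b) M" for b using f(2) g(2) by simp
    from univ[OF f(3) this] obtain h where
      h: "h \<in> sheaf_maps G SG R L M \<and> (\<forall>b \<in> UNIV. \<forall>e \<in> topspace (total (?D b)). h (p b e) = (if b then f else g) e)"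
      and uniq: "\<forall>h'. h' \<in> sheaf_maps G SG R L M \<and> (\<forall>b \<in> UNIV. \<forall>e \<in> topspace (total (?D b)). h' (p b e) = (if b then f else g) e) \<longrightarrow> h' = h"
      by (rule ex1E)
    have ext: "f \<in> extensional (topspace (total E))" "g \<in> extensional (topspace (total F))"
      using sheaf_map_ext[OF s(1) f(3,2)] sheaf_map_ext[OF s(2) f(3) g(2)] .
    show "\<exists>!h. h \<in> Hom (\<W> U) L M \<and> h \<cdot>\<^bsub>\<W> U\<^esub> (E, p True, L) = m \<and> h \<cdot>\<^bsub>\<W> U\<^esub> (F, p False, L) = n"
      unfolding f(1) g(1)
    proof (rule ex1I)
      show "(L, h, M) \<in> Hom (\<W> U) L M \<and> (L, h, M) \<cdot>\<^bsub>\<W> U\<^esub> (E, p True, L) = (E, f, M) \<and>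
          (L, h, M) \<cdot>\<^bsub>\<W> U\<^esub> (F, p False, L) = (F, g, M)"
        unfolding W_comp_eq_iff[OF ext(1)] W_comp_eq_iff[OF ext(2)]
        using W_HomI[OF P f(4) conjunct1[OF h]] bspec[OF conjunct2[OF h] UNIV_I, of True]
          bspec[OF conjunct2[OF h] UNIV_I, of False] by simp
      fix k assume k: "k \<in> Hom (\<W> U) L M \<and> k \<cdot>\<^bsub>\<W> U\<^esub> (E, p True, L) = (E, f, M) \<and>
          k \<cdot>\<^bsub>\<W> U\<^esub> (F, p False, L) = (F, g, M)"
      obtain h' where h': "k = (L, h', M)" "h' \<in> sheaf_maps G SG R L M" using conjunct1[OF k] by (rule W_HomE)
      have e: "(\<forall>x \<in> topspace (total E). h' (p True x) = f x) \<and> (\<forall>x \<in> topspace (total F). h' (p False x) = g x)"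
        using conjunct2[OF k] unfolding h'(1) W_comp_eq_iff[OF ext(1)] W_comp_eq_iff[OF ext(2)] .
      have "h' (p b x) = (if b then f else g) x" if x: "x \<in> topspace (total (?D b))" for b x
        using e x by (auto split: if_splits)
      then have "h' = h" using uniq h'(2) by blast
      then show "k = (L, h, M)" by (simp add: h'(1))
    qed
  qed
  then show ?thesis by (intro exI)
qed

theorem abelian_W: "abelian_category (\<W> U)"
proof (intro abelian_category.intro abelian_category_axioms.intro category_W)
  show "\<exists>pls. preadditive (\<W> U) pls" by (rule exI, rule preadditive_W)
  show "\<exists>z. zero_object (\<W> U) z"
  proof -
    obtain Z where "Z \<in> Obj (\<W> U)" "\<And>e. e \<in> topspace (total Z) \<Longrightarrow> e = szero Z (proj Z e)"
      by (rule zero_sheaf_exists) blast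
    then show ?thesis by (intro exI zero_object_W)
  qed
  fix m assume "m \<in> Arr (\<W> U)"
  then obtain E f F where f: "m = (E, f, F)" "f \<in> sheaf_maps G SG R E F" "E \<in> Obj (\<W> U)" "F \<in> Obj (\<W> U)"
    by (rule W_ArrE)
  show "\<exists>k. is_kernel (\<W> U) m k" using kernel_inclusion(3)[OF f(3,4,2)] unfolding f(1) by (rule exI)
  show "\<exists>q. is_cokernel (\<W> U) m q"
    by (rule cokernel_quotient[OF f(3,4,2)]) (unfold f(1), rule exI)
qed (rule products_exist coproducts_exist mono_arrow_kernel epi_arrow_cokernel; assumption)+

end

theorem theorem5:
  fixes G :: "('g, 'z) monoid_scheme" and T :: "'g topology"
    and R :: "('r, 'y) ring_scheme" and U :: "'u set"
  assumes "profinite_group G T"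
    and "ring R"
    and "infinite U"
    and "closed_subgroups G T \<lesssim> U"
  shows
    "left_adjoint (weyl_cat G T R U) (gsheaf_cat G T R U) inc_functor (weyl_functor G R) \<and>
     idempotent_functor (gsheaf_cat G T R U) (functor_comp inc_functor (weyl_functor G R)) \<and>
     fully_faithful (weyl_cat G T R U) (gsheaf_cat G T R U) inc_functor \<and>
     abelian_category (weyl_cat G T R U) \<and>
     (\<forall>(J :: ('i, 'j) precat) D. small_category U J \<and> is_functor J (weyl_cat G T R U) D \<longrightarrow>
        (\<exists>L \<iota>. \<forall>V. U \<subseteq> V \<longrightarrow> is_colimit (weyl_cat G T R V) J D L \<iota>) \<and>
        (\<exists>L \<pi>. \<forall>V. U \<subseteq> V \<longrightarrow> is_limit (weyl_cat G T R V) J D L \<pi>) \<and>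
        (\<exists>L \<pi>. \<forall>V. U \<subseteq> V \<longrightarrow>
           is_limit (gsheaf_cat G T R V) J (functor_comp inc_functor D) L \<pi>) \<and>
        (\<forall>L \<pi>. is_limit (gsheaf_cat G T R U) J (functor_comp inc_functor D) L \<pi> \<longrightarrow>
           is_limit (weyl_cat G T R U) J D
             (OMap (weyl_functor G R) L) (\<lambda>i. AMap (weyl_functor G R) (\<pi> i))))"
proof -
  interpret weyl_universe G T R U
    using assms by (simp add: weyl_universe_def weyl_universe_axioms_def)
  show ?thesis
  proof (intro conjI allI impI inc_left_adjoint weyl_idempotent inc_fully_faithful abelian_W)
    fix J :: "('i, 'j) precat" and D
    assume JD: "small_category U J \<and> is_functor J (\<W> U) D"
    have J: "category J" using JD by (simp add: small_category_def)
    note obj = functor_W_diagram(2)[OF conjunct2[OF JD]] and hom = functor_W_diagram(3)[OF conjunct2[OF JD]]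
    show "\<exists>L \<iota>. \<forall>V. U \<subseteq> V \<longrightarrow> is_colimit (\<W> V) J D L \<iota>"
      by (rule colimits_exist[OF conjunct1[OF JD] conjunct2[OF JD]]) blast
    obtain L \<pi> where L: "\<And>V. U \<subseteq> V \<Longrightarrow> is_limit (\<S> V) J (functor_comp inc_functor D) L \<pi>"
      by (rule limits_exist[OF conjunct1[OF JD] conjunct2[OF JD]]) blast
    then show "\<exists>L \<pi>. \<forall>V. U \<subseteq> V \<longrightarrow> is_limit (\<S> V) J (functor_comp inc_functor D) L \<pi>" by blast
    \<comment> \<open>The limit among all sheaves does not depend on \<open>V\<close>, and neither
      does its image under the Weyl functor; so the same witnesses serve all
      \<open>V\<close>.\<close>
    have "is_limit (\<W> V) J D (OMap (weyl_functor G R) L) (\<lambda>i. AMap (weyl_functor G R) (\<pi> i))" if V: "U \<subseteq> V" for V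
    proof (rule limit_weyl[OF J _ _ L[OF V]])
      show "OMap D i \<in> Obj (\<W> V)" if "i \<in> Obj J" for i using W_Obj_mono[OF obj[OF that] V] .
      show "AMap D u \<in> Hom (\<W> V) (OMap D (Dom J u)) (OMap D (Cod J u))" if "u \<in> Arr J" for u
        using hom[OF that] W_Obj_mono[OF _ V] unfolding W_Hom by blast
    qed
    then show "\<exists>L \<pi>. \<forall>V. U \<subseteq> V \<longrightarrow> is_limit (\<W> V) J D L \<pi>" by blast
    fix L \<pi> assume lim: "is_limit (\<S> U) J (functor_comp inc_functor D) L \<pi>"
    show "is_limit (\<W> U) J D (OMap (weyl_functor G R) L) (\<lambda>i. AMap (weyl_functor G R) (\<pi> i))"
      by (rule limit_weyl[OF J obj hom lim])
  qed
qed

end
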